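(* Let $\rho=\frac{1+\mathrm{i}\sqrt3}{2}$, let $a_\triangle(n)$ be the number of well-rounded sublattices of index $n$ of the hexagonal lattice $\mathbb{Z}[\rho]\subset\mathbb{C}\cong\mathbb{R}^2$, and $A_\triangle(x)=\sum_{n\le x}a_\triangle(n)$. Then, as $x\to\infty$, $$A_\triangle(x)=\frac{9\log3}{16}\,\frac{L(1,\chi_{-3})}{\zeta(2)}\,x(\log x-1)+c_\triangle x+O\big(x^{3/4}\log x\big)=\frac{3\sqrt3\log3}{8\pi}x(\log x-1)+c_\triangle x+O\big(x^{3/4}\log x\big),$$ where $$c_\triangle=L(1,\chi_{-3})+\frac{9\log3\,L(1,\chi_{-3})}{16\,\zeta(2)}\Bigg(\Big(\gamma+\frac{L'(1,\chi_{-3})}{L(1,\chi_{-3})}-2\frac{\zeta'(2)}{\zeta(2)}\Big)+2\gamma-\frac{\log3}{4}$$ $$-\sum_{p=1}^\infty\frac1p\Big(\log3-\sum_{q\in\mathbb{N},\,p<q\le3p-1}\frac1q\Big)-\sum_{k=0}^\infty\frac{4}{2k+1}\Big(\frac12\log3-\sum_{\ell\in\mathbb{Z},\,k<\ell\le3k}\frac1{2\ell+1}\Big)\Bigg)\approx0.4915036,$$ and $c_\triangle$ is the coefficient of $(s-1)^{-1}$ in the Laurent expansion of $\sum_{n\ge1}a_\triangle(n)n^{-s}$ around $s=1$.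
   Context: A lattice in $\mathbb{R}^2$ is well-rounded if its non-zero vectors of minimal length span $\mathbb{R}^2$; a sublattice means a subgroup of finite index. $\gamma$ is the Euler–Mascheroni constant, $\zeta$ the Riemann zeta function, and $L(s,\chi_{-3})=\sum_{n\ge1}\chi_{-3}(n)n^{-s}$ with $\chi_{-3}(n)=0$ if $3\mid n$, $1$ if $n\equiv1\pmod3$, $-1$ if $n\equiv2\pmod3$.
   Formalization: In the formula for c_△ the two correction series (over p and over k) are multiplied by 1/log 3, a factor missing from the display; without it the expression is about 0.4139, contradicting the stated value 0.4915036 and the asymptotics. *)

theory Defs
  imports "HOL-Complex_Analysis.Complex_Analysis" "HOL-Algebra.Coset"
    "HOL-Library.Landau_Symbols"
begin

definition hex_rho :: complex where
  "hex_rho = (1 + \<i> * complex_of_real (sqrt 3)) / 2"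

definition hex_lattice :: "complex set" where
  "hex_lattice = {of_int a + of_int b * hex_rho | a b :: int. True}"

definition additive_group :: "complex set \<Rightarrow> complex monoid" where
  "additive_group \<Lambda> = \<lparr>carrier = \<Lambda>, monoid.mult = (+), one = 0\<rparr>"

definition is_sublattice_of_index :: "complex set \<Rightarrow> complex set \<Rightarrow> nat \<Rightarrow> bool" where
  "is_sublattice_of_index L \<Lambda> n \<longleftrightarrow>
     subgroup L (additive_group \<Lambda>) \<and>
     finite (rcosets\<^bsub>additive_group \<Lambda>\<^esub> L) \<and>
     card (rcosets\<^bsub>additive_group \<Lambda>\<^esub> L) = n"

definition minimal_vectors :: "complex set \<Rightarrow> complex set" where
  "minimal_vectors L = {v \<in> L. v \<noteq> 0 \<and> (\<forall>w \<in> L. w \<noteq> 0 \<longrightarrow> norm v \<le> norm w)}"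

text \<open>Here \<^const>\<open>span\<close> is the span over the reals.\<close>

definition well_rounded :: "complex set \<Rightarrow> bool" where
  "well_rounded L \<longleftrightarrow> span (minimal_vectors L) = UNIV"

definition a_triangle :: "nat \<Rightarrow> nat" where
  "a_triangle n = card {L. is_sublattice_of_index L hex_lattice n \<and> well_rounded L}"

definition A_triangle :: "real \<Rightarrow> real" where
  "A_triangle x = (\<Sum>n = 1..nat \<lfloor>x\<rfloor>. real (a_triangle n))"

definition chi3 :: "nat \<Rightarrow> real" where
  "chi3 n = (if n mod 3 = 0 then 0 else if n mod 3 = 1 then 1 else -1)"

text \<open>
  Only values and derivatives at the real points 1 and 2 are needed, so both functions are
  given by their series on the real axis: the first converges for \<open>s > 0\<close> (in the order of
  summation written, conditionally for \<open>s \<le> 1\<close>), the second for \<open>s > 1\<close>.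
\<close>

definition L_chi3 :: "real \<Rightarrow> real" where
  "L_chi3 s = (\<Sum>n. chi3 (Suc n) * real (Suc n) powr (- s))"

definition zeta_series :: "real \<Rightarrow> real" where
  "zeta_series s = (\<Sum>n. real (Suc n) powr (- s))"

text \<open>
  The first series below is the sum over \<open>p \<ge> 1\<close> with \<open>p = Suc i\<close>.

  The factor \<open>1 / ln 3\<close> in front of the two series corrects the source, whose display lacks it.
  Without it the expression equals 0.41393..., which contradicts the stated value
  0.4915036; with it the value is 0.49150355....  The factor comes from the Dirichlet series
  of \<^const>\<open>a_triangle\<close>, which for real part of \<open>s\<close> greater than 1 is
  \<open>\<zeta>(s) L(s,\<chi>) (1 + 3 / (1 + 3\<^sup>-\<^sup>s) * F(s) / \<zeta>(2 s))\<close>, where \<open>F(s)\<close> is the sum of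
  \<open>(p q)\<^sup>-\<^sup>s\<close> over positive \<open>p\<close>, \<open>q\<close> of equal parity with \<open>q < p < 3 q\<close>.
  With \<open>\<Sigma>\<^sub>1\<close>, \<open>\<Sigma>\<^sub>2\<close> the two series below,
  \<open>F(s) = ln 3 / 4 * (1 / (s - 1) + 2 \<gamma> - ln 3 / 2) - (\<Sigma>\<^sub>1 + \<Sigma>\<^sub>2) / 4 + o(1)\<close> as \<open>s\<close> tends to 1,
  so taking out the factor \<open>ln 3 / 4\<close> divides the two series by \<open>ln 3\<close>.
\<close>

definition c_triangle :: real where
  "c_triangle = L_chi3 1 + 9 * ln 3 * L_chi3 1 / (16 * zeta_series 2) *
     ((euler_mascheroni + deriv L_chi3 1 / L_chi3 1 - 2 * (deriv zeta_series 2 / zeta_series 2))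
      + 2 * euler_mascheroni - ln 3 / 4
      - 1 / ln 3 *
        ((\<Sum>i. let p = Suc i in
             1 / real p * (ln 3 - (\<Sum>q\<in>{p<..3 * p - 1}. 1 / real q)))
         + (\<Sum>k. 4 / real (2 * k + 1) *
             (1 / 2 * ln 3 - (\<Sum>l\<in>{k<..3 * k}. 1 / real (2 * l + 1))))))"

end

theory Submission
  imports Defs "HOL-Number_Theory.Number_Theory" "HOL-Computational_Algebra.Squarefree" "HOL-Real_Asymp.Real_Asymp"
begin

text \<open>
  A well-rounded sublattice has a basis \<open>v, w\<close> of minimal vectors. If it is not hexagonal, then
  \<open>v + w\<close> and \<open>v - w\<close> are orthogonal, so they are \<open>p z\<close> and \<open>q \<theta> z\<close> with \<open>z\<close> primitive and
  \<open>\<theta> = 2 \<rho> - 1\<close>, and one may take \<open>z\<close> not divisible by \<open>\<theta>\<close>; the minimality of \<open>v\<close> and \<open>w\<close> is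
  \<open>q < p < 3 q\<close>, membership in the lattice forces equal parity, the index is \<open>p q |z|\<^sup>2\<close>, and only the
  sign of \<open>z\<close> is ambiguous. Hexagonal sublattices are the nonzero ideals. So \<open>a\<^sub>\<triangle>\<close> is the ideal
  counting function plus its convolution with the counting function of the pairs \<open>(p, q)\<close>, thinned
  out by a Moebius sieve (primitivity) and by a geometric series in \<open>- 1 / 3\<close> (the factor \<open>\<theta>\<close>).
  The hyperbola method gives the main terms with error \<open>O(x\<^sup>3\<^sup>/\<^sup>4)\<close>, and dilations by squares and
  powers of 3 preserve this shape. The Laurent coefficient comes from comparing
  the Dirichlet series with \<open>- K \<zeta>' + c \<zeta>\<close>: the partial sums of the difference are \<open>O(x\<^sup>3\<^sup>/\<^sup>4)\<close>.
\<close>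

section \<open>Summatory functions and Dirichlet convolution\<close>

text \<open>The exponent 3/4 is that of the hyperbola method when both factors have summatory
  functions that are linear up to O(sqrt y): the arms stop at sqrt x, and summing sqrt (x / m) there
  costs x^(3/4). The dilations keep this because the sums of d^(-3/2) and of 3^(-3k/4) converge, but
  they run through arguments below 1, so the asymptotics are extended to all positive arguments. The
  convolution brings in the constants of the logarithmic means of both factors: L(1) gamma + L'(1)
  for the ideals, and for the pairs a constant containing one series over q, which measures how far
  the sum of 1 / p over q < p < 3 q, p of the parity of q, falls short of ln 3 / 2. Its terms decay
  only like 1 / q^2, and the series of zeta'(2) and L'(1) are no better, so the digits of the
  constant are won by Euler-Maclaurin summation with explicit remainders. The relation 2 zeta(2) = 9
  L(1)^2 leaves pi only inside L(1). That the coefficient of x is the Laurent coefficient depends on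
  the form x (log x - 1), which is that of the partial sums of log n.\<close>

definition summatory :: "(nat \<Rightarrow> real) \<Rightarrow> real \<Rightarrow> real" where
  "summatory f x = (\<Sum>n=1..nat \<lfloor>x\<rfloor>. f n)"

definition dconv :: "(nat \<Rightarrow> real) \<Rightarrow> (nat \<Rightarrow> real) \<Rightarrow> nat \<Rightarrow> real" where
  "dconv f g n = (\<Sum>d | d dvd n. f d * g (n div d))"

lemma summatory_of_nat [simp]: "summatory f (real n) = (\<Sum>k=1..n. f k)"
  by (simp add: summatory_def)

lemma summatory_less_1 [simp]: "x < 1 \<Longrightarrow> summatory f x = 0"
  by (auto simp: summatory_def)

text \<open>Real cutoffs x / m become truncated division of the integer cutoff, so exchanges of
  summation can be carried out over natural numbers.\<close>

lemma nat_floor_divide_nat: "nat \<lfloor>x / real m\<rfloor> = nat \<lfloor>x\<rfloor> div m" for x :: real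
proof -
  have "\<lfloor>x / real_of_int (int m)\<rfloor> = \<lfloor>x\<rfloor> div int m"
    by (rule floor_divide_real_eq_div) simp
  then show ?thesis
    by (cases "x \<ge> 0"; cases "m = 0") (auto simp: nat_div_distrib intro: div_nonpos_pos_le0)
qed

text \<open>A pair (n, d) with d dividing n is a lattice point (m, k) = (d, n / d) under the
  hyperbola m k \<le> N.\<close>

lemma dvd_pairs_conv_Sigma:
  "(SIGMA n:{1..N::nat}. {d. d dvd n}) = (\<lambda>(m, k). (m * k, m)) ` (SIGMA m:{1..N}. {1..N div m})"
proof -
  have "(n, d) \<in> (\<lambda>(m, k). (m * k, m)) ` (SIGMA m:{1..N}. {1..N div m})"
    if n: "n \<in> {1..N}" "d dvd n" for n d
  proof -
    from n obtain k where k: "n = d * k" by (auto elim: dvdE)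
    have "d * k \<ge> 1" "d * k \<le> N" using n k by auto
    then have "d \<noteq> 0" "k \<noteq> 0" by auto
    then have "d \<ge> 1" "k \<ge> 1" "d * k \<le> N" using \<open>d * k \<le> N\<close> by auto
    moreover from this have "d \<le> N" "k \<le> N div d"
      using le_trans[of d "d * k" N] by (auto simp: less_eq_div_iff_mult_less_eq mult.commute)
    ultimately show ?thesis using k by (intro image_eqI[of _ _ "(d, k)"]) auto
  qed
  moreover have "m * k \<in> {1..N}" if "m \<in> {1..N}" "k \<in> {1..N div m}" for m k
    using that by (auto simp: less_eq_div_iff_mult_less_eq mult.commute Suc_le_eq)
  ultimately show ?thesis by (auto simp del: One_nat_def)
qed

lemma sum_dvd_pairs:
  "(\<Sum>n=1..N. \<Sum>d | d dvd n. F d (n div d)) = (\<Sum>m=1..N. \<Sum>k=1..N div m. F m (k::nat) :: real)"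
proof -
  have "(\<Sum>n=1..N. \<Sum>d | d dvd n. F d (n div d)) = (\<Sum>(n, d)\<in>(SIGMA n:{1..N}. {d. d dvd n}). F d (n div d))"
    by (subst sum.Sigma) (auto simp: finite_divisors_nat)
  also have "\<dots> = (\<Sum>(m, k)\<in>(SIGMA m:{1..N}. {1..N div m}). F m k)"
    unfolding dvd_pairs_conv_Sigma
  proof (subst sum.reindex)
    show "inj_on (\<lambda>(m, k). (m * k, m)) (SIGMA m:{1..N}. {1..N div m})"
      by (auto simp: inj_on_def)
  qed (auto intro!: sum.cong)
  also have "\<dots> = (\<Sum>m=1..N. \<Sum>k=1..N div m. F m k)"
    by (subst sum.Sigma) auto
  finally show ?thesis .
qed

lemma summatory_dconv:
  "summatory (dconv f g) x = (\<Sum>m=1..nat \<lfloor>x\<rfloor>. f m * summatory g (x / real m))"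
  unfolding summatory_def dconv_def nat_floor_divide_nat
  by (subst sum_dvd_pairs[of "\<lambda>d k. f d * g k"]) (simp add: sum_distrib_left)

text \<open>Inclusion-exclusion on lattice points. With M the integer square root of N, a point
  under the hyperbola has a coordinate at most M, and the square of side M lies wholly under
  it.\<close>

lemma hyperbola_nat:
  assumes M: "M * M \<le> N" "N < Suc M * Suc M"
  shows "(\<Sum>m=1..N. \<Sum>k=1..N div m. F m k :: real) =
    (\<Sum>m=1..M. \<Sum>k=1..N div m. F m k) + (\<Sum>k=1..M. \<Sum>m=1..N div k. F m k) - (\<Sum>m=1..M. \<Sum>k=1..M. F m k)"
proof -
  define P where "P = (SIGMA m:{1..N}. {1..N div m})"
  define A where "A = (SIGMA m:{1..M}. {1..N div m})"
  define B where "B = (\<lambda>(k,m). (m,k)) ` (SIGMA k:{1..M}. {1..N div k})"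
  have fin: "finite A" "finite B" by (auto simp: A_def B_def)
  have MN: "M \<le> N" using M(1) le_square le_trans by blast
  have mem: "(m,k) \<in> P \<longleftrightarrow> 1 \<le> m \<and> 1 \<le> k \<and> m * k \<le> N" for m k
  proof -
    have "m \<le> N" if "m * k \<le> N" "1 \<le> k" using that le_trans[of m "m * k" N] by auto
    then show ?thesis by (auto simp: P_def less_eq_div_iff_mult_less_eq mult.commute)
  qed
  have memA: "(m,k) \<in> A \<longleftrightarrow> 1 \<le> m \<and> m \<le> M \<and> 1 \<le> k \<and> m * k \<le> N" for m k
    by (auto simp: A_def less_eq_div_iff_mult_less_eq mult.commute)
  have memB: "(m,k) \<in> B \<longleftrightarrow> 1 \<le> m \<and> k \<le> M \<and> 1 \<le> k \<and> m * k \<le> N" for m k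
    by (auto simp: B_def less_eq_div_iff_mult_less_eq mult.commute image_iff)
  have small: "m \<le> M \<or> k \<le> M" if "m * k \<le> N" for m k
  proof (rule ccontr)
    assume "\<not> ?thesis"
    then have "Suc M * Suc M \<le> m * k" by (intro mult_le_mono) auto
    with that M show False by simp
  qed
  have un: "P = A \<union> B"
  proof -
    have "z \<in> P \<longleftrightarrow> z \<in> A \<union> B" for z
      using small[of "fst z" "snd z"] by (cases z) (auto simp: mem memA memB)
    then show ?thesis by blast
  qed
  have int: "A \<inter> B = {1..M} \<times> {1..M}"
  proof -
    have "m * k \<le> N" if "m \<le> M" "k \<le> M" for m k
      using mult_le_mono[OF that] M(1) by simp
    then show ?thesis by (auto simp: memA memB)
  qed
  have "(\<Sum>m=1..N. \<Sum>k=1..N div m. F m k) = (\<Sum>(m,k)\<in>P. F m k)"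
    unfolding P_def by (subst sum.Sigma) auto
  also have "\<dots> = (\<Sum>(m,k)\<in>A. F m k) + (\<Sum>(m,k)\<in>B. F m k) - (\<Sum>(m,k)\<in>A \<inter> B. F m k)"
    unfolding un by (rule sum_Un[OF fin])
  also have "(\<Sum>(m,k)\<in>A. F m k) = (\<Sum>m=1..M. \<Sum>k=1..N div m. F m k)"
    unfolding A_def by (subst sum.Sigma) auto
  also have "(\<Sum>(m,k)\<in>B. F m k) = (\<Sum>k=1..M. \<Sum>m=1..N div k. F m k)"
    unfolding B_def by (subst sum.reindex) (auto simp: inj_on_def sum.Sigma intro!: sum.cong)
  also have "(\<Sum>(m,k)\<in>A \<inter> B. F m k) = (\<Sum>m=1..M. \<Sum>k=1..M. F m k)"
    unfolding int by (simp add: sum.cartesian_product)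
  finally show ?thesis .
qed

text \<open>Supplies the two hypotheses of \<open>hyperbola_nat\<close> for a real cutoff.\<close>

lemma floor_sqrt_bounds:
  fixes x :: real assumes "x \<ge> 0"
  shows "nat \<lfloor>sqrt x\<rfloor> * nat \<lfloor>sqrt x\<rfloor> \<le> nat \<lfloor>x\<rfloor>" "nat \<lfloor>x\<rfloor> < Suc (nat \<lfloor>sqrt x\<rfloor>) * Suc (nat \<lfloor>sqrt x\<rfloor>)"
proof -
  define M where "M = nat \<lfloor>sqrt x\<rfloor>"
  have "sqrt x \<ge> 0" using assms by simp
  then have M: "real M \<le> sqrt x" "sqrt x < real M + 1"
    unfolding M_def by linarith+
  have "real M * real M \<le> sqrt x * sqrt x" using M \<open>sqrt x \<ge> 0\<close> by (intro mult_mono) simp_all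
  then have "real (M * M) \<le> x" using assms by simp
  then show "nat \<lfloor>sqrt x\<rfloor> * nat \<lfloor>sqrt x\<rfloor> \<le> nat \<lfloor>x\<rfloor>" unfolding M_def[symmetric] by (simp add: le_nat_floor)
  have "sqrt x * sqrt x < (real M + 1) * (real M + 1)" using M assms by (intro mult_strict_mono) auto
  then have "x < real (Suc M * Suc M)" using assms by (simp add: algebra_simps)
  then show "nat \<lfloor>x\<rfloor> < Suc (nat \<lfloor>sqrt x\<rfloor>) * Suc (nat \<lfloor>sqrt x\<rfloor>)" unfolding M_def[symmetric]
    using assms by (simp add: floor_less_iff nat_less_iff del: of_nat_mult of_nat_Suc)
qed

lemma summatory_dconv_hyperbola:
  assumes "x \<ge> 0"
  shows "summatory (dconv f g) x =
    (\<Sum>m=1..nat \<lfloor>sqrt x\<rfloor>. f m * summatory g (x / real m)) +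
    (\<Sum>k=1..nat \<lfloor>sqrt x\<rfloor>. g k * summatory f (x / real k)) - summatory f (sqrt x) * summatory g (sqrt x)"
proof -
  have "summatory (dconv f g) x = (\<Sum>m=1..nat \<lfloor>x\<rfloor>. \<Sum>k=1..nat \<lfloor>x\<rfloor> div m. f m * g k)"
    unfolding summatory_def dconv_def by (rule sum_dvd_pairs)
  also note hyperbola_nat[OF floor_sqrt_bounds[OF assms], of "\<lambda>m k. f m * g k"]
  finally show ?thesis
    unfolding summatory_def nat_floor_divide_nat sum_product
    by (simp only: sum_distrib_left[symmetric] sum_distrib_right[symmetric] mult.commute[of "g _"])
qed

section \<open>Partial summation and the hyperbola method with square-root errors\<close>

lemma abel_summation:
  fixes f v :: "nat \<Rightarrow> 'a :: comm_ring_1"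
  shows "(\<Sum>n=1..N. f n * v n) = (\<Sum>n=1..N. f n) * v (Suc N) + (\<Sum>n=1..N. (\<Sum>k=1..n. f k) * (v n - v (Suc n)))"
  by (induction N) (simp_all add: algebra_simps)

text \<open>Partial summation is used twice: a decreasing weight preserves the comparison of the
  partial sums of \<open>f\<close> with those of the constant \<open>C\<close>, and the same
  identity read backwards for the constant resums the bound.\<close>

lemma sum_weighted_le:
  fixes f v :: "nat \<Rightarrow> real"
  assumes F: "\<And>n. (\<Sum>k=1..n. f k) \<le> C * real n"
    and v: "\<And>n. 1 \<le> n \<Longrightarrow> v (Suc n) \<le> v n" "\<And>n. 1 \<le> n \<Longrightarrow> v n \<ge> 0"
  shows "(\<Sum>n=1..N. f n * v n) \<le> C * (\<Sum>n=1..N. v n)"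
proof -
  have "(\<Sum>n=1..N. f n * v n) \<le> (C * real N) * v (Suc N) + (\<Sum>n=1..N. (C * real n) * (v n - v (Suc n)))"
    unfolding abel_summation[of f v] using F v by (intro add_mono mult_right_mono sum_mono) auto
  also have "\<dots> = (\<Sum>n=1..N. C * v n)"
    using abel_summation[of "\<lambda>_. C" v N] by (simp add: mult.commute)
  finally show ?thesis by (simp add: sum_distrib_left)
qed

lemma sum_inverse_sqrt_le: "(\<Sum>n=1..N. 1 / sqrt (real n)) \<le> 2 * sqrt (real N)"
proof (induction N)
  case (Suc N)
  \<comment> \<open>Telescoping against 2 sqrt n: the difference of consecutive roots is 1 / (a +
    b), and b \<le> a.\<close>
  have "1 / sqrt (real (Suc N)) \<le> 2 * (sqrt (real (Suc N)) - sqrt (real N))"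
  proof -
    define a b where "a = sqrt (real (Suc N))" and "b = sqrt (real N)"
    have ab: "a > 0" "b \<ge> 0" "b \<le> a" "a * a - b * b = 1" by (auto simp: a_def b_def)
    have "1 = (a - b) * (a + b)" using ab by (simp add: algebra_simps)
    also have "\<dots> \<le> (a - b) * (2 * a)" using ab by (intro mult_left_mono) auto
    finally show ?thesis using ab unfolding a_def[symmetric] b_def[symmetric] by (simp add: field_simps)
  qed
  with Suc show ?case by simp
qed auto

text \<open>Partial sums of at most linear growth, weighted by n^(-1/2), grow like sqrt s; with s =
  sqrt x this is the factor x^(1/4) in the error of each arm of the hyperbola.\<close>

lemma sum_over_sqrt_le:
  fixes f :: "nat \<Rightarrow> real"
  assumes "\<And>y. y \<ge> 1 \<Longrightarrow> \<bar>summatory f y - a * y\<bar> \<le> C * sqrt y" and "s \<ge> 1"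
  shows "(\<Sum>n=1..nat \<lfloor>s\<rfloor>. f n * (1 / sqrt (real n))) \<le> 2 * (\<bar>a\<bar> + \<bar>C\<bar>) * sqrt s"
proof -
  have "(\<Sum>k=1..n. f k) \<le> (\<bar>a\<bar> + \<bar>C\<bar>) * real n" for n
  proof (cases "n = 0")
    case False
    then have "\<bar>summatory f (real n) - a * n\<bar> \<le> C * sqrt n" using assms(1)[of "real n"] by auto
    then have "(\<Sum>k=1..n. f k) \<le> a * n + C * sqrt n" unfolding summatory_of_nat by linarith
    also have "\<dots> \<le> \<bar>a\<bar> * n + \<bar>C\<bar> * n"
      using False by (intro add_mono mult_mono) (auto simp: real_le_lsqrt power2_eq_square intro: order.trans[OF real_sqrt_le_iff[THEN iffD2, of _ "real n * real n"]])
    finally show ?thesis by (simp add: algebra_simps)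
  qed auto
  then have "(\<Sum>n=1..nat \<lfloor>s\<rfloor>. f n * (1 / sqrt (real n))) \<le> (\<bar>a\<bar> + \<bar>C\<bar>) * (\<Sum>n=1..nat \<lfloor>s\<rfloor>. 1 / sqrt (real n))"
    by (rule sum_weighted_le) (auto simp: field_simps)
  also have "\<dots> \<le> (\<bar>a\<bar> + \<bar>C\<bar>) * (2 * sqrt (real (nat \<lfloor>s\<rfloor>)))"
    by (intro mult_left_mono sum_inverse_sqrt_le) auto
  also have "\<dots> \<le> (\<bar>a\<bar> + \<bar>C\<bar>) * (2 * sqrt s)"
    using assms(2) by (intro mult_left_mono) auto
  finally show ?thesis by (simp add: algebra_simps)
qed

lemma abs_diff_le_trans_mult:
  "\<bar>u - v\<bar> \<le> p * t \<Longrightarrow> \<bar>v - w\<bar> \<le> q * t \<Longrightarrow> \<bar>u - w\<bar> \<le> (p + q) * (t :: real)"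
  by (simp add: distrib_right)

lemma abs_diff_le_add3_mult:
  "\<bar>u - u'\<bar> \<le> p * t \<Longrightarrow> \<bar>v - v'\<bar> \<le> q * t \<Longrightarrow> \<bar>w - w'\<bar> \<le> r * t \<Longrightarrow>
    \<bar>u + v - w - (u' + v' - w')\<bar> \<le> (p + q + r) * (t :: real)"
  by (simp add: distrib_right)

text \<open>One arm of the hyperbola. Replacing \<open>summatory g (x / m)\<close> by b x / m costs
  at most C2 sqrt x * f m / sqrt m, which \<open>sum_over_sqrt_le\<close> sums to order x^(3/4). The
  main terms form the logarithmic mean of \<open>f\<close> at sqrt x, whose own error x^(-1/4) is
  multiplied by x.\<close>

lemma hyperbola_half:
  fixes f g :: "nat \<Rightarrow> real"
  assumes nonneg: "\<And>n. f n \<ge> 0"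
    and F: "\<And>y. y \<ge> 1 \<Longrightarrow> \<bar>summatory f y - a * y\<bar> \<le> C1 * sqrt y"
    and F1: "\<And>y. y \<ge> 1 \<Longrightarrow> \<bar>summatory (\<lambda>n. f n / real n) y - (a * ln y + a')\<bar> \<le> C3 / sqrt y"
    and G: "\<And>y. y \<ge> 1 \<Longrightarrow> \<bar>summatory g y - b * y\<bar> \<le> C2 * sqrt y"
    and x: "x \<ge> 1"
  shows "\<bar>(\<Sum>m=1..nat \<lfloor>sqrt x\<rfloor>. f m * summatory g (x / real m)) - b * x * (a * ln (sqrt x) + a')\<bar>
     \<le> (2 * C2 * (\<bar>a\<bar> + \<bar>C1\<bar>) + \<bar>b\<bar> * C3) * (sqrt x * sqrt (sqrt x))"
proof -
  define s where "s = sqrt x"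
  have s: "s \<ge> 1" "s * s = x" using x by (auto simp: s_def)
  have C2: "C2 \<ge> 0" using G[of 1] by simp
  let ?M = "nat \<lfloor>s\<rfloor>"
  have ineq1: "\<bar>f m * summatory g (x / real m) - b * x * (f m / real m)\<bar> \<le> C2 * s * (f m * (1 / sqrt (real m)))"
    if "m \<in> {1..?M}" for m
  proof -
    have m: "1 \<le> m" "real m \<le> s" using that s by (auto simp: le_nat_iff le_floor_iff)
    have "real m * 1 \<le> s * s" using m s by (intro mult_mono) auto
    then have "x / real m \<ge> 1" using m s by (simp add: field_simps)
    from G[OF this] have "\<bar>summatory g (x / real m) - b * (x / real m)\<bar> \<le> C2 * (s / sqrt (real m))"
      by (simp add: s_def real_sqrt_divide)
    then have "f m * \<bar>summatory g (x / real m) - b * (x / real m)\<bar> \<le> f m * (C2 * (s / sqrt (real m)))"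
      using nonneg by (intro mult_left_mono) auto
    also have "f m * \<bar>summatory g (x / real m) - b * (x / real m)\<bar> = \<bar>f m * (summatory g (x / real m) - b * (x / real m))\<bar>"
      using nonneg[of m] by (simp add: abs_mult)
    finally show ?thesis by (simp add: algebra_simps)
  qed
  have "\<bar>(\<Sum>m=1..?M. f m * summatory g (x / real m)) - b * x * summatory (\<lambda>n. f n / real n) s\<bar>
      = \<bar>\<Sum>m=1..?M. f m * summatory g (x / real m) - b * x * (f m / real m)\<bar>"
    by (simp add: summatory_def sum_subtractf sum_distrib_left)
  also have "\<dots> \<le> (\<Sum>m=1..?M. C2 * s * (f m * (1 / sqrt (real m))))"
    by (rule order.trans[OF sum_abs sum_mono]) (use ineq1 in auto)
  also have "\<dots> = C2 * s * (\<Sum>m=1..?M. f m * (1 / sqrt (real m)))" by (simp add: sum_distrib_left)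
  also have "\<dots> \<le> C2 * s * (2 * (\<bar>a\<bar> + \<bar>C1\<bar>) * sqrt s)"
    using s C2 by (intro mult_left_mono sum_over_sqrt_le[OF F]) auto
  finally have 1: "\<bar>(\<Sum>m=1..?M. f m * summatory g (x / real m)) - b * x * summatory (\<lambda>n. f n / real n) s\<bar>
     \<le> 2 * C2 * (\<bar>a\<bar> + \<bar>C1\<bar>) * (s * sqrt s)" by (simp add: algebra_simps)
  have "\<bar>b * x * summatory (\<lambda>n. f n / real n) s - b * x * (a * ln s + a')\<bar>
      = \<bar>b\<bar> * x * \<bar>summatory (\<lambda>n. f n / real n) s - (a * ln s + a')\<bar>"
    using x by (simp add: abs_mult flip: right_diff_distrib)
  also have "\<dots> \<le> \<bar>b\<bar> * x * (C3 / sqrt s)"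
    using x F1[OF s(1)] by (intro mult_left_mono) auto
  also have "x / sqrt s = s * sqrt s" using s by (simp add: field_simps flip: s(2))
  then have "\<bar>b\<bar> * x * (C3 / sqrt s) = \<bar>b\<bar> * C3 * (s * sqrt s)"
    by (metis (no_types, opaque_lifting) mult.assoc mult.commute times_divide_eq_right)
  finally have 2: "\<bar>b * x * summatory (\<lambda>n. f n / real n) s - b * x * (a * ln s + a')\<bar> \<le> \<bar>b\<bar> * C3 * (s * sqrt s)" .
  show ?thesis using abs_diff_le_trans_mult[OF 1 2] unfolding s_def .
qed

lemma sqrt_sqrt_conv_powr: "x > 0 \<Longrightarrow> sqrt x * sqrt (sqrt x) = x powr (3/4)"
  by (simp add: powr_half_sqrt[symmetric] powr_powr flip: powr_add)

text \<open>Each arm contributes a b x ln (sqrt x), so together they give the full logarithm; the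
  corner square subtracts a b x, the origin of \<open>- a * b\<close> in the linear
  coefficient.\<close>

lemma dconv_summatory_asymptotics:
  fixes f g :: "nat \<Rightarrow> real"
  assumes nonneg: "\<And>n. f n \<ge> 0" "\<And>n. g n \<ge> 0"
    and F: "\<And>y. y \<ge> 1 \<Longrightarrow> \<bar>summatory f y - a * y\<bar> \<le> C1 * sqrt y"
    and F1: "\<And>y. y \<ge> 1 \<Longrightarrow> \<bar>summatory (\<lambda>n. f n / real n) y - (a * ln y + a')\<bar> \<le> C3 / sqrt y"
    and G: "\<And>y. y \<ge> 1 \<Longrightarrow> \<bar>summatory g y - b * y\<bar> \<le> C2 * sqrt y"
    and G1: "\<And>y. y \<ge> 1 \<Longrightarrow> \<bar>summatory (\<lambda>n. g n / real n) y - (b * ln y + b')\<bar> \<le> C4 / sqrt y"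
  obtains C where "\<And>x. x \<ge> 1 \<Longrightarrow>
    \<bar>summatory (dconv f g) x - (a * b * x * ln x + (a * b' + a' * b - a * b) * x)\<bar> \<le> C * x powr (3/4)"
proof
  fix x :: real assume x: "x \<ge> 1"
  define s where "s = sqrt x"
  have s: "s \<ge> 1" "s * s = x" using x by (auto simp: s_def)
  have C: "C1 \<ge> 0" "C2 \<ge> 0" using F[of 1] G[of 1] by simp_all
  note H1 = hyperbola_half[OF nonneg(1) F F1 G x]
  note H2 = hyperbola_half[OF nonneg(2) G G1 F x]
  have "\<bar>summatory f s * summatory g s - a * b * x\<bar> = \<bar>(summatory f s - a * s) * summatory g s + a * s * (summatory g s - b * s)\<bar>"
    using s by (simp add: algebra_simps flip: s(2))
  also have "\<dots> \<le> \<bar>summatory f s - a * s\<bar> * \<bar>summatory g s\<bar> + \<bar>a\<bar> * s * \<bar>summatory g s - b * s\<bar>"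
    using s by (intro order.trans[OF abs_triangle_ineq]) (simp add: abs_mult)
  also have "\<dots> \<le> (C1 * sqrt s) * ((\<bar>b\<bar> + C2) * s) + \<bar>a\<bar> * s * (C2 * sqrt s)"
  proof (intro add_mono mult_mono F G s mult_nonneg_nonneg)
    have "\<bar>summatory g s\<bar> \<le> \<bar>b * s\<bar> + C2 * sqrt s" using G[OF s(1)] by linarith
    also have "C2 * sqrt s \<le> C2 * s"
    proof (intro mult_left_mono C)
      show "sqrt s \<le> s" using s by (intro real_le_lsqrt) (auto simp: power2_eq_square)
    qed
    finally show "\<bar>summatory g s\<bar> \<le> (\<bar>b\<bar> + C2) * s" using s by (simp add: abs_mult algebra_simps)
  qed (use s C in auto)
  finally have H3: "\<bar>summatory f s * summatory g s - a * b * x\<bar> \<le> (C1 * (\<bar>b\<bar> + C2) + \<bar>a\<bar> * C2) * (s * sqrt s)"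
    by (simp add: algebra_simps)
  have lns: "ln x = 2 * ln s" using s by (simp flip: s(2) add: ln_mult)
  have main: "a * b * x * ln x + (a * b' + a' * b - a * b) * x =
      b * x * (a * ln s + a') + a * x * (b * ln s + b') - a * b * x"
    unfolding lns by (simp add: algebra_simps)
  have "\<bar>summatory (dconv f g) x - (a * b * x * ln x + (a * b' + a' * b - a * b) * x)\<bar> \<le>
      ((2 * C2 * (\<bar>a\<bar> + \<bar>C1\<bar>) + \<bar>b\<bar> * C3) + (2 * C1 * (\<bar>b\<bar> + \<bar>C2\<bar>) + \<bar>a\<bar> * C4)
      + (C1 * (\<bar>b\<bar> + C2) + \<bar>a\<bar> * C2)) * (s * sqrt s)"
    unfolding main summatory_dconv_hyperbola[OF order.trans[OF zero_le_one x]]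
    using abs_diff_le_add3_mult[OF H1[folded s_def] H2[folded s_def] H3] unfolding s_def .
  also have "s * sqrt s = x powr (3/4)" using x by (simp add: s_def sqrt_sqrt_conv_powr)
  finally show "\<bar>summatory (dconv f g) x - (a * b * x * ln x + (a * b' + a' * b - a * b) * x)\<bar> \<le>
     ((2 * C2 * (\<bar>a\<bar> + \<bar>C1\<bar>) + \<bar>b\<bar> * C3) + (2 * C1 * (\<bar>b\<bar> + \<bar>C2\<bar>) + \<bar>a\<bar> * C4)
      + (C1 * (\<bar>b\<bar> + C2) + \<bar>a\<bar> * C2)) * x powr (3/4)" .
qed

section \<open>The norm form of the Eisenstein integers\<close>

text \<open>The squared absolute value of x + y rho. The mixed term has a plus sign because rho is a
  primitive sixth root of unity, of trace 1.\<close>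

definition eis_norm :: "int \<Rightarrow> int \<Rightarrow> int" where
  "eis_norm x y = x\<^sup>2 + x * y + y\<^sup>2"

definition eis_reps :: "nat \<Rightarrow> (int \<times> int) set" where
  "eis_reps n = {(x, y). eis_norm x y = int n}"

lemma four_eis_norm: "4 * eis_norm x y = (2 * x + y)\<^sup>2 + 3 * y\<^sup>2"
  by (simp add: eis_norm_def power2_eq_square algebra_simps)

lemma eis_norm_commute: "eis_norm x y = eis_norm y x"
  by (simp add: eis_norm_def)

lemma eis_norm_nonneg: "eis_norm x y \<ge> 0"
proof -
  have "4 * eis_norm x y \<ge> 0" unfolding four_eis_norm by simp
  then show ?thesis by simp
qed

lemma eis_norm_eq_0_iff [simp]: "eis_norm x y = 0 \<longleftrightarrow> x = 0 \<and> y = 0"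
proof
  assume "eis_norm x y = 0"
  then have "(2 * x + y)\<^sup>2 + 3 * y\<^sup>2 = 0" using four_eis_norm[of x y] by simp
  then have "y\<^sup>2 = 0" "(2 * x + y)\<^sup>2 = 0"
    using zero_le_power2[of y] zero_le_power2[of "2 * x + y"] by linarith+
  then show "x = 0 \<and> y = 0" by simp
qed (simp add: eis_norm_def)

text \<open>The arguments on the left are the coordinates of (x + y rho)(a + b rho), computed with
  rho^2 = rho - 1.\<close>

lemma eis_norm_mult:
  "eis_norm (x * a - y * b) (x * b + y * a + y * b) = eis_norm x y * eis_norm a b"
  by (simp add: eis_norm_def power2_eq_square algebra_simps)

lemma eis_norm_scale: "eis_norm (d * x) (d * y) = d\<^sup>2 * eis_norm x y"
  by (simp add: eis_norm_def power2_eq_square algebra_simps)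

lemma square_le_eis_norm: "y\<^sup>2 \<le> 4 * eis_norm x y" "x\<^sup>2 \<le> 4 * eis_norm x y"
proof -
  show y: "y\<^sup>2 \<le> 4 * eis_norm x y" for x y
    using four_eis_norm[of x y] zero_le_power2[of "2 * x + y"] zero_le_power2[of y] by linarith
  show "x\<^sup>2 \<le> 4 * eis_norm x y" using y[of x y] eis_norm_commute[of x y] by simp
qed

lemma finite_eis_reps [simp]: "finite (eis_reps n)"
proof (rule finite_subset)
  have *: "\<bar>x\<bar> \<le> 4 * int n" if "x\<^sup>2 \<le> 4 * int n" for x
  proof -
    have "\<bar>x\<bar> * 1 \<le> \<bar>x\<bar> * \<bar>x\<bar>" if "x \<noteq> 0" using that by (intro mult_left_mono) auto
    then have "\<bar>x\<bar> \<le> x\<^sup>2" by (cases "x = 0") (auto simp: power2_eq_square abs_mult_self_eq)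
    then show ?thesis using that by simp
  qed
  show "eis_reps n \<subseteq> {- 4 * int n..4 * int n} \<times> {- 4 * int n..4 * int n}"
  proof (rule subrelI)
    fix x y assume "(x, y) \<in> eis_reps n"
    then have "x\<^sup>2 \<le> 4 * int n" "y\<^sup>2 \<le> 4 * int n" using square_le_eis_norm[of x y] square_le_eis_norm[of y x] by (auto simp: eis_reps_def)
    then show "(x, y) \<in> {- 4 * int n..4 * int n} \<times> {- 4 * int n..4 * int n}"
      using * by (auto simp: abs_le_iff) (smt (verit))+
  qed
qed auto

section \<open>Inert, split and ramified primes\<close>

text \<open>Such primes are inert. The norm divides x^3 - y^3, and cubing is injective on nonzero
  residues because 3 does not divide p - 1; hence x and y are congruent, which makes the norm
  congruent to 3 y^2.\<close>

lemma eis_norm_dvd_imp_dvd_of_prime_2_mod_3: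
  fixes p :: nat
  assumes p: "prime p" "p mod 3 = 2" and dvd: "int p dvd eis_norm x y"
  shows "int p dvd x \<and> int p dvd y"
proof -
  have pp: "prime (int p)" using p by simp
  have dvd_x: "int p dvd x \<Longrightarrow> int p dvd y" if "int p dvd eis_norm x y" for x y
  proof -
    assume "int p dvd x"
    moreover have "y\<^sup>2 = eis_norm x y - x * (x + y)" by (simp add: eis_norm_def power2_eq_square algebra_simps)
    ultimately have "int p dvd y\<^sup>2" using that by simp
    then show "int p dvd y" using pp prime_dvd_power by blast
  qed
  have "int p dvd x \<or> int p dvd y"
  proof (rule ccontr)
    assume "\<not> ?thesis"
    then have nx: "\<not> int p dvd x" and ny: "\<not> int p dvd y" by auto
    define k where "k = p div 3"
    \<comment> \<open>Since p = 3 k + 2, Fermat makes z^(3k) the inverse of z, so residues with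
      equal cubes have equal inverses.\<close>
    have pk: "p - 1 = 3 * k + 1" using p(2) unfolding k_def by presburger
    have flt: "[z ^ (3 * k + 1) = 1] (mod int p)" if "\<not> int p dvd z" for z
    proof -
      define u where "u = nat (z mod int p)"
      have u: "int u = z mod int p" using p(1) by (simp add: u_def prime_gt_0_nat)
      have "\<not> p dvd u"
        using that u by (metis dvd_mod_iff int_dvd_int_iff dvd_refl)
      then have "[u ^ (p - 1) = 1] (mod p)" using fermat_theorem p(1) by blast
      then have "[int u ^ (p - 1) = 1] (mod int p)"
        by (metis cong_int_iff of_nat_1 of_nat_power)
      moreover have "[int u = z] (mod int p)" unfolding u by (simp add: cong_def)
      ultimately show ?thesis unfolding pk by (metis cong_pow cong_sym cong_trans)
    qed
    have "x ^ 3 - y ^ 3 = (x - y) * eis_norm x y"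
      by (simp add: eis_norm_def power2_eq_square power3_eq_cube algebra_simps)
    then have "[x ^ 3 = y ^ 3] (mod int p)" using dvd by (simp add: cong_iff_dvd_diff)
    then have "[(x ^ 3) ^ k = (y ^ 3) ^ k] (mod int p)" by (rule cong_pow)
    then have "[x ^ (3 * k) * x = y ^ (3 * k) * x] (mod int p)"
      by (simp add: power_mult cong_mult)
    moreover have "[x ^ (3 * k) * x = y ^ (3 * k) * y] (mod int p)"
      using flt[OF nx] flt[OF ny] by (simp add: mult.commute) (metis cong_sym cong_trans)
    ultimately have "[y ^ (3 * k) * x = y ^ (3 * k) * y] (mod int p)"
      by (metis cong_sym cong_trans)
    then have "int p dvd y ^ (3 * k) * (x - y)" by (simp add: cong_iff_dvd_diff algebra_simps)
    then have xy: "int p dvd x - y" using pp ny prime_dvd_mult_iff prime_dvd_power by blast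
    have "3 * y\<^sup>2 = eis_norm x y - (x - y) * (x + 2 * y)" by (simp add: eis_norm_def power2_eq_square algebra_simps)
    then have "int p dvd 3 * y\<^sup>2" using dvd xy by simp
    then have "int p dvd 3" using pp ny prime_dvd_mult_iff prime_dvd_power by blast
    then have "p dvd 3" by (metis int_dvd_int_iff of_nat_numeral)
    then have "p \<le> 3" "p \<noteq> 2" by (auto dest: dvd_imp_le)
    then show False using p by (cases "p = 3") (auto dest: prime_ge_2_nat)
  qed
  then show ?thesis using dvd_x dvd eis_norm_commute[of x y] by metis
qed

text \<open>Such primes split. This is Thue's argument with a primitive cube root of unity t modulo
  p: some small nonzero (x, y) satisfies x = t y modulo p, so its norm is a positive multiple of p
  below 3 p.\<close>

lemma eis_norm_eq_prime:
  fixes p :: nat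
  assumes p: "prime p" "p mod 3 = 1"
  obtains a b where "eis_norm a b = int p"
proof -
  have "3 dvd p - 1" using p(2) by presburger
  then have "card {x\<in>totatives p. ord p x = 3} = totient 3"
    using prime_card_elements_with_ord_eq_totient[OF prime_gt_1_nat[OF p(1)] p(1), of 3] by simp
  moreover have "totient 3 > (0 :: nat)" by simp
  ultimately obtain t0 where t0: "ord p t0 = 3"
    by (metis (mono_tags, lifting) Collect_empty_eq card.empty less_irrefl)
  define t where "t = int t0"
  have t3: "[t ^ 3 = 1] (mod int p)"
    using ord[of t0 p] t0 unfolding t_def by (metis cong_int_iff of_nat_1 of_nat_power)
  have t1: "\<not> int p dvd t - 1"
  proof
    assume "int p dvd t - 1"
    then have "[t0 = 1] (mod p)" unfolding t_def by (metis cong_iff_dvd_diff cong_int_iff of_nat_1)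
    then have "ord p t0 = 1" by (simp add: ord_eq_Suc_0_iff)
    then show False using t0 by simp
  qed
  have "t ^ 3 - 1 = (t - 1) * (t\<^sup>2 + t + 1)" by (simp add: power2_eq_square power3_eq_cube algebra_simps)
  then have "int p dvd (t - 1) * (t\<^sup>2 + t + 1)" using t3 by (simp add: cong_iff_dvd_diff)
  then have tt: "int p dvd t\<^sup>2 + t + 1" using t1 p(1) by (simp add: prime_dvd_mult_iff)
  \<comment> \<open>The box with s + 1 points on each side holds more than p points, while s^2 < p
    keeps each of the three monomials of the norm below p in absolute value.\<close>
  define s where "s = floor_sqrt p"
  have s: "s\<^sup>2 \<le> p" "p < (Suc s)\<^sup>2" by (simp_all add: s_def Suc_floor_sqrt_power2_gt)
  have s2: "s\<^sup>2 \<noteq> p"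
  proof
    assume *: "s\<^sup>2 = p"
    then have "s dvd p" by (metis dvd_triv_left power2_eq_square)
    then have "s = 1 \<or> s = p" using p(1) by (simp add: prime_nat_iff)
    then show False using * p(1) prime_gt_1_nat[OF p(1)] by (auto simp: power2_eq_square)
  qed
  define f where "f = (\<lambda>(i, j). (i - t * j) mod int p)"
  let ?S = "{0..int s} \<times> {0..int s}"
  have "f ` ?S \<subseteq> {0..<int p}" using p(1) by (auto simp: f_def prime_gt_0_nat)
  then have "card (f ` ?S) \<le> p" using card_mono[of "{0..<int p}" "f ` ?S"] by simp
  also have "p < card ?S" using s(2) by (simp add: power2_eq_square nat_add_distrib)
  finally have "\<not> inj_on f ?S" using pigeonhole by blast
  then obtain i j i' j' where ij: "(i,j) \<in> ?S" "(i',j') \<in> ?S" "(i,j) \<noteq> (i',j')" "f (i,j) = f (i',j')"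
    unfolding inj_on_def by fast
  define x y where "x = i - i'" and "y = j - j'"
  have xy: "\<bar>x\<bar> \<le> int s" "\<bar>y\<bar> \<le> int s" "x \<noteq> 0 \<or> y \<noteq> 0" using ij by (auto simp: x_def y_def)
  have "int p dvd (i - t * j) - (i' - t * j')" using ij(4) by (simp add: f_def mod_eq_dvd_iff)
  then have d: "int p dvd x - t * y" by (simp add: x_def y_def algebra_simps)
  have "eis_norm x y = (x - t * y) * (x + t * y + y) + y\<^sup>2 * (t\<^sup>2 + t + 1)"
    by (simp add: eis_norm_def power2_eq_square algebra_simps)
  then have "int p dvd eis_norm x y" using d tt by simp
  then obtain k where k: "eis_norm x y = int p * k" by (elim dvdE)
  have pos: "eis_norm x y > 0" using xy(3) eis_norm_nonneg[of x y] eis_norm_eq_0_iff[of x y] by linarith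
  have ab: "\<bar>u\<bar> * \<bar>v\<bar> < int p" if "\<bar>u\<bar> \<le> int s" "\<bar>v\<bar> \<le> int s" for u v
  proof -
    have "\<bar>u\<bar> * \<bar>v\<bar> \<le> int s * int s" using that by (intro mult_mono) auto
    also have "\<dots> = int (s\<^sup>2)" by (simp add: power2_eq_square)
    also have "\<dots> < int p" using s s2 by linarith
    finally show ?thesis .
  qed
  have "eis_norm x y \<le> \<bar>x\<bar> * \<bar>x\<bar> + \<bar>x\<bar> * \<bar>y\<bar> + \<bar>y\<bar> * \<bar>y\<bar>"
    by (simp add: eis_norm_def power2_eq_square flip: abs_mult)
  also have "\<dots> < int p + int p + int p" by (intro add_strict_mono ab xy(1,2))
  finally have "int p * k < int p * 3" using k by simp
  then have "k < 3" using p(1) by (simp add: prime_gt_0_nat)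
  moreover have "k > 0" using pos k p(1) by (simp add: zero_less_mult_iff prime_gt_0_nat)
  ultimately have "k = 1 \<or> k = 2" by linarith
  \<comment> \<open>The form x^2 + x y + y^2 is even only when x and y both are, and then it is
    divisible by 4, while 2 p is not.\<close>
  moreover have "k \<noteq> 2"
  proof
    assume "k = 2"
    then have ev: "eis_norm x y = 2 * int p" using k by simp
    then have "even (x\<^sup>2 + x * y + y\<^sup>2)" by (simp add: eis_norm_def)
    then have "even x" "even y" by auto
    then obtain u v where "x = 2 * u" "y = 2 * v" by (elim evenE)
    then have "2 * int p = 4 * eis_norm u v" using ev eis_norm_scale[of 2 u v] by simp
    then have "even (int p)" by presburger
    then have "p = 2" using p(1) by (metis even_of_nat primes_dvd_imp_eq two_is_prime_nat)
    then show False using p(2) by simp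
  qed
  ultimately show ?thesis using k that by auto
qed

lemma card_eis_reps_scaled:
  fixes p n :: nat
  assumes p: "prime p"
  shows "card {z\<in>eis_reps (p * n). int p dvd fst z \<and> int p dvd snd z} = (if p dvd n then card (eis_reps (n div p)) else 0)"
proof (cases "p dvd n")
  case True
  then obtain m where m: "n = p * m" by (elim dvdE)
  have p0: "p > 0" using p by (simp add: prime_gt_0_nat)
  have "{z\<in>eis_reps (p * n). int p dvd fst z \<and> int p dvd snd z} = (\<lambda>(x,y). (int p * x, int p * y)) ` eis_reps m"
    using p0 by (auto simp: eis_reps_def m eis_norm_scale power2_eq_square elim!: dvdE intro!: image_eqI)
  then show ?thesis using True p0 by (simp add: m card_image inj_on_def split_def prod_eq_iff)
next
  case False
  have "eis_norm (int p * u) (int p * v) \<noteq> int (p * n)" for u v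
  proof
    assume "eis_norm (int p * u) (int p * v) = int (p * n)"
    then have "int p * (int p * eis_norm u v) = int p * int n" by (simp add: eis_norm_scale power2_eq_square mult.assoc)
    then have "int n = int p * eis_norm u v" using p by auto
    then have "p dvd n" by (metis dvd_triv_left int_dvd_int_iff)
    with False show False by simp
  qed
  then have "{z\<in>eis_reps (p * n). int p dvd fst z \<and> int p dvd snd z} = {}"
    by (auto simp: eis_reps_def elim!: dvdE)
  then show ?thesis using False by simp
qed

text \<open>Multiplication by a + b rho, an element of norm p, embeds the representations of n into
  those of p n; the congruence in the statement is divisibility by this element.\<close>

lemma card_eis_reps_prime_factor:
  fixes p n :: nat and a b :: int
  assumes p: "prime p" and ab: "eis_norm a b = int p"
  shows "card {z\<in>eis_reps (p * n). int p dvd snd z * a - fst z * b} = card (eis_reps n)"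
proof -
  have p0: "int p > 0" using p by (simp add: prime_gt_0_nat)
  define f where "f = (\<lambda>(u, v). (u * a - v * b, u * b + v * a + v * b))"
  have inv1: "x * (a + b) + y * b = int p * u" "y * a - x * b = int p * v" if "f (u, v) = (x, y)" for u v x y
  proof -
    have xy: "x = u * a - v * b" "y = u * b + v * a + v * b" using that by (auto simp: f_def)
    show "x * (a + b) + y * b = int p * u" "y * a - x * b = int p * v"
      unfolding ab[symmetric] xy eis_norm_def by (simp_all add: power2_eq_square algebra_simps)
  qed
  have "inj f"
  proof (rule injI, clarify)
    fix u v u' v' assume "f (u, v) = f (u', v')"
    moreover obtain x y where "f (u', v') = (x, y)" by (cases "f (u', v')")
    ultimately show "u = u' \<and> v = v'" using inv1[of u v x y] inv1[of u' v' x y] p0 by auto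
  qed
  moreover have "{z\<in>eis_reps (p * n). int p dvd snd z * a - fst z * b} = f ` eis_reps n"
  proof (intro equalityI subsetI)
    fix z assume "z \<in> f ` eis_reps n"
    then obtain u v where uv: "z = f (u, v)" "eis_norm u v = int n" by (auto simp: eis_reps_def)
    obtain x y where xy: "z = (x, y)" by (cases z)
    have "eis_norm x y = int (p * n)"
      using xy uv eis_norm_mult[of u a v b] ab by (simp add: f_def)
    then show "z \<in> {z\<in>eis_reps (p * n). int p dvd snd z * a - fst z * b}"
      using inv1(2)[of u v x y] uv(1)[symmetric] unfolding xy by (simp add: eis_reps_def)
  next
    fix z assume "z \<in> {z\<in>eis_reps (p * n). int p dvd snd z * a - fst z * b}"
    moreover obtain x y where z: "z = (x, y)" by (cases z)
    ultimately have N: "eis_norm x y = int p * int n" and "int p dvd y * a - x * b" by (auto simp: eis_reps_def)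
    then obtain v where v: "y * a - x * b = int p * v" by (elim dvdE)
    \<comment> \<open>\<open>w\<close> and y a - x b are the coordinates of x + y rho times the
      conjugate (a + b) - b rho. Dividing both by p inverts the embedding, and the norm forces p to
      divide \<open>w\<close> as well.\<close>
    define w where "w = x * (a + b) + y * b"
    have "eis_norm w (y * a - x * b) = eis_norm x y * eis_norm a b"
      unfolding w_def by (simp add: eis_norm_def power2_eq_square algebra_simps)
    then have "w\<^sup>2 = int p * (int p * int n) - (int p * v) * (w + int p * v)"
      unfolding v N ab by (simp add: eis_norm_def power2_eq_square algebra_simps)
    then have "int p dvd w\<^sup>2" by simp
    then have "int p dvd w" using p by (metis prime_dvd_power prime_nat_int_transfer)
    then obtain u where u: "w = int p * u" by (elim dvdE)
    have "int p * (u * a - v * b) = int p * x" "int p * (u * b + v * a + v * b) = int p * y"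
    proof -
      have "int p * (u * a - v * b) = w * a - (y * a - x * b) * b" unfolding u v by (simp add: algebra_simps)
      also have "\<dots> = eis_norm a b * x" by (simp add: w_def eis_norm_def power2_eq_square algebra_simps)
      finally show "int p * (u * a - v * b) = int p * x" using ab by simp
      have "int p * (u * b + v * a + v * b) = w * b + (y * a - x * b) * (a + b)" unfolding u v by (simp add: algebra_simps)
      also have "\<dots> = eis_norm a b * y" by (simp add: w_def eis_norm_def power2_eq_square algebra_simps)
      finally show "int p * (u * b + v * a + v * b) = int p * y" using ab by simp
    qed
    then have f: "f (u, v) = z" using p0 by (simp add: f_def z)
    have "int p * eis_norm u v = int p * int n"
    proof -
      have "u * a - v * b = x" "u * b + v * a + v * b = y" using f by (simp_all add: f_def z)
      then have "eis_norm x y = eis_norm u v * eis_norm a b" using eis_norm_mult[of u a v b] by simp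
      then show ?thesis unfolding N ab by (metis mult.commute)
    qed
    then have "eis_norm u v = int n" using p0 by simp
    then have "(u, v) \<in> eis_reps n" by (simp add: eis_reps_def)
    then show "z \<in> f ` eis_reps n" using f by blast
  qed
  ultimately show ?thesis by (simp add: card_image inj_on_subset)
qed

lemma prime_3_nat: "prime (3 :: nat)"
  by simp

lemma chi3_mult: "chi3 (m * n) = chi3 m * chi3 n"
proof -
  have "m mod 3 = 0 \<or> m mod 3 = 1 \<or> m mod 3 = 2" "n mod 3 = 0 \<or> n mod 3 = 1 \<or> n mod 3 = 2" by presburger+
  moreover have "(m * n) mod 3 = ((m mod 3) * (n mod 3)) mod 3" by (simp add: mod_mult_eq)
  ultimately show ?thesis unfolding chi3_def by (elim disjE) simp_all
qed

text \<open>The Euler factor (1 - T)(1 - chi3 p T) of the Dirichlet series of ideals, written as a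
  recursion. The residue of p modulo 3 decides between ramified, split and inert.\<close>

lemma card_eis_reps_prime_mult:
  fixes p n :: nat
  assumes p: "prime p"
  shows "real (card (eis_reps (p * n))) = (1 + chi3 p) * card (eis_reps n)
           - chi3 p * (if p dvd n then card (eis_reps (n div p)) else 0)"
proof -
  consider "p mod 3 = 0" | "p mod 3 = 1" | "p mod 3 = 2" by linarith
  then show ?thesis
  proof cases
    case 1
    then have p3: "p = 3" using p by (metis mod_0_imp_dvd primes_dvd_imp_eq prime_3_nat)
    \<comment> \<open>Multiplication by theta = 2 rho - 1, of norm 3: the prime 3 is ramified and
      every representation of 3 n is a multiple of theta.\<close>
    define f :: "int \<times> int \<Rightarrow> int \<times> int" where "f = (\<lambda>(u, v). (- u - 2 * v, 2 * u + v))"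
    have "eis_reps (3 * n) = f ` eis_reps n"
    proof (intro equalityI subsetI)
      fix z assume "z \<in> eis_reps (3 * n)"
      then obtain x y where z: "z = (x, y)" and N: "eis_norm x y = 3 * int n" by (auto simp: eis_reps_def)
      have "(x - y)\<^sup>2 = 3 * (int n - x * y)" using N by (simp add: eis_norm_def power2_eq_square algebra_simps)
      then have "3 dvd (x - y)\<^sup>2" by simp
      moreover have "prime (3 :: int)" by simp
      ultimately have "3 dvd x - y" using prime_dvd_power by blast
      then obtain k where k: "x = y + 3 * k" by (metis add.commute diff_add_cancel dvdE)
      have "f (y + k, - y - 2 * k) = z" by (simp add: f_def z k)
      moreover have "3 * eis_norm (y + k) (- y - 2 * k) = 3 * int n"
        unfolding N[symmetric] k eis_norm_def by (simp add: power2_eq_square algebra_simps)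
      ultimately show "z \<in> f ` eis_reps n" by (auto simp: eis_reps_def intro!: image_eqI[of _ _ "(y + k, - y - 2 * k)"])
    next
      fix z assume "z \<in> f ` eis_reps n"
      then show "z \<in> eis_reps (3 * n)" 
        by (auto simp: eis_reps_def f_def eis_norm_def power2_eq_square algebra_simps)
    qed
    moreover have "inj f" by (auto simp: inj_def f_def)
    ultimately show ?thesis unfolding p3 by (simp add: card_image inj_on_subset chi3_def)
  next
    case 3
    have "eis_reps (p * n) = {z\<in>eis_reps (p * n). int p dvd fst z \<and> int p dvd snd z}"
    proof -
      have "int p dvd fst z \<and> int p dvd snd z" if z: "z \<in> eis_reps (p * n)" for z
      proof (rule eis_norm_dvd_imp_dvd_of_prime_2_mod_3[OF p 3])
        have "eis_norm (fst z) (snd z) = int p * int n" using z by (auto simp: eis_reps_def)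
        then show "int p dvd eis_norm (fst z) (snd z)" by simp
      qed
      then show ?thesis by blast
    qed
    then have "card (eis_reps (p * n)) = card {z\<in>eis_reps (p * n). int p dvd fst z \<and> int p dvd snd z}" by simp
    also have "\<dots> = (if p dvd n then card (eis_reps (n div p)) else 0)"
      by (rule card_eis_reps_scaled[OF p])
    finally show ?thesis using 3 by (simp add: chi3_def)
  next
    case 2
    obtain a b where ab: "eis_norm a b = int p" using eis_norm_eq_prime[OF p 2] .
    \<comment> \<open>The conjugate (a + b) - b rho is the second prime element above p.\<close>
    have ab': "eis_norm (a + b) (- b) = int p" using ab by (simp add: eis_norm_def power2_eq_square algebra_simps)
    have pp: "prime (int p)" using p by simp
    have p4: "\<not> int p dvd 4"
    proof
      assume "int p dvd 4"
      then have "p dvd 4" by (metis int_dvd_int_iff of_nat_numeral)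
      then have "p dvd 2 ^ 2" by simp
      then have "p dvd 2" using p prime_dvd_power by blast
      then have "p = 2" using p by (metis primes_dvd_imp_eq two_is_prime_nat)
      then show False using 2 by simp
    qed
    have nsq: "\<not> int p * int p dvd 4 * int p" using p4 pp by (auto simp: mult.commute dvd_times_right_cancel_iff)
    have b: "\<not> int p dvd b"
    proof
      assume *: "int p dvd b"
      have "a\<^sup>2 = int p - b * (a + b)" using ab by (simp add: eis_norm_def power2_eq_square algebra_simps)
      then have "int p dvd a\<^sup>2" using * by simp
      then have "int p dvd a" using pp prime_dvd_power by blast
      then have "int p * int p dvd eis_norm a b" using * by (auto simp: eis_norm_def power2_eq_square intro!: dvd_add mult_dvd_mono)
      then show False using nsq ab by simp
    qed
    \<comment> \<open>2 a + b is the trace of a + b rho. That p does not divide it separates the two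
      prime elements above p, so being divisible by both means being divisible by p.\<close>
    have ab2: "\<not> int p dvd 2 * a + b"
    proof
      assume *: "int p dvd 2 * a + b"
      have "3 * b\<^sup>2 = 4 * int p - (2 * a + b) * (2 * a + b)" using four_eis_norm[of a b] ab by (simp add: power2_eq_square)
      then have "int p dvd 3 * b\<^sup>2" using * by simp
      moreover have "\<not> int p dvd 3"
      proof
        assume "int p dvd 3"
        then have "p dvd 3" by (metis int_dvd_int_iff of_nat_numeral)
        then have "p = 3" using p by (metis primes_dvd_imp_eq prime_3_nat)
        then show False using 2 by simp
      qed
      ultimately show False using b pp prime_dvd_mult_iff prime_dvd_power by blast
    qed
    let ?E = "eis_reps (p * n)"
    define A where "A = {z\<in>?E. int p dvd snd z * a - fst z * b}"
    define B where "B = {z\<in>?E. int p dvd snd z * (a + b) - fst z * (- b)}"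
    have "?E \<subseteq> A \<union> B"
    proof
      fix z assume z: "z \<in> ?E"
      obtain x y where xy: "z = (x, y)" by (cases z)
      \<comment> \<open>The two linear forms test divisibility by the prime element and by its
        conjugate. As \<open>eis_norm a b\<close> is p, their product is congruent modulo p to - b^2
        times the norm of (x, y).\<close>
      have "(y * a - x * b) * (y * (a + b) - x * (- b)) = y\<^sup>2 * eis_norm a b - b\<^sup>2 * eis_norm x y"
        by (simp add: eis_norm_def power2_eq_square algebra_simps)
      then have "int p dvd (y * a - x * b) * (y * (a + b) - x * (- b))"
        using z xy ab by (simp add: eis_reps_def)
      then show "z \<in> A \<union> B" using pp z xy unfolding A_def B_def prime_dvd_mult_iff[OF pp] by auto
    qed
    then have E: "?E = A \<union> B" by (auto simp: A_def B_def)
    have "A \<inter> B = {z\<in>?E. int p dvd fst z \<and> int p dvd snd z}"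
    proof -
      have "int p dvd x \<and> int p dvd y" if *: "int p dvd y * a - x * b" "int p dvd y * (a + b) - x * (- b)" for x y
      proof -
        have "y * (2 * a + b) = (y * a - x * b) + (y * (a + b) - x * (- b))" by (simp add: algebra_simps)
        then have "int p dvd y * (2 * a + b)" using * by (metis dvd_add)
        then have y: "int p dvd y" using ab2 pp prime_dvd_mult_iff by blast
        have "x * b = y * a - (y * a - x * b)" by simp
        then have "int p dvd x * b" using * y by (metis dvd_diff dvd_mult2)
        then show ?thesis using y b pp prime_dvd_mult_iff by blast
      qed
      then have "int p dvd y * a - x * b \<and> int p dvd y * (a + b) - x * (- b) \<longleftrightarrow> int p dvd x \<and> int p dvd y" for x y
        by (metis dvd_diff dvd_mult2)
      moreover have "A \<inter> B = {z\<in>?E. int p dvd snd z * a - fst z * b \<and> int p dvd snd z * (a + b) - fst z * (- b)}"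
        unfolding A_def B_def by blast
      ultimately show ?thesis by (simp only:)
    qed
    then have int: "card (A \<inter> B) = (if p dvd n then card (eis_reps (n div p)) else 0)"
      using card_eis_reps_scaled[OF p] by simp
    have fin: "finite A" "finite B" by (auto simp: A_def B_def)
    have "card A + card B = card ?E + card (A \<inter> B)" unfolding E by (rule card_Un_Int[OF fin])
    moreover have "card A = card (eis_reps n)" "card B = card (eis_reps n)"
      unfolding A_def B_def using card_eis_reps_prime_factor[OF p ab] card_eis_reps_prime_factor[OF p ab'] by simp_all
    ultimately have "card ?E + card (A \<inter> B) = 2 * card (eis_reps n)" by simp
    then have "real (card ?E) = 2 * real (card (eis_reps n)) - real (card (A \<inter> B))" by linarith
    then show ?thesis using 2 unfolding int by (simp add: chi3_def)
  qed
qed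

text \<open>The number of ideals of norm n in Z[rho], as \<open>card_eis_reps\<close> and
  \<open>card_hex_wr\<close> confirm. At n = 0 the index set is infinite and the sum is 0 by
  convention.\<close>

definition hex_ideals :: "nat \<Rightarrow> real" where
  "hex_ideals n = (\<Sum>d | d dvd n. chi3 d)"

text \<open>The divisors of p n are those of n together with p times them, and the overlap is p
  times the divisors of n / p.\<close>

lemma hex_ideals_prime_mult:
  fixes p n :: nat
  assumes p: "prime p" and n: "n > 0"
  shows "hex_ideals (p * n) = (1 + chi3 p) * hex_ideals n - chi3 p * (if p dvd n then hex_ideals (n div p) else 0)"
proof -
  have p0: "p > 0" using p by (simp add: prime_gt_0_nat)
  let ?D = "\<lambda>n. {d. d dvd n}"
  have fin: "finite (?D n)" using n by simp
  have scale: "sum chi3 (times p ` D) = chi3 p * sum chi3 D" for D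
    using p0 by (subst sum.reindex) (auto simp: inj_on_def chi3_mult sum_distrib_left)
  have "?D (p * n) = ?D n \<union> times p ` ?D n"
  proof (intro equalityI subsetI)
    fix d assume "d \<in> ?D (p * n)"
    then have d: "d dvd p * n" by simp
    show "d \<in> ?D n \<union> times p ` ?D n"
    proof (cases "p dvd d")
      case True
      then show ?thesis using d p0 by (auto elim!: dvdE)
    next
      case False
      then have "coprime d p" using p by (metis coprime_commute prime_imp_coprime)
      then show ?thesis using d by (simp add: coprime_dvd_mult_right_iff)
    qed
  qed auto
  then have "hex_ideals (p * n) = sum chi3 (?D n) + sum chi3 (times p ` ?D n) - sum chi3 (?D n \<inter> times p ` ?D n)"
    unfolding hex_ideals_def using fin by (simp add: sum_Un)
  also have "?D n \<inter> times p ` ?D n = (if p dvd n then times p ` ?D (n div p) else {})"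
    using p0 by (auto elim!: dvdE intro: dvd_trans[of p "p * _"])
  finally have "hex_ideals (p * n) = hex_ideals n + chi3 p * hex_ideals n
      - sum chi3 (if p dvd n then times p ` ?D (n div p) else {})"
    unfolding scale by (simp only: hex_ideals_def)
  then show ?thesis using scale[of "?D (n div p)"] by (cases "p dvd n") (simp_all add: hex_ideals_def algebra_simps)
qed

lemma eis_reps_1: "eis_reps 1 = {(1,0),(-1,0),(0,1),(0,-1),(1,-1),(-1,1)}"
proof -
  have "(x, y) \<in> {(1,0),(-1,0),(0,1),(0,-1),(1,-1),(-1,1)}" if "eis_norm x y = 1" for x y
  proof -
    have sq: "\<bar>u\<bar> \<le> 2" if "u\<^sup>2 \<le> 4" for u :: int
      using that abs_le_square_iff[of u 2] by simp
    have "\<bar>x\<bar> \<le> 2" "\<bar>y\<bar> \<le> 2" using sq square_le_eis_norm[of x y] square_le_eis_norm[of y x] that by auto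
    then have "x \<in> {-2,-1,0,1,2}" "y \<in> {-2,-1,0,1,2}" by auto
    then show ?thesis using that by (auto simp: eis_norm_def)
  qed
  then show ?thesis by (auto simp: eis_reps_def eis_norm_def)
qed

text \<open>Both sides obey the same recursion when a prime factor is split off, so their ratio is
  the one at n = 1, the number of units.\<close>

theorem card_eis_reps: "n > 0 \<Longrightarrow> real (card (eis_reps n)) = 6 * hex_ideals n"
proof (induction n rule: less_induct)
  case (less n)
  show ?case
  proof (cases "n = 1")
    case True
    then show ?thesis using eis_reps_1 by (simp add: hex_ideals_def chi3_def)
  next
    case False
    then obtain p where p: "prime p" "p dvd n" using prime_factor_nat by blast
    then obtain m where m: "n = p * m" by (elim dvdE)
    have "m > 0" using less.prems m by auto
    moreover from this have "m < n" using m p(1) prime_gt_1_nat by simp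
    moreover have "m div p > 0" "m div p < n" if "p dvd m"
    proof -
      show "m div p > 0" using that \<open>m > 0\<close> by (auto elim!: dvdE)
      show "m div p < n" using \<open>m < n\<close> div_le_dividend le_less_trans by blast
    qed
    ultimately show ?thesis
      unfolding m using card_eis_reps_prime_mult[OF p(1), of m] hex_ideals_prime_mult[OF p(1), of m]
        less.IH[of m] less.IH[of "m div p"] by (cases "p dvd m") (simp_all add: m algebra_simps)
  qed
qed

section \<open>Dirichlet series with bounded partial sums\<close>

text \<open>The mean value inequality on the segment from n to n + 1, where the derivative of the
  power is - s z^(-s-1).\<close>

lemma norm_powr_diff_Suc_le:
  fixes s :: complex
  assumes n: "n \<ge> 1" and s: "Re s \<ge> \<sigma>" "\<sigma> \<ge> 0"
  shows "norm (of_nat n powr (- s) - of_nat (Suc n) powr (- s)) \<le> norm s * real n powr (- \<sigma> - 1)"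
proof -
  have "norm ((of_real (real n) :: complex) powr (- s) - of_real (real (Suc n)) powr (- s)) \<le>
      (norm s * real n powr (- \<sigma> - 1)) * norm (complex_of_real (real n) - of_real (real (Suc n)))"
  proof (rule field_differentiable_bound[where S = "closed_segment (of_real (real n)) (of_real (real (Suc n)))"
        and f' = "\<lambda>z. - s * z powr (- s - 1)"])
    fix z :: complex
    assume "z \<in> closed_segment (of_real (real n)) (of_real (real (Suc n)))"
    then have "z \<in> of_real ` closed_segment (real n) (real (Suc n))"
      by (simp only: closed_segment_of_real)
    then obtain t where t: "z = of_real t" "t \<ge> real n"
      by (auto simp: closed_segment_eq_real_ivl split: if_splits)
    have t0: "t \<ge> 1" using n t(2) by simp
    show "((\<lambda>z. z powr (- s)) has_field_derivative - s * z powr (- s - 1))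
        (at z within closed_segment (of_real (real n)) (of_real (real (Suc n))))"
    proof (rule has_field_derivative_at_within, rule has_field_derivative_powr)
      show "z \<notin> \<real>\<^sub>\<le>\<^sub>0" using t0 unfolding t(1) nonpos_Reals_of_real_iff by simp
    qed
    have "norm (z powr (- s - 1)) = t powr (- Re s - 1)"
      using t t0 by (simp add: norm_powr_real_powr)
    also have "\<dots> \<le> t powr (- \<sigma> - 1)" using t0 s by (intro powr_mono) auto
    also have "\<dots> \<le> real n powr (- \<sigma> - 1)" using t n s by (intro powr_mono2') auto
    finally show "norm (- s * z powr (- s - 1)) \<le> norm s * real n powr (- \<sigma> - 1)"
      by (simp add: norm_mult mult_left_mono)
  qed auto
  also have "norm (complex_of_real (real n) - of_real (real (Suc n))) = 1"
    by (simp flip: of_real_diff)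
  finally show ?thesis by simp
qed

lemma summable_Suc_powr: "a < -1 \<Longrightarrow> summable (\<lambda>n. real (Suc n) powr a)"
  using summable_real_powr_iff[of a] by (subst summable_Suc_iff) simp

text \<open>After partial summation the terms are of order n^(\<theta> - Re s - 1), locally
  uniformly in s, so the transformed series may be differentiated termwise even where the original
  one converges only conditionally.\<close>

theorem dirichlet_series_of_partial_sums:
  fixes b :: "nat \<Rightarrow> complex" and \<theta> :: real
  assumes \<theta>: "\<theta> \<ge> 0" and bound: "\<And>N. norm (\<Sum>n=1..N. b n) \<le> C * real N powr \<theta>"
  obtains g g' where
    "\<And>s. Re s > \<theta> \<Longrightarrow> (\<lambda>n. b (Suc n) * of_nat (Suc n) powr (- s)) sums g s"
    "\<And>s. Re s > \<theta> \<Longrightarrow> (\<lambda>n. - (b (Suc n) * (of_real (ln (real (Suc n))) * of_nat (Suc n) powr (- s)))) sums g' s"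
    "\<And>s. Re s > \<theta> \<Longrightarrow> (g has_field_derivative g' s) (at s)"
proof -
  define B where "B = (\<lambda>N. \<Sum>n=1..N. b n)"
  define v where "v = (\<lambda>s n. of_nat n powr (- s) :: complex)"
  define w where "w = (\<lambda>s n. - (of_real (ln (real n)) * of_nat n powr (- s)) :: complex)"
  define S where "S = {s. Re s > \<theta>}"
  have C: "C \<ge> 0" using bound[of 1] by (simp add: order.trans[OF norm_ge_zero])
  have opS: "open S" by (simp add: S_def open_halfspace_Re_gt)
  have dv: "((\<lambda>s. v s n) has_field_derivative w s n) (at s)" if "n \<ge> 1" for n s
  proof -
    have "((\<lambda>s. of_nat n powr (- s)) has_field_derivative (Ln (of_nat n) * of_nat n powr (- s)) * (- 1)) (at s)"
      by (rule DERIV_chain2[OF has_field_derivative_powr_right]) (use that in \<open>auto intro!: derivative_eq_intros\<close>)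
    then show ?thesis using that by (simp add: v_def w_def Ln_of_nat)
  qed
  have "\<exists>g g'. \<forall>s\<in>S. (\<lambda>n. B (Suc n) * (v s (Suc n) - v s (Suc (Suc n)))) sums g s \<and>
      (\<lambda>n. B (Suc n) * (w s (Suc n) - w s (Suc (Suc n)))) sums g' s \<and> (g has_field_derivative g' s) (at s)"
  proof (rule series_and_derivative_comparison_local[OF opS])
    fix n s assume "s \<in> S"
    show "((\<lambda>s. B (Suc n) * (v s (Suc n) - v s (Suc (Suc n)))) has_field_derivative
        B (Suc n) * (w s (Suc n) - w s (Suc (Suc n)))) (at s)"
      using dv[of "Suc n" s] dv[of "Suc (Suc n)" s]
      by (auto intro!: derivative_eq_intros simp: algebra_simps)
  next
    fix s assume s: "s \<in> S"
    \<comment> \<open>The radius \<open>d\<close> is half the distance of s from the line Re =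
      \<theta>, so the ball around s stays to the right of the midpoint
      \<open>\<sigma>\<close>.\<close>
    define \<sigma> where "\<sigma> = (\<theta> + Re s) / 2"
    define d where "d = (Re s - \<theta>) / 2"
    have d: "d > 0" "\<sigma> > \<theta>" using s by (auto simp: d_def \<sigma>_def S_def)
    define h where "h = (\<lambda>n. C * (norm s + d) * real (Suc n) powr (\<theta> - \<sigma> - 1))"
    have "summable h" unfolding h_def using d by (intro summable_mult summable_Suc_powr) auto
    moreover have "norm (B (Suc n) * (v y (Suc n) - v y (Suc (Suc n)))) \<le> h n" if y: "y \<in> ball s d" for n y
    proof -
      have "\<bar>Re (s - y)\<bar> \<le> norm (s - y)" by (rule abs_Re_le_cmod)
      then have re: "Re y \<ge> \<sigma>" using y unfolding dist_norm mem_ball d_def \<sigma>_def by (simp add: abs_le_iff field_simps)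
      have ny: "norm y \<le> norm s + d" using y norm_triangle_sub[of y s] by (simp add: dist_norm norm_minus_commute)
      have "norm (B (Suc n) * (v y (Suc n) - v y (Suc (Suc n)))) \<le>
          (C * real (Suc n) powr \<theta>) * (norm y * real (Suc n) powr (- \<sigma> - 1))"
        unfolding norm_mult B_def v_def using re d \<theta> C by (intro mult_mono bound norm_powr_diff_Suc_le) auto
      also have "\<dots> \<le> (C * real (Suc n) powr \<theta>) * ((norm s + d) * real (Suc n) powr (- \<sigma> - 1))"
        using ny C by (intro mult_left_mono mult_right_mono) auto
      also have "\<dots> = C * (norm s + d) * (real (Suc n) powr \<theta> * real (Suc n) powr (- \<sigma> - 1))" by (simp add: algebra_simps)
      also have "real (Suc n) powr \<theta> * real (Suc n) powr (- \<sigma> - 1) = real (Suc n) powr (\<theta> - \<sigma> - 1)"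
        by (simp add: algebra_simps flip: powr_add)
      finally show ?thesis by (simp add: h_def)
    qed
    ultimately show "\<exists>d h. 0 < d \<and> summable h \<and>
        (\<forall>\<^sub>F n in sequentially. \<forall>y\<in>ball s d \<inter> S. norm (B (Suc n) * (v y (Suc n) - v y (Suc (Suc n)))) \<le> h n)"
      using d by (intro exI[of _ d] exI[of _ h]) auto
  qed
  then obtain g g' where gg: "\<And>s. s \<in> S \<Longrightarrow> (\<lambda>n. B (Suc n) * (v s (Suc n) - v s (Suc (Suc n)))) sums g s"
     "\<And>s. s \<in> S \<Longrightarrow> (\<lambda>n. B (Suc n) * (w s (Suc n) - w s (Suc (Suc n)))) sums g' s"
     "\<And>s. s \<in> S \<Longrightarrow> (g has_field_derivative g' s) (at s)" by blast
  \<comment> \<open>Undoes the partial summation, given that the boundary term vanishes in the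
    limit; this is applied to the powers \<open>v\<close> and to their s-derivatives
    \<open>w\<close>.\<close>
  have shift: "(\<lambda>n. b (Suc n) * u (Suc n)) sums l"
    if sums: "(\<lambda>n. B (Suc n) * (u (Suc n) - u (Suc (Suc n)))) sums l"
      and lim: "(\<lambda>N. B N * u (Suc N)) \<longlonglongrightarrow> 0" for u l
  proof -
    have "(\<lambda>N. B N * u (Suc N) + (\<Sum>n<N. B (Suc n) * (u (Suc n) - u (Suc (Suc n))))) \<longlonglongrightarrow> 0 + l"
      using sums lim unfolding sums_def by (intro tendsto_add)
    moreover have "B N * u (Suc N) + (\<Sum>n<N. B (Suc n) * (u (Suc n) - u (Suc (Suc n)))) = (\<Sum>n<N. b (Suc n) * u (Suc n))" for N
    proof -
      have reidx: "(\<Sum>n<N. F (Suc n)) = (\<Sum>n=1..N. F n)" for F :: "nat \<Rightarrow> complex"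
        by (rule sum.reindex_bij_witness[of _ "\<lambda>n. n - 1" Suc]) auto
      show ?thesis unfolding reidx[of "\<lambda>n. b n * u n"] reidx[of "\<lambda>n. B n * (u n - u (Suc n))"]
        by (subst abel_summation) (simp add: B_def)
    qed
    ultimately show ?thesis by (simp add: sums_def)
  qed
  have lim: "(\<lambda>N. B N * v s (Suc N)) \<longlonglongrightarrow> 0" "(\<lambda>N. B N * w s (Suc N)) \<longlonglongrightarrow> 0" if "s \<in> S" for s
  proof -
    define e where "e = Re s - \<theta>"
    have e: "e > 0" using that by (simp add: e_def S_def)
    have nv: "norm (v s (Suc N)) = real (Suc N) powr (- Re s)" for N
      unfolding v_def by (simp add: norm_powr_real_powr flip: of_nat_Suc)
    have nw: "norm (w s (Suc N)) = ln (real (Suc N)) * real (Suc N) powr (- Re s)" for N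
      unfolding w_def norm_minus_cancel norm_mult by (simp add: norm_powr_real_powr flip: of_nat_Suc)
    have B: "norm (B N) \<le> C * real (Suc N) powr \<theta>" for N
      unfolding B_def using C \<theta> by (intro order.trans[OF bound] mult_left_mono powr_mono2) auto
    have pw: "real (Suc N) powr \<theta> * real (Suc N) powr (- Re s) = real (Suc N) powr (- e)" for N
      by (simp add: e_def flip: powr_add)
    have "norm (B N * v s (Suc N)) \<le> C * (real (Suc N) powr (- e))" for N
    proof -
      have "norm (B N * v s (Suc N)) \<le> (C * real (Suc N) powr \<theta>) * real (Suc N) powr (- Re s)"
        unfolding norm_mult nv by (intro mult_right_mono B) auto
      then show ?thesis using pw[of N] by (simp add: mult.assoc)
    qed
    moreover have "(\<lambda>N. C * (real (Suc N) powr (- e))) \<longlonglongrightarrow> 0" using e by real_asymp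
    ultimately show "(\<lambda>N. B N * v s (Suc N)) \<longlonglongrightarrow> 0"
      by (rule Lim_null_comparison[OF always_eventually[OF allI]])
    have "norm (B N * w s (Suc N)) \<le> C * (ln (real (Suc N)) * real (Suc N) powr (- e))" for N
    proof -
      have "norm (B N * w s (Suc N)) \<le> (C * real (Suc N) powr \<theta>) * (ln (real (Suc N)) * real (Suc N) powr (- Re s))"
        unfolding norm_mult nw by (intro mult_right_mono B) auto
      also have "\<dots> = C * (ln (real (Suc N)) * (real (Suc N) powr \<theta> * real (Suc N) powr (- Re s)))"
        by (simp only: mult_ac)
      finally show ?thesis unfolding pw .
    qed
    moreover have "(\<lambda>N. C * (ln (real (Suc N)) * real (Suc N) powr (- e))) \<longlonglongrightarrow> 0" using e by real_asymp
    ultimately show "(\<lambda>N. B N * w s (Suc N)) \<longlonglongrightarrow> 0"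
      by (rule Lim_null_comparison[OF always_eventually[OF allI]])
  qed
  show ?thesis
  proof (rule that)
    fix s assume "Re s > \<theta>"
    then have s: "s \<in> S" by (simp add: S_def)
    show "(\<lambda>n. b (Suc n) * of_nat (Suc n) powr (- s)) sums g s"
      using shift[OF gg(1)[OF s] lim(1)[OF s]] by (simp add: v_def)
    show "(\<lambda>n. - (b (Suc n) * (of_real (ln (real (Suc n))) * of_nat (Suc n) powr (- s)))) sums g' s"
      using shift[OF gg(2)[OF s] lim(2)[OF s]] by (simp add: w_def)
    show "(g has_field_derivative g' s) (at s)" by (rule gg(3)[OF s])
  qed
qed

text \<open>Restriction to the real axis: the real part of the complex derivative is the derivative
  of the real part along it.\<close>

lemma dirichlet_series_real:
  fixes b :: "nat \<Rightarrow> real" and \<theta> :: real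
  assumes \<theta>: "\<theta> \<ge> 0" "s > \<theta>" and bound: "\<And>N. \<bar>\<Sum>n=1..N. b n\<bar> \<le> C * real N powr \<theta>"
  shows "summable (\<lambda>n. b (Suc n) * real (Suc n) powr (- s))"
    and "summable (\<lambda>n. b (Suc n) * ln (real (Suc n)) * real (Suc n) powr (- s))"
    and "((\<lambda>s. \<Sum>n. b (Suc n) * real (Suc n) powr (- s)) has_real_derivative
           - (\<Sum>n. b (Suc n) * ln (real (Suc n)) * real (Suc n) powr (- s))) (at s)"
proof -
  have "norm (\<Sum>n=1..N. complex_of_real (b n)) \<le> C * real N powr \<theta>" for N
    using bound[of N] by (metis norm_of_real of_real_sum)
  from dirichlet_series_of_partial_sums[OF \<theta>(1) this] obtain g g' where g:
    "\<And>s. Re s > \<theta> \<Longrightarrow> (\<lambda>n. of_real (b (Suc n)) * of_nat (Suc n) powr (- s)) sums g s"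
    "\<And>s. Re s > \<theta> \<Longrightarrow> (\<lambda>n. - (of_real (b (Suc n)) * (of_real (ln (real (Suc n))) * of_nat (Suc n) powr (- s)))) sums g' s"
    "\<And>s. Re s > \<theta> \<Longrightarrow> (g has_field_derivative g' s) (at s)" by blast
  have pw: "of_nat (Suc n) powr (- complex_of_real s) = of_real (real (Suc n) powr (- s))" for n s
    using powr_of_real[of "real (Suc n)" "- s"] by simp
  have 1: "(\<lambda>n. b (Suc n) * real (Suc n) powr (- s)) sums Re (g (of_real s))" if "s > \<theta>" for s
    using sums_Re[OF g(1)[of "of_real s"]] that unfolding pw by (simp flip: of_real_mult)
  have 2: "(\<lambda>n. - (b (Suc n) * ln (real (Suc n)) * real (Suc n) powr (- s))) sums Re (g' (of_real s))"
    using sums_Re[OF g(2)[of "of_real s"]] \<theta> unfolding pw by (simp add: mult_ac flip: of_real_mult)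
  show "summable (\<lambda>n. b (Suc n) * real (Suc n) powr (- s))" using 1 \<theta> sums_summable by blast
  show "summable (\<lambda>n. b (Suc n) * ln (real (Suc n)) * real (Suc n) powr (- s))"
    using sums_summable[OF 2] by (simp only: summable_minus_iff)
  have "((\<lambda>x. g (of_real x)) has_vector_derivative g' (of_real s)) (at s)"
    by (rule has_vector_derivative_real_field, rule g(3)) (use \<theta> in simp)
  then have "((\<lambda>x. Re (g (of_real x))) has_vector_derivative Re (g' (of_real s))) (at s)"
    by (rule bounded_linear.has_vector_derivative[OF bounded_linear_Re])
  then have "((\<lambda>x. Re (g (of_real x))) has_real_derivative Re (g' (of_real s))) (at s)"
    by (simp add: has_real_derivative_iff_has_vector_derivative)
  moreover have "Re (g' (of_real s)) = - (\<Sum>n. b (Suc n) * ln (real (Suc n)) * real (Suc n) powr (- s))"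
    using sums_unique[OF sums_minus[OF 2]] by simp
  moreover have "eventually (\<lambda>x. Re (g (of_real x)) = (\<Sum>n. b (Suc n) * real (Suc n) powr (- x))) (nhds s)"
    using eventually_nhds_in_open[of "{\<theta><..}" s] \<theta> by (auto elim!: eventually_mono dest!: 1 sums_unique)
  ultimately show "((\<lambda>s. \<Sum>n. b (Suc n) * real (Suc n) powr (- s)) has_real_derivative
           - (\<Sum>n. b (Suc n) * ln (real (Suc n)) * real (Suc n) powr (- s))) (at s)"
    by (simp add: DERIV_cong_ev)
qed

section \<open>L and zeta at the points 1 and 2\<close>

lemma chi3_partial_sum: "(\<Sum>n=1..N. chi3 n) = (if N mod 3 = 1 then 1 else 0)"
proof (induction N)
  case (Suc N)
  consider "N mod 3 = 0" | "N mod 3 = 1" | "N mod 3 = 2" by linarith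
  then show ?case using Suc by cases (simp_all add: chi3_def mod_Suc)
qed (simp)

lemma chi3_partial_sum_bounds: "0 \<le> (\<Sum>n=1..N. chi3 n)" "(\<Sum>n=1..N. chi3 n) \<le> 1"
  by (simp_all only: chi3_partial_sum) auto

text \<open>The partial sums of \<open>chi3\<close> stay in {0, 1}, so the exponent \<theta> = 0
  reaches the point 1 of conditional convergence. Here \<open>deriv\<close> is traded for an
  explicit series.\<close>

lemma L_chi3_deriv:
  "(\<lambda>n. chi3 (Suc n) * ln (real (Suc n)) / real (Suc n)) sums (- deriv L_chi3 1)"
  "(\<lambda>n. chi3 (Suc n) / real (Suc n)) sums L_chi3 1"
proof -
  have b: "\<bar>\<Sum>n=1..N. chi3 n\<bar> \<le> 1 * real N powr 0" for N
    unfolding chi3_partial_sum by (cases "N = 0") auto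
  note D = dirichlet_series_real[of 0 1, OF _ _ b, simplified]
  have "(L_chi3 has_real_derivative - (\<Sum>n. chi3 (Suc n) * ln (real (Suc n)) * real (Suc n) powr - 1)) (at 1)"
    using D(3) unfolding L_chi3_def[abs_def] by simp
  then have "deriv L_chi3 1 = - (\<Sum>n. chi3 (Suc n) * ln (real (Suc n)) * real (Suc n) powr - 1)"
    by (rule DERIV_imp_deriv)
  then show "(\<lambda>n. chi3 (Suc n) * ln (real (Suc n)) / real (Suc n)) sums (- deriv L_chi3 1)"
    using summable_sums[OF D(2)] by (simp add: powr_minus field_simps)
  show "(\<lambda>n. chi3 (Suc n) / real (Suc n)) sums L_chi3 1"
    using summable_sums[OF D(1)] by (simp add: L_chi3_def powr_minus field_simps)
qed

lemma zeta_series_deriv: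
  "(\<lambda>n. ln (real (Suc n)) / (real (Suc n))\<^sup>2) sums (- deriv zeta_series 2)"
  "(\<lambda>n. 1 / (real (Suc n))\<^sup>2) sums zeta_series 2"
proof -
  have b: "\<bar>\<Sum>n=1..N. (\<lambda>_. 1 :: real) n\<bar> \<le> 1 * real N powr 1" for N by simp
  note D = dirichlet_series_real[of 1 2, OF _ _ b, simplified]
  have "(zeta_series has_real_derivative - (\<Sum>n. ln (real (Suc n)) * real (Suc n) powr - 2)) (at 2)"
    using D(3) unfolding zeta_series_def[abs_def] by simp
  then have "deriv zeta_series 2 = - (\<Sum>n. ln (real (Suc n)) * real (Suc n) powr - 2)"
    by (rule DERIV_imp_deriv)
  then show "(\<lambda>n. ln (real (Suc n)) / (real (Suc n))\<^sup>2) sums (- deriv zeta_series 2)"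
    using summable_sums[OF D(2)] by (simp add: powr_minus powr_numeral field_simps)
  show "(\<lambda>n. 1 / (real (Suc n))\<^sup>2) sums zeta_series 2"
    using summable_sums[OF D(1)] by (simp add: zeta_series_def powr_minus powr_numeral field_simps)
qed

lemma zeta_series_2: "zeta_series 2 = pi\<^sup>2 / 6"
proof (rule sums_unique2[OF zeta_series_deriv(2)])
  show "(\<lambda>n. 1 / (real (Suc n))\<^sup>2) sums (pi\<^sup>2 / 6)"
    using inverse_squares_sums by (simp add: add.commute)
qed

text \<open>L(1) is the integral of 1 / (1 + t + t^2) over [0, 1], with the arctangent
  antiderivative \<open>F\<close>. Monotonicity of differences of antiderivatives stands in for the
  integral and for Abel's theorem: the error after N periods lies between 0 and the integral of
  t^(3N).\<close>

lemma L_chi3_1: "L_chi3 1 = pi / (3 * sqrt 3)"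
proof -
  define F where "F = (\<lambda>t. 2 / sqrt 3 * arctan ((2 * t + 1) / sqrt 3))"
  define P where "P = (\<lambda>N t. \<Sum>k<N. t ^ (3 * k + 1) / real (3 * k + 1) - t ^ (3 * k + 2) / real (3 * k + 2) :: real)"
  have pos: "1 + t + t\<^sup>2 > 0" if "t \<ge> 0" for t :: real using that by (simp add: add_pos_nonneg)
  have F: "(F has_real_derivative 1 / (1 + t + t\<^sup>2)) (at t)" if "t \<ge> 0" for t
  proof -
    have "3 + (2 * t + 1)\<^sup>2 = 4 * (1 + t + t\<^sup>2)" by (simp add: power2_eq_square algebra_simps)
    then have e: "1 + ((2 * t + 1) / sqrt 3)\<^sup>2 = 4 / 3 * (1 + t + t\<^sup>2)" by (simp add: power_divide field_simps)
    have "((\<lambda>t. (2 * t + 1) / sqrt 3) has_real_derivative 2 / sqrt 3) (at t)"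
      by (auto intro!: derivative_eq_intros simp: divide_simps)
    from DERIV_cmult[OF DERIV_chain2[OF DERIV_arctan this]]
    have "(F has_real_derivative 2 / sqrt 3 * (inverse (1 + ((2 * t + 1) / sqrt 3)\<^sup>2) * (2 / sqrt 3))) (at t)"
      unfolding F_def .
    moreover have "2 / sqrt 3 * (inverse (4 / 3 * (1 + t + t\<^sup>2)) * (2 / sqrt 3)) = 1 / (1 + t + t\<^sup>2)"
    proof -
      have "2 / sqrt 3 * (x * (2 / sqrt 3)) = 4 / 3 * x" for x :: real by (simp add: field_simps)
      then show ?thesis using pos[OF that] by (simp only:) (simp add: field_simps)
    qed
    ultimately show ?thesis unfolding e by simp
  qed
  have F01: "F 1 - F 0 = pi / (3 * sqrt 3)"
  proof -
    have "arctan (3 / sqrt 3) = pi / 3"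
    proof (rule arctan_unique)
      show "- (pi / 2) < pi / 3" using pi_gt_zero by linarith
      show "tan (pi / 3) = 3 / sqrt 3" using tan_60 by (simp add: real_div_sqrt)
    qed simp
    moreover have "arctan (1 / sqrt 3) = pi / 6"
    proof (rule arctan_unique)
      show "- (pi / 2) < pi / 6" using pi_gt_zero by linarith
    qed (use tan_30 in simp_all)
    ultimately show ?thesis by (simp add: F_def field_simps)
  qed
  have dd: "((\<lambda>t. t ^ Suc n / real (Suc n)) has_real_derivative t ^ n) (at t)" for n t
  proof -
    have "real (Suc n) \<noteq> 0" by simp
    then show ?thesis by (auto intro!: derivative_eq_intros simp del: of_nat_Suc power_Suc)
  qed
  have bound: "\<bar>P N 1 - pi / (3 * sqrt 3)\<bar> \<le> 1 / real (3 * N + 1)" for N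
  proof -
    define G where "G = (\<lambda>t. F t - P N t)"
    define R where "R = (\<lambda>t. t ^ (3 * N + 1) / real (3 * N + 1))"
    have dG: "(G has_real_derivative t ^ (3 * N) / (1 + t + t\<^sup>2)) (at t)" if t: "t \<ge> 0" for t
    proof -
      have "(\<Sum>k<N. t ^ (3 * k) - t ^ (3 * k + 1)) * (1 + t + t\<^sup>2) = 1 - t ^ (3 * N)"
      proof (induction N)
        case (Suc N)
        have e: "t ^ (3 * N + 1) = t ^ (3 * N) * t" "t ^ (3 * Suc N) = t ^ (3 * N) * (t * t * t)"
          by (simp_all add: power_add power3_eq_cube mult.assoc)
        show ?case unfolding sum.lessThan_Suc distrib_right Suc unfolding e power2_eq_square by (simp add: algebra_simps)
      qed simp
      then have "(\<Sum>k<N. t ^ (3 * k) - t ^ (3 * k + 1)) = (1 - t ^ (3 * N)) / (1 + t + t\<^sup>2)"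
        using pos[OF t] by (simp add: field_simps)
      moreover have dP: "((\<lambda>t. P N t) has_real_derivative (\<Sum>k<N. t ^ (3 * k) - t ^ (3 * k + 1))) (at t)"
        unfolding P_def
      proof (intro DERIV_sum)
        fix k
        from DERIV_diff[OF dd[of "3 * k"] dd[of "3 * k + 1"]]
        show "((\<lambda>t. t ^ (3 * k + 1) / real (3 * k + 1) - t ^ (3 * k + 2) / real (3 * k + 2)) has_real_derivative
           t ^ (3 * k) - t ^ (3 * k + 1)) (at t)" by simp
      qed
      ultimately show ?thesis
        unfolding G_def using DERIV_diff[OF F[OF t] dP] by (simp add: diff_divide_distrib)
    qed
    have dR: "(R has_real_derivative t ^ (3 * N)) (at t)" for t
      unfolding R_def using dd[of "3 * N" t] by simp
    have "G 0 \<le> G 1"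
    proof (rule DERIV_nonneg_imp_nondecreasing[where f = G])
      fix t :: real assume t: "0 \<le> t" "t \<le> 1"
      then have "t ^ (3 * N) / (1 + t + t\<^sup>2) \<ge> 0" using pos[of t] by (simp add: less_imp_le)
      then show "\<exists>y. (G has_real_derivative y) (at t) \<and> 0 \<le> y" using dG[OF t(1)] by blast
    qed simp
    moreover have "R 0 - G 0 \<le> R 1 - G 1"
    proof (rule DERIV_nonneg_imp_nondecreasing[where f = "\<lambda>t. R t - G t"])
      fix t :: real assume t: "0 \<le> t" "t \<le> 1"
      have "t ^ (3 * N) / (1 + t + t\<^sup>2) \<le> t ^ (3 * N) / 1"
        using t by (intro divide_left_mono) (auto simp: add_pos_nonneg)
      then show "\<exists>y. ((\<lambda>t. R t - G t) has_real_derivative y) (at t) \<and> 0 \<le> y"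
        using DERIV_diff[OF dR[of t] dG[OF t(1)]] by (intro exI[of _ "t ^ (3 * N) - t ^ (3 * N) / (1 + t + t\<^sup>2)"]) simp
    qed simp
    moreover have "P N 0 = 0" by (simp add: P_def)
    ultimately show ?thesis using F01 by (simp add: G_def R_def)
  qed
  have "(\<lambda>N. P N 1) \<longlonglongrightarrow> pi / (3 * sqrt 3)"
  proof (rule LIM_zero_cancel, rule Lim_null_comparison)
    show "eventually (\<lambda>N. norm (P N 1 - pi / (3 * sqrt 3)) \<le> 1 / real (3 * N + 1)) sequentially"
      using bound by (intro always_eventually) auto
    show "(\<lambda>N. 1 / real (3 * N + 1)) \<longlonglongrightarrow> 0" by real_asymp
  qed
  moreover have "P N 1 = (\<Sum>n<3 * N. chi3 (Suc n) / real (Suc n))" for N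
  proof (induction N)
    case (Suc N)
    have "3 * Suc N = Suc (Suc (Suc (3 * N)))" by simp
    moreover have "Suc (3 * N) mod 3 = 1" "Suc (Suc (3 * N)) mod 3 = 2" "Suc (Suc (Suc (3 * N))) mod 3 = 0" by presburger+
    then have "chi3 (Suc (3 * N)) = 1" "chi3 (Suc (Suc (3 * N))) = - 1" "chi3 (Suc (Suc (Suc (3 * N)))) = 0"
      unfolding chi3_def by simp_all
    ultimately have "(\<Sum>n<3 * Suc N. chi3 (Suc n) / real (Suc n)) =
       (\<Sum>n<3 * N. chi3 (Suc n) / real (Suc n)) + 1 / real (3 * N + 1) - 1 / real (3 * N + 2)"
      by (simp only: sum.lessThan_Suc) simp
    then show ?case using Suc by (simp add: P_def)
  qed (simp add: P_def)
  moreover have "(\<lambda>N. \<Sum>n<3 * N. chi3 (Suc n) / real (Suc n)) \<longlonglongrightarrow> L_chi3 1"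
    using L_chi3_deriv(2) unfolding sums_def
    by (rule filterlim_compose) (intro filterlim_subseq strict_monoI, simp)
  ultimately show ?thesis using LIMSEQ_unique by simp
qed

section \<open>Harmonic asymptotics\<close>

text \<open>One telescoping majorant yields both convergence and an explicit tail bound; it serves
  the remainders of partial summation.\<close>

lemma telescoping_tail:
  fixes e w :: "nat \<Rightarrow> real"
  assumes e: "\<And>n. n \<ge> m \<Longrightarrow> \<bar>e n\<bar> \<le> w n - w (Suc n)" and w: "w \<longlonglongrightarrow> 0"
  shows "summable e" and "\<And>N. N \<ge> m \<Longrightarrow> \<bar>suminf e - (\<Sum>n<N. e n)\<bar> \<le> w N"
proof -
  have sums: "(\<lambda>n. w (n + N) - w (Suc (n + N))) sums w N" for N
    using telescope_sums'[OF LIMSEQ_ignore_initial_segment[OF w, of N]] by simp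
  have summ: "summable (\<lambda>n. e (n + N))" "summable (\<lambda>n. \<bar>e (n + N)\<bar>)" if "N \<ge> m" for N
    by (rule summable_comparison_test[OF _ sums_summable[OF sums[of N]]], use e that in force)+
  show s: "summable e" using summ(1)[of m] by (simp only: summable_iff_shift)
  fix N assume N: "N \<ge> m"
  have "suminf e - (\<Sum>n<N. e n) = (\<Sum>n. e (n + N))"
    using suminf_minus_initial_segment[OF s] by simp
  also have "\<bar>\<dots>\<bar> \<le> (\<Sum>n. \<bar>e (n + N)\<bar>)" using summ(2)[OF N] by (rule summable_rabs)
  also have "\<dots> \<le> (\<Sum>n. w (n + N) - w (Suc (n + N)))"
    by (rule suminf_le[OF _ summ(2)[OF N] sums_summable[OF sums]]) (use e N in auto)
  also have "\<dots> = w N" using sums by (simp add: sums_iff)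
  finally show "\<bar>suminf e - (\<Sum>n<N. e n)\<bar> \<le> w N" .
qed

lemma sum_lessThan_Suc_eq: "(\<Sum>n<N. F (Suc n)) = (\<Sum>n=1..N. F n)"
  by (rule sum.reindex_bij_witness[of _ "\<lambda>n. n - 1" Suc]) auto

lemma floor_ge_half: "y \<ge> 1 \<Longrightarrow> real (nat \<lfloor>y\<rfloor>) \<ge> y / 2" "y \<ge> 1 \<Longrightarrow> nat \<lfloor>y\<rfloor> \<ge> 1"
  "y \<ge> 0 \<Longrightarrow> real (nat \<lfloor>y\<rfloor>) \<le> y" "y < real (nat \<lfloor>y\<rfloor>) + 1" for y :: real
proof -
  show 1: "y < real (nat \<lfloor>y\<rfloor>) + 1" by linarith
  show 2: "y \<ge> 1 \<Longrightarrow> nat \<lfloor>y\<rfloor> \<ge> 1" by linarith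
  show "real (nat \<lfloor>y\<rfloor>) \<ge> y / 2" if "y \<ge> 1"
  proof -
    have "real (nat \<lfloor>y\<rfloor>) \<ge> 1" using 2[OF that] by simp
    then show ?thesis using 1 by linarith
  qed
  show "y \<ge> 0 \<Longrightarrow> real (nat \<lfloor>y\<rfloor>) \<le> y" by linarith
qed

text \<open>The bounds for gamma compare harm N with ln (N + 1); moving the logarithm back to N
  costs at most 1 / N.\<close>

lemma harm_bounds:
  assumes "N \<ge> 1"
  shows "\<bar>harm N - (ln (real N) + euler_mascheroni)\<bar> \<le> 1 / real N"
proof -
  obtain n where n: "N = Suc n" using assms by (cases N) auto
  have "ln (real N + 1) - ln (real N) = ln ((real N + 1) / real N)" using n by (simp add: ln_div)
  also have "\<dots> = ln (1 + 1 / real N)" using assms by (simp add: add_divide_distrib)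
  also have "\<dots> \<le> 1 / real N" by (rule ln_add_one_self_le_self) auto
  finally have 1: "ln (real N + 1) - ln (real N) \<le> 1 / real N" .
  have 2: "ln (real N) \<le> ln (real N + 1)" using n by simp
  have "real (n + 2) = real N + 1" using n by simp
  then have "harm N - ln (real N + 1) + 1 / real (2 * (n + 2)) \<le> euler_mascheroni"
     "euler_mascheroni \<le> harm N - ln (real N + 1) + 1 / real (2 * (n + 1))"
    using euler_mascheroni_lower[of n] euler_mascheroni_upper[of n] unfolding n[symmetric] by (simp_all add: add.commute)
  moreover have "1 / real (2 * (n + 2)) \<ge> 0" "1 / real (2 * (n + 1)) \<le> 1 / real N"
    unfolding n by (simp_all add: field_simps)
  ultimately show ?thesis using 1 2 unfolding abs_le_iff by linarith
qed

lemma summatory_harmonic: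
  assumes y: "y \<ge> 1"
  shows "\<bar>summatory (\<lambda>n. 1 / real n) y - (ln y + euler_mascheroni)\<bar> \<le> 4 / y"
proof -
  define N where "N = nat \<lfloor>y\<rfloor>"
  have N: "real N \<ge> y / 2" "N \<ge> 1" "real N \<le> y" "y < real N + 1"
    using y floor_ge_half[of y] unfolding N_def by simp_all
  have "ln y - ln (real N) = ln (y / real N)" using y N by (simp add: ln_div)
  also have "\<dots> \<le> y / real N - 1" using y N by (intro ln_le_minus_one) auto
  also have "y / real N \<le> (real N + 1) / real N" using N by (intro divide_right_mono) auto
  then have "y / real N - 1 \<le> 1 / real N" using N by (simp add: add_divide_distrib)
  finally have "ln y - ln (real N) \<le> 1 / real N" .
  moreover have "ln (real N) \<le> ln y" using N y by simp
  moreover have "1 / real N \<le> 2 / y"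
  proof -
    have "y \<le> 2 * real N" using N by linarith
    then show ?thesis using \<open>N \<ge> 1\<close> y(1) by (simp add: divide_simps mult.commute)
  qed
  moreover have "summatory (\<lambda>n. 1 / real n) y = harm N"
    by (simp add: summatory_def harm_def N_def inverse_eq_divide)
  ultimately show ?thesis using harm_bounds[OF N(2)] by (simp add: abs_le_iff)
qed

text \<open>Partial summation against 1 / n: the errors \<open>E n\<close> enter with weights of
  order n^(-2), giving a convergent series whose sum is part of the constant. Only existence of the
  constant is obtained here; its value is found along a suitable sequence.\<close>

lemma summatory_div_asymptotics:
  fixes f :: "nat \<Rightarrow> real"
  assumes F: "\<And>y. y \<ge> 1 \<Longrightarrow> \<bar>summatory f y - a * y\<bar> \<le> C * sqrt y"
  obtains a' C' where "\<And>y. y \<ge> 1 \<Longrightarrow> \<bar>summatory (\<lambda>n. f n / real n) y - (a * ln y + a')\<bar> \<le> C' / sqrt y"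
proof -
  define E where "E = (\<lambda>n. (\<Sum>k=1..n. f k) - a * real n)"
  have E: "\<bar>E n\<bar> \<le> C * sqrt (real n)" for n
    using F[of "real n"] by (cases "n = 0") (auto simp: E_def)
  have C: "C \<ge> 0" using E[of 1] by simp
  define e where "e = (\<lambda>n. E n * (1 / real n - 1 / real (Suc n)))"
  \<comment> \<open>Chosen so that terms of order n^(-3/2) telescope: 1 / (r s^2) \<le> 2 / r - 2 /
    s for r = sqrt n and s = sqrt (n + 1).\<close>
  define w where "w = (\<lambda>n. 2 * C / sqrt (real n))"
  have ew: "\<bar>e n\<bar> \<le> w n - w (Suc n)" if "n \<ge> 1" for n
  proof -
    define r s where "r = sqrt (real n)" and "s = sqrt (real (Suc n))"
    have rs: "r > 0" "s > 0" "r \<le> s" "s * s = r * r + 1" "real n = r * r" "real (Suc n) = s * s"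
      using that by (auto simp: r_def s_def)
    have eq: "1 / (r * r) - 1 / (s * s) = 1 / (r * r * (s * s))"
      using rs by (simp add: field_simps)
    have "\<bar>e n\<bar> = \<bar>E n\<bar> * (1 / (r * r * (s * s)))"
      unfolding e_def rs(5,6) eq using rs by (simp add: abs_mult)
    also have "\<dots> \<le> (C * r) * (1 / (r * r * (s * s)))"
      using E[of n] rs unfolding r_def[symmetric] by (intro mult_right_mono) auto
    also have "\<dots> = C * (1 / (r * (s * s)))" using rs by simp
    also have "\<dots> \<le> C * (2 / r - 2 / s)"
    proof (rule mult_left_mono[OF _ C])
      have "(s - r) * (s + r) = 1" using rs by (simp add: algebra_simps)
      moreover have "(s - r) * (s + r) \<le> (s - r) * (2 * s)" using rs by (intro mult_left_mono) auto
      ultimately show "1 / (r * (s * s)) \<le> 2 / r - 2 / s" using rs by (simp add: field_simps)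
    qed
    finally show ?thesis by (simp add: w_def r_def s_def algebra_simps)
  qed
  have w0: "w \<longlonglongrightarrow> 0" unfolding w_def by real_asymp
  note tail = telescoping_tail[OF ew w0]
  have e0: "e 0 = 0" by (simp add: e_def E_def)
  have partial: "(\<Sum>n=1..N. f n / real n) = a * harm N + E N / real (Suc N) + (\<Sum>n<Suc N. e n)" for N
  proof -
    have "(\<Sum>n=1..N. (f n - a) * (1 / real n)) = (\<Sum>n=1..N. f n - a) * (1 / real (Suc N)) +
       (\<Sum>n=1..N. (\<Sum>k=1..n. f k - a) * (1 / real n - 1 / real (Suc n)))" by (rule abel_summation)
    moreover have "(\<Sum>k=1..n. f k - a) = E n" for n by (simp add: E_def sum_subtractf)
    moreover have "(\<Sum>n=1..N. (f n - a) * (1 / real n)) = (\<Sum>n=1..N. f n / real n) - a * harm N"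
      by (simp add: harm_def diff_divide_distrib sum_subtractf sum_distrib_left inverse_eq_divide)
    moreover have "(\<Sum>n<Suc N. e n) = (\<Sum>n=1..N. e n)"
      unfolding sum.lessThan_Suc_shift e0 using sum_lessThan_Suc_eq[of e N] by simp
    ultimately show ?thesis by (simp add: e_def)
  qed
  show ?thesis
  proof (rule that[of "a * euler_mascheroni + suminf e" "4 * \<bar>a\<bar> + 3 * C"])
    fix y :: real assume y: "y \<ge> 1"
    define N where "N = nat \<lfloor>y\<rfloor>"
    have N: "real N \<ge> y / 2" "N \<ge> 1" "real N \<le> y" "y < real N + 1" using y floor_ge_half[of y] by (auto simp: N_def)
    have sy: "sqrt y \<le> sqrt (real (Suc N))" "sqrt y \<le> y" "sqrt y > 0"
      using N y by (auto intro!: real_le_lsqrt simp: power2_eq_square)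
    have i1: "1 / sqrt (real (Suc N)) \<le> 1 / sqrt y" using sy by (intro divide_left_mono) auto
    have "\<bar>harm N - (ln y + euler_mascheroni)\<bar> \<le> 4 / y"
      using summatory_harmonic[OF y] by (simp add: summatory_def harm_def N_def inverse_eq_divide)
    also have "\<dots> \<le> 4 / sqrt y" using sy y by (intro divide_left_mono) auto
    finally have "\<bar>a\<bar> * \<bar>harm N - (ln y + euler_mascheroni)\<bar> \<le> \<bar>a\<bar> * (4 / sqrt y)" by (intro mult_left_mono) auto
    then have A: "\<bar>a * harm N - (a * ln y + a * euler_mascheroni)\<bar> \<le> 4 * \<bar>a\<bar> / sqrt y"
      by (simp flip: abs_mult add: algebra_simps)
    have B: "\<bar>E N / real (Suc N)\<bar> \<le> C / sqrt y"
    proof -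
      have "\<bar>E N / real (Suc N)\<bar> \<le> C * sqrt (real N) / real (Suc N)"
        using E[of N] by (simp add: abs_mult divide_right_mono)
      also have "\<dots> \<le> C * sqrt (real (Suc N)) / real (Suc N)"
        using C by (intro divide_right_mono mult_left_mono) auto
      also have "\<dots> = C * (1 / sqrt (real (Suc N)))" by (simp add: real_div_sqrt field_simps)
      also have "\<dots> \<le> C * (1 / sqrt y)" using C i1 by (intro mult_left_mono) auto
      finally show ?thesis by simp
    qed
    have D: "\<bar>suminf e - (\<Sum>n<Suc N. e n)\<bar> \<le> 2 * C / sqrt y"
    proof -
      have "\<bar>suminf e - (\<Sum>n<Suc N. e n)\<bar> \<le> w (Suc N)" using tail(2)[of "Suc N"] by (simp del: sum.lessThan_Suc)
      also have "\<dots> = 2 * C * (1 / sqrt (real (Suc N)))" by (simp add: w_def)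
      also have "\<dots> \<le> 2 * C * (1 / sqrt y)" using C i1 by (intro mult_left_mono) auto
      finally show ?thesis by simp
    qed
    have "summatory (\<lambda>n. f n / real n) y = a * harm N + E N / real (Suc N) + (\<Sum>n<Suc N. e n)"
      unfolding summatory_def N_def[symmetric] by (rule partial)
    then have "\<bar>summatory (\<lambda>n. f n / real n) y - (a * ln y + (a * euler_mascheroni + suminf e))\<bar> \<le>
        4 * \<bar>a\<bar> / sqrt y + C / sqrt y + 2 * C / sqrt y"
      using A B D by linarith
    also have "\<dots> = (4 * \<bar>a\<bar> + 3 * C) / sqrt y" by (simp add: add_divide_distrib)
    finally show "\<bar>summatory (\<lambda>n. f n / real n) y - (a * ln y + (a * euler_mascheroni + suminf e))\<bar> \<le>
        (4 * \<bar>a\<bar> + 3 * C) / sqrt y" .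
  qed
qed

text \<open>Any sequence tending to infinity determines the constant, which allows cutoffs at which
  the breakpoint of the summation is an integer.\<close>

lemma summatory_div_asymptotics':
  fixes f :: "nat \<Rightarrow> real" and \<phi> :: "nat \<Rightarrow> real"
  assumes F: "\<And>y. y \<ge> 1 \<Longrightarrow> \<bar>summatory f y - a * y\<bar> \<le> C * sqrt y"
    and \<phi>: "filterlim \<phi> at_top sequentially"
    and lim: "(\<lambda>N. summatory (\<lambda>n. f n / real n) (\<phi> N) - a * ln (\<phi> N)) \<longlonglongrightarrow> b"
  obtains C' where "\<And>y. y \<ge> 1 \<Longrightarrow> \<bar>summatory (\<lambda>n. f n / real n) y - (a * ln y + b)\<bar> \<le> C' / sqrt y"
proof -
  obtain a' C' where *: "\<And>y. y \<ge> 1 \<Longrightarrow> \<bar>summatory (\<lambda>n. f n / real n) y - (a * ln y + a')\<bar> \<le> C' / sqrt y"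
    using summatory_div_asymptotics[OF F] by blast
  have "(\<lambda>N. summatory (\<lambda>n. f n / real n) (\<phi> N) - a * ln (\<phi> N) - a') \<longlonglongrightarrow> 0"
  proof (rule Lim_null_comparison)
    show "eventually (\<lambda>N. norm (summatory (\<lambda>n. f n / real n) (\<phi> N) - a * ln (\<phi> N) - a') \<le> C' / sqrt (\<phi> N)) sequentially"
      using eventually_ge_at_top[of "1 :: real", THEN filterlim_iff[THEN iffD1, OF \<phi>, rule_format]]
    proof eventually_elim
      case (elim N)
      show ?case using *[OF elim] by (simp add: algebra_simps)
    qed
    have "((\<lambda>y. C' / sqrt y) \<longlongrightarrow> 0) at_top" by real_asymp
    then show "(\<lambda>N. C' / sqrt (\<phi> N)) \<longlonglongrightarrow> 0" using \<phi> by (rule filterlim_compose)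
  qed
  then have "(\<lambda>N. summatory (\<lambda>n. f n / real n) (\<phi> N) - a * ln (\<phi> N)) \<longlonglongrightarrow> a'" by (rule LIM_zero_cancel)
  then have "a' = b" using lim LIMSEQ_unique by blast
  then show ?thesis using * that by blast
qed

lemma chi3_abs_le: "\<bar>chi3 n\<bar> \<le> 1"
  by (simp add: chi3_def)

text \<open>With partial sums of \<open>chi3\<close> between 0 and 1, the boundary term and the tail
  of the transformed series each cost at most 1 / y.\<close>

lemma summatory_chi3_div:
  assumes y: "y \<ge> 1"
  shows "\<bar>summatory (\<lambda>n. chi3 n / real n) y - L_chi3 1\<bar> \<le> 2 / y"
proof -
  define X where "X = (\<lambda>n. \<Sum>k=1..n. chi3 k)"
  have X: "0 \<le> X n" "X n \<le> 1" for n using chi3_partial_sum_bounds[of n] by (auto simp: X_def)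
  define e where "e = (\<lambda>n. X n * (1 / real n - 1 / real (Suc n)))"
  define w where "w = (\<lambda>n. 1 / real n)"
  have d: "0 \<le> 1 / real n - 1 / real (Suc n)" if "n \<ge> 1" for n using that by (simp add: field_simps)
  have ew: "\<bar>e n\<bar> \<le> w n - w (Suc n)" if "n \<ge> 1" for n
    using mult_mono[OF X(2)[of n] order_refl[of "1 / real n - 1 / real (Suc n)"]] X(1)[of n] d[OF that]
    by (simp add: e_def w_def abs_mult)
  have w0: "w \<longlonglongrightarrow> 0" unfolding w_def by real_asymp
  note tail = telescoping_tail[OF ew w0]
  have partial: "(\<Sum>n=1..N. chi3 n / real n) = X N / real (Suc N) + (\<Sum>n<Suc N. e n)" for N
  proof -
    have "(\<Sum>n=1..N. chi3 n * (1 / real n)) = X N * (1 / real (Suc N)) + (\<Sum>n=1..N. e n)"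
      unfolding X_def e_def by (rule abel_summation)
    moreover have "(\<Sum>n<Suc N. e n) = (\<Sum>n=1..N. e n)"
      unfolding sum.lessThan_Suc_shift using sum_lessThan_Suc_eq[of e N] by (simp add: e_def X_def)
    ultimately show ?thesis by simp
  qed
  have XN: "(\<lambda>N. X N / real (Suc N)) \<longlonglongrightarrow> 0"
    by (rule Lim_null_comparison[of _ "\<lambda>N. 1 / real (Suc N)"])
       (use X in \<open>auto intro!: always_eventually divide_right_mono LIMSEQ_Suc[OF lim_1_over_n] simp del: of_nat_Suc\<close>)
  have "(\<lambda>N. X N / real (Suc N) + (\<Sum>n<Suc N. e n)) \<longlonglongrightarrow> 0 + suminf e"
    by (intro tendsto_add XN LIMSEQ_Suc[OF summable_LIMSEQ[OF tail(1)]])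
  moreover have "(\<lambda>N. X N / real (Suc N) + (\<Sum>n<Suc N. e n)) \<longlonglongrightarrow> L_chi3 1"
    using L_chi3_deriv(2) unfolding sums_def sum_lessThan_Suc_eq[of "\<lambda>n. chi3 n / real n"] partial .
  ultimately have L: "L_chi3 1 = suminf e" using LIMSEQ_unique by fastforce
  define N where "N = nat \<lfloor>y\<rfloor>"
  have N: "y < real N + 1" using y floor_ge_half[of y] by (auto simp: N_def)
  have i: "1 / real (Suc N) \<le> 1 / y" using N y by (intro divide_left_mono) auto
  have "X N / real (Suc N) \<le> 1 / real (Suc N)" using X by (intro divide_right_mono) auto
  moreover have "0 \<le> X N / real (Suc N)" using X by simp
  moreover have "\<bar>suminf e - (\<Sum>n<Suc N. e n)\<bar> \<le> 1 / real (Suc N)" using tail(2)[of "Suc N"] by (simp add: w_def del: sum.lessThan_Suc of_nat_Suc)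
  moreover have "summatory (\<lambda>n. chi3 n / real n) y = X N / real (Suc N) + (\<Sum>n<Suc N. e n)"
    unfolding summatory_def N_def[symmetric] by (rule partial)
  ultimately show ?thesis using i unfolding L by (simp add: abs_le_iff)
qed

lemma hex_ideals_conv_dconv: "hex_ideals = dconv chi3 (\<lambda>_. 1)"
  by (simp add: fun_eq_iff hex_ideals_def dconv_def)

lemma hex_ideals_div_conv_dconv:
  "(\<lambda>n. hex_ideals n / real n) = dconv (\<lambda>n. chi3 n / real n) (\<lambda>n. 1 / real n)"
proof
  fix n
  show "hex_ideals n / real n = dconv (\<lambda>n. chi3 n / real n) (\<lambda>n. 1 / real n) n"
    unfolding hex_ideals_def dconv_def sum_divide_distrib
    by (intro sum.cong refl) (auto elim!: dvdE)
qed

text \<open>The hyperbola method for \<open>chi3\<close> convolved with 1. Rounding errors cost sqrt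
  x, the tail of L(1) costs 2 sqrt x, and the sums with bounded inner sums of \<open>chi3\<close>
  cost at most sqrt x each.\<close>

lemma summatory_hex_ideals:
  assumes x: "x \<ge> 1"
  shows "\<bar>summatory hex_ideals x - L_chi3 1 * x\<bar> \<le> 5 * sqrt x"
proof -
  define s where "s = sqrt x"
  have s: "s \<ge> 1" "s * s = x" "x \<ge> 0" using x by (auto simp: s_def)
  let ?M = "nat \<lfloor>s\<rfloor>"
  have M: "real ?M \<le> s" using s by linarith
  have one: "summatory (\<lambda>_. 1) y = real (nat \<lfloor>y\<rfloor>)" for y by (simp add: summatory_def)
  have X: "0 \<le> summatory chi3 y" "summatory chi3 y \<le> 1" for y
    unfolding summatory_def using chi3_partial_sum_bounds by blast+
  define A where "A = (\<Sum>m=1..?M. chi3 m * summatory (\<lambda>_. 1) (x / real m))"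
  define B where "B = (\<Sum>k=1..?M. 1 * summatory chi3 (x / real k))"
  define D where "D = summatory chi3 s * summatory (\<lambda>_. 1) s"
  have "\<bar>A - x * summatory (\<lambda>n. chi3 n / real n) s\<bar> = \<bar>\<Sum>m=1..?M. chi3 m * (real (nat \<lfloor>x / real m\<rfloor>) - x / real m)\<bar>"
    by (simp add: A_def one summatory_def sum_distrib_left right_diff_distrib sum_subtractf mult.commute)
  also have "\<dots> \<le> (\<Sum>m=1..?M. 1)"
  proof (rule order.trans[OF sum_abs sum_mono])
    fix m
    have "x / real m \<ge> 0" using x by simp
    then have "\<bar>real (nat \<lfloor>x / real m\<rfloor>) - x / real m\<bar> \<le> 1" by linarith
    then show "\<bar>chi3 m * (real (nat \<lfloor>x / real m\<rfloor>) - x / real m)\<bar> \<le> 1"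
      using chi3_abs_le[of m] mult_mono[of "\<bar>chi3 m\<bar>" 1 "\<bar>real (nat \<lfloor>x / real m\<rfloor>) - x / real m\<bar>" 1] by (simp add: abs_mult)
  qed
  also have "\<dots> \<le> s" using M by simp
  finally have 1: "\<bar>A - x * summatory (\<lambda>n. chi3 n / real n) s\<bar> \<le> s" .
  have "\<bar>x * summatory (\<lambda>n. chi3 n / real n) s - x * L_chi3 1\<bar> = x * \<bar>summatory (\<lambda>n. chi3 n / real n) s - L_chi3 1\<bar>"
    using s by (simp add: abs_mult flip: right_diff_distrib)
  also have "\<dots> \<le> x * (2 / s)" using summatory_chi3_div[OF s(1)] s by (intro mult_left_mono) auto
  also have "\<dots> = 2 * s" using s(1) by (simp flip: s(2))
  finally have 2: "\<bar>x * summatory (\<lambda>n. chi3 n / real n) s - x * L_chi3 1\<bar> \<le> 2 * s" .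
  have "0 \<le> B" unfolding B_def using X by (intro sum_nonneg) auto
  moreover have "B \<le> (\<Sum>k=1..?M. 1)" unfolding B_def using X by (intro sum_mono) auto
  ultimately have 3: "0 \<le> B" "B \<le> s" using M by auto
  have "0 \<le> D" unfolding D_def using X one by (intro mult_nonneg_nonneg) auto
  moreover have "D \<le> 1 * s" unfolding D_def one using X M by (intro mult_mono) auto
  ultimately have 4: "0 \<le> D" "D \<le> s" by auto
  have "summatory hex_ideals x = A + B - D"
    unfolding hex_ideals_conv_dconv summatory_dconv_hyperbola[OF s(3)] A_def B_def D_def s_def ..
  then show ?thesis using 1 2 3 4 unfolding s_def[symmetric] by (simp add: mult.commute abs_le_iff)
qed

text \<open>The limit is the constant term of zeta(s) L(s) at s = 1. At the cutoff N^2 both arms of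
  the hyperbola end at N; the arm with harmonic inner sums produces ln m and hence the series of
  L'(1).\<close>

lemma summatory_hex_ideals_div_limit:
  "(\<lambda>N. summatory (\<lambda>n. hex_ideals n / real n) ((real N)\<^sup>2) - L_chi3 1 * ln ((real N)\<^sup>2))
      \<longlonglongrightarrow> L_chi3 1 * euler_mascheroni + deriv L_chi3 1"
proof -
  define X1 where "X1 = summatory (\<lambda>n. chi3 n / real n)"
  define H1 where "H1 = summatory (\<lambda>n. 1 / real n)"
  define \<Lambda> where "\<Lambda> = (\<lambda>N. \<Sum>m=1..N. chi3 m * ln (real m) / real m)"
  define main where "main = (\<lambda>N. (X1 (real N) - L_chi3 1) * (2 * ln (real N) + euler_mascheroni) - \<Lambda> N + L_chi3 1 * euler_mascheroni)"
  have bound: "\<bar>summatory (\<lambda>n. hex_ideals n / real n) ((real N)\<^sup>2) - L_chi3 1 * ln ((real N)\<^sup>2) - main N\<bar> \<le> 6 / real N + 2 * H1 (real N) / real N"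
    if N: "N \<ge> 1" for N
  proof -
    have N2: "(real N)\<^sup>2 \<ge> 0" "sqrt ((real N)\<^sup>2) = real N" by simp_all
    define A where "A = (\<Sum>m=1..N. chi3 m / real m * H1 ((real N)\<^sup>2 / real m))"
    define B where "B = (\<Sum>k=1..N. 1 / real k * X1 ((real N)\<^sup>2 / real k))"
    have eq: "summatory (\<lambda>n. hex_ideals n / real n) ((real N)\<^sup>2) = A + B - X1 (real N) * H1 (real N)"
      unfolding hex_ideals_div_conv_dconv summatory_dconv_hyperbola[OF N2(1)] N2(2) A_def B_def X1_def H1_def by simp
    have ge: "(real N)\<^sup>2 / real m \<ge> real N" if "m \<in> {1..N}" for m
      using that N by (simp add: field_simps power2_eq_square mult_left_mono)
    have lnN: "ln ((real N)\<^sup>2) = 2 * ln (real N)" using N by (simp add: ln_realpow)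
    have "A - (X1 (real N) * (2 * ln (real N) + euler_mascheroni) - \<Lambda> N)
        = (\<Sum>m=1..N. chi3 m / real m * (H1 ((real N)\<^sup>2 / real m) - (ln ((real N)\<^sup>2 / real m) + euler_mascheroni)))"
    proof -
      have "(\<Sum>m=1..N. chi3 m / real m * (ln ((real N)\<^sup>2 / real m) + euler_mascheroni)) =
         (\<Sum>m=1..N. chi3 m / real m * (2 * ln (real N) + euler_mascheroni) - chi3 m * ln (real m) / real m)"
        by (intro sum.cong refl, subst ln_div) (use N in \<open>auto simp: lnN field_simps\<close>)
      also have "\<dots> = X1 (real N) * (2 * ln (real N) + euler_mascheroni) - \<Lambda> N"
        by (simp add: sum_subtractf sum_distrib_right X1_def \<Lambda>_def)
      finally show ?thesis by (simp add: A_def right_diff_distrib sum_subtractf)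
    qed
    also have "\<bar>\<dots>\<bar> \<le> (\<Sum>m=1..N. 4 / (real N)\<^sup>2)"
    proof (rule order.trans[OF sum_abs sum_mono])
      fix m assume m: "m \<in> {1..N}"
      have "\<bar>H1 ((real N)\<^sup>2 / real m) - (ln ((real N)\<^sup>2 / real m) + euler_mascheroni)\<bar> \<le> 4 / ((real N)\<^sup>2 / real m)"
        unfolding H1_def using ge[OF m] N by (intro summatory_harmonic) auto
      moreover have "\<bar>chi3 m / real m\<bar> \<le> 1 / real m" using chi3_abs_le[of m] by (simp add: divide_right_mono)
      ultimately have "\<bar>chi3 m / real m * (H1 ((real N)\<^sup>2 / real m) - (ln ((real N)\<^sup>2 / real m) + euler_mascheroni))\<bar>
        \<le> 1 / real m * (4 / ((real N)\<^sup>2 / real m))" unfolding abs_mult by (intro mult_mono) auto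
      then show "\<bar>chi3 m / real m * (H1 ((real N)\<^sup>2 / real m) - (ln ((real N)\<^sup>2 / real m) + euler_mascheroni))\<bar> \<le> 4 / (real N)\<^sup>2"
        using m by simp
    qed
    also have "\<dots> = 4 / real N" using N by (simp add: power2_eq_square)
    finally have 1: "\<bar>A - (X1 (real N) * (2 * ln (real N) + euler_mascheroni) - \<Lambda> N)\<bar> \<le> 4 / real N" .
    \<comment> \<open>The inner sums X1 (N^2 / k) and X1 N are both close to L(1), so this arm and
      the corner product cancel up to O(ln N / N).\<close>
    have "\<bar>B - X1 (real N) * H1 (real N)\<bar> = \<bar>\<Sum>k=1..N. 1 / real k * (X1 ((real N)\<^sup>2 / real k) - X1 (real N))\<bar>"
      by (simp add: B_def H1_def sum_distrib_left sum_subtractf right_diff_distrib mult.commute)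
    also have "\<dots> \<le> (\<Sum>k=1..N. 2 / (real N)\<^sup>2 + 2 / real N * (1 / real k))"
    proof (rule order.trans[OF sum_abs sum_mono])
      fix k assume k: "k \<in> {1..N}"
      have "\<bar>X1 ((real N)\<^sup>2 / real k) - L_chi3 1\<bar> \<le> 2 / ((real N)\<^sup>2 / real k)" "\<bar>X1 (real N) - L_chi3 1\<bar> \<le> 2 / real N"
        unfolding X1_def using ge[OF k] N by (intro summatory_chi3_div; simp)+
      then have "\<bar>X1 ((real N)\<^sup>2 / real k) - X1 (real N)\<bar> \<le> 2 / ((real N)\<^sup>2 / real k) + 2 / real N" by linarith
      then have "1 / real k * \<bar>X1 ((real N)\<^sup>2 / real k) - X1 (real N)\<bar> \<le> 1 / real k * (2 / ((real N)\<^sup>2 / real k) + 2 / real N)"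
        by (intro mult_left_mono) auto
      also have "\<dots> = 2 / (real N)\<^sup>2 + 2 / real N * (1 / real k)" using k N by (simp add: field_simps)
      finally show "\<bar>1 / real k * (X1 ((real N)\<^sup>2 / real k) - X1 (real N))\<bar> \<le> 2 / (real N)\<^sup>2 + 2 / real N * (1 / real k)"
        by (simp add: abs_mult)
    qed
    also have "\<dots> = 2 / real N + 2 * H1 (real N) / real N"
      using N by (simp add: sum.distrib H1_def sum_distrib_left sum_divide_distrib power2_eq_square mult.commute)
    finally have 2: "\<bar>B - X1 (real N) * H1 (real N)\<bar> \<le> 2 / real N + 2 * H1 (real N) / real N" .
    have "summatory (\<lambda>n. hex_ideals n / real n) ((real N)\<^sup>2) - L_chi3 1 * ln ((real N)\<^sup>2) - main N =
      (A - (X1 (real N) * (2 * ln (real N) + euler_mascheroni) - \<Lambda> N)) + (B - X1 (real N) * H1 (real N))"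
      unfolding eq lnN main_def by (simp add: algebra_simps)
    then show ?thesis using 1 2 by linarith
  qed
  have H1N: "H1 (real N) \<le> ln (real N) + euler_mascheroni + 4 / real N" if "N \<ge> 1" for N
    using summatory_harmonic[of "real N"] that unfolding H1_def by (simp add: abs_le_iff)
  have "(\<lambda>N. summatory (\<lambda>n. hex_ideals n / real n) ((real N)\<^sup>2) - L_chi3 1 * ln ((real N)\<^sup>2) - main N) \<longlonglongrightarrow> 0"
  proof (rule Lim_null_comparison)
    show "eventually (\<lambda>N. norm (summatory (\<lambda>n. hex_ideals n / real n) ((real N)\<^sup>2) - L_chi3 1 * ln ((real N)\<^sup>2) - main N)
       \<le> 6 / real N + 2 * (ln (real N) + euler_mascheroni + 4 / real N) / real N) sequentially"
      using eventually_ge_at_top[of 1]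
    proof eventually_elim
      case (elim N)
      have "2 * H1 (real N) / real N \<le> 2 * (ln (real N) + euler_mascheroni + 4 / real N) / real N"
        using H1N[OF elim] by (intro divide_right_mono) auto
      then show ?case using bound[OF elim] by simp
    qed
    show "(\<lambda>N. 6 / real N + 2 * (ln (real N) + euler_mascheroni + 4 / real N) / real N) \<longlonglongrightarrow> 0" by real_asymp
  qed
  moreover have "main \<longlonglongrightarrow> 0 - (- deriv L_chi3 1) + L_chi3 1 * euler_mascheroni"
    unfolding main_def
  proof (intro tendsto_intros)
    show "(\<lambda>N. (X1 (real N) - L_chi3 1) * (2 * ln (real N) + euler_mascheroni)) \<longlonglongrightarrow> 0"
    proof (rule Lim_null_comparison)
      show "eventually (\<lambda>N. norm ((X1 (real N) - L_chi3 1) * (2 * ln (real N) + euler_mascheroni)) \<le>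
         2 / real N * \<bar>2 * ln (real N) + euler_mascheroni\<bar>) sequentially"
        using eventually_ge_at_top[of 1]
      proof eventually_elim
        case (elim N)
        then show ?case unfolding X1_def using summatory_chi3_div[of "real N"]
          by (simp add: abs_mult mult_right_mono del: times_divide_eq_left)
      qed
      have "(\<lambda>N. 2 / real N * (2 * ln (real N) + euler_mascheroni)) \<longlonglongrightarrow> 0" by real_asymp
      then have "(\<lambda>N. \<bar>2 / real N * (2 * ln (real N) + euler_mascheroni)\<bar>) \<longlonglongrightarrow> 0" by (rule tendsto_rabs_zero)
      then show "(\<lambda>N. 2 / real N * \<bar>2 * ln (real N) + euler_mascheroni\<bar>) \<longlonglongrightarrow> 0"
        by (simp only: abs_mult abs_divide abs_numeral abs_of_nat)
    qed
    show "\<Lambda> \<longlonglongrightarrow> - deriv L_chi3 1"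
      using L_chi3_deriv(1) unfolding sums_def sum_lessThan_Suc_eq[of "\<lambda>n. chi3 n * ln (real n) / real n"] \<Lambda>_def .
  qed
  ultimately have "(\<lambda>N. (summatory (\<lambda>n. hex_ideals n / real n) ((real N)\<^sup>2) - L_chi3 1 * ln ((real N)\<^sup>2) - main N) + main N)
     \<longlonglongrightarrow> 0 + (0 - (- deriv L_chi3 1) + L_chi3 1 * euler_mascheroni)" by (rule tendsto_add)
  then show ?thesis by (simp add: add.commute)
qed

lemma summatory_hex_ideals_div:
  obtains C where "\<And>y. y \<ge> 1 \<Longrightarrow> \<bar>summatory (\<lambda>n. hex_ideals n / real n) y -
    (L_chi3 1 * ln y + (L_chi3 1 * euler_mascheroni + deriv L_chi3 1))\<bar> \<le> C / sqrt y"
proof -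
  have "filterlim (\<lambda>N. (real N)\<^sup>2) at_top sequentially" by real_asymp
  from summatory_div_asymptotics'[OF summatory_hex_ideals this summatory_hex_ideals_div_limit] that
  show ?thesis by blast
qed

lemma hex_ideals_nonneg: "hex_ideals n \<ge> 0"
proof (cases "n = 0")
  case False
  then show ?thesis using card_eis_reps[of n] by simp
next
  case True
  then show ?thesis unfolding hex_ideals_def by (simp add: sum.infinite)
qed

section \<open>Asymptotics under series of dilations\<close>

text \<open>Below 1 the main term is itself of the size of the error. This extends asymptotics from
  y \<ge> 1 to y > 0, as series of dilations require.\<close>

lemma y_ln_y_small:
  fixes y :: real
  assumes y: "0 < y" "y < 1"
  shows "\<bar>a * y * ln y + b * y\<bar> \<le> (4 * \<bar>a\<bar> + \<bar>b\<bar>) * y powr (3/4)"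
proof -
  \<comment> \<open>With the fourth root, the bound - ln y \<le> 4 / z loses exactly a quarter power
    of y.\<close>
  define z where "z = y powr (1/4)"
  have z: "z > 0" "z \<le> 1" "y = z ^ 4" "y powr (3/4) = z ^ 3"
    using y powr_mono'[of 0 "1/4" y] by (simp_all add: z_def powr_powr flip: powr_numeral) 
  have "ln (1 / z) \<le> 1 / z - 1" using z by (intro ln_le_minus_one) auto
  then have "- ln z \<le> 1 / z" using z by (simp add: ln_div)
  then have "- ln y \<le> 4 * (1 / z)" unfolding z(3) using z by (simp add: ln_realpow)
  then have "y * (- ln y) \<le> y * (4 * (1 / z))" using y by (intro mult_left_mono) auto
  also have "\<dots> = 4 * z ^ 3" using z(1) unfolding z(3) by (simp add: eval_nat_numeral)
  finally have 1: "\<bar>y * ln y\<bar> \<le> 4 * z ^ 3" using y by (simp add: abs_mult ln_less_zero)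
  have 2: "\<bar>y\<bar> \<le> z ^ 3" using y z by (simp add: z(3) power_decreasing)
  have "\<bar>a * y * ln y + b * y\<bar> \<le> \<bar>a\<bar> * \<bar>y * ln y\<bar> + \<bar>b\<bar> * \<bar>y\<bar>"
    by (rule order.trans[OF abs_triangle_ineq]) (simp add: abs_mult)
  also have "\<dots> \<le> \<bar>a\<bar> * (4 * z ^ 3) + \<bar>b\<bar> * z ^ 3" using 1 2 by (intro add_mono mult_left_mono) auto
  finally show ?thesis by (simp add: z(4) algebra_simps)
qed

text \<open>Since ln (x / t) = ln x - ln t, the main terms sum to multiples of \<open>M\<close> and
  \<open>Q\<close>; the errors can be summed because the weights |u| t^(-3/4) can.\<close>

lemma asymptotics_dilation_series:
  fixes S T :: "real \<Rightarrow> real" and u t :: "nat \<Rightarrow> real"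
  assumes T: "\<And>y. y > 0 \<Longrightarrow> \<bar>T y - (a * y * ln y + b * y)\<bar> \<le> C * y powr (3/4)"
    and t: "\<And>d. t d > 0"
    and S: "\<And>x. x > 0 \<Longrightarrow> (\<lambda>d. u d * T (x / t d)) sums S x"
    and M: "(\<lambda>d. u d / t d) sums M" and Q: "(\<lambda>d. u d * ln (t d) / t d) sums Q"
    and W: "summable (\<lambda>d. \<bar>u d\<bar> * t d powr (- (3/4)))"
  obtains C' where "\<And>x. x > 0 \<Longrightarrow> \<bar>S x - (a * M * x * ln x + (b * M - a * Q) * x)\<bar> \<le> C' * x powr (3/4)"
proof (rule that)
  fix x :: real assume x: "x > 0"
  define e where "e = (\<lambda>d. u d * (T (x / t d) - (a * (x / t d) * ln (x / t d) + b * (x / t d))))"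
  have "(\<lambda>d. u d * T (x / t d) - (a * x * ln x * (u d / t d) + b * x * (u d / t d) - a * x * (u d * ln (t d) / t d)))
     sums (S x - (a * x * ln x * M + b * x * M - a * x * Q))"
    by (intro sums_diff sums_add sums_mult S x M Q)
  also have "(\<lambda>d. u d * T (x / t d) - (a * x * ln x * (u d / t d) + b * x * (u d / t d) - a * x * (u d * ln (t d) / t d))) = e"
  proof
    fix d
    have l: "ln (x / t d) = ln x - ln (t d)" using x t[of d] by (simp add: ln_div)
    show "u d * T (x / t d) - (a * x * ln x * (u d / t d) + b * x * (u d / t d) - a * x * (u d * ln (t d) / t d)) = e d"
      unfolding e_def l by (simp add: algebra_simps diff_divide_distrib add_divide_distrib)
  qed
  finally have es: "e sums (S x - (a * x * ln x * M + b * x * M - a * x * Q))" .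
  have eb: "\<bar>e d\<bar> \<le> C * x powr (3/4) * (\<bar>u d\<bar> * t d powr (- (3/4)))" for d
  proof -
    have "\<bar>e d\<bar> \<le> \<bar>u d\<bar> * (C * (x / t d) powr (3/4))"
      unfolding e_def abs_mult using t x by (intro mult_left_mono T) auto
    also have "(x / t d) powr (3/4) = x powr (3/4) * t d powr (- (3/4))"
      using x t[of d] by (simp add: powr_divide powr_minus field_simps)
    finally show ?thesis by (simp add: mult_ac)
  qed
  have sm: "summable (\<lambda>d. \<bar>e d\<bar>)"
    by (rule summable_comparison_test'[OF summable_mult[OF W]]) (use eb in auto)
  have "\<bar>suminf e\<bar> \<le> (\<Sum>d. \<bar>e d\<bar>)" by (rule summable_rabs[OF sm])
  also have "\<dots> \<le> (\<Sum>d. C * x powr (3/4) * (\<bar>u d\<bar> * t d powr (- (3/4))))"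
    by (intro suminf_le eb sm summable_mult W)
  also have "\<dots> = C * (\<Sum>d. \<bar>u d\<bar> * t d powr (- (3/4))) * x powr (3/4)" by (subst suminf_mult[OF W]) (simp add: mult_ac)
  finally show "\<bar>S x - (a * M * x * ln x + (b * M - a * Q) * x)\<bar> \<le> C * (\<Sum>d. \<bar>u d\<bar> * t d powr (- (3/4))) * x powr (3/4)"
    using sums_unique[OF es] by (simp add: algebra_simps)
qed

section \<open>Primitive Eisenstein integers\<close>

definition mu :: "nat \<Rightarrow> real" where
  "mu n = (if squarefree n then (-1) ^ card (prime_factors n) else 0)"

lemma abs_mu_le: "\<bar>mu n\<bar> \<le> 1"
  by (simp add: mu_def)

lemma mu_mult_prime:
  assumes p: "prime p" and d: "\<not> p dvd d" "d > 0"
  shows "mu (p * d) = - mu d"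
proof -
  have "coprime p d" using p d by (simp add: prime_imp_coprime)
  moreover have "squarefree p" using p by (simp add: squarefree_prime)
  ultimately have "squarefree (p * d) \<longleftrightarrow> squarefree d"
    by (auto intro: squarefree_mult_coprime dest: squarefree_multD)
  moreover have "prime_factors (p * d) = insert p (prime_factors d)"
    using p d by (subst prime_factors_product) (auto simp: prime_factorization_prime)
  moreover have "p \<notin> prime_factors d" using d by auto
  ultimately show ?thesis by (simp add: mu_def)
qed

text \<open>For a prime p dividing n, the divisors prime to p cancel against their p-fold multiples,
  and the remaining divisors are divisible by p^2.\<close>

lemma sum_mu_divisors:
  assumes n: "n > 0"
  shows "(\<Sum>d | d dvd n. mu d) = (if n = 1 then 1 else 0)"
proof (cases "n = 1")
  case True
  then show ?thesis by (simp add: mu_def)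
next
  case False
  then obtain p where p: "prime p" "p dvd n" using prime_factor_nat by blast
  have p0: "p > 0" using p by (simp add: prime_gt_0_nat)
  let ?A = "{d. d dvd n \<and> \<not> p dvd d}"
  have fin: "finite ?A" by (rule finite_subset[of _ "{d. d dvd n}"]) (use n in auto)
  have sq: "mu (p * (p * d)) = 0" for d
  proof -
    have "\<not> squarefree (p * (p * d))"
      using p by (metis dvd_triv_left mult.assoc not_prime_unit power2_eq_square squarefreeD)
    then show ?thesis by (simp add: mu_def)
  qed
  have "(\<Sum>d | d dvd n. mu d) = (\<Sum>d\<in>?A \<union> times p ` ?A. mu d)"
  proof (rule sum.mono_neutral_right)
    show "?A \<union> times p ` ?A \<subseteq> {d. d dvd n}"
      using p by (auto intro!: divides_mult prime_imp_coprime)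
    show "\<forall>d\<in>{d. d dvd n} - (?A \<union> times p ` ?A). mu d = 0"
    proof
      fix d assume d: "d \<in> {d. d dvd n} - (?A \<union> times p ` ?A)"
      then obtain e where e: "d = p * e" by auto
      have "e dvd n" using d e by (auto dest: dvd_mult_right)
      then have "p dvd e" using d e by auto
      then show "mu d = 0" using e sq by (auto elim!: dvdE)
    qed
  qed (use n in auto)
  also have "\<dots> = sum mu ?A + sum mu (times p ` ?A)"
    by (rule sum.union_disjoint) (use fin in auto)
  also have "sum mu (times p ` ?A) = (\<Sum>d\<in>?A. mu (p * d))"
    using p0 by (subst sum.reindex) (auto simp: inj_on_def)
  also have "\<dots> = (\<Sum>d\<in>?A. - mu d)"
    using n by (intro sum.cong refl mu_mult_prime p) (auto intro!: Nat.gr0I)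
  finally show ?thesis using False by (simp add: sum_negf)
qed

text \<open>Tannery's theorem: the partial sum up to N is a sum of f m times the partial sum of
  \<open>g\<close> up to N div m, dominated by |f m| times the absolute sum of
  \<open>g\<close>.\<close>

lemma sums_dconv:
  fixes f g :: "nat \<Rightarrow> real"
  assumes f: "summable (\<lambda>n. \<bar>f (Suc n)\<bar>)" and g: "summable (\<lambda>n. \<bar>g (Suc n)\<bar>)"
  shows "(\<lambda>n. dconv f g (Suc n)) sums ((\<Sum>n. f (Suc n)) * (\<Sum>n. g (Suc n)))"
proof -
  have reidx: "(\<Sum>n<N. F (Suc n)) = (\<Sum>n=1..N. F n)" for F :: "nat \<Rightarrow> real" and N
    by (rule sum.reindex_bij_witness[of _ "\<lambda>n. n - 1" Suc]) auto
  define G where "G = (\<lambda>N. \<Sum>n<N. g (Suc n))"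
  have Glim: "G \<longlonglongrightarrow> (\<Sum>n. g (Suc n))"
    unfolding G_def using summable_LIMSEQ[OF summable_rabs_cancel[OF g]] .
  have Gb: "\<bar>G N\<bar> \<le> (\<Sum>n. \<bar>g (Suc n)\<bar>)" for N
    unfolding G_def using sum_le_suminf[OF g, of "{..<N}"] by (intro order.trans[OF sum_abs]) auto
  define h where "h = (\<lambda>m N. if m < N then f (Suc m) * G (N div Suc m) else 0)"
  have eq: "(\<Sum>n<N. dconv f g (Suc n)) = (\<Sum>m. h m N)" for N
  proof -
    have "(\<Sum>n<N. dconv f g (Suc n)) = (\<Sum>m=1..N. \<Sum>k=1..N div m. f m * g k)"
      unfolding reidx[of "dconv f g"] unfolding dconv_def by (rule sum_dvd_pairs)
    also have "\<dots> = (\<Sum>m=1..N. f m * G (N div m))"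
      unfolding G_def reidx by (simp add: sum_distrib_left)
    also have "\<dots> = (\<Sum>m<N. f (Suc m) * G (N div Suc m))"
      unfolding reidx[of "\<lambda>m. f m * G (N div m)"] ..
    also have "\<dots> = (\<Sum>m<N. h m N)" by (simp add: h_def)
    also have "\<dots> = (\<Sum>m. h m N)" by (rule suminf_finite[symmetric]) (auto simp: h_def)
    finally show ?thesis .
  qed
  have "((\<lambda>N. \<Sum>m. h m N) \<longlongrightarrow> (\<Sum>m. f (Suc m) * (\<Sum>n. g (Suc n)))) sequentially"
  proof (rule tannerys_theorem[where M = "\<lambda>m. \<bar>f (Suc m)\<bar> * (\<Sum>n. \<bar>g (Suc n)\<bar>)", THEN conjunct2, THEN conjunct2])
    fix m
    have "filterlim (\<lambda>N. N div Suc m) at_top sequentially"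
      unfolding filterlim_at_top
    proof
      fix Z
      show "eventually (\<lambda>N. Z \<le> N div Suc m) sequentially"
        using eventually_ge_at_top[of "Z * Suc m"] by eventually_elim (simp add: less_eq_div_iff_mult_less_eq del: mult_Suc_right)
    qed
    then have "(\<lambda>N. f (Suc m) * G (N div Suc m)) \<longlonglongrightarrow> f (Suc m) * (\<Sum>n. g (Suc n))"
      by (intro tendsto_mult tendsto_const filterlim_compose[OF Glim])
    moreover have "eventually (\<lambda>N. f (Suc m) * G (N div Suc m) = h m N) sequentially"
      using eventually_gt_at_top[of m] by eventually_elim (simp add: h_def)
    ultimately show "((\<lambda>N. h m N) \<longlongrightarrow> f (Suc m) * (\<Sum>n. g (Suc n))) sequentially"
      by (rule Lim_transform_eventually)
  next
    show "\<forall>\<^sub>F (m, N) in sequentially \<times>\<^sub>F sequentially. norm (h m N) \<le> \<bar>f (Suc m)\<bar> * (\<Sum>n. \<bar>g (Suc n)\<bar>)"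
    proof (rule always_eventually, clarify)
      fix m N
      have "\<bar>f (Suc m)\<bar> * \<bar>G (N div Suc m)\<bar> \<le> \<bar>f (Suc m)\<bar> * (\<Sum>n. \<bar>g (Suc n)\<bar>)"
        by (intro mult_left_mono Gb) auto
      moreover have "0 \<le> (\<Sum>n. \<bar>g (Suc n)\<bar>)" using g by (intro suminf_nonneg) auto
      ultimately show "norm (h m N) \<le> \<bar>f (Suc m)\<bar> * (\<Sum>n. \<bar>g (Suc n)\<bar>)" by (simp add: h_def abs_mult)
    qed
  next
    show "summable (\<lambda>m. \<bar>f (Suc m)\<bar> * (\<Sum>n. \<bar>g (Suc n)\<bar>))" by (rule summable_mult2[OF f])
  qed simp
  also have "(\<Sum>m. f (Suc m) * (\<Sum>n. g (Suc n))) = (\<Sum>n. f (Suc n)) * (\<Sum>n. g (Suc n))"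
    using suminf_mult2[OF summable_rabs_cancel[OF f]] by simp
  finally show ?thesis unfolding sums_def eq .
qed

lemma summable_inverse_squares: "summable (\<lambda>n. 1 / (real (Suc n))\<^sup>2)"
  and summable_ln_over_squares: "summable (\<lambda>n. ln (real (Suc n)) / (real (Suc n))\<^sup>2)"
  by (rule sums_summable[OF zeta_series_deriv(2)], rule sums_summable[OF zeta_series_deriv(1)])

lemma zeta_series_2_pos: "zeta_series 2 > 0"
  unfolding zeta_series_2 by simp

text \<open>The values at 2 of 1 / zeta and of minus its derivative, obtained from convolution
  identities alone: mu convolved with 1 is the unit, and as ln is additive over n = d e, weighting
  by ln n gives 0.\<close>

lemma mu_sums:
  "(\<lambda>n. mu (Suc n) / (real (Suc n))\<^sup>2) sums (1 / zeta_series 2)"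
  "(\<lambda>n. mu (Suc n) * ln (real (Suc n)) / (real (Suc n))\<^sup>2) sums (deriv zeta_series 2 / (zeta_series 2)\<^sup>2)"
proof -
  define f where "f = (\<lambda>n. mu n / (real n)\<^sup>2)"
  define fl where "fl = (\<lambda>n. mu n * ln (real n) / (real n)\<^sup>2)"
  define g where "g = (\<lambda>n. 1 / (real n)\<^sup>2)"
  define gl where "gl = (\<lambda>n. ln (real n) / (real n)\<^sup>2)"
  have g: "summable (\<lambda>n. \<bar>g (Suc n)\<bar>)" using summable_inverse_squares by (simp add: g_def)
  have gl: "summable (\<lambda>n. \<bar>gl (Suc n)\<bar>)" using summable_ln_over_squares by (simp add: gl_def)
  have f: "summable (\<lambda>n. \<bar>f (Suc n)\<bar>)"
  proof (rule summable_comparison_test'[OF g])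
    fix n show "norm \<bar>f (Suc n)\<bar> \<le> \<bar>g (Suc n)\<bar>"
      using abs_mu_le[of "Suc n"] by (simp add: f_def g_def divide_right_mono)
  qed
  have fl: "summable (\<lambda>n. \<bar>fl (Suc n)\<bar>)"
  proof (rule summable_comparison_test'[OF gl])
    fix n show "norm \<bar>fl (Suc n)\<bar> \<le> \<bar>gl (Suc n)\<bar>"
      using mult_right_mono[OF abs_mu_le[of "Suc n"], of "ln (real (Suc n))"]
      by (simp add: fl_def gl_def divide_right_mono abs_mult del: of_nat_Suc)
  qed
  have G: "(\<Sum>n. g (Suc n)) = zeta_series 2" "(\<Sum>n. gl (Suc n)) = - deriv zeta_series 2"
    unfolding g_def gl_def using zeta_series_deriv by (simp_all add: sums_iff)
  have conv: "dconv f g n = (if n = 1 then 1 else 0)" if "n > 0" for n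
  proof -
    have "dconv f g n = (\<Sum>d | d dvd n. mu d * (1 / (real n)\<^sup>2))"
      unfolding dconv_def f_def g_def using that
      by (intro sum.cong refl) (auto elim!: dvdE simp: power_mult_distrib)
    also have "\<dots> = (\<Sum>d | d dvd n. mu d) * (1 / (real n)\<^sup>2)" by (simp only: sum_distrib_right)
    finally show ?thesis using sum_mu_divisors[OF that] by simp
  qed
  have conv': "dconv fl g n + dconv f gl n = 0" if "n > 0" for n
  proof -
    have "dconv fl g n + dconv f gl n = (\<Sum>d | d dvd n. mu d * (ln (real n) / (real n)\<^sup>2))"
      unfolding dconv_def f_def g_def fl_def gl_def sum.distrib[symmetric] using that
      by (intro sum.cong refl) (auto elim!: dvdE simp: power_mult_distrib ln_mult add_divide_distrib distrib_left)
    also have "\<dots> = (\<Sum>d | d dvd n. mu d) * (ln (real n) / (real n)\<^sup>2)" by (simp only: sum_distrib_right)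
    finally show ?thesis using sum_mu_divisors[OF that] by simp
  qed
  have z: "zeta_series 2 \<noteq> 0" using zeta_series_2_pos by simp
  have "(\<lambda>n. dconv f g (Suc n)) sums 1"
    using sums_If_finite[of "\<lambda>n. n = 0" "\<lambda>_. 1 :: real"] conv by simp
  then have 1: "(\<Sum>n. f (Suc n)) * zeta_series 2 = 1"
    using sums_dconv[OF f g] G sums_unique2 by metis
  then have F: "(\<Sum>n. f (Suc n)) = 1 / zeta_series 2" using z by (simp add: field_simps)
  have "(\<lambda>n. dconv fl g (Suc n) + dconv f gl (Suc n)) sums ((\<Sum>n. fl (Suc n)) * zeta_series 2 + (\<Sum>n. f (Suc n)) * (- deriv zeta_series 2))"
    using sums_add[OF sums_dconv[OF fl g] sums_dconv[OF f gl]] unfolding G .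
  moreover have "(\<lambda>n. dconv fl g (Suc n) + dconv f gl (Suc n)) sums 0" using conv' by simp
  ultimately have "(\<Sum>n. fl (Suc n)) * zeta_series 2 + (\<Sum>n. f (Suc n)) * (- deriv zeta_series 2) = 0"
    using sums_unique2 by blast
  then have FL: "(\<Sum>n. fl (Suc n)) = deriv zeta_series 2 / (zeta_series 2)\<^sup>2"
    using z unfolding F by (simp add: field_simps power2_eq_square)
  show "(\<lambda>n. mu (Suc n) / (real (Suc n))\<^sup>2) sums (1 / zeta_series 2)"
    using summable_sums[OF summable_rabs_cancel[OF f]] unfolding F by (simp add: f_def)
  show "(\<lambda>n. mu (Suc n) * ln (real (Suc n)) / (real (Suc n))\<^sup>2) sums (deriv zeta_series 2 / (zeta_series 2)\<^sup>2)"
    using summable_sums[OF summable_rabs_cancel[OF fl]] unfolding FL by (simp add: fl_def)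
qed

section \<open>Sieving for primitive elements and removing theta\<close>

definition prim_reps :: "nat \<Rightarrow> (int \<times> int) set" where
  "prim_reps n = {(x, y) \<in> eis_reps n. coprime x y}"

text \<open>Divisibility of x - y by 3 is divisibility of x + y rho by theta = 2 rho - 1, so these
  are the primitive elements not divisible by theta.\<close>

definition prim3_reps :: "nat \<Rightarrow> (int \<times> int) set" where
  "prim3_reps n = {(x, y) \<in> eis_reps n. coprime x y \<and> \<not> 3 dvd x - y}"

lemma finite_prim_reps [simp]: "finite (prim_reps n)" "finite (prim3_reps n)"
  by (rule finite_subset[OF _ finite_eis_reps[of n]]; auto simp: prim_reps_def prim3_reps_def)+

lemma card_eis_reps_multiples:
  assumes n: "n > 0" and d: "d > 0"
  shows "card {(x, y)\<in>eis_reps n. int d dvd x \<and> int d dvd y} = (if d\<^sup>2 dvd n then card (eis_reps (n div d\<^sup>2)) else 0)"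
proof (cases "d\<^sup>2 dvd n")
  case True
  then obtain m where m: "n = d\<^sup>2 * m" by (elim dvdE)
  have "{(x, y)\<in>eis_reps n. int d dvd x \<and> int d dvd y} = (\<lambda>(x, y). (int d * x, int d * y)) ` eis_reps m"
    using d by (auto simp: eis_reps_def m eis_norm_scale elim!: dvdE intro!: image_eqI)
  then show ?thesis using True d by (simp add: m card_image inj_on_def split_def prod_eq_iff)
next
  case False
  have "eis_norm (int d * u) (int d * v) \<noteq> int n" for u v
  proof
    assume "eis_norm (int d * u) (int d * v) = int n"
    then have "int n = int (d\<^sup>2) * eis_norm u v" by (simp add: eis_norm_scale)
    then have "d\<^sup>2 dvd n" by (metis dvd_triv_left int_dvd_int_iff)
    with False show False by simp
  qed
  then have e: "{(x, y)\<in>eis_reps n. int d dvd x \<and> int d dvd y} = {}"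
    by (auto simp: eis_reps_def elim!: dvdE)
  show ?thesis unfolding e using False by simp
qed

text \<open>Moebius inversion over the common divisors of x and y. The sum runs to a bound N
  independent of n, so that it can be exchanged with a summation over n.\<close>

lemma card_prim_reps:
  assumes n: "n > 0" and N: "n \<le> N"
  shows "real (card (prim_reps n)) = (\<Sum>d=1..N. if d\<^sup>2 dvd n then mu d * real (card (eis_reps (n div d\<^sup>2))) else 0)"
proof -
  have gcd: "(\<Sum>d=1..N. if int d dvd x \<and> int d dvd y then mu d else 0) = (if coprime x y then 1 else 0)"
    if xy: "(x, y) \<in> eis_reps n" for x y
  proof -
    define e where "e = nat (gcd x y)"
    have "eis_norm x y = int n" using xy by (simp add: eis_reps_def)
    then have xy0: "x \<noteq> 0 \<or> y \<noteq> 0" using n by (auto simp: eis_norm_def)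
    then have e0: "e > 0" by (simp add: e_def)
    have dvd_iff: "d dvd e \<longleftrightarrow> int d dvd x \<and> int d dvd y" for d
      unfolding e_def by (metis abs_gcd_int gcd_greatest_iff int_dvd_int_iff int_nat_eq nat_abs_dvd_iff abs_ge_zero gcd_ge_0_int of_nat_dvd_iff)
    have "int e dvd x" "int e dvd y" using dvd_iff[of e] by auto
    then obtain u v where "x = int e * u" "y = int e * v" by (elim dvdE)
    then have "int n = int e * (int e * eis_norm u v)" using \<open>eis_norm x y = int n\<close> by (simp add: eis_norm_scale power2_eq_square)
    then have "e dvd n" by (metis dvd_triv_left int_dvd_int_iff)
    then have "e \<le> N" using n N by (meson dvd_imp_le le_trans)
    have sub: "{d. d dvd e} \<subseteq> {1..N}" 
    proof
      fix d assume "d \<in> {d. d dvd e}"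
      then have "d \<le> e" "d \<noteq> 0" using e0 by (auto dest: dvd_imp_le)
      then show "d \<in> {1..N}" using \<open>e \<le> N\<close> by simp
    qed
    have "(\<Sum>d=1..N. if int d dvd x \<and> int d dvd y then mu d else 0) = (\<Sum>d\<in>{1..N} \<inter> {d. d dvd e}. mu d)"
      unfolding dvd_iff[symmetric] by (simp add: sum.inter_restrict)
    also have "{1..N} \<inter> {d. d dvd e} = {d. d dvd e}" using sub by blast
    also have "(\<Sum>d | d dvd e. mu d) = (if e = 1 then 1 else 0)" by (rule sum_mu_divisors[OF e0])
    also have "e = 1 \<longleftrightarrow> coprime x y" by (simp add: e_def coprime_iff_gcd_eq_1 nat_eq_iff)
    finally show ?thesis .
  qed
  have "real (card (prim_reps n)) = (\<Sum>(x,y)\<in>eis_reps n. if coprime x y then 1 else 0)"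
    by (simp add: prim_reps_def split_def sum.If_cases Int_def conj_commute)
  also have "\<dots> = (\<Sum>(x,y)\<in>eis_reps n. \<Sum>d=1..N. if int d dvd x \<and> int d dvd y then mu d else 0)"
    using gcd by (intro sum.cong refl) auto
  also have "\<dots> = (\<Sum>d=1..N. \<Sum>(x,y)\<in>eis_reps n. if int d dvd x \<and> int d dvd y then mu d else 0)"
    unfolding split_def by (rule sum.swap)
  also have "\<dots> = (\<Sum>d=1..N. mu d * real (card {(x, y)\<in>eis_reps n. int d dvd x \<and> int d dvd y}))"
    by (simp add: split_def sum.If_cases Int_def conj_commute mult.commute)
  also have "\<dots> = (\<Sum>d=1..N. if d\<^sup>2 dvd n then mu d * real (card (eis_reps (n div d\<^sup>2))) else 0)"
    using n by (intro sum.cong refl) (simp add: card_eis_reps_multiples)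
  finally show ?thesis .
qed

text \<open>A common divisor of the coordinates of theta (u + v rho) divides 3, and 3 itself would
  force theta to divide u + v rho.\<close>

lemma coprime_theta:
  assumes uv: "coprime u v" "\<not> 3 dvd u - v"
  shows "coprime (- u - 2 * v) (2 * u + v :: int)"
proof (rule coprimeI)
  fix c assume c: "c dvd - u - 2 * v" "c dvd 2 * u + v"
  have "3 * u = (- u - 2 * v) + 2 * (2 * u + v)" "3 * v = - (2 * (- u - 2 * v) + (2 * u + v))" by simp_all
  then have "c dvd 3 * u" "c dvd 3 * v" using c by (metis dvd_add dvd_mult dvd_minus_iff)+
  then have "c dvd gcd (3 * u) (3 * v)" by simp
  also have "gcd (3 * u) (3 * v) = 3" using uv(1) by (simp add: gcd_mult_left coprime_iff_gcd_eq_1)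
  finally have "c dvd 3" .
  show "is_unit c"
  proof (rule ccontr)
    assume nu: "\<not> is_unit c"
    have "prime (3 :: int)" by simp
    then have "3 dvd c" using \<open>c dvd 3\<close> nu by (metis dvd_def dvd_triv_right prime_elem_iff_irreducible prime_elem_iff_prime_abs irreducibleD' prime_imp_prime_elem)
    then have "3 dvd 2 * u + v" using c(2) by (rule dvd_trans)
    then have "3 dvd u - v" by presburger
    with uv show False by simp
  qed
qed

text \<open>Since theta^2 = - 3, a primitive element is divisible by theta at most once; dividing it
  out leaves a primitive element of norm n / 3 that theta does not divide.\<close>

lemma card_prim_reps_split:
  assumes n: "n > 0"
  shows "card (prim_reps n) = card (prim3_reps n) + (if 3 dvd n then card (prim3_reps (n div 3)) else 0)"
proof -
  define B where "B = {(x, y) \<in> prim_reps n. 3 dvd x - y}"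
  have un: "prim_reps n = prim3_reps n \<union> B" "prim3_reps n \<inter> B = {}"
    by (auto simp: prim_reps_def prim3_reps_def B_def)
  have finB: "finite B" by (rule finite_subset[OF _ finite_prim_reps(1)[of n]]) (auto simp: B_def)
  have "card (prim_reps n) = card (prim3_reps n) + card B"
    unfolding un(1) by (rule card_Un_disjoint) (use un finB in auto)
  moreover have "card B = (if 3 dvd n then card (prim3_reps (n div 3)) else 0)"
  proof (cases "3 dvd n")
    case False
    have "\<not> 3 dvd x - y" if "eis_norm x y = int n" for x y
    proof
      assume "3 dvd x - y"
      then have "3 dvd (x - y)\<^sup>2 + 3 * (x * y)" by (simp add: power2_eq_square)
      also have "(x - y)\<^sup>2 + 3 * (x * y) = int n" unfolding that[symmetric] eis_norm_def by (simp add: power2_eq_square algebra_simps)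
      finally have "3 dvd n" by presburger
      with False show False by simp
    qed
    then have "B = {}" by (auto simp: B_def prim_reps_def eis_reps_def)
    then show ?thesis using False by simp
  next
    case True
    then obtain m where m: "n = 3 * m" by (elim dvdE)
    define f :: "int \<times> int \<Rightarrow> int \<times> int" where "f = (\<lambda>(u, v). (- u - 2 * v, 2 * u + v))"
    have norm: "eis_norm (- u - 2 * v) (2 * u + v) = 3 * eis_norm u v" for u v
      by (simp add: eis_norm_def power2_eq_square algebra_simps)
    have "B = f ` prim3_reps m"
    proof (intro equalityI subsetI)
      fix z assume "z \<in> f ` prim3_reps m"
      then obtain u v where uv: "z = (- u - 2 * v, 2 * u + v)" "eis_norm u v = int m" "coprime u v" "\<not> 3 dvd u - v"
        by (auto simp: f_def prim3_reps_def eis_reps_def)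
      have "coprime (- u - 2 * v) (2 * u + v)" by (rule coprime_theta[OF uv(3,4)])
      moreover have "3 dvd (- u - 2 * v) - (2 * u + v)" by presburger
      ultimately show "z \<in> B" using uv norm[of u v] by (simp add: B_def prim_reps_def eis_reps_def m)
    next
      fix z assume "z \<in> B"
      then obtain x y where z: "z = (x, y)" "eis_norm x y = 3 * int m" "coprime x y" "3 dvd x - y"
        by (auto simp: B_def prim_reps_def eis_reps_def m)
      from z(4) obtain k where k: "x = y + 3 * k" by (metis add.commute diff_add_cancel dvdE)
      \<comment> \<open>The quotient of x + y rho by theta, for x = y + 3 k.\<close>
      define u v where "u = y + k" and "v = - y - 2 * k"
      have f: "x = - u - 2 * v" "y = 2 * u + v" by (simp_all add: u_def v_def k)
      have "coprime u v"
      proof (rule coprimeI)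
        fix c assume "c dvd u" "c dvd v"
        then have "c dvd x" "c dvd y" unfolding f by simp_all
        then show "is_unit c" using z(3) by (meson coprime_def)
      qed
      moreover have "\<not> 3 dvd u - v"
      proof
        assume *: "3 dvd u - v"
        have "3 dvd x" "3 dvd y" using * unfolding f by presburger+
        then have "is_unit (3 :: int)" using z(3) by (meson coprime_def)
        then show False by simp
      qed
      moreover have "eis_norm u v = int m" using z(2) norm[of u v] unfolding f by simp
      ultimately have "(u, v) \<in> prim3_reps m" by (simp add: prim3_reps_def eis_reps_def)
      moreover have "f (u, v) = z" by (simp add: f_def z(1) f)
      ultimately show "z \<in> f ` prim3_reps m" by blast
    qed
    moreover have "inj f" by (auto simp: inj_def f_def)
    ultimately show ?thesis using True by (simp add: m card_image inj_on_subset)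
  qed
  ultimately show ?thesis by simp
qed

lemma sum_multiples:
  assumes q: "q > 0"
  shows "(\<Sum>m=1..N. if q dvd m then F m else 0) = (\<Sum>k=1..N div q. F (q * k :: nat) :: real)"
proof -
  have "(\<Sum>m=1..N. if q dvd m then F m else 0) = (\<Sum>m\<in>{1..N} \<inter> {m. q dvd m}. F m)"
    by (simp add: sum.inter_restrict)
  also have "{1..N} \<inter> {m. q dvd m} = times q ` {1..N div q}"
  proof -
    have "q * k \<le> N \<longleftrightarrow> k \<le> N div q" for k using q by (simp add: less_eq_div_iff_mult_less_eq mult.commute)
    then show ?thesis using q by (auto elim!: dvdE simp: Suc_le_eq)
  qed
  also have "(\<Sum>m\<in>times q ` {1..N div q}. F m) = (\<Sum>k=1..N div q. F (q * k))"
    using q by (subst sum.reindex) (auto simp: inj_on_def)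
  finally show ?thesis .
qed

text \<open>Halved because z and - z belong to the same lattice.\<close>

definition prim_half :: "nat \<Rightarrow> real" where "prim_half n = real (card (prim_reps n)) / 2"
definition prim3_half :: "nat \<Rightarrow> real" where "prim3_half n = real (card (prim3_reps n)) / 2"

text \<open>The factor 3 is the number of units, halved for the sign.\<close>

lemma summatory_prim_conv:
  "summatory (dconv prim_half g) x =
     (\<Sum>d=1..nat \<lfloor>x\<rfloor>. mu d * (3 * summatory (dconv hex_ideals g) (x / real (d\<^sup>2))))"
proof -
  let ?N = "nat \<lfloor>x\<rfloor>"
  have half: "prim_half m = (\<Sum>d=1..?N. if d\<^sup>2 dvd m then mu d * (3 * hex_ideals (m div d\<^sup>2)) else 0)" if "m \<in> {1..?N}" for m
  proof -
    have "real (card (eis_reps (m div d\<^sup>2))) = 6 * hex_ideals (m div d\<^sup>2)" if dvd: "d\<^sup>2 dvd m" for d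
    proof (rule card_eis_reps)
      obtain k where k: "m = d\<^sup>2 * k" using dvd by (elim dvdE)
      moreover have "m \<noteq> 0" using \<open>m \<in> {1..?N}\<close> by simp
      ultimately have "d \<noteq> 0" "k \<noteq> 0" by auto
      then show "m div d\<^sup>2 > 0" unfolding k by simp
    qed
    then show ?thesis unfolding prim_half_def using that
      by (subst card_prim_reps[of _ ?N]) (auto simp: sum_divide_distrib intro!: sum.cong)
  qed
  have "summatory (dconv prim_half g) x = (\<Sum>m=1..?N. prim_half m * summatory g (x / real m))" by (rule summatory_dconv)
  also have "\<dots> = (\<Sum>m=1..?N. \<Sum>d=1..?N. if d\<^sup>2 dvd m then mu d * (3 * hex_ideals (m div d\<^sup>2)) * summatory g (x / real m) else 0)"
    by (intro sum.cong refl) (auto simp: half sum_distrib_right intro!: sum.cong)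
  also have "\<dots> = (\<Sum>d=1..?N. \<Sum>m=1..?N. if d\<^sup>2 dvd m then mu d * (3 * hex_ideals (m div d\<^sup>2)) * summatory g (x / real m) else 0)"
    by (rule sum.swap)
  also have "\<dots> = (\<Sum>d=1..?N. \<Sum>k=1..?N div d\<^sup>2. mu d * (3 * hex_ideals k) * summatory g (x / real (d\<^sup>2) / real k))"
  proof (rule sum.cong[OF refl])
    fix d assume "d \<in> {1..?N}"
    then have d: "d\<^sup>2 > 0" by simp
    have e: "x / real (d\<^sup>2 * k) = x / real (d\<^sup>2) / real k" "d\<^sup>2 * k div d\<^sup>2 = k" for k
      using d by (simp_all only: of_nat_mult divide_divide_eq_left nonzero_mult_div_cancel_left[OF less_imp_neq[OF d, symmetric]])
    show "(\<Sum>m=1..?N. if d\<^sup>2 dvd m then mu d * (3 * hex_ideals (m div d\<^sup>2)) * summatory g (x / real m) else 0) =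
       (\<Sum>k=1..?N div d\<^sup>2. mu d * (3 * hex_ideals k) * summatory g (x / real (d\<^sup>2) / real k))"
      using sum_multiples[OF d, of "\<lambda>m. mu d * (3 * hex_ideals (m div d\<^sup>2)) * summatory g (x / real m)" ?N] unfolding e .
  qed
  also have "\<dots> = (\<Sum>d=1..?N. mu d * (3 * summatory (dconv hex_ideals g) (x / real (d\<^sup>2))))"
    unfolding summatory_dconv nat_floor_divide_nat by (simp add: sum_distrib_left mult_ac)
  finally show ?thesis .
qed

text \<open>Recast as an infinite series, the form that \<open>asymptotics_dilation_series\<close>
  takes; the argument falls below 1 for large d, so almost all terms vanish.\<close>

lemma prim_half_dilation_sums:
  assumes x: "x > 0"
  shows "(\<lambda>d. mu (Suc d) * (3 * summatory (dconv hex_ideals g) (x / real ((Suc d)\<^sup>2)))) sums summatory (dconv prim_half g) x"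
proof -
  let ?N = "nat \<lfloor>x\<rfloor>"
  have "(\<lambda>d. mu (Suc d) * (3 * summatory (dconv hex_ideals g) (x / real ((Suc d)\<^sup>2)))) sums
     (\<Sum>d<?N. mu (Suc d) * (3 * summatory (dconv hex_ideals g) (x / real ((Suc d)\<^sup>2))))"
  proof (rule sums_finite)
    fix d assume "d \<notin> {..<?N}"
    then have "x < real (Suc d)" using x by auto linarith
    also have "\<dots> \<le> real ((Suc d)\<^sup>2)" unfolding of_nat_le_iff by (simp add: power2_eq_square)
    finally have "x / real ((Suc d)\<^sup>2) < 1" by (simp add: field_simps del: of_nat_Suc of_nat_power)
    then show "mu (Suc d) * (3 * summatory (dconv hex_ideals g) (x / real ((Suc d)\<^sup>2))) = 0" by simp
  qed simp
  also have "(\<Sum>d<?N. mu (Suc d) * (3 * summatory (dconv hex_ideals g) (x / real ((Suc d)\<^sup>2)))) = summatory (dconv prim_half g) x"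
    unfolding summatory_prim_conv by (rule sum.reindex_bij_witness[of _ "\<lambda>n. n - 1" Suc]) auto
  finally show ?thesis .
qed

lemma summatory_prim_half_split:
  "summatory (dconv prim_half g) x = summatory (dconv prim3_half g) x + summatory (dconv prim3_half g) (x / 3)"
proof -
  let ?N = "nat \<lfloor>x\<rfloor>"
  have "summatory (dconv prim_half g) x = (\<Sum>m=1..?N. prim3_half m * summatory g (x / real m) +
     (if 3 dvd m then prim3_half (m div 3) * summatory g (x / real m) else 0))"
    unfolding summatory_dconv
    by (intro sum.cong refl) (auto simp: prim_half_def prim3_half_def card_prim_reps_split field_simps)
  also have "\<dots> = (\<Sum>m=1..?N. prim3_half m * summatory g (x / real m)) +
      (\<Sum>k=1..?N div 3. prim3_half k * summatory g (x / real (3 * k)))"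
    unfolding sum.distrib using sum_multiples[of 3 "\<lambda>m. prim3_half (m div 3) * summatory g (x / real m)" ?N] by simp
  also have "\<dots> = summatory (dconv prim3_half g) x + summatory (dconv prim3_half g) (x / 3)"
    using nat_floor_divide_nat[of x 3] unfolding summatory_dconv by (simp add: field_simps)
  finally show ?thesis .
qed

text \<open>Solving S(x) + S(x / 3) = T(x) for S gives an alternating series, which is finite
  because S vanishes below 1.\<close>

lemma prim3_half_dilation_sums:
  assumes x: "x > 0"
  shows "(\<lambda>k. (-1) ^ k * summatory (dconv prim_half g) (x / 3 ^ k)) sums summatory (dconv prim3_half g) x"
proof -
  define S where "S = summatory (dconv prim3_half g)"
  have part: "(\<Sum>k<K. (-1) ^ k * summatory (dconv prim_half g) (x / 3 ^ k)) = S x - (-1) ^ K * S (x / 3 ^ K)" for K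
    by (induction K) (simp_all add: S_def summatory_prim_half_split[of g "x / 3 ^ _"] algebra_simps)
  have "eventually (\<lambda>K. x / 3 ^ K < 1) sequentially"
  proof -
    have "(\<lambda>K. x / 3 ^ K) \<longlonglongrightarrow> 0" by real_asymp
    then show ?thesis by (rule order_tendstoD) simp
  qed
  then have "eventually (\<lambda>K. S x = (\<Sum>k<K. (-1) ^ k * summatory (dconv prim_half g) (x / 3 ^ k))) sequentially"
    by eventually_elim (simp add: part, simp add: S_def)
  then show ?thesis unfolding sums_def S_def[symmetric] by (rule Lim_transform_eventually[OF tendsto_const])
qed

section \<open>Sublattices of the hexagonal lattice\<close>

definition eis :: "int \<Rightarrow> int \<Rightarrow> complex" where
  "eis a b = of_int a + of_int b * hex_rho"

text \<open>Twice the real inner product, so that it is an integer.\<close>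

definition eis_form :: "int \<Rightarrow> int \<Rightarrow> int \<Rightarrow> int \<Rightarrow> int" where
  "eis_form a b c d = 2 * a * c + a * d + b * c + 2 * b * d"

definition lat :: "complex \<Rightarrow> complex \<Rightarrow> complex set" where
  "lat v w = {of_int m * v + of_int k * w | m k :: int. True}"

lemma Re_eis: "Re (eis a b) = real_of_int a + real_of_int b / 2"
  and Im_eis: "Im (eis a b) = real_of_int b * sqrt 3 / 2"
  by (simp_all add: eis_def hex_rho_def)

lemma eis_eq_iff [simp]: "eis a b = eis c d \<longleftrightarrow> a = c \<and> b = d"
  by (auto simp: complex_eq_iff Re_eis Im_eis)

lemma eis_add: "eis a b + eis c d = eis (a + c) (b + d)"
  and eis_diff: "eis a b - eis c d = eis (a - c) (b - d)"
  and eis_uminus: "- eis a b = eis (- a) (- b)"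
  and eis_scale: "of_int m * eis a b = eis (m * a) (m * b)"
  and eis_0: "eis 0 0 = 0"
  by (simp_all add: eis_def algebra_simps)

lemma hex_rho_square: "hex_rho * hex_rho = hex_rho - 1"
  by (simp add: hex_rho_def complex_eq_iff)

lemma eis_mult: "eis a b * eis c d = eis (a * c - b * d) (a * d + b * c + b * d)"
proof -
  have "eis a b * eis c d = of_int (a * c) + of_int (a * d + b * c) * hex_rho + of_int (b * d) * (hex_rho * hex_rho)"
    by (simp add: eis_def algebra_simps)
  then show ?thesis unfolding hex_rho_square by (simp add: eis_def algebra_simps)
qed

lemma hex_lattice_conv_eis: "hex_lattice = {eis a b | a b. True}"
  by (simp add: hex_lattice_def eis_def)

lemma norm_square_eis: "(norm (eis a b))\<^sup>2 = of_int (eis_norm a b)"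
  unfolding cmod_power2 Re_eis Im_eis by (simp add: eis_norm_def power2_eq_square field_simps)

lemma norm_square_comb:
  fixes v w :: complex
  shows "(norm (of_real s * v + of_real t * w))\<^sup>2 = s\<^sup>2 * (norm v)\<^sup>2 + t\<^sup>2 * (norm w)\<^sup>2 + 2 * s * t * inner v w"
  unfolding cmod_power2 inner_complex_def by (simp add: power2_eq_square algebra_simps)

lemma inner_eis: "2 * inner (eis a b) (eis c d) = of_int (eis_form a b c d)"
  by (simp add: inner_complex_def Re_eis Im_eis eis_form_def field_simps)

text \<open>Four times the Gram determinant of two lattice vectors; the hexagonal lattice has
  squared covolume 3 / 4.\<close>

lemma eis_form_identity: "4 * eis_norm a b * eis_norm c d - (eis_form a b c d)\<^sup>2 = 3 * (a * d - b * c)\<^sup>2"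
  by (simp add: eis_norm_def eis_form_def power2_eq_square algebra_simps)

lemma lat_swap: "lat w v = lat v w"
proof -
  have "lat w v \<subseteq> lat v w" for v w
  proof
    fix u assume "u \<in> lat w v"
    then obtain m k where "u = of_int m * w + of_int k * v" by (auto simp: lat_def)
    then have "u = of_int k * v + of_int m * w" by simp
    then show "u \<in> lat v w" unfolding lat_def by blast
  qed
  then show ?thesis by blast
qed

lemma lat_uminus: "lat v (- w) = lat v w"
proof -
  have "lat v (- w) \<subseteq> lat v w" for v w
  proof
    fix u assume "u \<in> lat v (- w)"
    then obtain m k where "u = of_int m * v + of_int k * (- w)" by (auto simp: lat_def)
    then have "u = of_int m * v + of_int (- k) * w" by simp
    then show "u \<in> lat v w" unfolding lat_def by blast
  qed
  from this[of v w] this[of v "- w"] show ?thesis by auto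
qed

lemma lat_memI: "of_int m * v + of_int k * w \<in> lat v w"
  unfolding lat_def by blast

lemma lat_basis: "v \<in> lat v w" "w \<in> lat v w"
  using lat_memI[of 1 v 0 w] lat_memI[of 0 v 1 w] by simp_all

section \<open>Sublattices as subgroups and their index\<close>

lemma additive_group_group: "group (additive_group hex_lattice)"
proof (rule groupI)
  fix x assume "x \<in> carrier (additive_group hex_lattice)"
  then obtain a b where x: "x = eis a b" by (auto simp: additive_group_def hex_lattice_conv_eis)
  have "eis (- a) (- b) \<in> hex_lattice" by (auto simp: hex_lattice_conv_eis)
  moreover have "eis (- a) (- b) + x = 0" by (simp add: x eis_add eis_0)
  ultimately show "\<exists>y\<in>carrier (additive_group hex_lattice). y \<otimes>\<^bsub>additive_group hex_lattice\<^esub> x = \<one>\<^bsub>additive_group hex_lattice\<^esub>"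
    by (auto simp: additive_group_def)
next
  have "eis 0 0 \<in> hex_lattice" unfolding hex_lattice_conv_eis by blast
  then show "\<one>\<^bsub>additive_group hex_lattice\<^esub> \<in> carrier (additive_group hex_lattice)"
    by (simp add: additive_group_def eis_0)
qed (auto simp: additive_group_def hex_lattice_conv_eis eis_add add.assoc)

lemma additive_group_inv:
  assumes "x \<in> hex_lattice"
  shows "inv\<^bsub>additive_group hex_lattice\<^esub> x = - x"
proof -
  interpret group "additive_group hex_lattice" by (rule additive_group_group)
  have "- x \<in> hex_lattice" using assms by (auto simp: hex_lattice_conv_eis eis_uminus)
  then show ?thesis using assms by (intro inv_equality) (auto simp: additive_group_def)
qed

lemma subgroup_additive_iff:
  "subgroup L (additive_group hex_lattice) \<longleftrightarrow>
     L \<subseteq> hex_lattice \<and> 0 \<in> L \<and> (\<forall>x\<in>L. \<forall>y\<in>L. x + y \<in> L) \<and> (\<forall>x\<in>L. - x \<in> L)" (is "?l \<longleftrightarrow> ?r")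
proof
  assume l: ?l
  then interpret subgroup L "additive_group hex_lattice" .
  have "L \<subseteq> hex_lattice" using subset by (simp add: additive_group_def)
  moreover have "- x \<in> L" if "x \<in> L" for x
    using m_inv_closed[OF that] additive_group_inv[of x] that \<open>L \<subseteq> hex_lattice\<close> by (metis subsetD)
  moreover have "x + y \<in> L" if "x \<in> L" "y \<in> L" for x y
    using m_closed[OF that] by (simp add: additive_group_def)
  moreover have "0 \<in> L" using one_closed by (simp add: additive_group_def)
  ultimately show ?r by blast
next
  assume r: ?r
  show ?l
  proof
    fix x assume "x \<in> L"
    then show "inv\<^bsub>additive_group hex_lattice\<^esub> x \<in> L" using r additive_group_inv[of x] by auto
  qed (use r in \<open>auto simp: additive_group_def\<close>)
qed

lemma rcos_eq_iff:
  assumes L: "0 \<in> L" "\<And>x y. x \<in> L \<Longrightarrow> y \<in> L \<Longrightarrow> x + y \<in> L" "\<And>x. x \<in> L \<Longrightarrow> - x \<in> L"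
  shows "L #>\<^bsub>additive_group \<Lambda>\<^esub> x = L #>\<^bsub>additive_group \<Lambda>\<^esub> y \<longleftrightarrow> x - y \<in> L"
proof -
  have r: "L #>\<^bsub>additive_group \<Lambda>\<^esub> x = (\<lambda>h. h + x) ` L" for x
    by (auto simp: r_coset_def additive_group_def)
  have sub: "(\<lambda>h. h + x) ` L \<subseteq> (\<lambda>h. h + y) ` L" if "x - y \<in> L" for x y
  proof
    fix u assume "u \<in> (\<lambda>h. h + x) ` L"
    then obtain h where h: "h \<in> L" "u = h + x" by blast
    have "u = (h + (x - y)) + y" using h by simp
    then show "u \<in> (\<lambda>h. h + y) ` L" using L(2)[OF h(1) that] by blast
  qed
  show ?thesis unfolding r
  proof
    assume "(\<lambda>h. h + x) ` L = (\<lambda>h. h + y) ` L"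
    moreover have "0 + x \<in> (\<lambda>h. h + x) ` L" using L(1) by (rule imageI)
    ultimately obtain h where "h \<in> L" "0 + x = h + y" by auto
    then show "x - y \<in> L" by (simp add: algebra_simps)
  next
    assume *: "x - y \<in> L"
    have "y - x \<in> L" using L(3)[OF *] by simp
    then show "(\<lambda>h. h + x) ` L = (\<lambda>h. h + y) ` L" using sub[OF *] sub[of y x] by blast
  qed
qed

lemma lat_closed:
  "0 \<in> lat v w" "x \<in> lat v w \<Longrightarrow> y \<in> lat v w \<Longrightarrow> x + y \<in> lat v w" "x \<in> lat v w \<Longrightarrow> - x \<in> lat v w"
proof -
  show "0 \<in> lat v w" using lat_memI[of 0 v 0 w] by simp
  show "x + y \<in> lat v w" if xy: "x \<in> lat v w" "y \<in> lat v w"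
  proof -
    obtain m k m' k' where "x = of_int m * v + of_int k * w" "y = of_int m' * v + of_int k' * w"
      using xy by (auto simp: lat_def)
    then have "x + y = of_int (m + m') * v + of_int (k + k') * w" by (simp add: algebra_simps)
    then show ?thesis by (simp only: lat_memI)
  qed
  show "- x \<in> lat v w" if x: "x \<in> lat v w"
  proof -
    obtain m k where "x = of_int m * v + of_int k * w" using x by (auto simp: lat_def)
    then have "- x = of_int (- m) * v + of_int (- k) * w" by (simp add: algebra_simps)
    then show ?thesis by (simp only: lat_memI)
  qed
qed

lemma lat_eis_sublattice: "subgroup (lat (eis a b) (eis c d)) (additive_group hex_lattice)"
proof -
  have "lat (eis a b) (eis c d) \<subseteq> hex_lattice"
    by (auto simp: lat_def hex_lattice_conv_eis eis_scale eis_add)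
  then show ?thesis unfolding subgroup_additive_iff using lat_closed by blast
qed

text \<open>Hermite normal form: Bezout coefficients of b and d complete to a unimodular change of
  basis, after which one basis vector is the real number D'.\<close>

lemma lat_hermite_form:
  assumes D: "a * d - b * c \<noteq> 0"
  obtains g D' e where "g > 0" "a * d - b * c = g * D'"
    "lat (eis a b) (eis c d) = {eis (t * D' + u * e) (u * g) | t u. True}"
proof -
  define g where "g = gcd b d"
  have g0: "g > 0" using D by (auto simp: g_def)
  obtain b' d' where bd: "b = g * b'" "d = g * d'" unfolding g_def by (metis dvdE gcd_dvd1 gcd_dvd2)
  obtain x y where "x * b + y * d = g" unfolding g_def by (metis bezout_int)
  then have "g * (x * b' + y * d') = g * 1" by (simp add: bd algebra_simps)
  then have bez: "x * b' + y * d' = 1" using g0 by simp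
  define D' where "D' = a * d' - b' * c"
  define e where "e = x * a + y * c"
  have "lat (eis a b) (eis c d) = {eis (t * D' + u * e) (u * g) | t u. True}"
  proof (intro equalityI subsetI)
    fix z assume "z \<in> lat (eis a b) (eis c d)"
    then obtain m k where z: "z = eis (m * a + k * c) (m * b + k * d)" by (auto simp: lat_def eis_scale eis_add)
    have "(y * m - k * x) * D' + (m * b' + k * d') * e = (m * a + k * c) * (x * b' + y * d')"
      by (simp add: D'_def e_def algebra_simps)
    then have "z = eis ((y * m - k * x) * D' + (m * b' + k * d') * e) ((m * b' + k * d') * g)"
      unfolding z bez by (simp add: bd algebra_simps)
    then show "z \<in> {eis (t * D' + u * e) (u * g) | t u. True}" by blast
  next
    fix z assume "z \<in> {eis (t * D' + u * e) (u * g) | t u. True}"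
    then obtain t u where z: "z = eis (t * D' + u * e) (u * g)" by blast
    have "(d' * t + x * u) * b + (- b' * t + y * u) * d = u * g * (x * b' + y * d')"
      by (simp add: bd algebra_simps)
    then have "z = eis ((d' * t + x * u) * a + (- b' * t + y * u) * c) ((d' * t + x * u) * b + (- b' * t + y * u) * d)"
      unfolding z bez by (simp add: D'_def e_def algebra_simps)
    then have "z = of_int (d' * t + x * u) * eis a b + of_int (- b' * t + y * u) * eis c d"
      by (simp only: eis_scale eis_add)
    then show "z \<in> lat (eis a b) (eis c d)" by (simp only: lat_memI)
  qed
  moreover have "a * d - b * c = g * D'" by (simp add: bd D'_def algebra_simps)
  ultimately show ?thesis using g0 that by blast
qed

text \<open>In Hermite form the points i + j rho with 0 \<le> i < |D'| and 0 \<le> j < g represent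
  every coset exactly once.\<close>

lemma lat_index:
  assumes D: "a * d - b * c \<noteq> 0"
  shows "is_sublattice_of_index (lat (eis a b) (eis c d)) hex_lattice (nat \<bar>a * d - b * c\<bar>)"
proof -
  define L where "L = lat (eis a b) (eis c d)"
  obtain g D' e where g: "g > 0" "a * d - b * c = g * D'"
    and L: "L = {eis (t * D' + u * e) (u * g) | t u. True}"
    using lat_hermite_form[OF D] unfolding L_def by blast
  have D': "D' \<noteq> 0" using g D by auto
  define A where "A = \<bar>D'\<bar>"
  have A: "A > 0" using D' by (simp add: A_def)
  define cos where "cos = (\<lambda>x. L #>\<^bsub>additive_group hex_lattice\<^esub> x)"
  have cos_eq: "cos x = cos y \<longleftrightarrow> x - y \<in> L" for x y
    unfolding cos_def by (rule rcos_eq_iff) (use lat_closed in \<open>auto simp: L_def\<close>)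
  have mem: "eis r s \<in> L \<longleftrightarrow> (\<exists>t u. r = t * D' + u * e \<and> s = u * g)" for r s
    unfolding L by auto
  define f where "f = (\<lambda>(i, j). cos (eis i j))"
  have "inj_on f ({0..<A} \<times> {0..<g})"
  proof (rule inj_onI, clarify)
    fix i j i' j' assume ij: "i \<in> {0..<A}" "j \<in> {0..<g}" "i' \<in> {0..<A}" "j' \<in> {0..<g}" "f (i, j) = f (i', j')"
    then have "eis (i - i') (j - j') \<in> L" by (simp add: f_def cos_eq eis_diff)
    then obtain t u where tu: "i - i' = t * D' + u * e" "j - j' = u * g" unfolding mem by blast
    have "g dvd j - j'" using tu by simp
    moreover have "\<bar>j - j'\<bar> < g" using ij by auto
    ultimately have j: "j - j' = 0" using dvd_imp_le_int[of "j - j'" g] by fastforce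
    then have "u = 0" using tu g by simp
    then have "A dvd i - i'" using tu by (simp add: A_def)
    moreover have "\<bar>i - i'\<bar> < A" using ij by auto
    ultimately have "i - i' = 0" using dvd_imp_le_int[of "i - i'" A] by fastforce
    then show "i = i' \<and> j = j'" using j by simp
  qed
  moreover have "rcosets\<^bsub>additive_group hex_lattice\<^esub> L = f ` ({0..<A} \<times> {0..<g})"
  proof -
    have "rcosets\<^bsub>additive_group hex_lattice\<^esub> L = cos ` hex_lattice"
      by (auto simp: RCOSETS_def cos_def additive_group_def)
    also have "\<dots> = f ` ({0..<A} \<times> {0..<g})"
    proof (intro equalityI subsetI)
      fix C assume "C \<in> cos ` hex_lattice"
      then obtain r s where C: "C = cos (eis r s)" by (auto simp: hex_lattice_conv_eis)
      define u where "u = s div g"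
      define i where "i = (r - u * e) mod A"
      have "A dvd (r - u * e) - i" unfolding i_def by simp
      then obtain t where t: "(r - u * e) - i = t * D'"
        unfolding A_def abs_dvd_iff by (metis dvdE mult.commute)
      have s: "s = u * g + s mod g" unfolding u_def by simp
      have "eis r s - eis i (s mod g) \<in> L"
        unfolding eis_diff mem using t s by (intro exI[of _ t] exI[of _ u]) (simp add: algebra_simps)
      then have "C = f (i, s mod g)" unfolding C f_def by (simp add: cos_eq)
      moreover have "i \<in> {0..<A}" "s mod g \<in> {0..<g}" using A g by (auto simp: i_def)
      ultimately show "C \<in> f ` ({0..<A} \<times> {0..<g})" by blast
    qed (auto simp: f_def hex_lattice_conv_eis)
    finally show ?thesis .
  qed
  ultimately have "finite (rcosets\<^bsub>additive_group hex_lattice\<^esub> L)"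
      "card (rcosets\<^bsub>additive_group hex_lattice\<^esub> L) = nat A * nat g"
    by (simp_all add: card_image)
  moreover have "nat A * nat g = nat \<bar>a * d - b * c\<bar>"
    using A g by (simp add: A_def abs_mult nat_mult_distrib mult.commute)
  ultimately show ?thesis
    using lat_eis_sublattice unfolding is_sublattice_of_index_def L_def by simp
qed

section \<open>Bases of minimal vectors\<close>

lemma complex_basis:
  assumes "Re v * Im w - Im v * Re w \<noteq> 0"
  obtains s t where "u = of_real s * v + of_real t * w"
proof
  let ?D = "Re v * Im w - Im v * Re w"
  show "u = of_real ((Re u * Im w - Im u * Re w) / ?D) * v + of_real ((Re v * Im u - Im v * Re u) / ?D) * w"
    using assms by (simp add: complex_eq_iff add_divide_distrib[symmetric] nonzero_eq_divide_eq) (simp add: algebra_simps)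
qed

lemma lagrange_complex: "(Re v * Im w - Im v * Re w)\<^sup>2 + (inner v w)\<^sup>2 = (norm v)\<^sup>2 * (norm w)\<^sup>2"
  unfolding cmod_power2 inner_complex_def by (simp add: power2_eq_square algebra_simps)

lemma round_real_bounds: "\<bar>s - real_of_int (round s)\<bar> \<le> 1 / 2"
  using of_int_round_abs_le[of s] by (simp add: abs_minus_commute)

text \<open>Two non-parallel minimal vectors v, w generate the lattice: rounding the coordinates of
  a lattice vector leaves a remainder of squared length at most 3 r / 4, which minimality makes 0.
  The upper bound on the form is minimality applied to v - w.\<close>

lemma well_rounded_obtain_basis:
  assumes L: "subgroup L (additive_group hex_lattice)" and wr: "well_rounded L"
  obtains a b c d where "L = lat (eis a b) (eis c d)" "eis_norm a b = eis_norm c d" "eis_norm a b > 0"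
    "0 \<le> eis_form a b c d" "eis_form a b c d \<le> eis_norm a b"
proof -
  have Lsub: "L \<subseteq> hex_lattice" and L0: "0 \<in> L" and Ladd: "\<And>x y. x \<in> L \<Longrightarrow> y \<in> L \<Longrightarrow> x + y \<in> L"
    and Lneg: "\<And>x. x \<in> L \<Longrightarrow> - x \<in> L"
    using L unfolding subgroup_additive_iff by auto
  have Lint: "of_int m * x \<in> L" if x: "x \<in> L" for m x
  proof -
    have nat: "of_nat n * x \<in> L" for n
      by (induction n) (use x L0 Ladd in \<open>auto simp: algebra_simps\<close>)
    show ?thesis
    proof (cases "m \<ge> 0")
      case True
      then show ?thesis using nat[of "nat m"] by simp
    next
      case False
      then have "of_int m * x = - (of_nat (nat (- m)) * x)" by simp
      then show ?thesis using Lneg[OF nat] by simp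
    qed
  qed
  have sp: "span (minimal_vectors L) = UNIV" using wr by (simp add: well_rounded_def)
  have "minimal_vectors L \<noteq> {}"
  proof
    assume "minimal_vectors L = {}"
    then have "(UNIV :: complex set) = {0}" using sp by simp
    then have "(1 :: complex) \<in> {0}" by blast
    then show False by simp
  qed
  then obtain v where v: "v \<in> minimal_vectors L" by blast
  have v0: "v \<noteq> 0" and vL: "v \<in> L" and vmin: "\<And>u. u \<in> L \<Longrightarrow> u \<noteq> 0 \<Longrightarrow> norm v \<le> norm u"
    using v by (auto simp: minimal_vectors_def)
  have "\<not> minimal_vectors L \<subseteq> {v, - v}"
  proof
    assume "minimal_vectors L \<subseteq> {v, - v}"
    also have "\<dots> \<subseteq> span {v}" by (auto intro: span_base span_neg)
    finally have "span (minimal_vectors L) \<subseteq> span {v}" by (intro span_minimal) auto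
    \<comment> \<open>If all minimal vectors lay on the line through v, the orthogonal vector i v
      could not be spanned.\<close>
    then have "\<i> * v \<in> span {v}" using sp by auto
    then obtain k where "\<i> * v = k *\<^sub>R v" by (auto simp: span_singleton)
    then have "(\<i> - of_real k) * v = 0" by (simp add: scaleR_conv_of_real algebra_simps)
    then have "\<i> = complex_of_real k" using v0 by simp
    then show False by (simp add: complex_eq_iff)
  qed
  then obtain w0 where w0: "w0 \<in> minimal_vectors L" "w0 \<noteq> v" "w0 \<noteq> - v" by blast
  have w0L: "w0 \<in> L" and nw0: "norm w0 = norm v"
    using w0(1) v by (auto simp: minimal_vectors_def intro!: antisym)
  \<comment> \<open>The sign makes the angle with v at most a right angle, so v - w is the shorter
    diagonal.\<close>
  define w where "w = (if inner v w0 \<ge> 0 then w0 else - w0)"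
  have w: "w \<in> L" "norm w = norm v" "w \<noteq> v" "w \<noteq> - v" "inner v w \<ge> 0"
    using w0 w0L nw0 Lneg by (auto simp: w_def)
  define r where "r = (norm v)\<^sup>2"
  have r0: "r > 0" using v0 by (simp add: r_def)
  have "v + - w \<in> L" using vL w Lneg Ladd by blast
  then have "norm v \<le> norm (v - w)" using vmin[of "v - w"] w by simp
  then have "r \<le> (norm (v - w))\<^sup>2" unfolding r_def by (intro power_mono) auto
  also have "\<dots> = 2 * r - 2 * inner v w"
    using norm_square_comb[of 1 v "-1" w] w(2) by (simp add: r_def)
  finally have inner_le: "2 * inner v w \<le> r" by simp
  have "(inner v w)\<^sup>2 < r\<^sup>2"
    using w(5) inner_le r0 by (intro power_strict_mono) auto
  then have det: "Re v * Im w - Im v * Re w \<noteq> 0"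
    using lagrange_complex[of v w] w(2) by (auto simp: r_def power2_eq_square)
  have "L = lat v w"
  proof (intro equalityI subsetI)
    fix u assume "u \<in> lat v w"
    then show "u \<in> L" using Lint vL w(1) Ladd by (auto simp: lat_def)
  next
    fix u assume u: "u \<in> L"
    obtain s t where st: "u = of_real s * v + of_real t * w" using complex_basis[OF det] .
    define u' where "u' = u + - (of_int (round s) * v + of_int (round t) * w)"
    have u'L: "u' \<in> L" unfolding u'_def using u Lint[OF vL] Lint[OF w(1)] Ladd Lneg by blast
    define x y where "x = s - of_int (round s)" and "y = t - of_int (round t)"
    have xy: "\<bar>x\<bar> \<le> 1 / 2" "\<bar>y\<bar> \<le> 1 / 2" unfolding x_def y_def by (rule round_real_bounds)+
    have "u' = of_real x * v + of_real y * w" by (simp add: u'_def st x_def y_def algebra_simps)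
    then have "(norm u')\<^sup>2 = x\<^sup>2 * r + y\<^sup>2 * r + 2 * x * y * inner v w"
      using norm_square_comb[of x v y w] w(2) by (simp add: r_def)
    also have "\<dots> \<le> 1 / 4 * r + 1 / 4 * r + 1 / 4 * r"
    proof (intro add_mono mult_right_mono)
      show "x\<^sup>2 \<le> 1 / 4" "y\<^sup>2 \<le> 1 / 4" using xy abs_le_square_iff[of x "1/2"] abs_le_square_iff[of y "1/2"] by (simp_all add: power2_eq_square)
      have "x * y \<le> \<bar>x\<bar> * \<bar>y\<bar>" by (metis abs_ge_self abs_mult)
      also have "\<dots> \<le> 1 / 2 * (1 / 2)" using xy by (intro mult_mono) auto
      finally have "x * y * (2 * inner v w) \<le> 1 / 4 * r" using w(5) inner_le r0
        by (intro order.trans[OF mult_right_mono[of "x * y" "1/4"] mult_left_mono]) auto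
      then show "2 * x * y * inner v w \<le> 1 / 4 * r" by (simp add: mult_ac)
    qed (use r0 in auto)
    also have "\<dots> < r" using r0 by simp
    finally have "norm u' < norm v" unfolding r_def using power2_less_imp_less norm_ge_zero by blast
    then have "u' = 0" using vmin[OF u'L] by force
    then have "u = of_int (round s) * v + of_int (round t) * w"
      unfolding u'_def diff_conv_add_uminus[symmetric] right_minus_eq .
    then show "u \<in> lat v w" by (simp only: lat_memI)
  qed
  moreover obtain a b where ab: "v = eis a b" using vL Lsub by (auto simp: hex_lattice_conv_eis)
  moreover obtain c d where cd: "w = eis c d" using w(1) Lsub by (auto simp: hex_lattice_conv_eis)
  moreover have rN: "r = of_int (eis_norm a b)" unfolding r_def ab by (rule norm_square_eis)
  moreover have "r = of_int (eis_norm c d)" unfolding r_def w(2)[symmetric] cd by (rule norm_square_eis)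
  moreover have "0 \<le> eis_form a b c d" "eis_form a b c d \<le> eis_norm a b"
    using w(5) inner_le inner_eis[of a b c d] rN unfolding ab cd by auto
  ultimately show ?thesis using that[of a b c d] r0 by simp
qed

lemma comb_norm_square:
  assumes "eis_norm c d = eis_norm a b"
  shows "(norm (of_int m * eis a b + of_int k * eis c d))\<^sup>2 = of_int ((m\<^sup>2 + k\<^sup>2) * eis_norm a b + m * k * eis_form a b c d)"
proof -
  have "(norm (of_int m * eis a b + of_int k * eis c d))\<^sup>2 =
     (real_of_int m)\<^sup>2 * of_int (eis_norm a b) + (real_of_int k)\<^sup>2 * of_int (eis_norm c d) + real_of_int m * real_of_int k * (2 * inner (eis a b) (eis c d))"
    using norm_square_comb[of "of_int m" "eis a b" "of_int k" "eis c d"] by (simp add: norm_square_eis)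
  then show ?thesis unfolding inner_eis assms by (simp add: algebra_simps)
qed

text \<open>Everything rests on m^2 + k^2 \<ge> 1 + |m k| for integers that are not both 0.\<close>

lemma int_form_ge:
  fixes m k r B :: int
  assumes "\<bar>B\<bar> \<le> r" "m \<noteq> 0 \<or> k \<noteq> 0"
  shows "(m\<^sup>2 + k\<^sup>2) * r + m * k * B \<ge> r" "\<bar>B\<bar> < r \<Longrightarrow> m \<noteq> 0 \<Longrightarrow> k \<noteq> 0 \<Longrightarrow> (m\<^sup>2 + k\<^sup>2) * r + m * k * B > r"
proof -
  have mk: "m\<^sup>2 + k\<^sup>2 \<ge> 1 + \<bar>m * k\<bar>"
  proof -
    have sq: "(\<bar>m\<bar> - \<bar>k\<bar>)\<^sup>2 \<ge> 0" by simp
    have e: "m\<^sup>2 + k\<^sup>2 = (\<bar>m\<bar> - \<bar>k\<bar>)\<^sup>2 + 2 * \<bar>m * k\<bar>" by (simp add: power2_eq_square algebra_simps abs_mult)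
    show ?thesis
    proof (cases "m * k = 0")
      case True
      then have "m\<^sup>2 + k\<^sup>2 > 0" using assms(2) by (auto simp: sum_power2_gt_zero_iff)
      moreover have "\<bar>m * k\<bar> = 0" using True by simp
      ultimately show ?thesis by linarith
    next
      case False
      then have "\<bar>m * k\<bar> \<ge> 1" by linarith
      then show ?thesis using e sq by linarith
    qed
  qed
  have lo: "- (m * k * B) \<le> \<bar>m * k\<bar> * \<bar>B\<bar>" by (metis abs_ge_minus_self abs_mult)
  moreover have "\<bar>m * k\<bar> * \<bar>B\<bar> \<le> \<bar>m * k\<bar> * r" using assms by (intro mult_left_mono) auto
  moreover have up: "(1 + \<bar>m * k\<bar>) * r \<le> (m\<^sup>2 + k\<^sup>2) * r" using mk assms(1) by (intro mult_right_mono) auto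
  moreover have e: "(1 + \<bar>m * k\<bar>) * r = r + \<bar>m * k\<bar> * r" by (simp add: distrib_right)
  ultimately show "(m\<^sup>2 + k\<^sup>2) * r + m * k * B \<ge> r" by linarith
  assume "\<bar>B\<bar> < r" "m \<noteq> 0" "k \<noteq> 0"
  then have "\<bar>m * k\<bar> * \<bar>B\<bar> < \<bar>m * k\<bar> * r" by (intro mult_strict_left_mono) auto
  then show "(m\<^sup>2 + k\<^sup>2) * r + m * k * B > r" using lo up e by linarith
qed

text \<open>For dependent vectors of equal norm r the Gram identity would make the form equal to 2 r
  in absolute value.\<close>

lemma lat_det_nonzero:
  assumes "eis_norm c d = eis_norm a b" "eis_norm a b > 0" "\<bar>eis_form a b c d\<bar> \<le> eis_norm a b"
  shows "a * d - b * c \<noteq> 0"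
proof
  assume "a * d - b * c = 0"
  then have "(eis_form a b c d)\<^sup>2 = (2 * eis_norm a b)\<^sup>2"
    using eis_form_identity[of a b c d] assms(1) by (simp add: power2_eq_square)
  then have "\<bar>eis_form a b c d\<bar> = \<bar>2 * eis_norm a b\<bar>" by (simp only: power2_eq_iff abs_eq_iff)
  then show False using assms by simp
qed

text \<open>The strict case leaves only four minimal vectors. That lets a rhombic basis be recovered
  from its lattice and keeps rhombic and hexagonal lattices apart.\<close>

lemma lat_minimal_vectors:
  assumes N: "eis_norm c d = eis_norm a b" "eis_norm a b > 0" and B: "\<bar>eis_form a b c d\<bar> \<le> eis_norm a b"
  shows "eis a b \<in> minimal_vectors (lat (eis a b) (eis c d))" "eis c d \<in> minimal_vectors (lat (eis a b) (eis c d))"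
    and "u \<in> minimal_vectors (lat (eis a b) (eis c d)) \<Longrightarrow> \<bar>eis_form a b c d\<bar> < eis_norm a b \<Longrightarrow> 
       u \<in> {eis a b, - eis a b, eis c d, - eis c d}"
proof -
  let ?L = "lat (eis a b) (eis c d)"
  let ?r = "eis_norm a b"
  have ge: "real_of_int ?r \<le> (norm u)\<^sup>2" if u: "u \<in> ?L" "u \<noteq> 0" for u
  proof -
    obtain m k where mk: "u = of_int m * eis a b + of_int k * eis c d" using u by (auto simp: lat_def)
    then have "m \<noteq> 0 \<or> k \<noteq> 0" using u by auto
    then show ?thesis unfolding mk comb_norm_square[OF N(1)] of_int_le_iff by (rule int_form_ge(1)[OF B])
  qed
  have nr: "(norm (eis a b))\<^sup>2 = ?r" "(norm (eis c d))\<^sup>2 = ?r" using norm_square_eis N by simp_all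
  have nz: "eis a b \<noteq> 0" "eis c d \<noteq> 0"
  proof -
    have "real_of_int ?r \<noteq> 0" unfolding of_int_eq_0_iff using N(2) by linarith
    then have "norm (eis a b) \<noteq> 0" "norm (eis c d) \<noteq> 0" unfolding nr[symmetric] using nr by (metis zero_power2 power_zero_numeral)+
    then show "eis a b \<noteq> 0" "eis c d \<noteq> 0" by auto
  qed
  show "eis a b \<in> minimal_vectors ?L" "eis c d \<in> minimal_vectors ?L"
    unfolding minimal_vectors_def using lat_basis nz ge nr by (auto intro!: power2_le_imp_le[of "norm (eis _ _)"])
  assume u: "u \<in> minimal_vectors ?L" and B': "\<bar>eis_form a b c d\<bar> < ?r"
  obtain m k where mk: "u = of_int m * eis a b + of_int k * eis c d" using u by (auto simp: lat_def minimal_vectors_def)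
  have "norm u \<le> norm (eis a b)" using u nz lat_basis by (auto simp: minimal_vectors_def)
  then have "(norm u)\<^sup>2 \<le> real_of_int ?r" using nr by (metis norm_ge_zero power_mono)
  then have le: "(m\<^sup>2 + k\<^sup>2) * ?r + m * k * eis_form a b c d \<le> ?r" unfolding mk comb_norm_square[OF N(1)] of_int_le_iff .
  have nz': "m \<noteq> 0 \<or> k \<noteq> 0" using u mk by (auto simp: minimal_vectors_def)
  have one: "\<bar>x\<bar> = 1" if "x\<^sup>2 * ?r \<le> ?r" "x \<noteq> 0" for x :: int
  proof -
    have "x\<^sup>2 \<le> 1" using that N(2) by (simp add: mult_le_cancel_right2)
    then show ?thesis using that(2) abs_le_square_iff[of x 1] by simp
  qed
  have "m = 0 \<or> k = 0" using int_form_ge(2)[OF B nz' B'] le by force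
  then show "u \<in> {eis a b, - eis a b, eis c d, - eis c d}"
  proof
    assume m: "m = 0"
    then have "\<bar>k\<bar> = 1" using le nz' one[of k] by simp
    then have "k = 1 \<or> k = - 1" by linarith
    then show ?thesis unfolding mk m by auto
  next
    assume k: "k = 0"
    then have "\<bar>m\<bar> = 1" using le nz' one[of m] by simp
    then have "m = 1 \<or> m = - 1" by linarith
    then show ?thesis unfolding mk k by auto
  qed
qed

lemma lat_well_rounded:
  assumes N: "eis_norm c d = eis_norm a b" "eis_norm a b > 0" and B: "\<bar>eis_form a b c d\<bar> \<le> eis_norm a b"
  shows "well_rounded (lat (eis a b) (eis c d))"
proof -
  have "Re (eis a b) * Im (eis c d) - Im (eis a b) * Re (eis c d) = real_of_int (a * d - b * c) * (sqrt 3 / 2)"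
    by (simp add: Re_eis Im_eis field_simps)
  then have det: "Re (eis a b) * Im (eis c d) - Im (eis a b) * Re (eis c d) \<noteq> 0"
  proof (simp only:)
    have "real_of_int (a * d - b * c) \<noteq> 0" using lat_det_nonzero[OF N B] unfolding of_int_eq_0_iff .
    then show "real_of_int (a * d - b * c) * (sqrt 3 / 2) \<noteq> 0" by (intro no_zero_divisors) auto
  qed
  have "u \<in> span (minimal_vectors (lat (eis a b) (eis c d)))" for u
  proof -
    obtain s t where "u = of_real s * eis a b + of_real t * eis c d" using complex_basis[OF det] .
    then have "u = s *\<^sub>R eis a b + t *\<^sub>R eis c d" by (simp add: scaleR_conv_of_real)
    then show ?thesis using lat_minimal_vectors(1,2)[OF N B] by (simp only:) (intro span_add span_scale span_base)
  qed
  then show ?thesis by (auto simp: well_rounded_def)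
qed

section \<open>Rectangular pairs\<close>

definition rect_pairs :: "nat \<Rightarrow> (nat \<times> nat) set" where
  "rect_pairs n = {(p, q). p * q = n \<and> q < p \<and> p < 3 * q \<and> even (p + q)}"

definition rect_count :: "nat \<Rightarrow> real" where
  "rect_count n = real (card (rect_pairs n))"

lemma finite_rect_pairs [simp]: "finite (rect_pairs n)"
proof (cases "n = 0")
  case True
  then show ?thesis by (auto simp: rect_pairs_def intro: finite_subset[of _ "{}"])
next
  case False
  have "rect_pairs n \<subseteq> {d. d dvd n} \<times> {d. d dvd n}" by (auto simp: rect_pairs_def)
  then show ?thesis by (rule finite_subset) (use False in auto)
qed

lemma rect_count_nonneg: "rect_count n \<ge> 0"
  by (simp add: rect_count_def)

text \<open>The number of \<open>p\<close> paired with \<open>q\<close> in a product of at most \<open>N\<close>.\<close>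

definition rect_len :: "nat \<Rightarrow> nat \<Rightarrow> nat" where
  "rect_len N q = (min (3 * q - 1) (N div q) - q) div 2"

lemma rect_fibre:
  assumes q: "q \<ge> 1"
  shows "{p. q < p \<and> p < 3 * q \<and> even (p + q) \<and> p * q \<le> N} = (\<lambda>j. q + 2 * j) ` {1..rect_len N q}"
proof (intro equalityI subsetI)
  fix p assume "p \<in> {p. q < p \<and> p < 3 * q \<and> even (p + q) \<and> p * q \<le> N}"
  then have p: "q < p" "p < 3 * q" "even (p + q)" "p * q \<le> N" by auto
  have "p \<le> N div q" using p q by (simp add: less_eq_div_iff_mult_less_eq)
  then have "p - q \<le> min (3 * q - 1) (N div q) - q" using p by simp
  moreover obtain j where j: "p - q = 2 * j" using p by (metis dvdE dvd_diff_nat dvd_triv_left even_add even_diff_nat less_imp_le)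
  ultimately have "j \<le> rect_len N q" unfolding rect_len_def by simp
  moreover have "j \<ge> 1" "p = q + 2 * j" using j p by auto
  ultimately show "p \<in> (\<lambda>j. q + 2 * j) ` {1..rect_len N q}" by auto
next
  fix p assume "p \<in> (\<lambda>j. q + 2 * j) ` {1..rect_len N q}"
  then obtain j where j: "p = q + 2 * j" "1 \<le> j" "j \<le> rect_len N q" by auto
  have "2 * j \<le> min (3 * q - 1) (N div q) - q" using j(3) unfolding rect_len_def by linarith
  then have "p \<le> min (3 * q - 1) (N div q)" using j by linarith
  then have "p \<le> 3 * q - 1" "p \<le> N div q" by auto
  then show "p \<in> {p. q < p \<and> p < 3 * q \<and> even (p + q) \<and> p * q \<le> N}"
    using j q by (auto simp: less_eq_div_iff_mult_less_eq)
qed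

text \<open>From q < p and p q \<le> N follows q^2 < N, so q is confined to q \<le> M, and p runs
  through the fibre over q.\<close>

lemma sum_rect_count:
  fixes w :: "nat \<Rightarrow> real"
  assumes M: "N < Suc M * Suc M"
  shows "(\<Sum>n=1..N. rect_count n * w n) = (\<Sum>q=1..M. \<Sum>j=1..rect_len N q. w ((q + 2 * j) * q))"
proof -
  let ?R = "SIGMA q:{1..M}. {p. q < p \<and> p < 3 * q \<and> even (p + q) \<and> p * q \<le> N}"
  have fin: "finite {p. q < p \<and> p < 3 * q \<and> even (p + q) \<and> p * q \<le> N}" for q
    by (rule finite_subset[of _ "{..<3 * q}"]) auto
  have "(\<Sum>n=1..N. rect_count n * w n) = (\<Sum>n=1..N. \<Sum>(p,q)\<in>rect_pairs n. w n)"
    by (simp add: rect_count_def split_def)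
  also have "\<dots> = (\<Sum>(n,(p,q))\<in>(SIGMA n:{1..N}. rect_pairs n). w n)"
    by (subst sum.Sigma) (auto simp: split_def)
  also have "\<dots> = (\<Sum>(q,p)\<in>?R. w (p * q))"
  proof (rule sum.reindex_bij_witness[of _ "\<lambda>(q,p). (p * q, (p, q))" "\<lambda>(n,(p,q)). (q,p)"])
    fix a assume a: "a \<in> (SIGMA n:{1..N}. rect_pairs n)"
    obtain n p q where a': "a = (n,(p,q))" by (cases a) auto
    have npq: "1 \<le> n" "n \<le> N" "p * q = n" "q < p" "p < 3 * q" "even (p + q)"
      using a unfolding a' by (auto simp: rect_pairs_def)
    have "q * q \<le> p * q" using npq(4) by (intro mult_le_mono) auto
    then have "q * q < Suc M * Suc M" using npq M by linarith
    then have "q < Suc M" using mult_le_mono[of "Suc M" q "Suc M" q] by (meson leD leI)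
    moreover have "q \<ge> 1" using npq by (cases q) auto
    ultimately show "(case a of (n,(p,q)) \<Rightarrow> (q,p)) \<in> ?R" using npq unfolding a' by simp
  qed (auto simp: rect_pairs_def)
  also have "\<dots> = (\<Sum>q=1..M. \<Sum>p | q < p \<and> p < 3 * q \<and> even (p + q) \<and> p * q \<le> N. w (p * q))"
    by (subst sum.Sigma) (use fin in auto)
  also have "\<dots> = (\<Sum>q=1..M. \<Sum>j=1..rect_len N q. w ((q + 2 * j) * q))"
  proof (rule sum.cong[OF refl])
    fix q assume "q \<in> {1..M}"
    then have "q \<ge> 1" by simp
    then show "(\<Sum>p | q < p \<and> p < 3 * q \<and> even (p + q) \<and> p * q \<le> N. w (p * q)) = (\<Sum>j=1..rect_len N q. w ((q + 2 * j) * q))"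
      unfolding rect_fibre[OF \<open>q \<ge> 1\<close>] by (subst sum.reindex) (auto simp: inj_on_def)
  qed
  finally show ?thesis .
qed

text \<open>Up to q = sqrt (N / 3) the binding constraint is p < 3 q; beyond it the constraint p q
  \<le> N takes over.\<close>

lemma rect_len_small:
  assumes "q \<ge> 1" "3 * (q * q) \<le> N"
  shows "rect_len N q = q - 1"
proof -
  have "3 * q \<le> N div q" using assms by (simp add: less_eq_div_iff_mult_less_eq)
  then have "rect_len N q = (3 * q - 1 - q) div 2" unfolding rect_len_def by (simp add: min_def)
  then show ?thesis using assms by linarith
qed

lemma rect_len_large:
  assumes "q \<ge> 1" "3 * (q * q) > N"
  shows "rect_len N q = (N div q - q) div 2"
proof -
  have "N div q < 3 * q" using assms by (simp add: div_less_iff_less_mult mult.assoc)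
  then have "min (3 * q - 1) (N div q) = N div q" by simp
  then show ?thesis unfolding rect_len_def by simp
qed

lemma rect_len_large_bounds:
  assumes "q \<ge> 1" "3 * (q * q) > N" "q * q \<le> N"
  shows "real q + 2 * real (rect_len N q) \<le> real N / real q"
    and "real N / real q < real q + 2 * real (rect_len N q) + 2"
proof -
  have q: "q \<le> N div q" using assms by (simp add: less_eq_div_iff_mult_less_eq)
  have r: "rect_len N q = (N div q - q) div 2" using assms by (intro rect_len_large) auto
  have up: "q + 2 * rect_len N q \<le> N div q" and lo: "N div q \<le> q + 2 * rect_len N q + 1"
    unfolding r using q by linarith+
  have "real (q + 2 * rect_len N q) \<le> real (N div q)" using up by (simp only: of_nat_le_iff)
  also have "\<dots> \<le> real N / real q" by (rule of_nat_div_le_of_nat)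
  finally show "real q + 2 * real (rect_len N q) \<le> real N / real q" by simp
  have "real N / real q < real (N div q) + 1"
  proof -
    have "N < (N div q + 1) * q" using assms(1) by (metis add.commute dividend_less_times_div mult.commute mult_Suc plus_1_eq_Suc One_nat_def Suc_le_eq)
    then have "real N < real ((N div q + 1) * q)" by (simp only: of_nat_less_iff)
    then show ?thesis using assms(1) by (simp add: field_simps)
  qed
  also have "real (N div q) \<le> real (q + 2 * rect_len N q + 1)" using lo by (simp only: of_nat_le_iff)
  finally show "real N / real q < real q + 2 * real (rect_len N q) + 2" by simp
qed

section \<open>Comparison of the sums over p with logarithms\<close>

lemma ln_step_bounds:
  fixes x :: real assumes "x > 0"
  shows "1 / (x + 2) \<le> (ln (x + 2) - ln x) / 2" "(ln (x + 2) - ln x) / 2 \<le> 1 / x"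
proof -
  have "ln (x + 2) - ln x = ln ((x + 2) / x)" using assms by (simp add: ln_div)
  also have "\<dots> \<le> (x + 2) / x - 1" using assms by (intro ln_le_minus_one) auto
  also have "\<dots> = 2 / x" using assms by (simp add: field_simps)
  finally show "(ln (x + 2) - ln x) / 2 \<le> 1 / x" by simp
  have "ln x - ln (x + 2) = ln (x / (x + 2))" using assms by (simp add: ln_div)
  also have "\<dots> \<le> x / (x + 2) - 1" using assms by (intro ln_le_minus_one) auto
  also have "\<dots> = - (2 / (x + 2))" using assms by (simp add: field_simps)
  finally show "1 / (x + 2) \<le> (ln (x + 2) - ln x) / 2" by simp
qed

lemma sum_ap_bounds:
  assumes q: "q \<ge> 1"
  shows "(\<Sum>j=1..J. 1 / (real q + 2 * real j)) \<le> (ln (real q + 2 * real J) - ln (real q)) / 2"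
    and "(ln (real q + 2 * real J + 2) - ln (real q + 2)) / 2 \<le> (\<Sum>j=1..J. 1 / (real q + 2 * real j))"
proof -
  show "(\<Sum>j=1..J. 1 / (real q + 2 * real j)) \<le> (ln (real q + 2 * real J) - ln (real q)) / 2"
  proof (induction J)
    case (Suc J)
    have "1 / (real q + 2 * real (Suc J)) \<le> (ln (real q + 2 * real (Suc J)) - ln (real q + 2 * real J)) / 2"
      using ln_step_bounds(1)[of "real q + 2 * real J"] q by (simp add: algebra_simps)
    then show ?case using Suc by (simp add: diff_divide_distrib)
  qed simp
  show "(ln (real q + 2 * real J + 2) - ln (real q + 2)) / 2 \<le> (\<Sum>j=1..J. 1 / (real q + 2 * real j))"
  proof (induction J)
    case (Suc J)
    have "(ln (real q + 2 * real (Suc J) + 2) - ln (real q + 2 * real J + 2)) / 2 \<le> 1 / (real q + 2 * real (Suc J))"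
      using ln_step_bounds(2)[of "real q + 2 * real J + 2"] q by (simp add: algebra_simps)
    then show ?case using Suc by (simp add: diff_divide_distrib)
  qed simp
qed

text \<open>The linear arithmetic of the estimates that follow, isolated with every logarithm
  replaced by a variable.\<close>

lemma half_diff_bounds:
  fixes A I x y z t u :: real
  shows "A \<le> y + x \<Longrightarrow> I \<le> (A - x) / 2 \<Longrightarrow> I \<le> y / 2"
    and "A \<le> z - x \<Longrightarrow> I \<le> (A - x) / 2 \<Longrightarrow> I \<le> z / 2 - x"
    and "z - x \<le> A \<Longrightarrow> (A - t) / 2 \<le> I \<Longrightarrow> t \<le> x + 2 * u \<Longrightarrow> z / 2 - x - u \<le> I"
    and "(y + x - t) / 2 \<le> I \<Longrightarrow> t \<le> x + 2 * u \<Longrightarrow> y / 2 - I \<le> u"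
  by (simp_all add: field_simps)

lemma ln_q2_le: "q \<ge> 1 \<Longrightarrow> ln (real q + 2) \<le> ln (real q) + 2 * (1 / real q)"
proof -
  assume "q \<ge> 1"
  then have "ln (real q + 2) / 2 - ln (real q) / 2 \<le> 1 / real q" using ln_step_bounds(2)[of "real q"] by (simp add: diff_divide_distrib)
  then show ?thesis by linarith
qed

text \<open>The deficit of the sum of 1 / p over q < p < 3 q, p of the parity of q, against the
  integral approximation ln 3 / 2. Splitting q by parity leads to the two series in
  \<open>c_triangle\<close>.\<close>

definition ln3_defect :: "nat \<Rightarrow> real" where
  "ln3_defect q = ln 3 / 2 - (\<Sum>j=1..q - 1. 1 / (real q + 2 * real j))"

lemma ln3_defect_bounds:
  assumes q: "q \<ge> 1"
  shows "0 \<le> ln3_defect q" "ln3_defect q \<le> 1 / real q"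
proof -
  define I where "I = (\<Sum>j=1..q - 1. 1 / (real q + 2 * real j))"
  have d: "ln3_defect q = ln 3 / 2 - I" by (simp add: ln3_defect_def I_def)
  have r: "real q + 2 * real (q - 1) = 3 * real q - 2" using q by (simp add: of_nat_diff)
  have l3: "ln (3 * real q) = ln 3 + ln (real q)" using q by (simp add: ln_mult)
  have "ln (3 * real q - 2) \<le> ln (3 * real q)" using q by (subst ln_le_cancel_iff) auto
  note l = this[unfolded l3]
  show "0 \<le> ln3_defect q" unfolding d
    using half_diff_bounds(1)[OF l sum_ap_bounds(1)[OF q, of "q - 1", folded I_def, unfolded r]] by simp
  have r2: "real q + 2 * real (q - 1) + 2 = 3 * real q" using r by simp
  have "(ln 3 + ln (real q) - ln (real q + 2)) / 2 \<le> I"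
    using sum_ap_bounds(2)[OF q, of "q - 1", folded I_def, unfolded r2] l3 by simp
  then show "ln3_defect q \<le> 1 / real q" unfolding d using half_diff_bounds(4) ln_q2_le[OF q] by blast
qed

lemma sum_Icc_nat_real: "(\<Sum>q=1..n. real q) = real n * (real n + 1) / 2"
  by (induction n) (simp_all add: field_simps)

lemma sum_split_at: "(a::nat) \<le> b \<Longrightarrow> (\<Sum>q=1..b. F q :: real) = (\<Sum>q=1..a. F q) + (\<Sum>q=Suc a..b. F q)"
  by (metis Suc_eq_plus1 le_add1 sum.ub_add_nat le_add_diff_inverse add.commute)

lemma floor_square_bounds:
  fixes u :: real
  assumes "u \<ge> 0" and "Q = nat \<lfloor>u\<rfloor>"
  shows "real Q \<le> u" "u < real Q + 1" "(real Q)\<^sup>2 \<le> u\<^sup>2" "u\<^sup>2 \<le> (real Q)\<^sup>2 + 2 * u"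
proof -
  show Q: "real Q \<le> u" "u < real Q + 1" using assms by linarith+
  show "(real Q)\<^sup>2 \<le> u\<^sup>2" using Q assms by (intro power_mono) auto
  have "(u - real Q) * (u + real Q) \<le> 1 * (2 * u)" using Q assms(1) by (intro mult_mono) linarith+
  then show "u\<^sup>2 \<le> (real Q)\<^sup>2 + 2 * u" by (simp add: power2_eq_square algebra_simps)
qed

lemma ln_floor_bounds:
  fixes u :: real
  assumes "u \<ge> 1" and "Q = nat \<lfloor>u\<rfloor>"
  shows "0 \<le> ln u - ln (real Q)" "ln u - ln (real Q) \<le> 1 / real Q"
proof -
  have Q: "real Q \<le> u" "u < real Q + 1" "Q \<ge> 1" using assms floor_square_bounds[of u Q] by (auto simp: le_nat_iff)
  show "0 \<le> ln u - ln (real Q)" using Q by simp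
  have "ln u - ln (real Q) = ln (u / real Q)" using Q assms by (simp add: ln_div)
  also have "\<dots> \<le> u / real Q - 1" using Q assms by (intro ln_le_minus_one) auto
  also have "u / real Q \<le> (real Q + 1) / real Q" using Q by (intro divide_right_mono) auto
  then have "u / real Q - 1 \<le> 1 / real Q" using Q by (simp add: add_divide_distrib)
  finally show "ln u - ln (real Q) \<le> 1 / real Q" .
qed

text \<open>Up to u = sqrt (N / 3) there are q - 1 values of p, beyond it about (N / q - q) / 2. The
  quadratic parts cancel up to O(sqrt N), and N / 2 times the harmonic sum between u and sqrt N
  gives N / 2 * ln 3 / 2.\<close>

lemma sum_rect_count_bound:
  assumes N: "N \<ge> 3"
  shows "\<bar>(\<Sum>n=1..N. rect_count n) - ln 3 / 4 * real N\<bar> \<le> 20 * sqrt (real N)"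
proof -
  define s where "s = sqrt (real N)"
  define u where "u = sqrt (real N / 3)"
  define Q1 where "Q1 = nat \<lfloor>u\<rfloor>"
  define Q2 where "Q2 = nat \<lfloor>s\<rfloor>"
  have s: "s * s = real N" "s\<^sup>2 = real N" "s \<ge> 1" using N by (auto simp: s_def)
  have u: "u\<^sup>2 = real N / 3" "u \<ge> 1" using N by (auto simp: u_def)
  have us: "u \<le> s" "s \<le> 2 * u"
  proof -
    show "u \<le> s" by (simp add: u_def s_def)
    have "s\<^sup>2 \<le> (2 * u)\<^sup>2" using s u by (simp add: power_mult_distrib)
    moreover have "0 \<le> 2 * u" using u(2) by linarith
    ultimately show "s \<le> 2 * u" by (rule power2_le_imp_le)
  qed
  note b1 = floor_square_bounds[of u Q1, OF order.trans[OF zero_le_one u(2)] Q1_def]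
  note b2 = floor_square_bounds[of s Q2, OF order.trans[OF zero_le_one s(3)] Q2_def]
  have Q: "Q1 \<ge> 1" "Q2 \<ge> 1" "Q1 \<le> Q2"
  proof -
    show "Q1 \<ge> 1" "Q2 \<ge> 1" unfolding Q1_def Q2_def using floor_ge_half(2)[OF u(2)] floor_ge_half(2)[OF s(3)] .
    show "Q1 \<le> Q2" unfolding Q1_def Q2_def using us(1) by (intro nat_mono floor_mono)
  qed
  have NM: "N < Suc Q2 * Suc Q2" "Q2 * Q2 \<le> N"
    using floor_sqrt_bounds[of "real N"] by (simp_all add: Q2_def s_def)
  have small: "3 * (q * q) \<le> N" if "q \<le> Q1" for q
  proof -
    have "real q * real q \<le> u * u" using that b1(1) u by (intro mult_mono) auto
    then have "real (3 * (q * q)) \<le> real N" using u(1) by (simp add: power2_eq_square)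
    then show ?thesis by (simp only: of_nat_le_iff)
  qed
  have large: "3 * (q * q) > N" if "q > Q1" for q
  proof -
    have "u < real q" using b1(2) that by linarith
    then have "u * u < real q * real q" using u by (intro mult_strict_mono) auto
    then have "real N < real (3 * (q * q))" using u(1) by (simp add: power2_eq_square)
    then show ?thesis by (simp only: of_nat_less_iff)
  qed
  have qq: "q * q \<le> N" if "q \<le> Q2" for q using mult_le_mono[OF that that] NM by linarith
  have "(\<Sum>n=1..N. rect_count n) = (\<Sum>q=1..Q2. real (rect_len N q))"
    using sum_rect_count[OF NM(1), of "\<lambda>_. 1"] by simp
  also have "\<dots> = (\<Sum>q=1..Q1. real (rect_len N q)) + (\<Sum>q=Suc Q1..Q2. real (rect_len N q))"
    by (rule sum_split_at[OF Q(3)])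
  finally have total: "(\<Sum>n=1..N. rect_count n) = (\<Sum>q=1..Q1. real (rect_len N q)) + (\<Sum>q=Suc Q1..Q2. real (rect_len N q))" .
  have "(\<Sum>q=1..Q1. real (rect_len N q)) = (\<Sum>q=1..Q1. real q - 1)"
    using small by (intro sum.cong refl) (auto simp: rect_len_small of_nat_diff)
  then have A: "(\<Sum>q=1..Q1. real (rect_len N q)) = (real Q1)\<^sup>2 / 2 - real Q1 / 2"
    unfolding sum_subtractf sum_Icc_nat_real by (simp add: power2_eq_square field_simps)
  define E where "E = (\<Sum>q=Suc Q1..Q2. (real N / real q - real q) / 2)"
  have B: "\<bar>(\<Sum>q=Suc Q1..Q2. real (rect_len N q)) - E\<bar> \<le> real Q2"
  proof -
    have "\<bar>(\<Sum>q=Suc Q1..Q2. real (rect_len N q)) - E\<bar> \<le> (\<Sum>q=Suc Q1..Q2. 1)"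
      unfolding E_def sum_subtractf[symmetric]
    proof (rule order.trans[OF sum_abs sum_mono])
      fix q assume q: "q \<in> {Suc Q1..Q2}"
      then have "1 \<le> q" "N < 3 * (q * q)" "q * q \<le> N" using large qq by auto
      note rl = rect_len_large_bounds[OF this]
      have abs: "\<bar>l - (X - r) / 2\<bar> \<le> 1" if a: "r + 2 * l \<le> X" and b: "X < r + 2 * l + 2" for l X r :: real
        using a b by (simp add: abs_le_iff field_simps)
      show "\<bar>real (rect_len N q) - (real N / real q - real q) / 2\<bar> \<le> 1" by (rule abs[OF rl])
    qed
    then show ?thesis by simp
  qed
  have harm_split: "(\<Sum>q=Suc Q1..Q2. 1 / real q) = harm Q2 - harm Q1"
    using sum_split_at[OF Q(3), of "\<lambda>q. 1 / real q"] by (simp add: harm_def inverse_eq_divide)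
  have sum_split: "(\<Sum>q=Suc Q1..Q2. real q) = real Q2 * (real Q2 + 1) / 2 - real Q1 * (real Q1 + 1) / 2"
    using sum_split_at[OF Q(3), of real] unfolding sum_Icc_nat_real by linarith
  have E: "E = real N / 2 * (harm Q2 - harm Q1) - (real Q2 * (real Q2 + 1) / 2 - real Q1 * (real Q1 + 1) / 2) / 2"
    unfolding E_def harm_split[symmetric] sum_split[symmetric]
    by (simp add: sum_subtractf sum_distrib_left sum_divide_distrib diff_divide_distrib mult.commute)
  have h: "\<bar>harm Q2 - harm Q1 - ln 3 / 2\<bar> \<le> 16 / s"
  proof -
    have lnsu: "ln s - ln u = ln 3 / 2" using N by (simp add: s_def u_def ln_sqrt ln_div field_simps)
    have i: "1 / real Q1 \<le> 4 / s" "1 / real Q2 \<le> 4 / s"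
    proof -
      have "real Q1 \<ge> 1" "real Q2 \<ge> 1" using Q by auto
      then have "s \<le> 4 * real Q1" "s \<le> 4 * real Q2" using b1(2) b2(2) us by linarith+
      then show "1 / real Q1 \<le> 4 / s" "1 / real Q2 \<le> 4 / s" using Q s by (simp_all add: field_simps)
    qed
    show ?thesis
      using harm_bounds[OF Q(1)] harm_bounds[OF Q(2)] ln_floor_bounds[OF u(2) Q1_def] ln_floor_bounds[OF s(3) Q2_def] lnsu i
      unfolding abs_le_iff by linarith
  qed
  have "\<bar>real N / 2 * (harm Q2 - harm Q1) - real N / 2 * (ln 3 / 2)\<bar> = real N / 2 * \<bar>harm Q2 - harm Q1 - ln 3 / 2\<bar>"
    unfolding right_diff_distrib[symmetric] abs_mult by simp
  also have "\<dots> \<le> real N / 2 * (16 / s)" using h by (intro mult_left_mono) auto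
  also have "\<dots> = 8 * s" using s(3) by (simp flip: s(1))
  finally have H: "\<bar>real N / 2 * (harm Q2 - harm Q1) - real N / 2 * (ln 3 / 2)\<bar> \<le> 8 * s" .
  have "(real Q2 * (real Q2 + 1) / 2 - real Q1 * (real Q1 + 1) / 2) / 2 = (real Q2)\<^sup>2 / 4 + real Q2 / 4 - (real Q1)\<^sup>2 / 4 - real Q1 / 4"
    by (simp add: power2_eq_square field_simps)
  then have E': "E = real N / 2 * (harm Q2 - harm Q1) - ((real Q2)\<^sup>2 / 4 + real Q2 / 4 - (real Q1)\<^sup>2 / 4 - real Q1 / 4)"
    unfolding E by (simp only:)
  have "real N / 2 * (ln 3 / 2) = ln 3 / 4 * real N" by simp
  then show ?thesis
    using total A B H E' b1 b2 us s(2) u(1) unfolding s_def[symmetric] abs_le_iff by linarith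
qed

lemma summatory_rect_count:
  assumes y: "y \<ge> 1"
  shows "\<bar>summatory rect_count y - ln 3 / 4 * y\<bar> \<le> 21 * sqrt y"
proof -
  define N where "N = nat \<lfloor>y\<rfloor>"
  have N: "real N \<le> y" "y < real N + 1" "N \<ge> 1" using y floor_ge_half[of y] by (auto simp: N_def)
  have l3: "0 \<le> ln (3::real)" "ln (3::real) \<le> 2" using ln_le_minus_one[of "3::real"] by auto
  have sy: "sqrt y \<ge> 1" using y by simp
  have main: "\<bar>(\<Sum>n=1..N. rect_count n) - ln 3 / 4 * real N\<bar> \<le> 20 * sqrt (real N)"
  proof (cases "N \<ge> 3")
    case True
    then show ?thesis by (rule sum_rect_count_bound)
  next
    case False
    \<comment> \<open>The smallest admissible pair is (3, 1), so nothing is counted below 3.\<close>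
    have "(\<Sum>n=1..N. rect_count n) = 0"
    proof (intro sum.neutral ballI)
      fix n assume n: "n \<in> {1..N}"
      have "rect_pairs n = {}"
      proof (rule ccontr)
        assume "rect_pairs n \<noteq> {}"
        then obtain p q where pq: "p * q = n" "q < p" "p < 3 * q" "even (p + q)" by (auto simp: rect_pairs_def)
        then have "q \<ge> 1" "p \<ge> q + 2" by presburger+
        then have "(q + 2) * 1 \<le> p * q" by (intro mult_le_mono) auto
        then show False using pq n False \<open>q \<ge> 1\<close> by auto
      qed
      then show "rect_count n = 0" by (simp add: rect_count_def)
    qed
    then have z: "(\<Sum>n=1..N. rect_count n) = 0" .
    have N2: "real N \<le> 2" "sqrt (real N) \<ge> 1" using False N by auto
    have "ln 3 / 4 * real N \<le> 2 / 4 * 2" by (rule mult_mono) (use l3 N2 in simp_all)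
    moreover have "0 \<le> ln 3 / 4 * real N" using l3 by simp
    ultimately show ?thesis using N2 unfolding z abs_le_iff by linarith
  qed
  have "sqrt (real N) \<le> sqrt y" using N by simp
  moreover have "ln 3 / 4 * (y - real N) \<le> 2 / 4 * 1" by (rule mult_mono) (use l3 N in simp_all)
  moreover have "0 \<le> ln 3 / 4 * (y - real N)" using N l3 by simp
  moreover have "ln 3 / 4 * (y - real N) = ln 3 / 4 * y - ln 3 / 4 * real N" by (rule right_diff_distrib)
  ultimately show ?thesis using main sy unfolding summatory_def N_def[symmetric] by linarith
qed

lemma ln3_defect_summable: "summable (\<lambda>n. ln3_defect (Suc n) / real (Suc n))"
proof (rule summable_comparison_test'[OF sums_summable[OF zeta_series_deriv(2)]])
  fix n :: nat
  have "ln3_defect (Suc n) / real (Suc n) \<le> (1 / real (Suc n)) / real (Suc n)"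
    using ln3_defect_bounds[of "Suc n"] by (intro divide_right_mono) auto
  then show "norm (ln3_defect (Suc n) / real (Suc n)) \<le> 1 / (real (Suc n))\<^sup>2"
    using ln3_defect_bounds[of "Suc n"] by (simp add: power2_eq_square)
qed

text \<open>An integral comparison: - \<open>\<Phi>\<close> is an antiderivative of
  \<open>f\<close>, which decreases as long as ln t \<le> ln N / 2.\<close>

lemma sum_antimono_ln_bounds:
  fixes N Q R :: nat
  assumes Q: "1 \<le> Q" "Q \<le> R" and R: "R * R \<le> N"
  defines "f \<equiv> \<lambda>t. (ln (real N) / 2 - ln t) / t" and "\<Phi> \<equiv> \<lambda>t. (ln (real N) / 2 - ln t)\<^sup>2 / 2"
  shows "(\<Sum>q=Suc Q..R. f (real q)) \<le> \<Phi> (real Q) - \<Phi> (real R)"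
    and "\<Phi> (real Q) - \<Phi> (real R) - (f (real Q) - f (real R)) \<le> (\<Sum>q=Suc Q..R. f (real q))"
proof -
  have lnR: "ln (real R) \<le> ln (real N) / 2"
  proof -
    have "real (R * R) \<le> real N" using R by (simp only: of_nat_le_iff)
    moreover have "real R > 0" using Q by simp
    moreover from this have "real R * real R > 0" by simp
    ultimately have "0 < real N" "real R * real R \<le> real N" by (simp_all only: of_nat_mult less_le_trans)
    with \<open>real R * real R > 0\<close> have "ln (real R * real R) \<le> ln (real N)" by (subst ln_le_cancel_iff)
    then show ?thesis using Q by (simp add: ln_mult)
  qed
  have f_anti: "f b \<le> f a" if "0 < a" "a \<le> b" "b \<le> real R" for a b
  proof -
    have "ln a \<le> ln b" "ln b \<le> ln (real R)" using that by (simp_all add: less_le_trans)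
    then have l: "0 \<le> ln (real N) / 2 - ln a" "ln (real N) / 2 - ln b \<le> ln (real N) / 2 - ln a" using lnR by linarith+
    show ?thesis unfolding f_def by (rule frac_le) (use l that in linarith)+
  qed
  have d\<Phi>: "((\<lambda>t. - \<Phi> t) has_real_derivative f t) (at t)" if "t > 0" for t
    unfolding \<Phi>_def f_def using that by (auto intro!: derivative_eq_intros simp: field_simps)
  have inc: "f (real (Suc q)) \<le> \<Phi> (real q) - \<Phi> (real (Suc q))" "\<Phi> (real q) - \<Phi> (real (Suc q)) \<le> f (real q)"
    if q: "1 \<le> q" "Suc q \<le> R" for q
  proof -
    have "\<exists>z. z > real q \<and> z < real (Suc q) \<and> (- \<Phi> (real (Suc q))) - (- \<Phi> (real q)) = (real (Suc q) - real q) * f z"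
      by (rule MVT2) (use d\<Phi> q in auto)
    then obtain z where z: "z > real q" "z < real (Suc q)" "\<Phi> (real q) - \<Phi> (real (Suc q)) = f z" by auto
    have "real (Suc q) \<le> real R" using q by (simp only: of_nat_le_iff)
    then show "f (real (Suc q)) \<le> \<Phi> (real q) - \<Phi> (real (Suc q))" "\<Phi> (real q) - \<Phi> (real (Suc q)) \<le> f (real q)"
      unfolding z(3) using z q by (auto intro!: f_anti)
  qed
  have "(\<Sum>q=Suc Q..R'. f (real q)) \<le> \<Phi> (real Q) - \<Phi> (real R') \<and>
     \<Phi> (real Q) - \<Phi> (real R') - (f (real Q) - f (real R')) \<le> (\<Sum>q=Suc Q..R'. f (real q))" if "Q \<le> R'" "R' \<le> R" for R'
    using that
  proof (induction R' rule: dec_induct)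
    case (step n)
    have "n \<ge> 1" using Q step.hyps by simp
    note s = inc[OF this step.prems]
    have "(\<Sum>q=Suc Q..Suc n. f (real q)) = (\<Sum>q=Suc Q..n. f (real q)) + f (real (Suc n))"
      using step.hyps by simp
    then show ?case using step.IH step.prems s by simp
  qed simp
  then show "(\<Sum>q=Suc Q..R. f (real q)) \<le> \<Phi> (real Q) - \<Phi> (real R)"
    "\<Phi> (real Q) - \<Phi> (real R) - (f (real Q) - f (real R)) \<le> (\<Sum>q=Suc Q..R. f (real q))"
    using Q by auto
qed

text \<open>At N = 3 Q^2 the breakpoint sqrt (N / 3) is the integer Q. Up to Q the inner sums are ln
  3 / 2 minus the defect; beyond it they are ln N / 2 - ln q up to 1 / q, and integrating this
  against 1 / q gives (ln 3)^2 / 8.\<close>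

lemma summatory_rect_count_div_limit:
  "(\<lambda>Q. summatory (\<lambda>n. rect_count n / real n) (real (3 * Q\<^sup>2)) - ln 3 / 4 * ln (real (3 * Q\<^sup>2)))
      \<longlonglongrightarrow> ln 3 / 4 * (2 * euler_mascheroni - ln 3 / 2) - (\<Sum>n. ln3_defect (Suc n) / real (Suc n))"
proof -
  define D where "D = (\<lambda>Q. \<Sum>q=1..Q. ln3_defect q / real q)"
  define main where "main = (\<lambda>Q. ln 3 / 2 * harm Q - D Q + (ln 3)\<^sup>2 / 8 - ln 3 / 4 * ln (real (3 * Q\<^sup>2)))"
  have bound: "\<bar>summatory (\<lambda>n. rect_count n / real n) (real (3 * Q\<^sup>2)) - ln 3 / 4 * ln (real (3 * Q\<^sup>2)) - main Q\<bar>
     \<le> 3 / real Q + 1 / (real Q)\<^sup>2" if Q: "Q \<ge> 1" for Q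
  proof -
    define N where "N = 3 * Q\<^sup>2"
    define s where "s = sqrt (real N)"
    define R where "R = nat \<lfloor>s\<rfloor>"
    define f where "f = (\<lambda>t. (ln (real N) / 2 - ln t) / t)"
    define \<Phi> where "\<Phi> = (\<lambda>t. (ln (real N) / 2 - ln t)\<^sup>2 / 2)"
    have N: "N \<ge> 3" "real N = 3 * (real Q)\<^sup>2" using Q by (simp_all add: N_def Suc_le_eq)
    have NM: "N < Suc R * Suc R" "R * R \<le> N"
      using floor_sqrt_bounds[of "real N"] by (simp_all add: R_def s_def)
    have QR: "Q \<le> R"
    proof -
      have "real Q \<le> s" unfolding s_def using N by (intro real_le_rsqrt) auto
      then show ?thesis unfolding R_def by (simp add: le_nat_iff le_floor_iff)
    qed
    have s1: "s \<ge> 1" using N by (simp add: s_def)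
    have lnN: "ln (real N) = ln 3 + 2 * ln (real Q)" using Q unfolding N(2) by (simp add: ln_mult ln_realpow)
    have w: "(\<Sum>j=1..J. 1 / real ((q + 2 * j) * q)) = (\<Sum>j=1..J. 1 / (real q + 2 * real j)) / real q" for J q
      by (simp add: sum_divide_distrib)
    have "summatory (\<lambda>n. rect_count n / real n) (real N) = (\<Sum>q=1..R. (\<Sum>j=1..rect_len N q. 1 / (real q + 2 * real j)) / real q)"
      using sum_rect_count[OF NM(1), of "\<lambda>n. 1 / real n"] unfolding w by simp
    also have "\<dots> = (\<Sum>q=1..Q. (\<Sum>j=1..rect_len N q. 1 / (real q + 2 * real j)) / real q) +
       (\<Sum>q=Suc Q..R. (\<Sum>j=1..rect_len N q. 1 / (real q + 2 * real j)) / real q)"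
      by (rule sum_split_at[OF QR])
    also have "(\<Sum>q=1..Q. (\<Sum>j=1..rect_len N q. 1 / (real q + 2 * real j)) / real q) = ln 3 / 2 * harm Q - D Q"
    proof -
      have "(\<Sum>q=1..Q. (\<Sum>j=1..rect_len N q. 1 / (real q + 2 * real j)) / real q) = (\<Sum>q=1..Q. (ln 3 / 2 - ln3_defect q) / real q)"
      proof (intro sum.cong refl)
        fix q assume q: "q \<in> {1..Q}"
        then have "3 * (q * q) \<le> N" by (simp add: N_def power2_eq_square mult_le_mono)
        then have "rect_len N q = q - 1" using q by (intro rect_len_small) auto
        then show "(\<Sum>j=1..rect_len N q. 1 / (real q + 2 * real j)) / real q = (ln 3 / 2 - ln3_defect q) / real q"
          by (simp add: ln3_defect_def)
      qed
      then show ?thesis by (simp add: D_def harm_def diff_divide_distrib sum_subtractf sum_distrib_left inverse_eq_divide)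
    qed
    finally have total: "summatory (\<lambda>n. rect_count n / real n) (real N) = ln 3 / 2 * harm Q - D Q +
       (\<Sum>q=Suc Q..R. (\<Sum>j=1..rect_len N q. 1 / (real q + 2 * real j)) / real q)" .
    \<comment> \<open>The error 1 / q^2 of each term is majorised by a telescoping difference that
      starts at 1 / Q.\<close>
    have "\<bar>(\<Sum>q=Suc Q..R. (\<Sum>j=1..rect_len N q. 1 / (real q + 2 * real j)) / real q) - (\<Sum>q=Suc Q..R. f (real q))\<bar>
       \<le> (\<Sum>q=Suc Q..R. 1 / real (q - 1) - 1 / real q)"
      unfolding sum_subtractf[symmetric]
    proof (rule order.trans[OF sum_abs sum_mono])
      fix q assume q: "q \<in> {Suc Q..R}"
      then have q1: "1 \<le> q" "q > 1" using Q by auto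
      have "Suc Q * Suc Q \<le> q * q" using q by (intro mult_le_mono) auto
      then have "N < 3 * (q * q)" by (simp add: N_def power2_eq_square)
      moreover have "q * q \<le> N" using q NM(2) mult_le_mono[of q R q R] by simp
      ultimately have rl: "real q + 2 * real (rect_len N q) \<le> real N / real q" "real N / real q < real q + 2 * real (rect_len N q) + 2"
        using rect_len_large_bounds[OF q1(1)] by blast+
      define I where "I = (\<Sum>j=1..rect_len N q. 1 / (real q + 2 * real j))"
      have lnNq: "ln (real N / real q) = ln (real N) - ln (real q)" using ln_div[of "real N" "real q"] N(1) q1 by simp
      have "ln (real q + 2 * real (rect_len N q)) \<le> ln (real N / real q)" using rl q1 by (subst ln_le_cancel_iff) (auto simp: N)
      then have up: "I \<le> ln (real N) / 2 - ln (real q)" unfolding lnNq using half_diff_bounds(2) sum_ap_bounds(1)[OF q1(1), of "rect_len N q", folded I_def] by blast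
      have "ln (real N / real q) \<le> ln (real q + 2 * real (rect_len N q) + 2)" using rl q1 Q by (subst ln_le_cancel_iff) (auto simp: N)
      then have lo: "ln (real N) / 2 - ln (real q) - 1 / real q \<le> I"
        unfolding lnNq using half_diff_bounds(3) sum_ap_bounds(2)[OF q1(1), of "rect_len N q", folded I_def] ln_q2_le[OF q1(1)] by blast
      have "\<bar>I / real q - f (real q)\<bar> = \<bar>I - (ln (real N) / 2 - ln (real q))\<bar> / real q"
        by (simp add: f_def flip: diff_divide_distrib)
      also have "\<dots> \<le> (1 / real q) / real q" using up lo by (intro divide_right_mono) (auto simp: abs_le_iff)
      also have "\<dots> \<le> 1 / real (q - 1) - 1 / real q" using q1 by (simp add: of_nat_diff field_simps)
      finally show "\<bar>(\<Sum>j=1..rect_len N q. 1 / (real q + 2 * real j)) / real q - f (real q)\<bar> \<le> 1 / real (q - 1) - 1 / real q"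
        unfolding I_def .
    qed
    also have "(\<Sum>q=Suc Q..R. 1 / real (q - 1) - 1 / real q) = 1 / real Q - 1 / real R"
      using QR by (induction R rule: dec_induct) auto
    also have "\<dots> \<le> 1 / real Q" by simp
    finally have e1: "\<bar>(\<Sum>q=Suc Q..R. (\<Sum>j=1..rect_len N q. 1 / (real q + 2 * real j)) / real q) - (\<Sum>q=Suc Q..R. f (real q))\<bar> \<le> 1 / real Q" .
    have \<Phi>Q: "\<Phi> (real Q) = (ln 3)\<^sup>2 / 8" unfolding \<Phi>_def lnN by (simp add: power2_eq_square field_simps)
    have lns: "ln (real N) / 2 = ln s" using N by (simp add: s_def ln_sqrt)
    have R1: "R \<ge> 1" using QR Q by simp
    have iR: "1 / real R \<le> 1 / real Q" using Q QR by (intro divide_left_mono) auto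
    have dR: "0 \<le> ln (real N) / 2 - ln (real R)" "ln (real N) / 2 - ln (real R) \<le> 1 / real R"
      unfolding lns using ln_floor_bounds[OF s1 R_def] by auto
    have \<Phi>R: "0 \<le> \<Phi> (real R)" "\<Phi> (real R) \<le> 1 / (real Q)\<^sup>2"
    proof -
      show "0 \<le> \<Phi> (real R)" by (simp add: \<Phi>_def)
      have "(ln (real N) / 2 - ln (real R))\<^sup>2 \<le> (1 / real Q)\<^sup>2" using dR iR by (intro power_mono) auto
      moreover have "0 \<le> (1 / real Q)\<^sup>2" by simp
      ultimately have "\<Phi> (real R) \<le> (1 / real Q)\<^sup>2" unfolding \<Phi>_def by linarith
      then show "\<Phi> (real R) \<le> 1 / (real Q)\<^sup>2" by (simp add: power_divide)
    qed
    have fR: "f (real R) \<ge> 0" unfolding f_def using dR by simp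
    have fQ: "f (real Q) \<le> 1 / real Q"
    proof -
      have "ln (3::real) \<le> 2" using ln_le_minus_one[of "3::real"] by auto
      then have "(ln 3 + 2 * ln (real Q)) / 2 - ln (real Q) \<le> 1" by (simp add: add_divide_distrib)
      then show ?thesis unfolding f_def lnN by (intro divide_right_mono) auto
    qed
    have e2: "\<bar>(\<Sum>q=Suc Q..R. f (real q)) - (ln 3)\<^sup>2 / 8\<bar> \<le> 1 / real Q + 1 / (real Q)\<^sup>2"
    proof -
      have "(\<Sum>q=Suc Q..R. f (real q)) \<le> \<Phi> (real Q) - \<Phi> (real R)"
        "\<Phi> (real Q) - \<Phi> (real R) - (f (real Q) - f (real R)) \<le> (\<Sum>q=Suc Q..R. f (real q))"
        using sum_antimono_ln_bounds[OF Q QR NM(2)] unfolding f_def \<Phi>_def .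
      then show ?thesis using \<Phi>Q \<Phi>R fR fQ unfolding abs_le_iff by linarith
    qed
    have "1 / real Q \<ge> 0" by simp
    then show ?thesis using e1 e2 total unfolding main_def N_def[symmetric] abs_le_iff by linarith
  qed
  have "(\<lambda>Q. summatory (\<lambda>n. rect_count n / real n) (real (3 * Q\<^sup>2)) - ln 3 / 4 * ln (real (3 * Q\<^sup>2)) - main Q) \<longlonglongrightarrow> 0"
  proof (rule Lim_null_comparison)
    show "eventually (\<lambda>Q. norm (summatory (\<lambda>n. rect_count n / real n) (real (3 * Q\<^sup>2)) - ln 3 / 4 * ln (real (3 * Q\<^sup>2)) - main Q)
       \<le> 3 / real Q + 1 / (real Q)\<^sup>2) sequentially"
      using eventually_ge_at_top[of 1] by eventually_elim (use bound in auto)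
    show "(\<lambda>Q. 3 / real Q + 1 / (real Q)\<^sup>2) \<longlonglongrightarrow> 0" by real_asymp
  qed
  moreover have "main \<longlonglongrightarrow> ln 3 / 2 * euler_mascheroni - (\<Sum>n. ln3_defect (Suc n) / real (Suc n)) + (ln 3)\<^sup>2 / 8 - (ln 3)\<^sup>2 / 4"
  proof (rule Lim_transform_eventually)
    show "(\<lambda>Q. ln 3 / 2 * (harm Q - ln (real Q)) - D Q + (ln 3)\<^sup>2 / 8 - (ln 3)\<^sup>2 / 4) \<longlonglongrightarrow>
       ln 3 / 2 * euler_mascheroni - (\<Sum>n. ln3_defect (Suc n) / real (Suc n)) + (ln 3)\<^sup>2 / 8 - (ln 3)\<^sup>2 / 4"
    proof (intro tendsto_intros euler_mascheroni_LIMSEQ)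
      show "D \<longlonglongrightarrow> (\<Sum>n. ln3_defect (Suc n) / real (Suc n))"
        using summable_LIMSEQ[OF ln3_defect_summable] unfolding sum_lessThan_Suc_eq[of "\<lambda>n. ln3_defect n / real n"] D_def .
    qed
    show "eventually (\<lambda>Q. ln 3 / 2 * (harm Q - ln (real Q)) - D Q + (ln 3)\<^sup>2 / 8 - (ln 3)\<^sup>2 / 4 = main Q) sequentially"
      using eventually_ge_at_top[of 1]
    proof eventually_elim
      case (elim Q)
      have "ln (real (3 * Q\<^sup>2)) = ln 3 + 2 * ln (real Q)" using elim by (simp add: ln_mult ln_realpow)
      then have "main Q = ln 3 / 2 * harm Q - D Q + (ln 3)\<^sup>2 / 8 - ln 3 / 4 * (ln 3 + 2 * ln (real Q))"
        unfolding main_def by (simp only:)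
      then show ?case by (simp add: field_simps power2_eq_square)
    qed
  qed
  ultimately have "(\<lambda>Q. (summatory (\<lambda>n. rect_count n / real n) (real (3 * Q\<^sup>2)) - ln 3 / 4 * ln (real (3 * Q\<^sup>2)) - main Q) + main Q)
     \<longlonglongrightarrow> 0 + (ln 3 / 2 * euler_mascheroni - (\<Sum>n. ln3_defect (Suc n) / real (Suc n)) + (ln 3)\<^sup>2 / 8 - (ln 3)\<^sup>2 / 4)" by (rule tendsto_add)
  then show ?thesis by (simp add: algebra_simps power2_eq_square)
qed

lemma summatory_rect_count_div:
  obtains C where "\<And>y. y \<ge> 1 \<Longrightarrow> \<bar>summatory (\<lambda>n. rect_count n / real n) y -
    (ln 3 / 4 * ln y + (ln 3 / 4 * (2 * euler_mascheroni - ln 3 / 2) - (\<Sum>n. ln3_defect (Suc n) / real (Suc n))))\<bar> \<le> C / sqrt y"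
proof -
  have "filterlim (\<lambda>Q. real (3 * Q\<^sup>2)) at_top sequentially" by real_asymp
  from summatory_div_asymptotics'[OF summatory_rect_count this summatory_rect_count_div_limit] that
  show ?thesis by blast
qed

section \<open>The two series of the constant as one series over q\<close>

definition c_sum_even :: "nat \<Rightarrow> real" where
  "c_sum_even i = (let p = Suc i in 1 / real p * (ln 3 - (\<Sum>q\<in>{p<..3 * p - 1}. 1 / real q)))"

definition c_sum_odd :: "nat \<Rightarrow> real" where
  "c_sum_odd k = 4 / real (2 * k + 1) * (1 / 2 * ln 3 - (\<Sum>l\<in>{k<..3 * k}. 1 / real (2 * l + 1)))"

lemma c_sum_even_conv: "c_sum_even i = 4 * (ln3_defect (2 * Suc i) / real (2 * Suc i))"
proof -
  define p where "p = Suc i"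
  have "(\<Sum>j=1..2 * p - 1. 1 / (real (2 * p) + 2 * real j)) = (\<Sum>q\<in>{p<..3 * p - 1}. 1 / (2 * real q))"
    by (rule sum.reindex_bij_witness[of _ "\<lambda>q. q - p" "\<lambda>j. p + j"]) (auto simp: of_nat_diff)
  also have "\<dots> = (\<Sum>q\<in>{p<..3 * p - 1}. 1 / real q) / 2" by (simp add: sum_divide_distrib mult.commute)
  finally have d: "ln3_defect (2 * p) = ln 3 / 2 - (\<Sum>q\<in>{p<..3 * p - 1}. 1 / real q) / 2" by (simp add: ln3_defect_def)
  have "1 / real p * (ln 3 - S) = 4 * ((ln 3 / 2 - S / 2) / real (2 * p))" for S :: real
    by (simp add: p_def field_simps)
  then show ?thesis unfolding c_sum_even_def Let_def p_def[symmetric] d .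
qed

lemma c_sum_odd_conv: "c_sum_odd k = 4 * (ln3_defect (2 * k + 1) / real (2 * k + 1))"
proof -
  have "(\<Sum>j=1..2 * k + 1 - 1. 1 / (real (2 * k + 1) + 2 * real j)) = (\<Sum>l\<in>{k<..3 * k}. 1 / real (2 * l + 1))"
    by (rule sum.reindex_bij_witness[of _ "\<lambda>q. q - k" "\<lambda>j. k + j"]) (auto simp: of_nat_diff)
  then show ?thesis unfolding c_sum_odd_def ln3_defect_def by simp
qed

text \<open>As the summand at n belongs to q = n + 1, even q sit at odd positions and odd q at even
  ones; K terms of each interleave to 2 K terms of the whole.\<close>

lemma ln3_defect_series_split:
  "(\<Sum>i. c_sum_even i) + (\<Sum>k. c_sum_odd k) = 4 * (\<Sum>n. ln3_defect (Suc n) / real (Suc n))"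
proof -
  define a where "a = (\<lambda>n. ln3_defect (Suc n) / real (Suc n))"
  have a: "summable a" unfolding a_def by (rule ln3_defect_summable)
  have a0: "a n \<ge> 0" for n using ln3_defect_bounds[of "Suc n"] by (simp add: a_def)
  have ev: "c_sum_even i = 4 * a (2 * i + 1)" and od: "c_sum_odd i = 4 * a (2 * i)" for i
    unfolding c_sum_even_conv c_sum_odd_conv a_def by simp_all
  have sub: "summable (\<lambda>i. a (2 * i + 1))" "summable (\<lambda>i. a (2 * i))"
    using summable_reindex[OF a _ a0, of "\<lambda>i. 2 * i + 1"] summable_reindex[OF a _ a0, of "\<lambda>i. 2 * i"]
    by (auto simp: inj_def o_def)
  have fin: "(\<Sum>i<K. a (2 * i + 1)) + (\<Sum>i<K. a (2 * i)) = (\<Sum>n<2 * K. a n)" for K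
    by (induction K) simp_all
  have "(\<lambda>K. \<Sum>n<2 * K. a n) \<longlonglongrightarrow> suminf a"
    using summable_LIMSEQ[OF a] by (rule filterlim_compose) (intro filterlim_subseq strict_monoI, simp)
  moreover have "(\<lambda>K. (\<Sum>i<K. a (2 * i + 1)) + (\<Sum>i<K. a (2 * i))) \<longlonglongrightarrow> (\<Sum>i. a (2 * i + 1)) + (\<Sum>i. a (2 * i))"
    by (intro tendsto_add summable_LIMSEQ sub)
  ultimately have "(\<Sum>i. a (2 * i + 1)) + (\<Sum>i. a (2 * i)) = suminf a"
    unfolding fin using LIMSEQ_unique by blast
  moreover have "(\<Sum>i. c_sum_even i) = 4 * (\<Sum>i. a (2 * i + 1))" "(\<Sum>k. c_sum_odd k) = 4 * (\<Sum>i. a (2 * i))"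
    unfolding ev od using suminf_mult[OF sub(1), of 4] suminf_mult[OF sub(2), of 4] by simp_all
  ultimately show ?thesis unfolding a_def by simp
qed

section \<open>Classification of well-rounded sublattices\<close>

text \<open>With \<open>z = x + y \<rho>\<close> and \<open>p = q + 2 j\<close>, the generators are \<open>(p z + q \<theta> z) / 2\<close> and \<open>(p z - q \<theta> z) / 2\<close>.\<close>

definition rh_lat :: "int \<Rightarrow> int \<Rightarrow> int \<Rightarrow> int \<Rightarrow> complex set" where
  "rh_lat x y q j = lat (eis (j * x - q * y) ((q + j) * y + q * x)) (eis ((q + j) * x + q * y) (j * y - q * x))"

text \<open>All four follow from theta z being orthogonal to z with |theta z|^2 = 3 |z|^2, where p =
  q + 2 j. The last identity is the determinant, which becomes the index p q |z|^2.\<close>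

lemma rh_norms:
  "4 * eis_norm (j * x - q * y) ((q + j) * y + q * x) = ((q + 2 * j)\<^sup>2 + 3 * q\<^sup>2) * eis_norm x y"
  "eis_norm ((q + j) * x + q * y) (j * y - q * x) = eis_norm (j * x - q * y) ((q + j) * y + q * x)"
  "2 * eis_form (j * x - q * y) ((q + j) * y + q * x) ((q + j) * x + q * y) (j * y - q * x) = ((q + 2 * j)\<^sup>2 - 3 * q\<^sup>2) * eis_norm x y"
  "(j * x - q * y) * (j * y - q * x) - ((q + j) * y + q * x) * ((q + j) * x + q * y) = - ((q + 2 * j) * q * eis_norm x y)"
  by (simp_all add: eis_norm_def eis_form_def power2_eq_square algebra_simps)

text \<open>The two halves of the strict inequality amount to p^2 < 9 q^2 and q^2 < p^2.\<close>

lemma rh_form_less: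
  assumes "0 < q" "0 < j" "j < q" "0 < eis_norm x y"
  shows "\<bar>eis_form (j * x - q * y) ((q + j) * y + q * x) ((q + j) * x + q * y) (j * y - q * x)\<bar>
      < eis_norm (j * x - q * y) ((q + j) * y + q * x)" (is "\<bar>?f\<bar> < ?r")
proof -
  define p where "p = q + 2 * j"
  have p: "q < p" "p < 3 * q" using assms by (auto simp: p_def)
  have "q\<^sup>2 < p\<^sup>2" using p assms by (intro power_strict_mono) auto
  moreover have "p\<^sup>2 < (3 * q)\<^sup>2" using p assms by (intro power_strict_mono) auto
  ultimately have "\<bar>2 * (p\<^sup>2 - 3 * q\<^sup>2)\<bar> < p\<^sup>2 + 3 * q\<^sup>2" by (simp add: power_mult_distrib abs_less_iff)
  then have "\<bar>2 * (p\<^sup>2 - 3 * q\<^sup>2)\<bar> * eis_norm x y < (p\<^sup>2 + 3 * q\<^sup>2) * eis_norm x y"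
    using assms by (intro mult_strict_right_mono) auto
  moreover have "\<bar>2 * (p\<^sup>2 - 3 * q\<^sup>2)\<bar> * eis_norm x y = \<bar>4 * ?f\<bar>"
  proof -
    have "4 * ?f = 2 * (2 * ?f)" by simp
    also have "\<dots> = 2 * (p\<^sup>2 - 3 * q\<^sup>2) * eis_norm x y" unfolding rh_norms(3) p_def by (simp only: mult.assoc)
    finally show ?thesis using assms by (simp add: abs_mult)
  qed
  moreover have "(p\<^sup>2 + 3 * q\<^sup>2) * eis_norm x y = 4 * ?r" using rh_norms(1)[of j x q y] by (simp add: p_def)
  ultimately show ?thesis by simp
qed

lemma rh_norm_pos:
  assumes "0 < q" "0 < j" "j < q" "0 < eis_norm x y"
  shows "0 < eis_norm (j * x - q * y) ((q + j) * y + q * x)"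
  using rh_form_less[OF assms] by linarith

lemma rh_lat_index:
  assumes "0 < q" "0 < j" "j < q" "0 < eis_norm x y"
  shows "is_sublattice_of_index (rh_lat x y q j) hex_lattice (nat ((q + 2 * j) * q * eis_norm x y))"
proof -
  have "(q + 2 * j) * q * eis_norm x y > 0" using assms by simp
  moreover from this have "(j * x - q * y) * (j * y - q * x) - ((q + j) * y + q * x) * ((q + j) * x + q * y) \<noteq> 0"
    unfolding rh_norms(4) by linarith
  from lat_index[OF this, unfolded rh_norms(4)]
  have "is_sublattice_of_index (rh_lat x y q j) hex_lattice (nat \<bar>- ((q + 2 * j) * q * eis_norm x y)\<bar>)"
    unfolding rh_lat_def .
  ultimately show ?thesis by (simp only: abs_minus_cancel abs_of_pos)
qed

lemma rh_lat_well_rounded: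
  assumes "0 < q" "0 < j" "j < q" "0 < eis_norm x y"
  shows "well_rounded (rh_lat x y q j)"
  unfolding rh_lat_def using rh_norms(2) rh_norm_pos[OF assms] rh_form_less[OF assms] by (intro lat_well_rounded) auto

lemma coprime_parallel:
  fixes s t b1 b2 :: int
  assumes "coprime s t" "b1 * t = b2 * s"
  obtains k where "b1 = k * s" "b2 = k * t"
proof -
  obtain x y where "x * s + y * t = gcd s t" using bezout_int by blast
  then have b: "x * s + y * t = 1" using assms(1) by (simp add: coprime_iff_gcd_eq_1)
  show ?thesis
  proof (rule that[of "x * b1 + y * b2"])
    have "(x * b1 + y * b2) * s = b1 * (x * s) + y * (b2 * s)" by (simp add: algebra_simps)
    also have "\<dots> = b1 * (x * s + y * t)" unfolding assms(2)[symmetric] by (simp add: algebra_simps)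
    finally show "b1 = (x * b1 + y * b2) * s" using b by simp
    have "(x * b1 + y * b2) * t = x * (b1 * t) + b2 * (y * t)" by (simp add: algebra_simps)
    also have "\<dots> = b2 * (x * s + y * t)" unfolding assms(2) by (simp add: algebra_simps)
    finally show "b2 = (x * b1 + y * b2) * t" using b by simp
  qed
qed

text \<open>A primitive z has an odd coordinate, so integrality of (p z + q theta z) / 2 forces p
  and q to have equal parity; the witness is j = (p - q) / 2.\<close>

lemma rh_of_halves:
  fixes x y p q a b :: int
  assumes xy: "coprime x y" and q: "0 < q" "q < p" "p < 3 * q"
    and ab: "2 * a = p * x + q * (- x - 2 * y)" "2 * b = p * y + q * (2 * x + y)"
  obtains j where "0 < j" "j < q" "p = q + 2 * j" "eis a b = eis (j * x - q * y) ((q + j) * y + q * x)"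
    "eis (p * x - a) (p * y - b) = eis ((q + j) * x + q * y) (j * y - q * x)"
proof -
  have "even (p * x - q * x)" "even (p * y + q * y)" 
  proof -
    have "p * x - q * x = 2 * (a + q * y)" "p * y + q * y = 2 * (b - q * x)" using ab by (simp_all add: algebra_simps)
    then show "even (p * x - q * x)" "even (p * y + q * y)" by simp_all
  qed
  then have "even ((p - q) * x)" "even ((p + q) * y)" by (simp_all add: algebra_simps)
  moreover have "odd x \<or> odd y" using xy by (auto simp: coprime_def)
  ultimately have "even (p - q)" by auto
  then obtain j where j: "p - q = 2 * j" by (elim evenE)
  then have p: "p = q + 2 * j" by simp
  have "2 * a = 2 * (j * x - q * y)" "2 * b = 2 * ((q + j) * y + q * x)"
    using ab unfolding p by (simp_all add: algebra_simps)
  then have "a = j * x - q * y" "b = (q + j) * y + q * x" by simp_all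
  moreover from this have "p * x - a = (q + j) * x + q * y" "p * y - b = j * y - q * x"
    unfolding p by (simp_all add: algebra_simps)
  ultimately show ?thesis using that[of j] q p by simp
qed

text \<open>The diagonals A = v + w = g z and B = v - w are orthogonal, so B is parallel to theta z.
  If theta does not divide z, then B = k theta z and g plays the role of p; if z = theta u, then B =
  k u and g plays the role of q. The bounds q < p < 3 q come from |A|^2 = 2 r + F and |B|^2 = 2 r -
  F with 0 \<le> F < r.\<close>

lemma rhombic_param:
  assumes N: "eis_norm c d = eis_norm a b" "eis_norm a b > 0"
    and f: "0 \<le> eis_form a b c d" "eis_form a b c d < eis_norm a b"
  obtains x y q j where "coprime x y" "\<not> 3 dvd x - y" "0 < q" "0 < j" "j < q"
    "lat (eis a b) (eis c d) = rh_lat x y q j"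
proof -
  define r F where "r = eis_norm a b" and "F = eis_form a b c d"
  define A1 A2 B1 B2 where "A1 = a + c" and "A2 = b + d" and "B1 = a - c" and "B2 = b - d"
  have NA: "eis_norm A1 A2 = 2 * r + F" and NB: "eis_norm B1 B2 = 2 * r - F"
  proof -
    have "eis_norm A1 A2 = eis_norm a b + eis_norm c d + eis_form a b c d" "eis_norm B1 B2 = eis_norm a b + eis_norm c d - eis_form a b c d"
      by (simp_all add: A1_def A2_def B1_def B2_def eis_norm_def eis_form_def power2_eq_square algebra_simps)
    then show "eis_norm A1 A2 = 2 * r + F" "eis_norm B1 B2 = 2 * r - F" using N by (simp_all add: r_def F_def)
  qed
  have orth: "eis_form A1 A2 B1 B2 = 0"
  proof -
    have "eis_form A1 A2 B1 B2 = 2 * (eis_norm a b - eis_norm c d)"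
      by (simp add: A1_def A2_def B1_def B2_def eis_norm_def eis_form_def power2_eq_square algebra_simps)
    then show ?thesis using N by simp
  qed
  have rF: "r > 0" "0 \<le> F" "F < r" using N f by (auto simp: r_def F_def)
  have "eis_norm A1 A2 > 0" using NA rF by simp
  then have A0: "A1 \<noteq> 0 \<or> A2 \<noteq> 0" by (auto simp: eis_norm_def)
  define g where "g = gcd A1 A2"
  have g0: "g > 0" using A0 by (auto simp: g_def)
  have "gcd A1 A2 \<noteq> 0" using g0 by (simp add: g_def)
  from gcd_coprime_exists[OF this] obtain z1 z2 where z': "A1 = z1 * g" "A2 = z2 * g" and cz: "coprime z1 z2"
    unfolding g_def by blast
  have z: "A1 = g * z1" "A2 = g * z2" unfolding z' by (rule mult.commute)+
  define N where "N = eis_norm z1 z2"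
  have NgN: "g\<^sup>2 * N = 2 * r + F" using NA unfolding z N_def eis_norm_scale .
  then have "N \<noteq> 0" using rF by (intro notI) simp
  then have Npos: "N > 0" using eis_norm_nonneg[of z1 z2] unfolding N_def[symmetric] by linarith
  have "g * (B1 * (2 * z1 + z2) - B2 * (- z1 - 2 * z2)) = 0"
    using orth unfolding z eis_form_def by (simp add: algebra_simps)
  \<comment> \<open>Orthogonality to z, rewritten as parallelism with theta z, whose coordinates are
    - z1 - 2 z2 and 2 z1 + z2.\<close>
  then have orth': "B1 * (2 * z1 + z2) = B2 * (- z1 - 2 * z2)" using g0 by simp
  have sq_less: "u < v" if "u\<^sup>2 * M < v\<^sup>2 * M" "M > 0" "v > 0" for u v M :: int
  proof -
    have "u\<^sup>2 < v\<^sup>2" using that by (simp add: mult_less_cancel_right)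
    then show ?thesis using that(3) power_less_imp_less_base[of u 2 v] by simp
  qed
  have ab: "2 * a = A1 + B1" "2 * b = A2 + B2" "2 * c = A1 - B1" "2 * d = A2 - B2" by (simp_all add: A1_def A2_def B1_def B2_def)
  show ?thesis
  proof (cases "3 dvd z1 - z2")
    case False
    obtain k where k: "B1 = k * (- z1 - 2 * z2)" "B2 = k * (2 * z1 + z2)"
      using coprime_parallel[OF coprime_theta[OF cz False] orth'] by blast
    have "eis_norm B1 B2 = k\<^sup>2 * (3 * N)"
      unfolding k eis_norm_scale N_def by (simp add: eis_norm_def power2_eq_square algebra_simps)
    then have kN: "3 * (k\<^sup>2 * N) = 2 * r - F" using NB by simp
    then have k0: "k \<noteq> 0" using rF by auto
    define q where "q = \<bar>k\<bar>"
    have q: "q > 0" "q\<^sup>2 = k\<^sup>2" using k0 by (auto simp: q_def)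
    have q3: "(3 * q)\<^sup>2 * N = 3 * (3 * (k\<^sup>2 * N))" by (simp add: q(2) power_mult_distrib)
    have "q\<^sup>2 * N < g\<^sup>2 * N" unfolding q(2) using NgN kN rF by linarith
    then have "q < g" by (rule sq_less[OF _ Npos g0])
    moreover have "g\<^sup>2 * N < (3 * q)\<^sup>2 * N" unfolding q3 using NgN kN rF by linarith
    then have "g < 3 * q" by (rule sq_less[OF _ Npos]) (use q(1) in simp)
    ultimately have qg: "q < g" "g < 3 * q" .
    show ?thesis
    \<comment> \<open>The sign of k decides which of v and w equals half of p z + q theta z.\<close>
    proof (cases "k > 0")
      case True
      then have kq: "k = q" by (simp add: q_def)
      obtain j where j: "0 < j" "j < q" "g = q + 2 * j" "eis a b = eis (j * z1 - q * z2) ((q + j) * z2 + q * z1)"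
        "eis (g * z1 - a) (g * z2 - b) = eis ((q + j) * z1 + q * z2) (j * z2 - q * z1)"
        using rh_of_halves[OF cz q(1) qg, of a b] ab unfolding z k kq by blast
      have gz: "g * z1 - a = c" "g * z2 - b = d" using z by (simp_all add: A1_def A2_def)
      have "lat (eis a b) (eis c d) = rh_lat z1 z2 q j" unfolding rh_lat_def j(4,5)[symmetric] gz ..
      then show ?thesis using that[OF cz False q(1) j(1,2)] by simp
    next
      case k': False
      then have kq: "k = - q" by (simp add: q_def)
      have "2 * c = g * z1 + q * (- z1 - 2 * z2)" "2 * d = g * z2 + q * (2 * z1 + z2)"
        using ab unfolding z k kq by simp_all
      then obtain j where j: "0 < j" "j < q" "g = q + 2 * j" "eis c d = eis (j * z1 - q * z2) ((q + j) * z2 + q * z1)"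
        "eis (g * z1 - c) (g * z2 - d) = eis ((q + j) * z1 + q * z2) (j * z2 - q * z1)"
        using rh_of_halves[OF cz q(1) qg, of c d] by blast
      have gz: "g * z1 - c = a" "g * z2 - d = b" using z by (simp_all add: A1_def A2_def)
      have "lat (eis c d) (eis a b) = rh_lat z1 z2 q j" unfolding rh_lat_def j(4,5)[symmetric] gz ..
      then show ?thesis using that[OF cz False q(1) j(1,2)] lat_swap[of "eis a b" "eis c d"] by simp
    qed
  next
    case True
    then obtain m where m: "z1 = z2 + 3 * m" by (metis add.commute diff_add_cancel dvdE)
    \<comment> \<open>The quotient of z by theta; being primitive, z is not divisible by theta a
      second time.\<close>
    define u1 u2 where "u1 = z2 + m" and "u2 = - z2 - 2 * m"
    have zu: "z1 = - u1 - 2 * u2" "z2 = 2 * u1 + u2" by (simp_all add: u1_def u2_def m)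
    have cu: "coprime u1 u2"
    proof (rule coprimeI)
      fix e assume "e dvd u1" "e dvd u2"
      then have "e dvd z1" "e dvd z2" unfolding zu by simp_all
      then show "is_unit e" using cz by (meson coprime_def)
    qed
    have nu: "\<not> 3 dvd u1 - u2"
    proof
      assume *: "3 dvd u1 - u2"
      have "3 dvd z1" "3 dvd z2" using * unfolding zu by presburger+
      then have "is_unit (3 :: int)" using cz by (meson coprime_def)
      then show False by simp
    qed
    have "B1 * u2 = B2 * u1" using orth' unfolding zu by (simp add: algebra_simps)
    then obtain k where k: "B1 = k * u1" "B2 = k * u2" using coprime_parallel[OF cu] by blast
    define M where "M = eis_norm u1 u2"
    have NM: "N = 3 * M" unfolding N_def M_def zu by (simp add: eis_norm_def power2_eq_square algebra_simps)
    have Mpos: "M > 0" using Npos NM by simp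
    have kM: "k\<^sup>2 * M = 2 * r - F" using NB unfolding k eis_norm_scale M_def .
    then have k0: "k \<noteq> 0" using rF by auto
    define p where "p = \<bar>k\<bar>"
    have p: "p > 0" "p\<^sup>2 = k\<^sup>2" using k0 by (auto simp: p_def)
    have gM: "3 * (g\<^sup>2 * M) = 2 * r + F" using NgN unfolding NM by simp
    have g3: "(3 * g)\<^sup>2 * M = 3 * (3 * (g\<^sup>2 * M))" by (simp add: power_mult_distrib)
    have "g\<^sup>2 * M < p\<^sup>2 * M" unfolding p(2) using gM kM rF by linarith
    then have "g < p" by (rule sq_less[OF _ Mpos p(1)])
    moreover have "p\<^sup>2 * M < (3 * g)\<^sup>2 * M" unfolding p(2) g3 using gM kM rF by linarith
    then have "p < 3 * g" by (rule sq_less[OF _ Mpos]) (use g0 in simp)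
    ultimately have gp: "g < p" "p < 3 * g" .
    have negE: "- eis s t = eis (- s) (- t)" for s t by (rule eis_uminus)
    show ?thesis
    proof (cases "k > 0")
      case True
      then have kp: "k = p" by (simp add: p_def)
      have "2 * a = p * u1 + g * (- u1 - 2 * u2)" "2 * b = p * u2 + g * (2 * u1 + u2)"
        using ab unfolding z k kp zu by simp_all
      then obtain j where j: "0 < j" "j < g" "p = g + 2 * j" "eis a b = eis (j * u1 - g * u2) ((g + j) * u2 + g * u1)"
        "eis (p * u1 - a) (p * u2 - b) = eis ((g + j) * u1 + g * u2) (j * u2 - g * u1)"
        using rh_of_halves[OF cu g0 gp, of a b] by blast
      \<comment> \<open>With the diagonals exchanged, the complementary generator is - w; a change
        of sign keeps the lattice.\<close>
      have gz: "p * u1 - a = - c" "p * u2 - b = - d" using ab k unfolding kp by simp_all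
      have "lat (eis a b) (- eis c d) = rh_lat u1 u2 g j" unfolding rh_lat_def j(4,5)[symmetric] gz negE ..
      then show ?thesis using that[OF cu nu g0 j(1,2)] lat_uminus[of "eis a b" "eis c d"] by simp
    next
      case k': False
      then have kp: "k = - p" by (simp add: p_def)
      have "2 * c = p * u1 + g * (- u1 - 2 * u2)" "2 * d = p * u2 + g * (2 * u1 + u2)"
        using ab unfolding z k kp zu by simp_all
      then obtain j where j: "0 < j" "j < g" "p = g + 2 * j" "eis c d = eis (j * u1 - g * u2) ((g + j) * u2 + g * u1)"
        "eis (p * u1 - c) (p * u2 - d) = eis ((g + j) * u1 + g * u2) (j * u2 - g * u1)"
        using rh_of_halves[OF cu g0 gp, of c d] by blast
      have gz: "p * u1 - c = - a" "p * u2 - d = - b" using ab k unfolding kp by simp_all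
      have "lat (eis c d) (- eis a b) = rh_lat u1 u2 g j" unfolding rh_lat_def j(4,5)[symmetric] gz negE ..
      then show ?thesis using that[OF cu nu g0 j(1,2)] lat_uminus[of "eis c d" "eis a b"] lat_swap[of "eis a b" "eis c d"] by simp
    qed
  qed
qed

text \<open>The gcd of the coordinates recovers the positive factor of a primitive vector.\<close>

lemma coprime_multiples_eq:
  fixes p p' x y x' y' :: int
  assumes "p > 0" "p' > 0" "coprime x y" "coprime x' y'" "p' * x' = p * x" "p' * y' = p * y"
  shows "p' = p \<and> x' = x \<and> y' = y"
proof -
  have "gcd (p' * x') (p' * y') = p'" "gcd (p * x) (p * y) = p" using assms(1-4) by (simp_all add: gcd_mult_left coprime_iff_gcd_eq_1)
  then have "p' = p" using assms(5,6) by simp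
  then show ?thesis using assms by simp
qed

text \<open>The four minimal vectors determine the basis up to order and signs, so p' z' = v' + w'
  is up to sign p z or q theta z. The latter is impossible since theta does not divide z'.\<close>

lemma rh_lat_eq_imp:
  assumes 1: "coprime x y" "\<not> 3 dvd x - y" "0 < q" "0 < j" "j < q"
    and 2: "coprime x' y'" "\<not> 3 dvd x' - y'" "0 < q'" "0 < j'" "j' < q'"
    and eq: "rh_lat x' y' q' j' = rh_lat x y q j"
  shows "q' + 2 * j' = q + 2 * j \<and> (x' = x \<and> y' = y \<or> x' = - x \<and> y' = - y)"
proof -
  have pos: "eis_norm x y > 0" if "coprime x y" for x y
  proof -
    have "x \<noteq> 0 \<or> y \<noteq> 0" using that by auto
    then show ?thesis using eis_norm_nonneg[of x y] eis_norm_eq_0_iff[of x y] by linarith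
  qed
  define V1 V2 W1 W2 where "V1 = j * x - q * y" and "V2 = (q + j) * y + q * x" and "W1 = (q + j) * x + q * y" and "W2 = j * y - q * x"
  define V1' V2' W1' W2' where "V1' = j' * x' - q' * y'" and "V2' = (q' + j') * y' + q' * x'" and "W1' = (q' + j') * x' + q' * y'" and "W2' = j' * y' - q' * x'"
  note defs = V1_def V2_def W1_def W2_def and defs' = V1'_def V2'_def W1'_def W2'_def
  have L: "rh_lat x y q j = lat (eis V1 V2) (eis W1 W2)" "rh_lat x' y' q' j' = lat (eis V1' V2') (eis W1' W2')"
    by (simp_all add: rh_lat_def defs defs')
  have c: "eis_norm W1 W2 = eis_norm V1 V2" "eis_norm V1 V2 > 0" "\<bar>eis_form V1 V2 W1 W2\<bar> < eis_norm V1 V2"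
    using rh_norms(2) rh_norm_pos[OF 1(3-5) pos[OF 1(1)]] rh_form_less[OF 1(3-5) pos[OF 1(1)]] by (simp_all add: defs)
  have c': "eis_norm W1' W2' = eis_norm V1' V2'" "eis_norm V1' V2' > 0" "\<bar>eis_form V1' V2' W1' W2'\<bar> < eis_norm V1' V2'"
    using rh_norms(2) rh_norm_pos[OF 2(3-5) pos[OF 2(1)]] rh_form_less[OF 2(3-5) pos[OF 2(1)]] by (simp_all add: defs')
  have "eis V1' V2' \<in> minimal_vectors (rh_lat x y q j)" "eis W1' W2' \<in> minimal_vectors (rh_lat x y q j)"
    using lat_minimal_vectors(1,2)[OF c'(1,2) less_imp_le[OF c'(3)]] unfolding eq[symmetric] L(2) .
  note mem = this[unfolded L(1), THEN lat_minimal_vectors(3)[OF c(1,2) less_imp_le[OF c(3)] _ c(3)]]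
  \<comment> \<open>Independence excludes that v' and w' are equal or opposite.\<close>
  have det: "V1' * W2' - V2' * W1' \<noteq> 0" using c' by (intro lat_det_nonzero) auto
  have s: "V1 + W1 = (q + 2 * j) * x" "V2 + W2 = (q + 2 * j) * y" "V1 - W1 = q * (- x - 2 * y)" "V2 - W2 = q * (2 * x + y)"
    by (simp_all add: defs algebra_simps)
  have s': "(q' + 2 * j') * x' = V1' + W1'" "(q' + 2 * j') * y' = V2' + W2'"
    by (simp_all add: defs' algebra_simps)
  let ?p = "q + 2 * j" and ?p' = "q' + 2 * j'"
  have th: False if "?p' * x' = q * (- X - 2 * Y)" "?p' * y' = q * (2 * X + Y)" "coprime X Y" "\<not> 3 dvd X - Y" for X Y
  proof -
    have "x' = - X - 2 * Y \<and> y' = 2 * X + Y"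
      using coprime_multiples_eq[of q ?p' "- X - 2 * Y" "2 * X + Y" x' y'] coprime_theta[OF that(3,4)] that 1 2 by simp
    then have "3 dvd x' - y'" by presburger
    with 2 show False by simp
  qed
  have neg: "coprime (- x) (- y)" "\<not> 3 dvd - x - (- y)" using 1 by (simp, presburger)
  consider "?p' * x' = ?p * x \<and> ?p' * y' = ?p * y" | "?p' * x' = ?p * (- x) \<and> ?p' * y' = ?p * (- y)"
    | "?p' * x' = q * (- x - 2 * y) \<and> ?p' * y' = q * (2 * x + y)"
    | "?p' * x' = q * (- (- x) - 2 * (- y)) \<and> ?p' * y' = q * (2 * (- x) + (- y))"
    using mem det unfolding s' eis_uminus eis_eq_iff insert_iff empty_iff
    by (elim disjE) (use s in \<open>auto simp: algebra_simps\<close>)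
  then show ?thesis
  proof cases
    case 1
    then show ?thesis using coprime_multiples_eq[of ?p ?p' x y x' y'] assms by simp
  next
    case 2
    then show ?thesis using coprime_multiples_eq[of ?p ?p' "- x" "- y" x' y'] neg assms by simp
  next
    case 3
    then show ?thesis using th[of x y] assms by blast
  next
    case 4
    then show ?thesis using th[of "- x" "- y"] neg by blast
  qed
qed

lemma rh_lat_uminus: "rh_lat (- x) (- y) q j = rh_lat x y q j"
proof -
  have "rh_lat (- x) (- y) q j = lat (- eis (j * x - q * y) ((q + j) * y + q * x)) (- eis ((q + j) * x + q * y) (j * y - q * x))"
    unfolding rh_lat_def eis_uminus by (simp add: algebra_simps)
  then show ?thesis unfolding rh_lat_def by (metis lat_swap lat_uminus)
qed

lemma lat_diff: "lat v (v - w) = lat v w"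
proof -
  have "lat v (v - w) \<subseteq> lat v w" for v w
  proof
    fix u assume "u \<in> lat v (v - w)"
    then obtain m k where "u = of_int m * v + of_int k * (v - w)" by (auto simp: lat_def)
    then have "u = of_int (m + k) * v + of_int (- k) * w" by (simp add: algebra_simps)
    then show "u \<in> lat v w" by (simp only: lat_memI)
  qed
  from this[of v w] this[of v "v - w"] show ?thesis by auto
qed

section \<open>Hexagonal sublattices as principal ideals\<close>

text \<open>The ideal generated by a + b rho; the second generator is rho times the first.\<close>

definition hex_lat :: "int \<Rightarrow> int \<Rightarrow> complex set" where
  "hex_lat a b = lat (eis a b) (eis (- b) (a + b))"

lemma hex_lat_forms: "eis_norm (- b) (a + b) = eis_norm a b" "eis_form a b (- b) (a + b) = eis_norm a b" "a * (a + b) - b * (- b) = eis_norm a b"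
  by (simp_all add: eis_norm_def eis_form_def power2_eq_square algebra_simps)

lemma hex_lat_conv: "hex_lat a b = {eis a b * eis m k | m k. True}"
  by (auto simp: hex_lat_def lat_def eis_scale eis_add eis_mult algebra_simps)

text \<open>When the form equals r, the Gram identity makes the determinant r or - r, so v and w
  enclose 60 degrees: w is rho v or v - rho v, and both span the same lattice with v.\<close>

lemma hexagonal_param:
  assumes N: "eis_norm c d = eis_norm a b" "eis_norm a b > 0" and f: "eis_form a b c d = eis_norm a b"
  shows "lat (eis a b) (eis c d) = hex_lat a b"
proof -
  define r where "r = eis_norm a b"
  have "(a * d - b * c)\<^sup>2 = r\<^sup>2" using eis_form_identity[of a b c d] N f by (simp add: r_def power2_eq_square)
  then have disj: "a * d - b * c = r \<or> a * d - b * c = - r" by (simp only: power2_eq_iff)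
  have F: "(2 * a + b) * c + (a + 2 * b) * d = r" using f by (simp add: eis_form_def r_def algebra_simps)
  \<comment> \<open>Cramer's rule for (c, d) from the values of the form and of the determinant; the
    system itself has determinant 2 r.\<close>
  have id: "2 * r * c = r * a - (a + 2 * b) * (a * d - b * c)" "2 * r * d = r * b + (2 * a + b) * (a * d - b * c)"
  proof -
    have "2 * eis_norm a b * c = ((2 * a + b) * c + (a + 2 * b) * d) * a - (a + 2 * b) * (a * d - b * c)"
      "2 * eis_norm a b * d = ((2 * a + b) * c + (a + 2 * b) * d) * b + (2 * a + b) * (a * d - b * c)"
      by (simp_all add: eis_norm_def power2_eq_square algebra_simps)
    then show "2 * r * c = r * a - (a + 2 * b) * (a * d - b * c)" "2 * r * d = r * b + (2 * a + b) * (a * d - b * c)"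
      unfolding F r_def[symmetric] by simp_all
  qed
  have "r > 0" using N by (simp add: r_def)
  then have r2: "2 * r \<noteq> 0" by simp
  from disj show ?thesis
  proof (elim disjE)
    assume D: "a * d - b * c = r"
    have "(2 * r) * c = (2 * r) * (- b)" "(2 * r) * d = (2 * r) * (a + b)" using id unfolding D by (simp_all add: algebra_simps)
    then have "c = - b" "d = a + b" unfolding mult_left_cancel[OF r2] .
    then show ?thesis by (simp add: hex_lat_def)
  next
    assume D: "a * d - b * c = - r"
    have "(2 * r) * c = (2 * r) * (a + b)" "(2 * r) * d = (2 * r) * (- a)" using id unfolding D by (simp_all add: algebra_simps)
    then have "c = a + b" "d = - a" unfolding mult_left_cancel[OF r2] .
    then have "eis c d = eis a b - eis (- b) (a + b)" by (simp add: eis_diff)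
    then show ?thesis by (simp add: hex_lat_def lat_diff)
  qed
qed

lemma card_fibres:
  assumes "finite A" "\<And>x. x \<in> A \<Longrightarrow> card {y \<in> A. f y = f x} = k"
  shows "card A = k * card (f ` A)"
proof -
  have "card A = (\<Sum>b\<in>f ` A. \<Sum>y\<in>{y \<in> A. f y = b}. 1)" using sum.image_gen[OF assms(1), of "\<lambda>_. 1 :: nat" f] by simp
  also have "\<dots> = (\<Sum>b\<in>f ` A. k)" using assms by (intro sum.cong) auto
  finally show ?thesis by simp
qed

section \<open>Counting the two families\<close>

definition hex_wr :: "nat \<Rightarrow> complex set set" where
  "hex_wr n = (\<lambda>(a, b). hex_lat a b) ` eis_reps n"

text \<open>The index n = m p q is distributed over m = |z|^2 and the pair (p, q), which makes the
  count a Dirichlet convolution.\<close>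

definition rh_params :: "nat \<Rightarrow> (nat \<times> (int \<times> int) \<times> (nat \<times> nat)) set" where
  "rh_params n = (SIGMA m:{m. m dvd n}. prim3_reps m \<times> rect_pairs (n div m))"

definition rh_of :: "nat \<times> (int \<times> int) \<times> (nat \<times> nat) \<Rightarrow> complex set" where
  "rh_of = (\<lambda>(m, (x, y), (p, q)). rh_lat x y (int q) ((int p - int q) div 2))"

text \<open>Two elements generate the same ideal exactly when they differ by one of the six
  units.\<close>

lemma card_hex_wr:
  assumes n: "n > 0"
  shows "real (card (hex_wr n)) = hex_ideals n"
proof -
  let ?f = "\<lambda>(a, b). hex_lat a b"
  have "card (eis_reps n) = 6 * card (hex_wr n)"
    unfolding hex_wr_def
  proof (rule card_fibres)
    fix z assume z: "z \<in> eis_reps n"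
    obtain a b where ab: "z = (a, b)" by (cases z)
    have N: "eis_norm a b = int n" using z by (simp add: ab eis_reps_def)
    define g where "g = (\<lambda>(m, k). (a * m - b * k, a * k + b * m + b * k))"
    have geis: "eis (fst (g (m, k))) (snd (g (m, k))) = eis a b * eis m k" for m k by (simp add: g_def eis_mult)
    have nz: "eis a b \<noteq> 0" using N n by (metis eis_0 eis_eq_iff eis_norm_eq_0_iff of_nat_0_less_iff less_irrefl)
    have inj: "inj g"
    proof (rule injI, clarify)
      fix m k m' k' assume "g (m, k) = g (m', k')"
      then have "eis a b * eis m k = eis a b * eis m' k'" using geis by metis
      then show "m = m' \<and> k = k'" using nz by simp
    qed
    have normg: "eis_norm (fst (g (m, k))) (snd (g (m, k))) = int n * eis_norm m k" for m k
      using eis_norm_mult[of a m b k] N by (simp add: g_def)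
    have "{y \<in> eis_reps n. ?f y = ?f z} = g ` eis_reps 1"
    proof (intro equalityI subsetI)
      fix y assume y: "y \<in> {y \<in> eis_reps n. ?f y = ?f z}"
      obtain c d where cd: "y = (c, d)" by (cases y)
      have "eis c d = eis c d * eis 1 0" by (simp add: eis_mult)
      then have "eis c d \<in> hex_lat c d" unfolding hex_lat_conv by blast
      then have "eis c d \<in> hex_lat a b" using y by (simp add: cd ab)
      then obtain m k where mk: "eis c d = eis a b * eis m k" unfolding hex_lat_conv by blast
      have "eis (fst (g (m, k))) (snd (g (m, k))) = eis c d" unfolding geis mk ..
      then have gy: "g (m, k) = y" unfolding eis_eq_iff cd by (simp add: prod_eq_iff)
      have "int n * eis_norm m k = int n" using normg[of m k] gy y by (simp add: cd eis_reps_def)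
      then have "eis_norm m k = 1" using n by simp
      then show "y \<in> g ` eis_reps 1" using gy by (auto simp: eis_reps_def intro!: image_eqI[of _ _ "(m, k)"])
    next
      fix y assume "y \<in> g ` eis_reps 1"
      then obtain m k where mk: "y = g (m, k)" "eis_norm m k = 1" by (auto simp: eis_reps_def)
      obtain c d where cd: "y = (c, d)" by (cases y)
      have gcd: "g (m, k) = (c, d)" using mk(1) cd by simp
      then have e: "eis c d = eis a b * eis m k" using geis[of m k] by simp
      \<comment> \<open>The inverse of a unit is its conjugate.\<close>
      have u: "eis m k * eis (m + k) (- k) = 1"
      proof -
        have "eis m k * eis (m + k) (- k) = eis (eis_norm m k) 0" by (simp add: eis_mult eis_norm_def power2_eq_square algebra_simps)
        then show ?thesis using mk(2) by (simp add: eis_def)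
      qed
      have "eis_norm c d = int n" using normg[of m k] mk(2) unfolding gcd by simp
      moreover have "hex_lat c d = hex_lat a b"
      proof (intro equalityI subsetI)
        fix v assume "v \<in> hex_lat c d"
        then obtain s t where "v = eis c d * eis s t" by (auto simp: hex_lat_conv)
        then have "v = eis a b * (eis m k * eis s t)" using e by simp
        then show "v \<in> hex_lat a b" unfolding hex_lat_conv eis_mult[of m k s t] by blast
      next
        fix v assume "v \<in> hex_lat a b"
        then obtain s t where v: "v = eis a b * eis s t" by (auto simp: hex_lat_conv)
        have "v = eis a b * (eis m k * eis (m + k) (- k)) * eis s t" unfolding u v by simp
        then have "v = eis c d * (eis (m + k) (- k) * eis s t)" using e by (simp add: mult.assoc)
        then show "v \<in> hex_lat c d" unfolding hex_lat_conv eis_mult[of "m + k"] by blast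
      qed
      ultimately show "y \<in> {y \<in> eis_reps n. ?f y = ?f z}" by (simp add: cd ab eis_reps_def)
    qed
    moreover have "card (eis_reps 1) = 6" unfolding eis_reps_1 by simp
    ultimately show "card {y \<in> eis_reps n. ?f y = ?f z} = 6" using inj by (simp add: card_image inj_on_subset)
  qed simp
  then show ?thesis using card_eis_reps[OF n] by simp
qed

lemma rh_params_mem:
  assumes "t \<in> rh_params n" "n > 0"
  obtains m x y p q where "t = (m, (x, y), (p, q))" "eis_norm x y = int m" "coprime x y" "\<not> 3 dvd x - y"
    "m > 0" "p * q * m = n" "0 < int q" "0 < (int p - int q) div 2" "(int p - int q) div 2 < int q"
    "int p = int q + 2 * ((int p - int q) div 2)"
proof -
  obtain m x y p q where t: "t = (m, (x, y), (p, q))" by (metis prod.exhaust)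
  have *: "m dvd n" "(x, y) \<in> prim3_reps m" "(p, q) \<in> rect_pairs (n div m)" using assms(1) by (auto simp: t rh_params_def)
  then have xy: "eis_norm x y = int m" "coprime x y" "\<not> 3 dvd x - y" by (auto simp: prim3_reps_def eis_reps_def)
  have pq: "p * q = n div m" "q < p" "p < 3 * q" "even (p + q)" using * by (auto simp: rect_pairs_def)
  have m0: "m > 0" using *(1) assms(2) by (auto intro: Nat.gr0I)
  have "even (int p - int q)" using pq(4) by presburger
  then have j: "int p - int q = 2 * ((int p - int q) div 2)" by simp
  have "p * q * m = n" using pq(1) *(1) by simp
  moreover have "0 < (int p - int q) div 2" "(int p - int q) div 2 < int q" "0 < int q" using pq j by linarith+
  ultimately show ?thesis using that[OF t xy m0] j by simp
qed

text \<open>Every fibre of \<open>rh_of\<close> consists of exactly two parameters, with z and -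
  z.\<close>

lemma card_rh_of:
  assumes n: "n > 0"
  shows "real (card (rh_of ` rh_params n)) = dconv prim3_half rect_count n"
proof -
  have fin: "finite (rh_params n)" unfolding rh_params_def by (intro finite_SigmaI finite_cartesian_product) (use n in auto)
  have "card (rh_params n) = 2 * card (rh_of ` rh_params n)"
  proof (rule card_fibres[OF fin])
    fix t assume t: "t \<in> rh_params n"
    obtain m x y p q where xy: "t = (m, (x, y), (p, q))" "eis_norm x y = int m" "coprime x y" "\<not> 3 dvd x - y"
      "m > 0" "p * q * m = n" "0 < int q" "0 < (int p - int q) div 2" "(int p - int q) div 2 < int q"
      "int p = int q + 2 * ((int p - int q) div 2)" using rh_params_mem[OF t n] by metis
    have "{s \<in> rh_params n. rh_of s = rh_of t} = {t, (m, (- x, - y), (p, q))}"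
    proof (intro equalityI subsetI)
      fix s assume s: "s \<in> {s \<in> rh_params n. rh_of s = rh_of t}"
      then have s1: "s \<in> rh_params n" by simp
      obtain m' x' y' p' q' where xy': "s = (m', (x', y'), (p', q'))" "eis_norm x' y' = int m'" "coprime x' y'" "\<not> 3 dvd x' - y'"
      "m' > 0" "p' * q' * m' = n" "0 < int q'" "0 < (int p' - int q') div 2" "(int p' - int q') div 2 < int q'"
      "int p' = int q' + 2 * ((int p' - int q') div 2)" using rh_params_mem[OF s1 n] by metis
      have eq: "rh_lat x' y' (int q') ((int p' - int q') div 2) = rh_lat x y (int q) ((int p - int q) div 2)"
        using s by (simp add: xy(1) xy'(1) rh_of_def)
      have z: "int q' + 2 * ((int p' - int q') div 2) = int q + 2 * ((int p - int q) div 2) \<and>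
          (x' = x \<and> y' = y \<or> x' = - x \<and> y' = - y)"
        using rh_lat_eq_imp[OF xy(3,4,7,8,9) xy'(3,4,7,8,9) eq] .
      then have "eis_norm x' y' = eis_norm x y" by (auto simp: eis_norm_def)
      then have m: "m' = m" using xy(2) xy'(2) by simp
      have p: "p' = p" using z xy(10) xy'(10) by linarith
      \<comment> \<open>\<open>rh_lat_eq_imp\<close> fixes only p and, up to sign, z; then q follows
        from the common index.\<close>
      have "p * q' * m = p * q * m" using xy(6) xy'(6) m p by simp
      moreover have "p > 0" using xy(7,8,10) by linarith
      ultimately have "p' = p \<and> q' = q" using p xy(5) by simp
      then show "s \<in> {t, (m, (- x, - y), (p, q))}" using z m by (auto simp: xy(1) xy'(1))
    next
      fix s assume "s \<in> {t, (m, (- x, - y), (p, q))}"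
      moreover have "(- x, - y) \<in> prim3_reps m"
      proof -
        have "\<not> 3 dvd - x - (- y)" using xy(4) by presburger
        then show ?thesis using xy by (simp add: prim3_reps_def eis_reps_def eis_norm_def)
      qed
      moreover have "rh_of (m, (- x, - y), (p, q)) = rh_of t" by (simp add: rh_of_def xy(1) rh_lat_uminus)
      ultimately show "s \<in> {s \<in> rh_params n. rh_of s = rh_of t}" using t by (auto simp: xy(1) rh_params_def)
    qed
    moreover have "t \<noteq> (m, (- x, - y), (p, q))" using xy by auto
    ultimately show "card {s \<in> rh_params n. rh_of s = rh_of t} = 2" by simp
  qed
  moreover have "card (rh_params n) = (\<Sum>m | m dvd n. card (prim3_reps m) * card (rect_pairs (n div m)))"
    unfolding rh_params_def by (subst card_SigmaI) (use n in \<open>auto simp: card_cartesian_product\<close>)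
  ultimately have "2 * real (card (rh_of ` rh_params n)) = (\<Sum>m | m dvd n. real (card (prim3_reps m)) * real (card (rect_pairs (n div m))))"
    by (metis (mono_tags, lifting) of_nat_mult of_nat_numeral of_nat_sum sum.cong)
  then show ?thesis by (simp add: dconv_def prim3_half_def rect_count_def flip: sum_divide_distrib)
qed

text \<open>Whether the form attains the norm separates the two families, and the determinant, being
  the index, yields the equation that places the parameters at n.\<close>

lemma wr_sublattices_conv:
  assumes n: "n > 0"
  shows "{L. is_sublattice_of_index L hex_lattice n \<and> well_rounded L} = hex_wr n \<union> rh_of ` rh_params n"
proof (intro equalityI subsetI)
  fix L assume "L \<in> {L. is_sublattice_of_index L hex_lattice n \<and> well_rounded L}"
  then have L: "is_sublattice_of_index L hex_lattice n" "well_rounded L" by auto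
  then have "subgroup L (additive_group hex_lattice)" by (simp add: is_sublattice_of_index_def)
  then obtain a b c d where abcd: "L = lat (eis a b) (eis c d)" "eis_norm a b = eis_norm c d" "eis_norm a b > 0"
    "0 \<le> eis_form a b c d" "eis_form a b c d \<le> eis_norm a b" using well_rounded_obtain_basis L(2) by blast
  have idx: "is_sublattice_of_index L hex_lattice m \<Longrightarrow> m = n" for m using L(1) by (simp add: is_sublattice_of_index_def)
  show "L \<in> hex_wr n \<union> rh_of ` rh_params n"
  proof (cases "eis_form a b c d = eis_norm a b")
    case True
    then have Lh: "L = hex_lat a b" unfolding abcd(1) using abcd by (intro hexagonal_param) auto
    have "is_sublattice_of_index L hex_lattice (nat \<bar>a * (a + b) - b * (- b)\<bar>)"
      unfolding Lh hex_lat_def by (rule lat_index) (use abcd(3) in \<open>unfold hex_lat_forms(3), linarith\<close>)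
    then have "nat (eis_norm a b) = n" using idx hex_lat_forms(3)[of a b] abcd(3) by (simp del: mult_minus_right)
    then have "(a, b) \<in> eis_reps n" using abcd(3) by (auto simp: eis_reps_def)
    then show ?thesis unfolding Lh hex_wr_def by force
  next
    case False
    then obtain x y q j where xy: "coprime x y" "\<not> 3 dvd x - y" "0 < q" "0 < j" "j < q" "L = rh_lat x y q j"
      using rhombic_param[of c d a b] abcd by (metis order_less_le)
    have pos: "eis_norm x y > 0"
    proof -
      have "x \<noteq> 0 \<or> y \<noteq> 0" using xy(1) by auto
      then show ?thesis using eis_norm_nonneg[of x y] eis_norm_eq_0_iff[of x y] by linarith
    qed
    define m p' q' where "m = nat (eis_norm x y)" and "p' = nat (q + 2 * j)" and "q' = nat q"
    have i: "int m = eis_norm x y" "int p' = q + 2 * j" "int q' = q" using pos xy by (auto simp: m_def p'_def q'_def)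
    have "nat ((q + 2 * j) * q * eis_norm x y) = n" using idx rh_lat_index[OF xy(3-5) pos] xy(6) by simp
    then have "int n = int p' * int q' * int m" unfolding i using xy pos by auto
    then have nn: "n = p' * q' * m" by (metis of_nat_eq_iff of_nat_mult)
    have m0: "m > 0" using pos by (simp add: m_def)
    have "n div m = p' * q'" "m dvd n" unfolding nn using m0 by simp_all
    moreover have "(x, y) \<in> prim3_reps m" using xy i by (simp add: prim3_reps_def eis_reps_def)
    moreover have "(p', q') \<in> rect_pairs (p' * q')"
    proof -
      have "int q' < int p'" "int p' < 3 * int q'" "even (int p' + int q')" unfolding i using xy by auto
      then have "q' < p'" "p' < 3 * q'" "even (p' + q')" by presburger+
      then show ?thesis by (simp add: rect_pairs_def)
    qed
    ultimately have "(m, (x, y), (p', q')) \<in> rh_params n" by (simp add: rh_params_def)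
    moreover have "rh_of (m, (x, y), (p', q')) = L" by (simp add: rh_of_def i xy(6))
    ultimately show ?thesis by force
  qed
next
  fix L assume "L \<in> hex_wr n \<union> rh_of ` rh_params n"
  then show "L \<in> {L. is_sublattice_of_index L hex_lattice n \<and> well_rounded L}"
  proof
    assume "L \<in> hex_wr n"
    then obtain a b where ab: "L = hex_lat a b" "eis_norm a b = int n" by (auto simp: hex_wr_def eis_reps_def)
    have "is_sublattice_of_index L hex_lattice (nat \<bar>a * (a + b) - b * (- b)\<bar>)"
      unfolding ab(1) hex_lat_def by (rule lat_index) (use ab(2) n in \<open>unfold hex_lat_forms(3), linarith\<close>)
    moreover have "well_rounded L" unfolding ab(1) hex_lat_def
      using hex_lat_forms[where a = a and b = b] ab(2) n by (intro lat_well_rounded) auto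
    ultimately show ?thesis using hex_lat_forms(3)[of a b] ab(2) by (simp del: mult_minus_right)
  next
    assume "L \<in> rh_of ` rh_params n"
    then obtain t where t: "t \<in> rh_params n" "L = rh_of t" by blast
    obtain m x y p q where xy: "t = (m, (x, y), (p, q))" "eis_norm x y = int m" "coprime x y" "\<not> 3 dvd x - y"
      "m > 0" "p * q * m = n" "0 < int q" "0 < (int p - int q) div 2" "(int p - int q) div 2 < int q"
      "int p = int q + 2 * ((int p - int q) div 2)" using rh_params_mem[OF t(1) n] by metis
    have pos: "0 < eis_norm x y" using xy by simp
    have Lr: "L = rh_lat x y (int q) ((int p - int q) div 2)" by (simp add: t(2) xy(1) rh_of_def)
    have "nat ((int q + 2 * ((int p - int q) div 2)) * int q * eis_norm x y) = n"
      unfolding xy(10)[symmetric] xy(2) using xy(6) by (metis nat_int of_nat_mult)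
    then show ?thesis using rh_lat_index[OF xy(7-9) pos] rh_lat_well_rounded[OF xy(7-9) pos] unfolding Lr by simp
  qed
qed

text \<open>A hexagonal basis consists of two minimal vectors whose form equals their norm r,
  whereas the minimal vectors of a rhombic lattice realise only the values 2 r, - 2 r, B and - B
  with |B| < r.\<close>

lemma hex_rh_disjoint:
  assumes n: "n > 0"
  shows "hex_wr n \<inter> rh_of ` rh_params n = {}"
proof (rule ccontr)
  assume "hex_wr n \<inter> rh_of ` rh_params n \<noteq> {}"
  then obtain a b t where ab: "eis_norm a b = int n" and t: "t \<in> rh_params n" "hex_lat a b = rh_of t"
    by (auto simp: hex_wr_def eis_reps_def)
  obtain m x y p q where xy: "t = (m, (x, y), (p, q))" "eis_norm x y = int m" "coprime x y" "\<not> 3 dvd x - y"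
      "m > 0" "p * q * m = n" "0 < int q" "0 < (int p - int q) div 2" "(int p - int q) div 2 < int q"
      "int p = int q + 2 * ((int p - int q) div 2)" using rh_params_mem[OF t(1) n] by metis
  have pos: "0 < eis_norm x y" using xy by simp
  define Q J where "Q = int q" and "J = (int p - int q) div 2"
  note qj = xy(7-9)[folded Q_def J_def]
  define V1 V2 W1 W2 where "V1 = J * x - Q * y" and "V2 = (Q + J) * y + Q * x" and "W1 = (Q + J) * x + Q * y" and "W2 = J * y - Q * x"
  note defs = V1_def V2_def W1_def W2_def
  have L: "hex_lat a b = lat (eis V1 V2) (eis W1 W2)"
    by (simp add: t(2) xy(1) rh_of_def rh_lat_def defs Q_def J_def)
  have c: "eis_norm W1 W2 = eis_norm V1 V2" "eis_norm V1 V2 > 0" "\<bar>eis_form V1 V2 W1 W2\<bar> < eis_norm V1 V2"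
    using rh_norms(2) rh_norm_pos[OF qj pos] rh_form_less[OF qj pos] by (simp_all add: defs)
  have "eis a b \<in> minimal_vectors (hex_lat a b)" "eis (- b) (a + b) \<in> minimal_vectors (hex_lat a b)"
    unfolding hex_lat_def using hex_lat_forms[where a = a and b = b] ab n by (intro lat_minimal_vectors; simp)+
  note this[unfolded L, THEN lat_minimal_vectors(3)[OF c(1,2) less_imp_le[OF c(3)] _ c(3)]]
  then have mem: "(a, b) \<in> {(V1, V2), (- V1, - V2), (W1, W2), (- W1, - W2)}" "(- b, a + b) \<in> {(V1, V2), (- V1, - V2), (W1, W2), (- W1, - W2)}"
    unfolding eis_uminus by auto
  have nn: "eis_norm (- s) (- t) = eis_norm s t" for s t by (simp add: eis_norm_def)
  have norm: "eis_norm a b = eis_norm V1 V2" using mem(1) c(1) nn by auto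
  have form_neg: "eis_form (- s) (- t) u v = - eis_form s t u v" "eis_form s t (- u) (- v) = - eis_form s t u v"
    "eis_form s t u v = eis_form u v s t" "eis_form s t s t = 2 * eis_norm s t" for s t u v
    by (simp_all add: eis_form_def eis_norm_def power2_eq_square algebra_simps)
  have fW: "eis_form W1 W2 V1 V2 = eis_form V1 V2 W1 W2" by (rule form_neg(3))
  define f where "f = (\<lambda>z w. eis_form (fst z) (snd z) (fst w) (snd w))"
  have "f z w \<in> {2 * eis_norm V1 V2, - 2 * eis_norm V1 V2, eis_form V1 V2 W1 W2, - eis_form V1 V2 W1 W2}"
    if "z \<in> {(V1, V2), (- V1, - V2), (W1, W2), (- W1, - W2)}" "w \<in> {(V1, V2), (- V1, - V2), (W1, W2), (- W1, - W2)}" for z w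
    using that fW c(1) by (elim insertE emptyE) (simp_all add: f_def form_neg(1,2,4))
  from this[OF mem] have "eis_norm V1 V2 \<in> {2 * eis_norm V1 V2, - 2 * eis_norm V1 V2, eis_form V1 V2 W1 W2, - eis_form V1 V2 W1 W2}"
    using hex_lat_forms(2)[of a b] norm by (simp add: f_def)
  then show False using c by (elim insertE emptyE; linarith)
qed

theorem a_triangle_conv:
  assumes n: "n > 0"
  shows "real (a_triangle n) = hex_ideals n + dconv prim3_half rect_count n"
proof -
  have fin: "finite (hex_wr n)" "finite (rh_of ` rh_params n)"
    unfolding hex_wr_def rh_params_def by (intro finite_imageI finite_SigmaI finite_cartesian_product; use n in simp)+
  have "a_triangle n = card (hex_wr n) + card (rh_of ` rh_params n)"
    unfolding a_triangle_def wr_sublattices_conv[OF n] by (rule card_Un_disjoint[OF fin hex_rh_disjoint[OF n]])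
  then show ?thesis using card_hex_wr[OF n] card_rh_of[OF n] by simp
qed

section \<open>Asymptotics of the counting function\<close>

text \<open>For y < 1 the counted sum is 0 and \<open>y_ln_y_small\<close> absorbs the main
  term.\<close>

lemma summatory_hex_rect_asymptotics:
  defines "b \<equiv> L_chi3 1 * (ln 3 / 4 * (2 * euler_mascheroni - ln 3 / 2) - (\<Sum>n. ln3_defect (Suc n) / real (Suc n)))
     + (L_chi3 1 * euler_mascheroni + deriv L_chi3 1) * (ln 3 / 4) - L_chi3 1 * (ln 3 / 4)"
  obtains C where "\<And>y. y > 0 \<Longrightarrow>
    \<bar>3 * summatory (dconv hex_ideals rect_count) y - (3 * (L_chi3 1 * (ln 3 / 4)) * y * ln y + 3 * b * y)\<bar> \<le> C * y powr (3/4)"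
proof -
  define a where "a = L_chi3 1 * (ln 3 / 4)"
  obtain C1 where C1: "\<And>y. y \<ge> 1 \<Longrightarrow> \<bar>summatory (\<lambda>n. hex_ideals n / real n) y -
    (L_chi3 1 * ln y + (L_chi3 1 * euler_mascheroni + deriv L_chi3 1))\<bar> \<le> C1 / sqrt y"
    using summatory_hex_ideals_div by blast
  obtain C2 where C2: "\<And>y. y \<ge> 1 \<Longrightarrow> \<bar>summatory (\<lambda>n. rect_count n / real n) y -
    (ln 3 / 4 * ln y + (ln 3 / 4 * (2 * euler_mascheroni - ln 3 / 2) - (\<Sum>n. ln3_defect (Suc n) / real (Suc n))))\<bar> \<le> C2 / sqrt y"
    using summatory_rect_count_div by blast
  obtain C where C: "\<And>x. x \<ge> 1 \<Longrightarrow> \<bar>summatory (dconv hex_ideals rect_count) x - (a * x * ln x + b * x)\<bar> \<le> C * x powr (3/4)"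
    using dconv_summatory_asymptotics[OF hex_ideals_nonneg rect_count_nonneg summatory_hex_ideals C1 summatory_rect_count C2]
    unfolding a_def b_def by blast
  show ?thesis
  proof (rule that)
    fix y :: real assume y: "y > 0"
    define M where "M = max (3 * C) (4 * \<bar>3 * a\<bar> + \<bar>3 * b\<bar>)"
    have "\<bar>3 * summatory (dconv hex_ideals rect_count) y - (3 * a * y * ln y + 3 * b * y)\<bar> \<le> M * y powr (3/4)"
    proof (cases "y \<ge> 1")
      case True
      have "3 * summatory (dconv hex_ideals rect_count) y - (3 * a * y * ln y + 3 * b * y) =
         3 * (summatory (dconv hex_ideals rect_count) y - (a * y * ln y + b * y))" by (simp add: algebra_simps)
      also have "\<bar>\<dots>\<bar> \<le> 3 * (C * y powr (3/4))" using C[OF True] by (simp add: abs_mult)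
      also have "\<dots> = 3 * C * y powr (3/4)" by simp
      also have "\<dots> \<le> M * y powr (3/4)" by (intro mult_right_mono) (auto simp: M_def)
      finally show ?thesis .
    next
      case False
      then have "\<bar>3 * summatory (dconv hex_ideals rect_count) y - (3 * a * y * ln y + 3 * b * y)\<bar> = \<bar>3 * a * y * ln y + 3 * b * y\<bar>"
        by (simp add: abs_minus_commute)
      also have "\<dots> \<le> (4 * \<bar>3 * a\<bar> + \<bar>3 * b\<bar>) * y powr (3/4)" using y False by (intro y_ln_y_small) auto
      also have "\<dots> \<le> M * y powr (3/4)" by (intro mult_right_mono) (auto simp: M_def)
      finally show ?thesis .
    qed
    then show "\<bar>3 * summatory (dconv hex_ideals rect_count) y - (3 * (L_chi3 1 * (ln 3 / 4)) * y * ln y + 3 * b * y)\<bar> \<le>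
       max (3 * C) (4 * \<bar>3 * (L_chi3 1 * (ln 3 / 4))\<bar> + \<bar>3 * b\<bar>) * y powr (3/4)"
      by (simp only: M_def a_def)
  qed
qed

text \<open>Dilation by squares: the error weight at d^2 is d^(-3/2), which is summable, and ln
  (d^2) = 2 ln d puts the factor 2 in front of zeta'(2).\<close>

lemma prim_half_asymptotics:
  fixes a b :: real
  assumes T: "\<And>y. y > 0 \<Longrightarrow> \<bar>3 * summatory (dconv hex_ideals g) y - (a * y * ln y + b * y)\<bar> \<le> C * y powr (3/4)"
  obtains C' where "\<And>x. x > 0 \<Longrightarrow> \<bar>summatory (dconv prim_half g) x -
    (a * (1 / zeta_series 2) * x * ln x + (b * (1 / zeta_series 2) - a * (2 * (deriv zeta_series 2 / (zeta_series 2)\<^sup>2))) * x)\<bar> \<le> C' * x powr (3/4)"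
proof (rule asymptotics_dilation_series[where T = "\<lambda>y. 3 * summatory (dconv hex_ideals g) y" and
      u = "\<lambda>d. mu (Suc d)" and t = "\<lambda>d. real ((Suc d)\<^sup>2)" and S = "summatory (dconv prim_half g)", OF T])
  show "(\<lambda>d. mu (Suc d) / real ((Suc d)\<^sup>2)) sums (1 / zeta_series 2)" using mu_sums(1) by simp
  have "mu (Suc d) * ln (real ((Suc d)\<^sup>2)) / real ((Suc d)\<^sup>2) = 2 * (mu (Suc d) * ln (real (Suc d)) / (real (Suc d))\<^sup>2)" for d
    using ln_realpow[of "real (Suc d)" 2] by simp
  then show "(\<lambda>d. mu (Suc d) * ln (real ((Suc d)\<^sup>2)) / real ((Suc d)\<^sup>2)) sums (2 * (deriv zeta_series 2 / (zeta_series 2)\<^sup>2))"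
    using sums_mult[OF mu_sums(2), of 2] by (simp only:)
  show "summable (\<lambda>d. \<bar>mu (Suc d)\<bar> * real ((Suc d)\<^sup>2) powr - (3 / 4))"
  proof (rule summable_comparison_test'[OF summable_Suc_powr[of "-3/2"]])
    fix d
    have "real ((Suc d)\<^sup>2) = real (Suc d) powr 2" by (simp add: powr_numeral)
    then have "real ((Suc d)\<^sup>2) powr - (3 / 4) = real (Suc d) powr (- 3 / 2)" unfolding powr_powr by (simp only: powr_powr) simp
    then show "norm (\<bar>mu (Suc d)\<bar> * real ((Suc d)\<^sup>2) powr - (3 / 4)) \<le> real (Suc d) powr (- 3 / 2)"
      using mult_right_mono[OF abs_mu_le[of "Suc d"], of "real (Suc d) powr (- 3 / 2)"] by (simp add: abs_mult)
  qed simp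
  show "\<And>x. 0 < x \<Longrightarrow> (\<lambda>d. mu (Suc d) * (3 * summatory (dconv hex_ideals g) (x / real ((Suc d)\<^sup>2)))) sums summatory (dconv prim_half g) x"
    by (rule prim_half_dilation_sums)
qed (use that in auto)

text \<open>Dilation by powers of 3 with alternating signs: the geometric series at - 1/3 has sum
  3/4, and the sum of k (- 1/3)^k, which is - 3/16, carries the logarithms.\<close>

lemma prim3_half_asymptotics:
  fixes a b :: real
  assumes T: "\<And>y. y > 0 \<Longrightarrow> \<bar>summatory (dconv prim_half g) y - (a * y * ln y + b * y)\<bar> \<le> C * y powr (3/4)"
  obtains C' where "\<And>x. x > 0 \<Longrightarrow> \<bar>summatory (dconv prim3_half g) x -
    (a * (3 / 4) * x * ln x + (b * (3 / 4) - a * (- (3 / 16 * ln 3))) * x)\<bar> \<le> C' * x powr (3/4)"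
proof (rule asymptotics_dilation_series[where T = "summatory (dconv prim_half g)" and
      u = "\<lambda>k. (-1) ^ k" and t = "\<lambda>k. 3 ^ k" and S = "summatory (dconv prim3_half g)", OF T])
  have "(\<lambda>k. (- 1 / 3 :: real) ^ k) sums (1 / (1 - (- 1 / 3)))" by (rule geometric_sums) simp
  moreover have "(- 1 / 3 :: real) ^ k = (-1) ^ k / 3 ^ k" for k by (rule power_divide)
  ultimately show "(\<lambda>k. (-1) ^ k / 3 ^ k) sums (3 / 4 :: real)" by simp
  have "(\<lambda>k. real (Suc k) * (- 1 / 3) ^ k) sums (1 / (1 - (- 1 / 3))\<^sup>2)"
    using geometric_deriv_sums[of "- 1 / 3 :: real"] by simp
  then have "(\<lambda>k. (- 1 / 3 * ln 3) * (real (Suc k) * (- 1 / 3) ^ k)) sums ((- 1 / 3 * ln 3) * (1 / (1 - (- 1 / 3))\<^sup>2))"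
    by (rule sums_mult)
  moreover have "(- 1 / 3 * ln 3) * (real (Suc k) * (- 1 / 3) ^ k) = (-1) ^ Suc k * ln (3 ^ Suc k) / 3 ^ Suc k" for k
  proof -
    have "ln (3 ^ Suc k :: real) = real (Suc k) * ln 3" by (rule ln_realpow)
    moreover have "(- 1 / 3 :: real) ^ k = (-1) ^ k / 3 ^ k" by (rule power_divide)
    ultimately show ?thesis by (simp only:) simp
  qed
  moreover have "(- 1 / 3 * ln 3) * (1 / (1 - (- 1 / 3))\<^sup>2) = (- (3 / 16 * ln 3) :: real)" by (simp add: power2_eq_square)
  ultimately have "(\<lambda>k. (-1) ^ Suc k * ln (3 ^ Suc k) / 3 ^ Suc k) sums (- (3 / 16 * ln 3) :: real)"
    by (simp only:)
  then show "(\<lambda>k. (-1) ^ k * ln (3 ^ k) / 3 ^ k) sums (- (3 / 16 * ln 3) :: real)"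
    by (subst (asm) sums_Suc_iff) simp
  show "summable (\<lambda>k. \<bar>(-1) ^ k\<bar> * (3 ^ k) powr - (3 / 4) :: real)"
  proof -
    have "(3 :: real) powr - (3 / 4) < 1" by (rule powr_less_one) auto
    then have "summable (\<lambda>k. (3 powr - (3 / 4) :: real) ^ k)" by (intro summable_geometric) simp
    moreover have "(3 powr - (3 / 4) :: real) ^ k = \<bar>(-1) ^ k\<bar> * (3 ^ k) powr - (3 / 4)" for k
      by (simp add: power_abs powr_realpow[symmetric] powr_powr mult.commute)
    ultimately show ?thesis by simp
  qed
  show "\<And>x. 0 < x \<Longrightarrow> (\<lambda>k. (-1) ^ k * summatory (dconv prim_half g) (x / 3 ^ k)) sums summatory (dconv prim3_half g) x"
    by (rule prim3_half_dilation_sums)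
qed (use that in auto)

lemma c_triangle_conv:
  "c_triangle = L_chi3 1 + 9 * ln 3 * L_chi3 1 / (16 * zeta_series 2) *
     (3 * euler_mascheroni + deriv L_chi3 1 / L_chi3 1 - 2 * (deriv zeta_series 2 / zeta_series 2) - ln 3 / 4
      - 4 / ln 3 * (\<Sum>n. ln3_defect (Suc n) / real (Suc n)))"
proof -
  have "(\<Sum>i. let p = Suc i in 1 / real p * (ln 3 - (\<Sum>q\<in>{p<..3 * p - 1}. 1 / real q)))
      + (\<Sum>k. 4 / real (2 * k + 1) * (1 / 2 * ln 3 - (\<Sum>l\<in>{k<..3 * k}. 1 / real (2 * l + 1)))) =
      4 * (\<Sum>n. ln3_defect (Suc n) / real (Suc n))"
    using ln3_defect_series_split unfolding c_sum_even_def c_sum_odd_def .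
  then show ?thesis unfolding c_triangle_def by (simp only:) simp
qed

definition K_triangle :: real where
  "K_triangle = 9 * ln 3 / 16 * (L_chi3 1 / zeta_series 2)"

lemma L_chi3_1_pos: "L_chi3 1 > 0"
  by (simp add: L_chi3_1)

lemma triangle_asymptotics:
  obtains C where "\<And>x. x \<ge> 1 \<Longrightarrow>
    \<bar>summatory hex_ideals x + summatory (dconv prim3_half rect_count) x - (K_triangle * (x * (ln x - 1)) + c_triangle * x)\<bar> \<le> C * x powr (3/4)"
proof -
  define L L' Z Z' D where "L = L_chi3 1" and "L' = deriv L_chi3 1" and "Z = zeta_series 2" and "Z' = deriv zeta_series 2"
    and "D = (\<Sum>n. ln3_defect (Suc n) / real (Suc n))"
  define b where "b = L * (ln 3 / 4 * (2 * euler_mascheroni - ln 3 / 2) - D) + (L * euler_mascheroni + L') * (ln 3 / 4) - L * (ln 3 / 4)"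
  define a where "a = L * (ln 3 / 4)"
  obtain C1 where "\<And>y. y > 0 \<Longrightarrow> \<bar>3 * summatory (dconv hex_ideals rect_count) y - (3 * a * y * ln y + 3 * b * y)\<bar> \<le> C1 * y powr (3/4)"
    using summatory_hex_rect_asymptotics unfolding a_def b_def L_def L'_def D_def by blast
  then obtain C2 where "\<And>y. y > 0 \<Longrightarrow> \<bar>summatory (dconv prim_half rect_count) y -
     (3 * a * (1 / Z) * y * ln y + (3 * b * (1 / Z) - 3 * a * (2 * (Z' / Z\<^sup>2))) * y)\<bar> \<le> C2 * y powr (3/4)"
    using prim_half_asymptotics[of rect_count "3 * a" "3 * b" C1] unfolding Z_def Z'_def by blast
  then obtain C3 where C3: "\<And>y. y > 0 \<Longrightarrow> \<bar>summatory (dconv prim3_half rect_count) y -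
     (3 * a * (1 / Z) * (3 / 4) * y * ln y + ((3 * b * (1 / Z) - 3 * a * (2 * (Z' / Z\<^sup>2))) * (3 / 4) - 3 * a * (1 / Z) * (- (3 / 16 * ln 3))) * y)\<bar> \<le> C3 * y powr (3/4)"
    using prim3_half_asymptotics[of rect_count "3 * a * (1 / Z)" "3 * b * (1 / Z) - 3 * a * (2 * (Z' / Z\<^sup>2))" C2] by blast
  have pos: "L \<noteq> 0" "Z \<noteq> 0" "ln (3::real) \<noteq> 0"
    using L_chi3_1_pos zeta_series_2_pos by (simp_all add: L_def Z_def)
  have K: "3 * a * (1 / Z) * (3 / 4) = K_triangle" by (simp add: a_def K_triangle_def L_def Z_def)
  \<comment> \<open>\<open>L\<close> is the share of the hexagonal sublattices, and
    \<open>K_triangle\<close> accounts for writing x (ln x - 1) instead of x ln x.\<close>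
  have c: "(3 * b * (1 / Z) - 3 * a * (2 * (Z' / Z\<^sup>2))) * (3 / 4) - 3 * a * (1 / Z) * (- (3 / 16 * ln 3)) = c_triangle - L - K_triangle"
    unfolding c_triangle_conv K_triangle_def L_def[symmetric] Z_def[symmetric] L'_def[symmetric] Z'_def[symmetric] D_def[symmetric] a_def b_def
    using pos by (simp add: field_simps power2_eq_square)
  show ?thesis
  proof (rule that)
    fix x :: real assume x: "x \<ge> 1"
    have "sqrt x = x powr (1/2)" using x by (simp add: powr_half_sqrt)
    also have "\<dots> \<le> x powr (3/4)" using x by (intro powr_mono) auto
    finally have "sqrt x \<le> x powr (3/4)" .
    moreover have "\<bar>summatory hex_ideals x - L * x\<bar> \<le> 5 * sqrt x" unfolding L_def by (rule summatory_hex_ideals[OF x])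
    moreover have "\<bar>summatory (dconv prim3_half rect_count) x - (K_triangle * x * ln x + (c_triangle - L - K_triangle) * x)\<bar> \<le> C3 * x powr (3/4)"
      using C3[of x] x unfolding K c by simp
    moreover have "K_triangle * (x * (ln x - 1)) + c_triangle * x = L * x + (K_triangle * x * ln x + (c_triangle - L - K_triangle) * x)"
      by (simp add: algebra_simps)
    ultimately have "\<bar>summatory hex_ideals x + summatory (dconv prim3_half rect_count) x - (K_triangle * (x * (ln x - 1)) + c_triangle * x)\<bar>
       \<le> 5 * x powr (3/4) + C3 * x powr (3/4)" by linarith
    then show "\<bar>summatory hex_ideals x + summatory (dconv prim3_half rect_count) x - (K_triangle * (x * (ln x - 1)) + c_triangle * x)\<bar>
       \<le> (5 + C3) * x powr (3/4)" by (simp add: distrib_right)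
  qed
qed

section \<open>Laurent expansion of the Dirichlet series\<close>

text \<open>The alternating series \<eta> converges for Re s > 0 and equals (1 - 2^(1-s)) zeta(s)
  for Re s > 1. Dividing continues zeta to a punctured neighbourhood of 1: the factor has a simple
  zero there with derivative ln 2, which is also the value of \<eta>, so the residue is 1.\<close>

lemma zeta_eta_continuation:
  obtains P :: "complex \<Rightarrow> complex" and F where
    "\<And>s. Re s > 1 \<Longrightarrow> (\<lambda>n. of_nat (Suc n) powr (- s)) sums P s"
    "\<And>s. Re s > 1 \<Longrightarrow> (\<lambda>n. - (of_real (ln (real (Suc n))) * of_nat (Suc n) powr (- s))) sums deriv P s"
    "(\<lambda>w. P (1 + w)) has_laurent_expansion F" "fls_nth F (-1) = 1"
proof -
  have "norm (\<Sum>n=1..N. (\<lambda>_. 1 :: complex) n) \<le> 1 * real N powr 1" for N by simp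
  from dirichlet_series_of_partial_sums[OF zero_le_one this] obtain z z' where
    z: "\<And>s. Re s > 1 \<Longrightarrow> (\<lambda>n. of_nat (Suc n) powr (- s)) sums z s"
       "\<And>s. Re s > 1 \<Longrightarrow> (\<lambda>n. - (of_real (ln (real (Suc n))) * of_nat (Suc n) powr (- s))) sums z' s"
       "\<And>s. Re s > 1 \<Longrightarrow> (z has_field_derivative z' s) (at s)"
    unfolding mult_1_left by blast
  have alt: "(\<Sum>n=1..N. (-1) ^ Suc n :: complex) = (if even N then 0 else 1)" for N
    by (induction N) auto
  have "norm (\<Sum>n=1..N. (-1) ^ Suc n :: complex) \<le> 1 * real N powr 0" for N
    unfolding alt by (cases "N = 0") auto
  note bound = this
  define e where "e = (\<lambda>n. (-1) ^ Suc n :: complex)"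
  have "norm (\<Sum>n=1..N. e n) \<le> 1 * real N powr 0" for N unfolding e_def by (rule bound)
  note bound = this
  obtain \<eta> \<eta>' where
    "\<And>s. Re s > 0 \<Longrightarrow> (\<lambda>n. e (Suc n) * of_nat (Suc n) powr (- s)) sums \<eta> s"
    "\<And>s. Re s > 0 \<Longrightarrow> (\<lambda>n. - (e (Suc n) * (of_real (ln (real (Suc n))) * of_nat (Suc n) powr (- s)))) sums \<eta>' s"
    "\<And>s. Re s > 0 \<Longrightarrow> (\<eta> has_field_derivative \<eta>' s) (at s)"
    using dirichlet_series_of_partial_sums[OF order_refl bound] by blast
  note \<eta> = this(1)[unfolded e_def] this(3)
  have dbl_lim: "filterlim (\<lambda>N :: nat. 2 * N) sequentially sequentially"
    by (intro filterlim_subseq strict_monoI) simp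
  have rel: "\<eta> s = (1 - 2 powr (1 - s)) * z s" if s: "Re s > 1" for s
  proof -
    \<comment> \<open>The terms at even integers form 2^(-s) zeta(s); subtracting them twice turns
      the zeta series into the alternating one.\<close>
    have dbl: "of_nat (Suc (2 * n + 1)) powr (- s) = 2 powr (- s) * of_nat (Suc n) powr (- s)" for n
    proof -
      have "of_nat (Suc (2 * n + 1)) = complex_of_real 2 * complex_of_real (real (Suc n))" by simp
      then have "of_nat (Suc (2 * n + 1)) powr (- s) = (complex_of_real 2 * complex_of_real (real (Suc n))) powr (- s)" by (simp only:)
      also have "\<dots> = complex_of_real 2 powr (- s) * complex_of_real (real (Suc n)) powr (- s)"
        by (rule powr_times_real) auto
      finally show ?thesis by simp
    qed
    have "(\<Sum>n<2 * N. (-1) ^ Suc (Suc n) * of_nat (Suc n) powr (- s)) =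
       (\<Sum>n<2 * N. of_nat (Suc n) powr (- s)) - 2 * (2 powr (- s)) * (\<Sum>n<N. of_nat (Suc n) powr (- s))" for N
    proof (induction N)
      case (Suc N)
      have e: "2 * Suc N = Suc (Suc (2 * N))" by simp
      have "of_nat (Suc (Suc (2 * N))) powr (- s) = 2 powr (- s) * of_nat (Suc N) powr (- s)" using dbl[of N] by simp
      then show ?case unfolding e sum.lessThan_Suc Suc by (simp add: algebra_simps)
    qed simp
    moreover have "(\<lambda>N. \<Sum>n<2 * N. (-1) ^ Suc (Suc n) * of_nat (Suc n) powr (- s)) \<longlonglongrightarrow> \<eta> s"
      by (rule filterlim_compose[OF _ dbl_lim]) (use \<eta>(1)[of s] s in \<open>simp add: sums_def\<close>)
    moreover have "(\<lambda>N. (\<Sum>n<2 * N. of_nat (Suc n) powr (- s)) - 2 * (2 powr (- s)) * (\<Sum>n<N. of_nat (Suc n) powr (- s)))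
        \<longlonglongrightarrow> z s - 2 * (2 powr (- s)) * z s"
    proof (intro tendsto_intros)
      show "(\<lambda>N. \<Sum>n<2 * N. of_nat (Suc n) powr (- s)) \<longlonglongrightarrow> z s"
        by (rule filterlim_compose[OF _ dbl_lim]) (use z(1)[of s] s in \<open>simp add: sums_def\<close>)
      show "(\<lambda>N. \<Sum>n<N. of_nat (Suc n) powr (- s)) \<longlonglongrightarrow> z s" using z(1)[of s] s unfolding sums_def by auto
    qed
    ultimately have "\<eta> s = z s - 2 * (2 powr (- s)) * z s" using LIMSEQ_unique by simp
    also have "2 * 2 powr (- s) = 2 powr (1 - s)" by (simp add: powr_diff powr_minus field_simps)
    finally show ?thesis by (simp add: algebra_simps)
  qed
  define P where "P = (\<lambda>s. \<eta> s / (1 - 2 powr (1 - s)))"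
  have Pz: "P s = z s" if s: "Re s > 1" for s
  proof -
    have "norm ((2 :: complex) powr (1 - s)) = 2 powr (1 - Re s)"
      using norm_powr_real_powr[of 2 "1 - s"] by simp
    also have "\<dots> < 2 powr 0" using s by (intro powr_less_mono) auto
    finally have "1 - (2 :: complex) powr (1 - s) \<noteq> 0" by auto
    then show ?thesis using rel[OF s] by (simp add: P_def)
  qed
  have derivP: "deriv P s = z' s" if s: "Re s > 1" for s
  proof -
    have "eventually (\<lambda>x. P x = z x) (nhds s)"
      using eventually_nhds_in_open[OF open_halfspace_Re_gt[of 1], of s] s by (auto elim!: eventually_mono simp: Pz)
    then have "deriv P s = deriv z s" by (intro deriv_cong_ev) auto
    then show ?thesis using z(3)[OF s] by (simp add: DERIV_imp_deriv)
  qed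
  define f where "f = (\<lambda>w. \<eta> (1 + w))"
  define h where "h = (\<lambda>w :: complex. 1 - 2 powr (- w))"
  define S where "S = {w. Re w > - 1}"
  have S: "open S" "connected S" "0 \<in> S"
    unfolding S_def by (auto simp: open_halfspace_Re_gt convex_halfspace_Re_gt intro: convex_connected)
  have df: "(f has_field_derivative \<eta>' (1 + w)) (at w)" if "w \<in> S" for w
  proof -
    have "(\<eta> has_field_derivative \<eta>' (1 + w)) (at (1 + w))" using that by (intro \<eta>(2)) (auto simp: S_def)
    then show ?thesis unfolding f_def using DERIV_shift[of \<eta> "\<eta>' (1 + w)" w 1] by (simp add: add.commute)
  qed
  have f: "f holomorphic_on S" using df by (auto simp: holomorphic_on_def field_differentiable_def intro: has_field_derivative_at_within)
  have h: "h holomorphic_on S" unfolding h_def by (intro holomorphic_intros) auto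
  have h': "(h has_field_derivative of_real (ln 2)) (at 0)"
  proof -
    have l: "Ln 2 = complex_of_real (ln 2)" using Ln_of_real[of 2] by simp
    have "((\<lambda>z. 2 powr z) has_field_derivative Ln 2 * 2 powr (- 0)) (at (- 0 :: complex))"
      by (rule has_field_derivative_powr_right) simp
    moreover have "((\<lambda>w :: complex. - w) has_field_derivative - 1) (at 0)" by (auto intro!: derivative_eq_intros)
    ultimately have "((\<lambda>w. 2 powr (- w)) has_field_derivative Ln 2 * 2 powr (- 0) * - 1) (at 0)"
      by (rule DERIV_chain2)
    from DERIV_diff[OF DERIV_const[of 1] this] show ?thesis unfolding h_def by (simp add: l)
  qed
  have \<eta>1: "\<eta> 1 = of_real (ln 2)"
  proof -
    have "(\<lambda>n. complex_of_real ((-1) ^ n / real (Suc n))) sums of_real (ln 2)"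
      by (rule sums_of_real[OF alternating_harmonic_series_sums])
    moreover have "complex_of_real ((-1) ^ n / real (Suc n)) = (-1) ^ Suc (Suc n) * of_nat (Suc n) powr (- 1)" for n
      by (simp add: powr_minus field_simps)
    ultimately have "(\<lambda>n. (-1) ^ Suc (Suc n) * of_nat (Suc n) powr (- 1)) sums complex_of_real (ln 2)" by (simp only:)
    then show ?thesis using sums_unique2[OF \<eta>(1)[of 1]] by simp
  qed
  have Pfh: "(\<lambda>w. P (1 + w)) = (\<lambda>w. f w / h w)" by (simp add: P_def f_def h_def)
  have ana: "f analytic_on {0}" "h analytic_on {0}" using f h S analytic_at by blast+
  obtain F1 H1 where "f has_fps_expansion F1" "h has_fps_expansion H1"
    using analytic_at_imp_has_fps_expansion_0[OF ana(1)] analytic_at_imp_has_fps_expansion_0[OF ana(2)] by blast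
  then have exp: "(\<lambda>w. P (1 + w)) has_laurent_expansion fps_to_fls F1 / fps_to_fls H1"
    unfolding Pfh by (intro has_laurent_expansion_divide has_laurent_expansion_fps)
  have "residue (\<lambda>w. f w / h w) 0 = f 0 / of_real (ln 2)"
    by (rule residue_simple_pole_deriv[OF f h S h']) (use \<eta>1 in \<open>auto simp: f_def h_def\<close>)
  also have "\<dots> = 1" using \<eta>1 by (simp add: f_def)
  finally have "fls_nth (fps_to_fls F1 / fps_to_fls H1) (-1) = 1"
    using has_laurent_expansion_residue_0[OF exp] unfolding Pfh by (simp add: fls_residue_def)
  moreover have "(\<lambda>n. of_nat (Suc n) powr (- s)) sums P s" if "Re s > 1" for s
    unfolding Pz[OF that] by (rule z(1)[OF that])
  moreover have "(\<lambda>n. - (of_real (ln (real (Suc n))) * of_nat (Suc n) powr (- s))) sums deriv P s" if "Re s > 1" for s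
    unfolding derivP[OF that] by (rule z(2)[OF that])
  ultimately show thesis using exp by (intro that)
qed

text \<open>Each step raises the error by 1 - n (ln (n + 1) - ln n), which lies between 0 and ln (n
  + 1) - ln n.\<close>

lemma sum_ln_bounds:
  assumes "N \<ge> 1"
  shows "0 \<le> (\<Sum>n=1..N. ln (real n)) - (real N * ln (real N) - real N)"
    and "(\<Sum>n=1..N. ln (real n)) - (real N * ln (real N) - real N) \<le> 1 + ln (real N)"
proof -
  have step: "real N * (ln (real (Suc N)) - ln (real N)) \<le> 1" "1 \<le> real (Suc N) * (ln (real (Suc N)) - ln (real N))" if "N \<ge> 1" for N
  proof -
    have "ln (real (Suc N)) - ln (real N) = ln (real (Suc N) / real N)" using that by (subst ln_div) auto
    also have "\<dots> \<le> real (Suc N) / real N - 1" using that by (intro ln_le_minus_one) auto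
    also have "\<dots> = 1 / real N" using that by (simp add: field_simps)
    finally show "real N * (ln (real (Suc N)) - ln (real N)) \<le> 1" using that by (simp add: field_simps)
    have "ln (real N) - ln (real (Suc N)) = ln (real N / real (Suc N))" using that by (subst ln_div) auto
    also have "\<dots> \<le> real N / real (Suc N) - 1" using that by (intro ln_le_minus_one) auto
    also have "\<dots> = - (1 / real (Suc N))" by (simp add: field_simps)
    finally have "1 / real (Suc N) \<le> ln (real (Suc N)) - ln (real N)" by simp
    then show "1 \<le> real (Suc N) * (ln (real (Suc N)) - ln (real N))" by (simp add: field_simps)
  qed
  have "0 \<le> (\<Sum>n=1..N. ln (real n)) - (real N * ln (real N) - real N) \<and>
     (\<Sum>n=1..N. ln (real n)) - (real N * ln (real N) - real N) \<le> 1 + ln (real N)"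
    using assms
  proof (induction N rule: dec_induct)
    case (step n)
    define a b where "a = ln (real n)" and "b = ln (real (Suc n))"
    have "real (Suc n) * b = real n * b + b" "real n * (b - a) = real n * b - real n * a" "real (Suc n) * (b - a) = real n * b + b - real n * a - a"
      by (simp_all add: algebra_simps)
    moreover have "n \<ge> 1" using step.hyps by simp
    from \<open>\<And>N. N \<ge> 1 \<Longrightarrow> real N * (ln (real (Suc N)) - ln (real N)) \<le> 1\<close>[OF this] \<open>\<And>N. N \<ge> 1 \<Longrightarrow> 1 \<le> real (Suc N) * (ln (real (Suc N)) - ln (real N))\<close>[OF this]
    have "real n * (b - a) \<le> 1" "1 \<le> real (Suc n) * (b - a)" unfolding a_def b_def .
    moreover have "(\<Sum>n=1..Suc n. ln (real n)) = (\<Sum>n=1..n. ln (real n)) + b"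
      by (simp add: b_def del: of_nat_Suc)
    moreover have "real (Suc n) = real n + 1" by simp
    ultimately show ?case using step.IH unfolding a_def[symmetric] b_def[symmetric] by linarith
  qed simp
  then show "0 \<le> (\<Sum>n=1..N. ln (real n)) - (real N * ln (real N) - real N)"
    "(\<Sum>n=1..N. ln (real n)) - (real N * ln (real N) - real N) \<le> 1 + ln (real N)" by auto
qed

text \<open>The shape N (ln N - 1) is that of the partial sums of ln n, so no linear term is left
  over. The derivative of a Laurent series has no term of order -1; hence the part with zeta' adds
  nothing to the coefficient c.\<close>

theorem laurent_of_asymptotics:
  fixes a :: "nat \<Rightarrow> real" and K c C :: real
  assumes A: "\<And>N. N \<ge> 1 \<Longrightarrow> \<bar>(\<Sum>n=1..N. a n) - (K * (real N * (ln (real N) - 1)) + c * real N)\<bar> \<le> C * real N powr (3/4)"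
  shows "\<exists>(f :: complex \<Rightarrow> complex) F. (\<forall>s. Re s > 1 \<longrightarrow> (\<lambda>n. of_real (a (Suc n)) * of_nat (Suc n) powr (- s)) sums f s)
    \<and> (\<lambda>w. f (1 + w)) has_laurent_expansion F \<and> fls_nth F (-1) = complex_of_real c"
proof -
  define b where "b = (\<lambda>n. a n - K * ln (real n) - c)"
  have bound: "\<bar>\<Sum>n=1..N. b n\<bar> \<le> (C + 5 * \<bar>K\<bar>) * real N powr (3/4)" for N
  proof (cases "N \<ge> 1")
    case True
    define E where "E = (\<Sum>n=1..N. ln (real n)) - (real N * ln (real N) - real N)"
    have one: "1 \<le> real N powr (3/4)" using True by (intro ge_one_powr_ge_zero) auto
    have "ln (real N) = 4 / 3 * ln (real N powr (3/4))" using True by (simp add: ln_powr)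
    also have "\<dots> \<le> 4 / 3 * (real N powr (3/4) - 1)" using True by (intro mult_left_mono ln_le_minus_one) auto
    finally have "1 + ln (real N) \<le> 5 * real N powr (3/4)" using one by (simp add: right_diff_distrib)
    then have "\<bar>E\<bar> \<le> 5 * real N powr (3/4)" using sum_ln_bounds[OF True] unfolding E_def by linarith
    then have "\<bar>K * E\<bar> \<le> \<bar>K\<bar> * (5 * real N powr (3/4))" unfolding abs_mult by (intro mult_left_mono) auto
    moreover have "(\<Sum>n=1..N. b n) = ((\<Sum>n=1..N. a n) - (K * (real N * (ln (real N) - 1)) + c * real N)) - K * E"
      unfolding b_def E_def sum_subtractf sum_distrib_left[symmetric] by (simp add: algebra_simps)
    ultimately have "\<bar>\<Sum>n=1..N. b n\<bar> \<le> C * real N powr (3/4) + \<bar>K\<bar> * (5 * real N powr (3/4))" using A[OF True] by linarith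
    then show ?thesis by (simp add: algebra_simps)
  next
    case False
    then have "N = 0" by simp
    then show ?thesis by simp
  qed
  then have "norm (\<Sum>n=1..N. complex_of_real (b n)) \<le> (C + 5 * \<bar>K\<bar>) * real N powr (3/4)" for N
    unfolding of_real_sum[symmetric] norm_of_real .
  note bound = this
  define e where "e = (\<lambda>n. complex_of_real (b n))"
  have "norm (\<Sum>n=1..N. e n) \<le> (C + 5 * \<bar>K\<bar>) * real N powr (3/4)" for N unfolding e_def by (rule bound)
  note bound = this
  have "(0 :: real) \<le> 3/4" by simp
  from dirichlet_series_of_partial_sums[OF this bound] obtain g g' where
    "\<And>s. Re s > 3/4 \<Longrightarrow> (\<lambda>n. e (Suc n) * of_nat (Suc n) powr (- s)) sums g s"
    "\<And>s. Re s > 3/4 \<Longrightarrow> (\<lambda>n. - (e (Suc n) * (of_real (ln (real (Suc n))) * of_nat (Suc n) powr (- s)))) sums g' s"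
    "\<And>s. Re s > 3/4 \<Longrightarrow> (g has_field_derivative g' s) (at s)" by blast
  note g = this(1)[unfolded e_def] this(3)
  obtain P F where P: "\<And>s. Re s > 1 \<Longrightarrow> (\<lambda>n. of_nat (Suc n) powr (- s)) sums P s"
    "\<And>s. Re s > 1 \<Longrightarrow> (\<lambda>n. - (of_real (ln (real (Suc n))) * of_nat (Suc n) powr (- s))) sums deriv P s"
    "(\<lambda>w. P (1 + w)) has_laurent_expansion F" "fls_nth F (-1) = 1"
    using zeta_eta_continuation by blast
  define f where "f = (\<lambda>s. - (of_real K) * deriv P s + of_real c * P s + g s)"
  have "(\<lambda>n. of_real (a (Suc n)) * of_nat (Suc n) powr (- s)) sums f s" if s: "Re s > 1" for s
  proof -
    have "(\<lambda>n. - (of_real K) * (- (of_real (ln (real (Suc n))) * of_nat (Suc n) powr (- s))) +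
       of_real c * of_nat (Suc n) powr (- s) + of_real (b (Suc n)) * of_nat (Suc n) powr (- s)) sums f s"
    proof -
      have "Re s > 3/4" using s by simp
      from sums_add[OF sums_add[OF sums_mult[OF P(2)[OF s]] sums_mult[OF P(1)[OF s]]] g(1)[OF this]] show ?thesis unfolding f_def .
    qed
    moreover have "- (of_real K) * (- (of_real (ln (real (Suc n))) * of_nat (Suc n) powr (- s))) +
       of_real c * of_nat (Suc n) powr (- s) + of_real (b (Suc n)) * of_nat (Suc n) powr (- s) =
       of_real (a (Suc n)) * of_nat (Suc n) powr (- s)" for n
      by (simp add: b_def algebra_simps del: of_nat_Suc)
    ultimately show ?thesis by (simp only:)
  qed
  moreover have dP: "(\<lambda>w. deriv P (1 + w)) has_laurent_expansion fls_deriv F"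
  proof -
    have "deriv (\<lambda>w. P (1 + w)) = (\<lambda>w. deriv P (1 + w))"
      unfolding deriv_def by (intro ext arg_cong[of _ _ Eps]) (simp add: DERIV_shift[of P _ _ 1] add.commute fun_eq_iff)
    then show ?thesis using has_laurent_expansion_deriv[OF P(3)] by simp
  qed
  obtain G where G: "(\<lambda>w. g (1 + w)) has_fps_expansion G"
  proof -
    have "(\<lambda>w. g (1 + w)) holomorphic_on {w. Re w > - 1/4}"
    proof -
      have "((\<lambda>w. g (1 + w)) has_field_derivative g' (1 + w)) (at w)" if "Re w > - 1/4" for w
      proof -
        have "(g has_field_derivative g' (1 + w)) (at (1 + w))" using that by (intro g(2)) auto
        then show ?thesis using DERIV_shift[of g "g' (1 + w)" w 1] by (simp add: add.commute)
      qed
      then show ?thesis by (auto simp: holomorphic_on_def field_differentiable_def intro: has_field_derivative_at_within)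
    qed
    then have "(\<lambda>w. g (1 + w)) analytic_on {0}"
      unfolding analytic_at by (intro exI[of _ "{w. Re w > - 1/4}"]) (simp add: open_halfspace_Re_gt)
    then show ?thesis using analytic_at_imp_has_fps_expansion_0 that by blast
  qed
  have "(\<lambda>w. f (1 + w)) has_laurent_expansion fls_const (- of_real K) * fls_deriv F + fls_const (of_real c) * F + fps_to_fls G"
    unfolding f_def by (intro has_laurent_expansion_add has_laurent_expansion_cmult_left dP P(3) has_laurent_expansion_fps G)
  moreover have "fls_nth (fls_const (- of_real K) * fls_deriv F + fls_const (of_real c) * F + fps_to_fls G) (-1) = complex_of_real c"
    using P(4) by simp
  ultimately show ?thesis by blast
qed

section \<open>Euler--Maclaurin summation\<close>

text \<open>The Bernoulli polynomial of degree 6. In u = t (1 - t) it is 1/42 - u^2 / 2 - u^3, which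
  decreases on [0, 1/4] from 1/42 to a value above - 1/42.\<close>

lemma bernoulli_poly_6_bounds:
  fixes t :: real
  assumes "0 \<le> t" "t \<le> 1"
  shows "\<bar>t ^ 6 - 3 * t ^ 5 + 5 / 2 * t ^ 4 - t\<^sup>2 / 2 + 1 / 42\<bar> \<le> 1 / 42"
proof -
  define u where "u = t * (1 - t)"
  have "1 / 4 - u = (t - 1 / 2)\<^sup>2" by (simp add: u_def power2_eq_square field_simps)
  then have u: "0 \<le> u" "u \<le> 1 / 4" using assms by (simp add: u_def, smt (verit) zero_le_power2)
  have eq: "t ^ 6 - 3 * t ^ 5 + 5 / 2 * t ^ 4 - t\<^sup>2 / 2 + 1 / 42 = 1 / 42 - u\<^sup>2 / 2 - u ^ 3"
    by (simp add: u_def eval_nat_numeral field_simps)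
  have "u\<^sup>2 \<le> (1 / 4)\<^sup>2" "u ^ 3 \<le> (1 / 4) ^ 3" using u by (intro power_mono; simp)+
  then have "u\<^sup>2 \<le> 1 / 16" "u ^ 3 \<le> 1 / 64" by (simp_all add: power_divide)
  moreover have "0 \<le> u\<^sup>2" "0 \<le> u ^ 3" using u by simp_all
  ultimately show ?thesis unfolding eq abs_le_iff by linarith
qed

text \<open>\<open>G i\<close> stands for the i-th derivative of an antiderivative
  \<open>G 0\<close> of the summand \<open>G 1\<close>; the factors are the Bernoulli numbers of
  index 1, 2 and 4 over factorials. Differences of this expression approximate h times sums of
  \<open>G 1\<close> with step h.\<close>

definition em_main :: "(nat \<Rightarrow> real \<Rightarrow> real) \<Rightarrow> real \<Rightarrow> real \<Rightarrow> real" where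
  "em_main G h x = G 0 x - h / 2 * G 1 x + h\<^sup>2 / 12 * G 2 x - h ^ 4 / 720 * G 4 x"

text \<open>Shifting the kernel \<open>B\<^sub>6 / 720\<close> by \<open>1 / 30240\<close> either way gives it a constant sign, which turns
  the error term into a telescoping difference of \<open>G 6\<close>.\<close>

lemma euler_maclaurin_step:
  fixes G :: "nat \<Rightarrow> real \<Rightarrow> real"
  assumes h: "h > 0"
    and D: "\<And>i x. i < 7 \<Longrightarrow> x \<ge> a \<Longrightarrow> (G i has_real_derivative G (Suc i) x) (at x)"
    and pos: "\<And>x. x \<ge> a \<Longrightarrow> 0 \<le> G 7 x"
  shows "em_main G h (a + h) - em_main G h a \<le> h * G 1 a"
    and "h * G 1 a \<le> em_main G h (a + h) - em_main G h a + h ^ 6 / 15120 * (G 6 (a + h) - G 6 a)"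
proof -
  \<comment> \<open>Repeated integration by parts in closed form: up to sign, and up to the shift
    \<open>\<sigma>\<close>, the coefficient of \<open>G i\<close> is h^i B_i(t) / i!. Since B_i' =
    i B_(i-1), the derivative collapses to the \<open>G 7\<close> term.\<close>
  define \<Psi> where "\<Psi> = (\<lambda>\<sigma> t. G 0 (a + h * t) - h * (t - 1 / 2) * G 1 (a + h * t)
     + h\<^sup>2 / 2 * (t\<^sup>2 - t + 1 / 6) * G 2 (a + h * t)
     - h ^ 3 / 6 * (t ^ 3 - 3 / 2 * t\<^sup>2 + t / 2) * G 3 (a + h * t)
     + h ^ 4 / 24 * (t ^ 4 - 2 * t ^ 3 + t\<^sup>2 - 1 / 30) * G 4 (a + h * t)
     - h ^ 5 / 120 * (t ^ 5 - 5 / 2 * t ^ 4 + 5 / 3 * t ^ 3 - t / 6) * G 5 (a + h * t)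
     + h ^ 6 / 720 * (t ^ 6 - 3 * t ^ 5 + 5 / 2 * t ^ 4 - t\<^sup>2 / 2 + 1 / 42 + \<sigma>) * G 6 (a + h * t))"
  have d: "((\<lambda>t. G i (a + h * t)) has_real_derivative G (Suc i) (a + h * t) * h) (at t)" if "i < 7" "t \<ge> 0" for i t
    by (rule DERIV_chain2[where g = "\<lambda>t. a + h * t"]) (use that h in \<open>auto intro!: D derivative_eq_intros\<close>)
  have d\<Psi>: "(\<Psi> \<sigma> has_real_derivative
      h ^ 7 / 720 * (t ^ 6 - 3 * t ^ 5 + 5 / 2 * t ^ 4 - t\<^sup>2 / 2 + 1 / 42 + \<sigma>) * G 7 (a + h * t)) (at t)" if t: "t \<ge> 0" for \<sigma> t
  proof -
    have d': "((\<lambda>t. G i (a + h * t)) has_real_derivative G j (a + h * t) * h) (at t)" if "i < 7" "j = Suc i" for i j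
      using d[OF that(1) t] that(2) by simp
    have e: "((\<lambda>t. G 0 (a + h * t)) has_real_derivative G 1 (a + h * t) * h) (at t)"
      "((\<lambda>t. G 1 (a + h * t)) has_real_derivative G 2 (a + h * t) * h) (at t)"
      "((\<lambda>t. G 2 (a + h * t)) has_real_derivative G 3 (a + h * t) * h) (at t)"
      "((\<lambda>t. G 3 (a + h * t)) has_real_derivative G 4 (a + h * t) * h) (at t)"
      "((\<lambda>t. G 4 (a + h * t)) has_real_derivative G 5 (a + h * t) * h) (at t)"
      "((\<lambda>t. G 5 (a + h * t)) has_real_derivative G 6 (a + h * t) * h) (at t)"
      "((\<lambda>t. G 6 (a + h * t)) has_real_derivative G 7 (a + h * t) * h) (at t)"
      by (rule d'; simp)+
    define g0 g1 g2 g3 g4 g5 g6 where "g0 = (\<lambda>t. G 0 (a + h * t))" and "g1 = (\<lambda>t. G 1 (a + h * t))" and "g2 = (\<lambda>t. G 2 (a + h * t))"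
      and "g3 = (\<lambda>t. G 3 (a + h * t))" and "g4 = (\<lambda>t. G 4 (a + h * t))" and "g5 = (\<lambda>t. G 5 (a + h * t))" and "g6 = (\<lambda>t. G 6 (a + h * t))"
    note gs = g0_def g1_def g2_def g3_def g4_def g5_def g6_def
    have eg: "(g0 has_real_derivative g1 t * h) (at t)" "(g1 has_real_derivative g2 t * h) (at t)" "(g2 has_real_derivative g3 t * h) (at t)"
      "(g3 has_real_derivative g4 t * h) (at t)" "(g4 has_real_derivative g5 t * h) (at t)" "(g5 has_real_derivative g6 t * h) (at t)"
      "(g6 has_real_derivative G 7 (a + h * t) * h) (at t)"
      using e unfolding gs .
    have \<Psi>': "\<Psi> \<sigma> = (\<lambda>t. g0 t - h * (t - 1 / 2) * g1 t
       + h\<^sup>2 / 2 * (t\<^sup>2 - t + 1 / 6) * g2 t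
       - h ^ 3 / 6 * (t ^ 3 - 3 / 2 * t\<^sup>2 + t / 2) * g3 t
       + h ^ 4 / 24 * (t ^ 4 - 2 * t ^ 3 + t\<^sup>2 - 1 / 30) * g4 t
       - h ^ 5 / 120 * (t ^ 5 - 5 / 2 * t ^ 4 + 5 / 3 * t ^ 3 - t / 6) * g5 t
       + h ^ 6 / 720 * (t ^ 6 - 3 * t ^ 5 + 5 / 2 * t ^ 4 - t\<^sup>2 / 2 + 1 / 42 + \<sigma>) * g6 t)"
      unfolding \<Psi>_def gs ..
    have p: "((\<lambda>t. h * (t - 1 / 2)) has_real_derivative h) (at t)"
      "((\<lambda>t. h\<^sup>2 / 2 * (t\<^sup>2 - t + 1 / 6)) has_real_derivative h\<^sup>2 / 2 * (2 * t - 1)) (at t)"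
      "((\<lambda>t. h ^ 3 / 6 * (t ^ 3 - 3 / 2 * t\<^sup>2 + t / 2)) has_real_derivative h ^ 3 / 6 * (3 * t\<^sup>2 - 3 * t + 1 / 2)) (at t)"
      "((\<lambda>t. h ^ 4 / 24 * (t ^ 4 - 2 * t ^ 3 + t\<^sup>2 - 1 / 30)) has_real_derivative h ^ 4 / 24 * (4 * t ^ 3 - 6 * t\<^sup>2 + 2 * t)) (at t)"
      "((\<lambda>t. h ^ 5 / 120 * (t ^ 5 - 5 / 2 * t ^ 4 + 5 / 3 * t ^ 3 - t / 6)) has_real_derivative
         h ^ 5 / 120 * (5 * t ^ 4 - 10 * t ^ 3 + 5 * t\<^sup>2 - 1 / 6)) (at t)"
      "((\<lambda>t. h ^ 6 / 720 * (t ^ 6 - 3 * t ^ 5 + 5 / 2 * t ^ 4 - t\<^sup>2 / 2 + 1 / 42 + \<sigma>)) has_real_derivative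
         h ^ 6 / 720 * (6 * t ^ 5 - 15 * t ^ 4 + 10 * t ^ 3 - t)) (at t)"
      by (auto intro!: derivative_eq_intros)
    note comb = DERIV_add[OF DERIV_diff[OF DERIV_add[OF DERIV_diff[OF DERIV_add[OF DERIV_diff[OF eg(1) DERIV_mult[OF p(1) eg(2)]]
      DERIV_mult[OF p(2) eg(3)]] DERIV_mult[OF p(3) eg(4)]] DERIV_mult[OF p(4) eg(5)]] DERIV_mult[OF p(5) eg(6)]] DERIV_mult[OF p(6) eg(7)]]
    show ?thesis unfolding \<Psi>'
      by (rule DERIV_cong[OF comb]) (simp add: eval_nat_numeral field_simps)
  qed
  have c: "0 \<le> h ^ 7 / 720" using h by simp
  have up: "\<Psi> (1 / 42) 0 \<le> \<Psi> (1 / 42) 1"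
  proof (rule DERIV_nonneg_imp_nondecreasing[where f = "\<Psi> (1 / 42)"])
    fix t :: real assume t: "0 \<le> t" "t \<le> 1"
    have "0 \<le> t ^ 6 - 3 * t ^ 5 + 5 / 2 * t ^ 4 - t\<^sup>2 / 2 + 1 / 42 + 1 / 42" using bernoulli_poly_6_bounds[OF t] by linarith
    then have "0 \<le> h ^ 7 / 720 * (t ^ 6 - 3 * t ^ 5 + 5 / 2 * t ^ 4 - t\<^sup>2 / 2 + 1 / 42 + 1 / 42) * G 7 (a + h * t)"
      using c pos[of "a + h * t"] h t by (intro mult_nonneg_nonneg) auto
    then show "\<exists>y. (\<Psi> (1 / 42) has_real_derivative y) (at t) \<and> 0 \<le> y" using d\<Psi>[OF t(1)] by blast
  qed simp
  have dn: "\<Psi> (- 1 / 42) 1 \<le> \<Psi> (- 1 / 42) 0"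
  proof (rule DERIV_nonpos_imp_nonincreasing[where f = "\<Psi> (- 1 / 42)"])
    fix t :: real assume t: "0 \<le> t" "t \<le> 1"
    have "t ^ 6 - 3 * t ^ 5 + 5 / 2 * t ^ 4 - t\<^sup>2 / 2 + 1 / 42 + (- 1 / 42) \<le> 0" using bernoulli_poly_6_bounds[OF t] by linarith
    then have "h ^ 7 / 720 * (t ^ 6 - 3 * t ^ 5 + 5 / 2 * t ^ 4 - t\<^sup>2 / 2 + 1 / 42 + (- 1 / 42)) * G 7 (a + h * t) \<le> 0"
      using c pos[of "a + h * t"] h t by (intro mult_nonpos_nonneg mult_nonneg_nonpos) auto
    then show "\<exists>y. (\<Psi> (- 1 / 42) has_real_derivative y) (at t) \<and> y \<le> 0" using d\<Psi>[OF t(1)] by blast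
  qed simp
  have ev: "\<Psi> \<sigma> 1 = em_main G h (a + h) + h ^ 6 / 720 * (1 / 42 + \<sigma>) * G 6 (a + h)"
    "\<Psi> \<sigma> 0 = em_main G h a + h * G 1 a + h ^ 6 / 720 * (1 / 42 + \<sigma>) * G 6 a" for \<sigma>
    by (simp_all add: \<Psi>_def em_main_def field_simps)
  show "em_main G h (a + h) - em_main G h a \<le> h * G 1 a" using dn by (simp add: ev)
  show "h * G 1 a \<le> em_main G h (a + h) - em_main G h a + h ^ 6 / 15120 * (G 6 (a + h) - G 6 a)"
    using up by (simp add: ev field_simps)
qed

lemma euler_maclaurin_sum:
  fixes G :: "nat \<Rightarrow> real \<Rightarrow> real"
  assumes h: "h > 0"
    and D: "\<And>i x. i < 7 \<Longrightarrow> x \<ge> a \<Longrightarrow> (G i has_real_derivative G (Suc i) x) (at x)"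
    and pos: "\<And>x. x \<ge> a \<Longrightarrow> 0 \<le> G 7 x"
  shows "em_main G h (a + h * real m) - em_main G h a \<le> h * (\<Sum>k<m. G 1 (a + h * real k))"
    and "h * (\<Sum>k<m. G 1 (a + h * real k)) \<le>
      em_main G h (a + h * real m) - em_main G h a + h ^ 6 / 15120 * (G 6 (a + h * real m) - G 6 a)"
proof -
  have "em_main G h (a + h * real m) - em_main G h a \<le> h * (\<Sum>k<m. G 1 (a + h * real k)) \<and>
    h * (\<Sum>k<m. G 1 (a + h * real k)) \<le>
      em_main G h (a + h * real m) - em_main G h a + h ^ 6 / 15120 * (G 6 (a + h * real m) - G 6 a)"
  proof (induction m)
    case (Suc m)
    have x: "x \<ge> a" if "x \<ge> a + h * real m" for x using that h by (smt (verit) mult_nonneg_nonneg of_nat_0_le_iff)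
    have e: "a + h * real m + h = a + h * real (Suc m)" by (simp add: algebra_simps)
    have s: "em_main G h (a + h * real m + h) - em_main G h (a + h * real m) \<le> h * G 1 (a + h * real m)"
      "h * G 1 (a + h * real m) \<le> em_main G h (a + h * real m + h) - em_main G h (a + h * real m)
         + h ^ 6 / 15120 * (G 6 (a + h * real m + h) - G 6 (a + h * real m))"
      by (rule euler_maclaurin_step; use h D x pos in blast)+
    show ?case using Suc s unfolding sum.lessThan_Suc distrib_left right_diff_distrib e by linarith
  qed simp
  then show "em_main G h (a + h * real m) - em_main G h a \<le> h * (\<Sum>k<m. G 1 (a + h * real k))"
    "h * (\<Sum>k<m. G 1 (a + h * real k)) \<le>
      em_main G h (a + h * real m) - em_main G h a + h ^ 6 / 15120 * (G 6 (a + h * real m) - G 6 a)" by auto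
qed

text \<open>The successive derivatives of \<open>(A ln x + B) / x\<^sup>e\<close> are again of this form.\<close>

primrec log_coeffs :: "real \<times> real \<Rightarrow> nat \<Rightarrow> nat \<Rightarrow> real \<times> real" where
  "log_coeffs z e 0 = z"
| "log_coeffs z e (Suc i) = (- real (e + i) * fst (log_coeffs z e i), fst (log_coeffs z e i) - real (e + i) * snd (log_coeffs z e i))"

definition log_fam :: "real \<times> real \<Rightarrow> nat \<Rightarrow> nat \<Rightarrow> real \<Rightarrow> real" where
  "log_fam z e i x = (fst (log_coeffs z e i) * ln x + snd (log_coeffs z e i)) / x ^ (e + i)"

lemma log_fam_deriv:
  assumes x: "x > 0"
  shows "(log_fam z e i has_real_derivative log_fam z e (Suc i) x) (at x)"
proof -
  define A B n where "A = fst (log_coeffs z e i)" and "B = snd (log_coeffs z e i)" and "n = e + i"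
  have "((\<lambda>x. (A * ln x + B) / x ^ n) has_real_derivative (- real n * A * ln x + (A - real n * B)) / x ^ Suc n) (at x)"
  proof -
    have p: "((\<lambda>x. x ^ n) has_real_derivative real n * x ^ n / x) (at x)"
      using DERIV_pow[of n x] x by (cases n) auto
    have l: "((\<lambda>x. A * ln x + B) has_real_derivative A / x) (at x)"
      using x by (auto intro!: derivative_eq_intros)
    show ?thesis by (rule DERIV_cong[OF DERIV_divide[OF l p]]) (use x in \<open>simp_all add: field_simps\<close>)
  qed
  then show ?thesis unfolding log_fam_def[abs_def] A_def B_def n_def by simp
qed

section \<open>Decimal enclosures of logarithms\<close>

text \<open>The odd power series of ln ((1 + y) / (1 - y)), with a geometric bound for its
  tail.\<close>

lemma ln_quotient_bounds:
  assumes "x > 1"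
  defines "y \<equiv> (x - 1) / (x + 1)"
  shows "(\<Sum>k<n. 2 * y ^ (2 * k + 1) / real (2 * k + 1)) \<le> ln x"
    and "ln x \<le> (\<Sum>k<n. 2 * y ^ (2 * k + 1) / real (2 * k + 1)) + 2 * (y ^ (2 * n + 1) / (1 - y\<^sup>2) / real (2 * n + 1))"
  using ln_approx_bounds[OF assms(1), of n] unfolding y_def by simp_all

text \<open>Each prime p is reached from p / (p - 1), where few terms of the series suffice and p -
  1 has only smaller prime factors. The primes up to 23 are those in the explicit initial segments
  of the series for zeta'(2) and L'(1).\<close>

lemma ln_bounds:
  "0.693147180559 \<le> ln (2::real)" "ln (2::real) \<le> 0.693147180560"
  "1.098612288668 \<le> ln (3::real)" "ln (3::real) \<le> 1.098612288669"
  "1.609437912434 \<le> ln (5::real)" "ln (5::real) \<le> 1.609437912435"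
  "1.945910149055 \<le> ln (7::real)" "ln (7::real) \<le> 1.945910149056"
  "2.397895272798 \<le> ln (11::real)" "ln (11::real) \<le> 2.397895272799"
  "2.564949357461 \<le> ln (13::real)" "ln (13::real) \<le> 2.564949357462"
  "2.833213344056 \<le> ln (17::real)" "ln (17::real) \<le> 2.833213344057"
  "2.944438979166 \<le> ln (19::real)" "ln (19::real) \<le> 2.944438979167"
  "3.135494215929 \<le> ln (23::real)" "ln (23::real) \<le> 3.135494215930"
proof -
  have l32: "0.40546510810815 \<le> ln (3 / 2 :: real)" "ln (3 / 2 :: real) \<le> 0.40546510810818"
    using ln_quotient_bounds[of "3 / 2" 9] by (simp_all add: eval_nat_numeral)
  have l2: "0.69314718055993 \<le> ln (2 :: real)" "ln (2 :: real) \<le> 0.69314718055996"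
    using ln_quotient_bounds[of 2 13] by (simp_all add: eval_nat_numeral)
  have l54: "0.22314355131414 \<le> ln (5 / 4 :: real)" "ln (5 / 4 :: real) \<le> 0.22314355131428"
    using ln_quotient_bounds[of "5 / 4" 6] by (simp_all add: eval_nat_numeral)
  have l76: "0.15415067982725 \<le> ln (7 / 6 :: real)" "ln (7 / 6 :: real) \<le> 0.15415067982726"
    using ln_quotient_bounds[of "7 / 6" 6] by (simp_all add: eval_nat_numeral)
  have l11: "0.09531017980432 \<le> ln (11 / 10 :: real)" "ln (11 / 10 :: real) \<le> 0.09531017980433"
    using ln_quotient_bounds[of "11 / 10" 5] by (simp_all add: eval_nat_numeral)
  have l13: "0.08004270767353 \<le> ln (13 / 12 :: real)" "ln (13 / 12 :: real) \<le> 0.08004270767354"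
    using ln_quotient_bounds[of "13 / 12" 5] by (simp_all add: eval_nat_numeral)
  have l17: "0.06062462181643 \<le> ln (17 / 16 :: real)" "ln (17 / 16 :: real) \<le> 0.06062462181644"
    using ln_quotient_bounds[of "17 / 16" 4] by (simp_all add: eval_nat_numeral)
  have l19: "0.05406722127027 \<le> ln (19 / 18 :: real)" "ln (19 / 18 :: real) \<le> 0.05406722127028"
    using ln_quotient_bounds[of "19 / 18" 4] by (simp_all add: eval_nat_numeral)
  have l23: "0.04445176257083 \<le> ln (23 / 22 :: real)" "ln (23 / 22 :: real) \<le> 0.04445176257084"
    using ln_quotient_bounds[of "23 / 22" 4] by (simp_all add: eval_nat_numeral)
  have el32: "ln (3 / 2 :: real) = ln 3 - (ln 2)"
    using ln_div[of "3 :: real" 2] by simp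
  have el54: "ln (5 / 4 :: real) = ln 5 - (ln 2 + ln 2)"
    using ln_div[of "5 :: real" 4] ln_mult[of "2 :: real" 2] by simp
  have el76: "ln (7 / 6 :: real) = ln 7 - (ln 2 + ln 3)"
    using ln_div[of "7 :: real" 6] ln_mult[of "2 :: real" 3] by simp
  have el11: "ln (11 / 10 :: real) = ln 11 - (ln 2 + ln 5)"
    using ln_div[of "11 :: real" 10] ln_mult[of "2 :: real" 5] by simp
  have el13: "ln (13 / 12 :: real) = ln 13 - (ln 2 + ln 2 + ln 3)"
    using ln_div[of "13 :: real" 12] ln_mult[of "2 :: real" 2] ln_mult[of "4 :: real" 3] by simp
  have el17: "ln (17 / 16 :: real) = ln 17 - (ln 2 + ln 2 + ln 2 + ln 2)"
    using ln_div[of "17 :: real" 16] ln_mult[of "2 :: real" 2] ln_mult[of "4 :: real" 2] ln_mult[of "8 :: real" 2] by simp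
  have el19: "ln (19 / 18 :: real) = ln 19 - (ln 2 + ln 3 + ln 3)"
    using ln_div[of "19 :: real" 18] ln_mult[of "2 :: real" 3] ln_mult[of "6 :: real" 3] by simp
  have el23: "ln (23 / 22 :: real) = ln 23 - (ln 2 + ln 11)"
    using ln_div[of "23 :: real" 22] ln_mult[of "2 :: real" 11] by simp
  have p10: "(10 :: real) ^ 12 = 1000000000000" "(10 :: real) ^ 14 = 100000000000000" by simp_all
  note facts = l32 l2 l54 l76 l11 l13 l17 l19 l23 el32 el54 el76 el11 el13 el17 el19 el23
  show "0.693147180559 \<le> ln (2::real)" using facts unfolding p10 by linarith
  show "ln (2::real) \<le> 0.693147180560" using facts unfolding p10 by linarith
  show "1.098612288668 \<le> ln (3::real)" using facts unfolding p10 by linarith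
  show "ln (3::real) \<le> 1.098612288669" using facts unfolding p10 by linarith
  show "1.609437912434 \<le> ln (5::real)" using facts unfolding p10 by linarith
  show "ln (5::real) \<le> 1.609437912435" using facts unfolding p10 by linarith
  show "1.945910149055 \<le> ln (7::real)" using facts unfolding p10 by linarith
  show "ln (7::real) \<le> 1.945910149056" using facts unfolding p10 by linarith
  show "2.397895272798 \<le> ln (11::real)" using facts unfolding p10 by linarith
  show "ln (11::real) \<le> 2.397895272799" using facts unfolding p10 by linarith
  show "2.564949357461 \<le> ln (13::real)" using facts unfolding p10 by linarith
  show "ln (13::real) \<le> 2.564949357462" using facts unfolding p10 by linarith
  show "2.833213344056 \<le> ln (17::real)" using facts unfolding p10 by linarith
  show "ln (17::real) \<le> 2.833213344057" using facts unfolding p10 by linarith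
  show "2.944438979166 \<le> ln (19::real)" using facts unfolding p10 by linarith
  show "ln (19::real) \<le> 2.944438979167" using facts unfolding p10 by linarith
  show "3.135494215929 \<le> ln (23::real)" using facts unfolding p10 by linarith
  show "ln (23::real) \<le> 3.135494215930" using facts unfolding p10 by linarith
qed

section \<open>Numerical value of the constant\<close>

lemma log_coeffs_numeral:
  "log_coeffs z e (numeral k) = (- real (e + pred_numeral k) * fst (log_coeffs z e (pred_numeral k)),
     fst (log_coeffs z e (pred_numeral k)) - real (e + pred_numeral k) * snd (log_coeffs z e (pred_numeral k)))"
  by (simp add: numeral_eq_Suc)

lemma power_Suc_numeral: "(x::real) ^ Suc (Suc 0) = x ^ 2" "x ^ Suc 2 = x ^ 3" "x ^ Suc (Suc (Suc 0)) = x ^ 3"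
  by (simp_all add: numeral_eq_Suc)

lemmas log_fam_eval = log_fam_def log_coeffs_numeral power_Suc_numeral

lemma sum_lessThan_add: "(\<Sum>n<a + m. f n) = (\<Sum>n<(a::nat). f n) + (\<Sum>k<m. f (a + k) :: real)"
  by (induction m) (simp_all add: add.assoc)

text \<open>\<open>log_fam (1, 0) 0\<close> is ln x with its derivatives, the family for sums of 1 /
  x over arithmetic progressions.\<close>

lemma ln_fam:
  assumes "x > 0"
  shows "em_main (log_fam (1, 0) 0) h x = ln x - h / (2 * x) - h\<^sup>2 / (12 * x\<^sup>2) + h ^ 4 / (120 * x ^ 4)"
    and "log_fam (1, 0) 0 1 x = 1 / x" "log_fam (1, 0) 0 6 x = - 120 / x ^ 6" "0 \<le> log_fam (1, 0) 0 7 x"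
  using assms by (simp_all add: em_main_def log_fam_eval del: power_Suc)

lemma sum_inverse_ap_bounds:
  fixes a h :: real
  assumes "a > 0" "h > 0"
  shows "em_main (log_fam (1, 0) 0) h (a + h * real m) - em_main (log_fam (1, 0) 0) h a \<le> h * (\<Sum>k<m. 1 / (a + h * real k))"
    and "h * (\<Sum>k<m. 1 / (a + h * real k)) \<le> em_main (log_fam (1, 0) 0) h (a + h * real m) - em_main (log_fam (1, 0) 0) h a
      + h ^ 6 / 126 * (1 / a ^ 6 - 1 / (a + h * real m) ^ 6)"
proof -
  have p: "a + h * real k > 0" for k using assms by (simp add: add_pos_nonneg)
  have s: "(\<Sum>k<m. log_fam (1, 0) 0 1 (a + h * real k)) = (\<Sum>k<m. 1 / (a + h * real k))"
    by (intro sum.cong refl ln_fam p)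
  note em = euler_maclaurin_sum[OF assms(2), of a "log_fam (1, 0) 0" m]
  show "em_main (log_fam (1, 0) 0) h (a + h * real m) - em_main (log_fam (1, 0) 0) h a \<le> h * (\<Sum>k<m. 1 / (a + h * real k))"
    unfolding s[symmetric] by (rule em) (use assms in \<open>auto intro!: log_fam_deriv ln_fam\<close>)
  have "h * (\<Sum>k<m. 1 / (a + h * real k)) \<le> em_main (log_fam (1, 0) 0) h (a + h * real m) - em_main (log_fam (1, 0) 0) h a
      + h ^ 6 / 15120 * (log_fam (1, 0) 0 6 (a + h * real m) - log_fam (1, 0) 0 6 a)"
    unfolding s[symmetric] by (rule em) (use assms in \<open>auto intro!: log_fam_deriv ln_fam\<close>)
  also have "h ^ 6 / 15120 * (log_fam (1, 0) 0 6 (a + h * real m) - log_fam (1, 0) 0 6 a) =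
      h ^ 6 / 126 * (1 / a ^ 6 - 1 / (a + h * real m) ^ 6)"
    unfolding ln_fam(3)[OF p] ln_fam(3)[OF assms(1)] by (simp add: field_simps)
  finally show "h * (\<Sum>k<m. 1 / (a + h * real k)) \<le> em_main (log_fam (1, 0) 0) h (a + h * real m) - em_main (log_fam (1, 0) 0) h a
      + h ^ 6 / 126 * (1 / a ^ 6 - 1 / (a + h * real m) ^ 6)" .
qed

section \<open>Enclosures of the analytic constants\<close>

text \<open>The first 15 harmonic terms are taken exactly, the rest by Euler-Maclaurin from 16 on;
  the remainder 1 / (126 * 16^6), below 5e-10, accounts for nearly the whole width of the
  interval.\<close>

lemma euler_mascheroni_approx:
  "0.577215664665 \<le> (euler_mascheroni :: real)" "(euler_mascheroni :: real) \<le> 0.577215665143"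
proof -
  define H where "H = (harm 15 :: real)"
  define S where "S = (\<lambda>m. \<Sum>k<m. 1 / (16 + 1 * real k))"
  define W where "W = (\<lambda>x :: real. ln x - 1 / (2 * x) - 1\<^sup>2 / (12 * x\<^sup>2) + 1 ^ 4 / (120 * x ^ 4))"
  have Hm: "harm (15 + m) = H + S m" for m
  proof (induction m)
    case (Suc m)
    have "harm (15 + Suc m) = harm (15 + m) + inverse (real (Suc (15 + m)))" by (simp only: add_Suc_right harm_Suc)
    then show ?case unfolding Suc by (simp add: S_def inverse_eq_divide)
  qed (simp add: H_def S_def)
  have W: "em_main (log_fam (1, 0) 0) 1 x = W x" if "x > 0" for x using ln_fam(1)[OF that, of 1] by (simp only: W_def)
  have b: "W (16 + 1 * real m) - W 16 \<le> 1 * S m" "1 * S m \<le> W (16 + 1 * real m) - W 16 + 1 ^ 6 / 126 * (1 / 16 ^ 6 - 1 / (16 + 1 * real m) ^ 6)" for m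
    using sum_inverse_ap_bounds[of 16 1 m] W[of "16 + 1 * real m"] W[of 16] unfolding S_def by simp_all
  have "(\<lambda>m. harm (m + 15) - ln (real (m + 15))) \<longlonglongrightarrow> (euler_mascheroni :: real)"
    using euler_mascheroni_LIMSEQ by (rule LIMSEQ_ignore_initial_segment)
  moreover have "(\<lambda>m. ln (real (m + 15)) - W (16 + 1 * real m)) \<longlonglongrightarrow> 0" unfolding W_def by real_asymp
  ultimately have "(\<lambda>m. (harm (m + 15) - ln (real (m + 15))) + (ln (real (m + 15)) - W (16 + 1 * real m))) \<longlonglongrightarrow> euler_mascheroni + 0"
    by (rule tendsto_add)
  moreover have "(harm (m + 15) - l) + (l - w) = H + (S m - w)" for m l w
    using Hm[of m] by (simp add: add.commute[of m 15])
  ultimately have lim: "(\<lambda>m. H + (S m - W (16 + 1 * real m))) \<longlonglongrightarrow> euler_mascheroni"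
    by (simp only: add_0_right)
  have "H - W 16 \<le> H + (S m - W (16 + 1 * real m))" for m using b(1)[of m] by simp
  then have lo: "H - W 16 \<le> euler_mascheroni" by (intro LIMSEQ_le_const[OF lim]) auto
  have "H + (S m - W (16 + 1 * real m)) \<le> H - W 16 + 1 / 126 * (1 / 16 ^ 6)" for m
  proof -
    have "1 ^ 6 / 126 * (1 / 16 ^ 6 - 1 / (16 + 1 * real m) ^ 6) \<le> 1 / 126 * (1 / 16 ^ 6 :: real)"
      unfolding power_one by (rule mult_left_mono) simp_all
    then show ?thesis using b(2)[of m] by linarith
  qed
  then have hi: "euler_mascheroni \<le> H - W 16 + 1 / 126 * (1 / 16 ^ 6)" by (intro LIMSEQ_le_const2[OF lim]) auto
  have H: "H = 1195757 / 360360" unfolding H_def harm_def by (simp add: numeral_eq_Suc)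
  have "ln (16 :: real) = 4 * ln 2" using ln_realpow[of "2 :: real" 4] by simp
  then have W16: "W 16 = 4 * ln 2 - (1 / 32 + 1 / 3072 - 1 / 7864320)" by (simp add: W_def)
  show "0.577215664665 \<le> (euler_mascheroni :: real)" using lo ln_bounds(2) unfolding H W16 by simp
  show "(euler_mascheroni :: real) \<le> 0.577215665143" using hi ln_bounds(1) unfolding H W16 by simp
qed

text \<open>Euler-Maclaurin with step 2 from q to 3 q. The sum \<open>T\<close> includes the term 1
  / q, which the defect does not, so it is added back; 0.254 rounds up half of 2^6 / 126.\<close>

lemma ln3_defect_expansion:
  assumes q: "q \<ge> 1"
  shows "ln3_defect q \<le> 2 / 3 / real q - 4 / 27 / (real q)\<^sup>2 + 16 / 243 / real q ^ 4"
    and "2 / 3 / real q - 4 / 27 / (real q)\<^sup>2 + 16 / 243 / real q ^ 4 - 0.254 / real q ^ 6 \<le> ln3_defect q"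
proof -
  define x where "x = real q"
  have x: "x > 0" using q by (simp add: x_def)
  obtain p where p: "q = Suc p" using q by (cases q) auto
  define T where "T = (\<Sum>k<q. 1 / (x + 2 * real k))"
  have "T = 1 / x + (\<Sum>j=1..q - 1. 1 / (x + 2 * real j))"
    unfolding T_def p sum.lessThan_Suc_shift by (simp add: sum.atLeast1_atMost_eq)
  then have d: "ln3_defect q = ln 3 / 2 - T + 1 / x" by (simp add: ln3_defect_def x_def)
  have e: "x + 2 * real q = 3 * x" by (simp add: x_def)
  have W: "em_main (log_fam (1, 0) 0) 2 (3 * x) - em_main (log_fam (1, 0) 0) 2 x =
     ln 3 + 2 / 3 / x + 8 / 27 / x\<^sup>2 - 32 / 243 / x ^ 4"
    using x unfolding ln_fam(1)[OF x] ln_fam(1)[of "3 * x", OF mult_pos_pos[OF zero_less_numeral x]]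
    by (simp add: ln_mult power_mult_distrib field_simps)
  have E: "2 ^ 6 / 126 * (1 / x ^ 6 - 1 / (3 * x) ^ 6) \<le> 0.508 / x ^ 6"
    using x by (simp add: power_mult_distrib field_simps)
  note b = sum_inverse_ap_bounds[of x 2 q, OF x zero_less_numeral, unfolded e W, folded T_def]
  show "ln3_defect q \<le> 2 / 3 / real q - 4 / 27 / (real q)\<^sup>2 + 16 / 243 / real q ^ 4"
    using b(1) unfolding d x_def[symmetric] by simp
  show "2 / 3 / real q - 4 / 27 / (real q)\<^sup>2 + 16 / 243 / real q ^ 4 - 0.254 / real q ^ 6 \<le> ln3_defect q"
    using b(2) E unfolding d x_def[symmetric] by simp
qed

text \<open>An antiderivative of the expansion of the defect divided by x, with all derivatives. The
  coefficient \<open>A\<close> is 2/3 for the upper bound and slightly smaller for the lower one,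
  which absorbs the term 0.254 / x^7.\<close>

definition defect_fam :: "real \<Rightarrow> nat \<Rightarrow> real \<Rightarrow> real" where
  "defect_fam A i x = log_fam (0, - A) 1 i x + log_fam (0, 2 / 27) 2 i x + log_fam (0, - 4 / 243) 4 i x"

lemma defect_fam_deriv: "x > 0 \<Longrightarrow> (defect_fam A i has_real_derivative defect_fam A (Suc i) x) (at x)"
  unfolding defect_fam_def[abs_def] by (intro DERIV_add log_fam_deriv)

lemma defect_fam_eval:
  assumes "x > 0"
  shows "em_main (defect_fam A) 1 x = - A / x + 2 / 27 / x\<^sup>2 - 4 / 243 / x ^ 4 - (A / x\<^sup>2 - 4 / 27 / x ^ 3 + 16 / 243 / x ^ 5) / 2
      + (- 2 * A / x ^ 3 + 4 / 9 / x ^ 4 - 80 / 243 / x ^ 6) / 12 - (- 24 * A / x ^ 5 + 80 / 9 / x ^ 6 - 1120 / 81 / x ^ 8) / 720"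
    and "defect_fam A 1 x = A / x\<^sup>2 - 4 / 27 / x ^ 3 + 16 / 243 / x ^ 5"
    and "defect_fam A 6 x = - 720 * A / x ^ 7 + 1120 / 3 / x ^ 8 - 8960 / 9 / x ^ 10"
    and "defect_fam A 7 x = 5040 * A / x ^ 8 - 8960 / 3 / x ^ 9 + 89600 / 9 / x ^ 11"
  using assms by (simp_all add: em_main_def defect_fam_def log_fam_eval del: power_Suc)

lemma defect_partial_sum_bounds:
  assumes A: "1 / 2 \<le> A"
  shows "em_main (defect_fam A) 1 (16 + 1 * real m) - em_main (defect_fam A) 1 16 \<le> 1 * (\<Sum>k<m. defect_fam A 1 (16 + 1 * real k))"
    and "1 * (\<Sum>k<m. defect_fam A 1 (16 + 1 * real k)) \<le> em_main (defect_fam A) 1 (16 + 1 * real m) - em_main (defect_fam A) 1 16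
       + 1 ^ 6 / 15120 * (defect_fam A 6 (16 + 1 * real m) - defect_fam A 6 16)"
proof -
  have pos: "0 \<le> defect_fam A 7 x" if x: "x \<ge> 16" for x
  proof -
    have "8960 / 3 \<le> 5040 * A * x" using mult_mono[of "1 / 2" A 16 x] A x by simp
    then have "(8960 / 3) / x ^ 9 \<le> (5040 * A * x) / x ^ 9" using x by (intro divide_right_mono) auto
    also have "\<dots> = 5040 * A / x ^ 8" using x by (simp add: eval_nat_numeral)
    finally have "8960 / 3 / x ^ 9 \<le> 5040 * A / x ^ 8" .
    moreover have "0 \<le> 89600 / 9 / x ^ 11" using x by simp
    moreover have "x > 0" using x by simp
    ultimately show ?thesis unfolding defect_fam_eval(4)[OF \<open>x > 0\<close>] by linarith
  qed
  show "em_main (defect_fam A) 1 (16 + 1 * real m) - em_main (defect_fam A) 1 16 \<le> 1 * (\<Sum>k<m. defect_fam A 1 (16 + 1 * real k))"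
    "1 * (\<Sum>k<m. defect_fam A 1 (16 + 1 * real k)) \<le> em_main (defect_fam A) 1 (16 + 1 * real m) - em_main (defect_fam A) 1 16
       + 1 ^ 6 / 15120 * (defect_fam A 6 (16 + 1 * real m) - defect_fam A 6 16)"
    by (rule euler_maclaurin_sum; use pos in \<open>auto intro!: defect_fam_deriv\<close>)+
qed

lemma defect_fam_limits:
  "(\<lambda>m. em_main (defect_fam A) 1 (16 + 1 * real m)) \<longlonglongrightarrow> 0" "(\<lambda>m. defect_fam A 6 (16 + 1 * real m)) \<longlonglongrightarrow> 0"
proof -
  have p: "16 + 1 * real m > 0" for m by simp
  show "(\<lambda>m. em_main (defect_fam A) 1 (16 + 1 * real m)) \<longlonglongrightarrow> 0" unfolding defect_fam_eval(1)[OF p] by real_asymp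
  show "(\<lambda>m. defect_fam A 6 (16 + 1 * real m)) \<longlonglongrightarrow> 0" unfolding defect_fam_eval(3)[OF p] by real_asymp
qed

lemma defect_head:
  "0.91425519419029 \<le> (\<Sum>q=1..15. (\<Sum>j=1..q - 1. 1 / (real q + 2 * real j)) / real q)"
  "(\<Sum>q=1..15. (\<Sum>j=1..q - 1. 1 / (real q + 2 * real j)) / real q) \<le> 0.9142551941903"
  by (simp_all add: sum.atLeast1_atMost_eq eval_nat_numeral)

text \<open>The terms decay like 1 / q^2, too slowly for direct summation: 15 terms are exact up to
  ln 3, and the tail is replaced by its expansion and summed by Euler-Maclaurin.\<close>

lemma ln3_defect_series_bounds:
  "0.95115650297 \<le> (\<Sum>n. ln3_defect (Suc n) / real (Suc n))" "(\<Sum>n. ln3_defect (Suc n) / real (Suc n)) \<le> 0.95115651921"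
proof -
  define D where "D = (\<Sum>n. ln3_defect (Suc n) / real (Suc n))"
  define T where "T = (\<lambda>m. \<Sum>k<m. ln3_defect (16 + k) / real (16 + k))"
  define R where "R = (\<Sum>q=1..15. (\<Sum>j=1..q - 1. 1 / (real q + 2 * real j)) / real q)"
  have H: "harm 15 = (1195757 / 360360 :: real)" unfolding harm_def by (simp add: numeral_eq_Suc)
  have head: "(\<Sum>q=1..15. ln3_defect q / real q) = ln 3 / 2 * (1195757 / 360360) - R"
  proof -
    have "(\<Sum>q=1..15. ln3_defect q / real q) = (\<Sum>q=1..15. ln 3 / 2 * inverse (real q)) - R"
      unfolding R_def sum_subtractf[symmetric] ln3_defect_def
      unfolding diff_divide_distrib divide_inverse[of "ln 3 / 2"] ..
    then show ?thesis unfolding sum_distrib_left[symmetric] harm_def[symmetric] H .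
  qed
  have part: "(\<Sum>n<15 + m. ln3_defect (Suc n) / real (Suc n)) = (\<Sum>q=1..15. ln3_defect q / real q) + T m" for m
    by (simp add: sum_lessThan_add T_def sum.atLeast1_atMost_eq)
  have "(\<lambda>m. \<Sum>n<m + 15. ln3_defect (Suc n) / real (Suc n)) \<longlonglongrightarrow> D"
    unfolding D_def by (intro LIMSEQ_ignore_initial_segment summable_LIMSEQ ln3_defect_summable)
  then have "(\<lambda>m. (\<Sum>q=1..15. ln3_defect q / real q) + T m) \<longlonglongrightarrow> D" by (simp only: part add.commute[of _ 15])
  from tendsto_diff[OF this tendsto_const[of "\<Sum>q=1..15. ln3_defect q / real q"]]
  have T: "T \<longlonglongrightarrow> D - (\<Sum>q=1..15. ln3_defect q / real q)" by simp
  have up: "T m \<le> em_main (defect_fam (2 / 3)) 1 (16 + 1 * real m) - em_main (defect_fam (2 / 3)) 1 16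
       + 1 ^ 6 / 15120 * (defect_fam (2 / 3) 6 (16 + 1 * real m) - defect_fam (2 / 3) 6 16)" for m
  proof -
    have "T m \<le> (\<Sum>k<m. defect_fam (2 / 3) 1 (16 + 1 * real k))" unfolding T_def
    proof (rule sum_mono)
      fix k
      define x where "x = real (16 + k)"
      have x: "x > 0" "16 + 1 * real k = x" by (simp_all add: x_def)
      have "ln3_defect (16 + k) / x \<le> (2 / 3 / x - 4 / 27 / x\<^sup>2 + 16 / 243 / x ^ 4) / x"
        unfolding x_def by (intro divide_right_mono ln3_defect_expansion(1)) auto
      also have "\<dots> = defect_fam (2 / 3) 1 x" using x unfolding defect_fam_eval(2)[OF x(1)] by (simp add: add_divide_distrib diff_divide_distrib eval_nat_numeral)
      finally show "ln3_defect (16 + k) / real (16 + k) \<le> defect_fam (2 / 3) 1 (16 + 1 * real k)" unfolding x(2) x_def .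
    qed
    then show ?thesis using defect_partial_sum_bounds(2)[of "2 / 3" m] by simp
  qed
  \<comment> \<open>For x \<ge> 16 one has 0.254 / x^7 \<le> (0.254 / 16^5) / x^2, and 0.254 / 16^5
    is just below 2.5e-7.\<close>
  define A where "A = 2 / 3 - (0.00000025 :: real)"
  have lo: "em_main (defect_fam A) 1 (16 + 1 * real m) - em_main (defect_fam A) 1 16 \<le> T m" for m
  proof -
    have "(\<Sum>k<m. defect_fam A 1 (16 + 1 * real k)) \<le> T m" unfolding T_def
    proof (rule sum_mono)
      fix k
      define x where "x = real (16 + k)"
      have x: "x > 0" "16 + 1 * real k = x" "x \<ge> 16" by (simp_all add: x_def)
      have "0.254 / x ^ 7 = 0.254 / x ^ 5 / x\<^sup>2" by (simp add: eval_nat_numeral)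
      also have "\<dots> \<le> 0.254 / 16 ^ 5 / x\<^sup>2" using x by (intro divide_right_mono divide_left_mono power_mono) auto
      also have "\<dots> \<le> 0.00000025 / x\<^sup>2" by (intro divide_right_mono) auto
      finally have e: "0.254 / x ^ 7 \<le> 0.00000025 / x\<^sup>2" .
      have "defect_fam A 1 x = 2 / 3 / x\<^sup>2 - 0.00000025 / x\<^sup>2 - 4 / 27 / x ^ 3 + 16 / 243 / x ^ 5"
        unfolding defect_fam_eval(2)[OF x(1)] A_def diff_divide_distrib ..
      also have "\<dots> \<le> 2 / 3 / x\<^sup>2 - 0.254 / x ^ 7 - 4 / 27 / x ^ 3 + 16 / 243 / x ^ 5" using e by linarith
      also have "\<dots> = (2 / 3 / x - 4 / 27 / x\<^sup>2 + 16 / 243 / x ^ 4 - 0.254 / x ^ 6) / x"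
        using x by (simp add: add_divide_distrib diff_divide_distrib eval_nat_numeral)
      also have "\<dots> \<le> ln3_defect (16 + k) / x"
        unfolding x_def by (intro divide_right_mono ln3_defect_expansion(2)) auto
      finally show "defect_fam A 1 (16 + 1 * real k) \<le> ln3_defect (16 + k) / real (16 + k)" unfolding x(2) x_def .
    qed
    then show ?thesis using defect_partial_sum_bounds(1)[of A m] by (simp add: A_def)
  qed
  have "D - (\<Sum>q=1..15. ln3_defect q / real q) \<le> 0 - em_main (defect_fam (2 / 3)) 1 16 + 1 ^ 6 / 15120 * (0 - defect_fam (2 / 3) 6 16)"
    by (rule LIMSEQ_le[OF T tendsto_add[OF tendsto_diff[OF defect_fam_limits(1) tendsto_const]
          tendsto_mult[OF tendsto_const tendsto_diff[OF defect_fam_limits(2) tendsto_const]]]]) (use up in blast)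
  then have hi': "D \<le> ln 3 / 2 * (1195757 / 360360) - R + (- em_main (defect_fam (2 / 3)) 1 16 - defect_fam (2 / 3) 6 16 / 15120)"
    unfolding head by simp
  have "0 - em_main (defect_fam A) 1 16 \<le> D - (\<Sum>q=1..15. ln3_defect q / real q)"
    by (rule LIMSEQ_le[OF tendsto_diff[OF defect_fam_limits(1) tendsto_const] T]) (use lo in blast)
  then have lo': "ln 3 / 2 * (1195757 / 360360) - R - em_main (defect_fam A) 1 16 \<le> D" unfolding head by simp
  have z: "(16 :: real) > 0" by simp
  show "0.95115650297 \<le> (\<Sum>n. ln3_defect (Suc n) / real (Suc n))"
    using lo' ln_bounds(3) defect_head(2) unfolding defect_fam_eval[OF z] D_def[symmetric] R_def[symmetric] A_def by simp
  show "(\<Sum>n. ln3_defect (Suc n) / real (Suc n)) \<le> 0.95115651921"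
    using hi' ln_bounds(4) defect_head(1) unfolding defect_fam_eval[OF z] D_def[symmetric] R_def[symmetric] by simp
qed

lemma ln_composite:
  "ln (4::real) = 2 * ln 2" "ln (6::real) = ln 2 + ln 3" "ln (8::real) = 3 * ln 2" "ln (9::real) = 2 * ln 3"
  "ln (10::real) = ln 2 + ln 5" "ln (12::real) = 2 * ln 2 + ln 3" "ln (14::real) = ln 2 + ln 7" "ln (15::real) = ln 3 + ln 5"
  "ln (16::real) = 4 * ln 2" "ln (20::real) = 2 * ln 2 + ln 5" "ln (22::real) = ln 2 + ln 11" "ln (25::real) = 2 * ln 5"
  "ln (26::real) = ln 2 + ln 13"
  using ln_mult[of "2 :: real" 2] ln_mult[of "2 :: real" 3] ln_mult[of "2 :: real" 4] ln_mult[of "3 :: real" 3] ln_mult[of "2 :: real" 5]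
    ln_mult[of "2 :: real" 6] ln_mult[of "2 :: real" 7] ln_mult[of "3 :: real" 5] ln_mult[of "2 :: real" 8] ln_mult[of "2 :: real" 10]
    ln_mult[of "2 :: real" 11] ln_mult[of "5 :: real" 5] ln_mult[of "2 :: real" 13] by simp_all

text \<open>ln x / x^2 has the antiderivative - (ln x + 1) / x, the member of order 0 of this
  family.\<close>

lemma ln_over_square_fam:
  assumes "x > 0"
  shows "em_main (log_fam (- 1, - 1) 1) 1 x = - (ln x + 1) / x - ln x / x\<^sup>2 / 2 + (1 - 2 * ln x) / x ^ 3 / 12 - (26 - 24 * ln x) / x ^ 5 / 720"
    and "log_fam (- 1, - 1) 1 1 x = ln x / x\<^sup>2" "log_fam (- 1, - 1) 1 6 x = (1044 - 720 * ln x) / x ^ 7"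
    and "log_fam (- 1, - 1) 1 7 x = (5040 * ln x - 8028) / x ^ 8"
  using assms by (simp_all add: em_main_def log_fam_eval mult.commute del: power_Suc)

lemma zeta_deriv_approx:
  "0.93754825419 \<le> - deriv zeta_series 2" "- deriv zeta_series 2 \<le> 0.93754825444"
proof -
  define G where "G = log_fam (- 1, - 1) 1"
  define T where "T = (\<lambda>m. \<Sum>k<m. ln (real (16 + k)) / (real (16 + k))\<^sup>2)"
  define H where "H = (\<Sum>n<15. ln (real (Suc n)) / (real (Suc n))\<^sup>2)"
  have p: "16 + 1 * real k > 0" for k by simp
  have part: "(\<Sum>n<15 + m. ln (real (Suc n)) / (real (Suc n))\<^sup>2) = H + T m" for m
    by (simp add: sum_lessThan_add H_def T_def)
  have "(\<lambda>m. \<Sum>n<m + 15. ln (real (Suc n)) / (real (Suc n))\<^sup>2) \<longlonglongrightarrow> - deriv zeta_series 2"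
    using zeta_series_deriv(1) unfolding sums_def by (rule LIMSEQ_ignore_initial_segment)
  then have "(\<lambda>m. H + T m) \<longlonglongrightarrow> - deriv zeta_series 2" by (simp only: part add.commute[of _ 15])
  from tendsto_diff[OF this tendsto_const[of H]] have T: "T \<longlonglongrightarrow> - deriv zeta_series 2 - H" by simp
  have s: "(\<Sum>k<m. G 1 (16 + 1 * real k)) = T m" for m
    unfolding T_def G_def by (rule sum.cong[OF refl], subst ln_over_square_fam(2)) simp_all
  \<comment> \<open>The seventh derivative is nonnegative once ln x \<ge> 8028 / 5040, about 1.59,
    while ln 16 exceeds 2.7.\<close>
  have pos: "0 \<le> G 7 x" if "x \<ge> 16" for x
  proof -
    have "ln 16 \<le> ln x" using that by simp
    then have "0 \<le> 5040 * ln x - 8028" using ln_bounds(1) ln_composite(9) by simp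
    then show ?thesis using that unfolding G_def by (subst ln_over_square_fam(4)) simp_all
  qed
  have em: "em_main G 1 (16 + 1 * real m) - em_main G 1 16 \<le> 1 * T m"
    "1 * T m \<le> em_main G 1 (16 + 1 * real m) - em_main G 1 16 + 1 ^ 6 / 15120 * (G 6 (16 + 1 * real m) - G 6 16)" for m
    unfolding s[symmetric] by (rule euler_maclaurin_sum; use pos in \<open>auto intro!: log_fam_deriv simp: G_def\<close>)+
  have lim: "(\<lambda>m. em_main G 1 (16 + 1 * real m)) \<longlonglongrightarrow> 0" "(\<lambda>m. G 6 (16 + 1 * real m)) \<longlonglongrightarrow> 0"
    unfolding G_def ln_over_square_fam(1)[OF p] ln_over_square_fam(3)[OF p] by real_asymp+
  have lo: "0 - em_main G 1 16 \<le> - deriv zeta_series 2 - H"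
    by (rule LIMSEQ_le[OF tendsto_diff[OF lim(1) tendsto_const] T]) (use em(1) in simp)
  have hi: "- deriv zeta_series 2 - H \<le> 0 - em_main G 1 16 + 1 ^ 6 / 15120 * (0 - G 6 16)"
    by (rule LIMSEQ_le[OF T tendsto_add[OF tendsto_diff[OF lim(1) tendsto_const] tendsto_mult[OF tendsto_const tendsto_diff[OF lim(2) tendsto_const]]]])
      (use em(2) in simp)
  have z: "(16 :: real) > 0" by simp
  have H: "H = ln 2 / 4 + ln 3 / 9 + ln 4 / 16 + ln 5 / 25 + ln 6 / 36 + ln 7 / 49 + ln 8 / 64 + ln 9 / 81 + ln 10 / 100
     + ln 11 / 121 + ln 12 / 144 + ln 13 / 169 + ln 14 / 196 + ln 15 / 225"
    unfolding H_def by (simp add: eval_nat_numeral)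
  show "0.93754825419 \<le> - deriv zeta_series 2"
    using lo ln_bounds unfolding H G_def ln_over_square_fam(1)[OF z] ln_composite by (simp add: add_divide_distrib diff_divide_distrib; linarith)
  show "- deriv zeta_series 2 \<le> 0.93754825444"
    using hi ln_bounds unfolding H G_def ln_over_square_fam(1)[OF z] ln_over_square_fam(3)[OF z] ln_composite by (simp add: add_divide_distrib diff_divide_distrib; linarith)
qed

text \<open>The antiderivative (ln x)^2 / 2 of ln x / x is not of the form that
  \<open>log_fam\<close> covers, so it is put in front as member 0.\<close>

definition ln_sq_fam :: "nat \<Rightarrow> real \<Rightarrow> real" where
  "ln_sq_fam i = (case i of 0 \<Rightarrow> (\<lambda>x. (ln x)\<^sup>2 / 2) | Suc j \<Rightarrow> log_fam (1, 0) 1 j)"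

lemma ln_sq_fam_numeral:
  "ln_sq_fam 0 = (\<lambda>x. (ln x)\<^sup>2 / 2)" "ln_sq_fam (Suc 0) = log_fam (1, 0) 1 0" "ln_sq_fam (numeral k) = log_fam (1, 0) 1 (pred_numeral k)"
  by (simp_all add: ln_sq_fam_def numeral_eq_Suc)

lemma ln_sq_fam_deriv:
  assumes "x > 0"
  shows "(ln_sq_fam i has_real_derivative ln_sq_fam (Suc i) x) (at x)"
proof (cases i)
  case 0
  have "((\<lambda>x. (ln x)\<^sup>2 / 2) has_real_derivative ln x / x) (at x)"
    using assms by (auto intro!: derivative_eq_intros)
  then show ?thesis by (simp add: 0 ln_sq_fam_def log_fam_def)
qed (use assms in \<open>simp add: ln_sq_fam_def log_fam_deriv\<close>)

lemma ln_sq_fam_eval: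
  assumes "x > 0"
  shows "em_main ln_sq_fam 3 x = (ln x)\<^sup>2 / 2 - 3 / 2 * (ln x / x) + 3 / 4 * ((1 - ln x) / x\<^sup>2) - 9 / 80 * ((11 - 6 * ln x) / x ^ 4)"
    and "ln_sq_fam 1 x = ln x / x" "ln_sq_fam 6 x = (274 - 120 * ln x) / x ^ 6"
    and "ln_sq_fam 7 x = (720 * ln x - 1764) / x ^ 7"
  using assms by (simp_all add: em_main_def ln_sq_fam_numeral log_fam_eval del: power_Suc)

lemma ln_sq_partial_sum_bounds:
  assumes a: "a \<ge> 25"
  shows "em_main ln_sq_fam 3 (a + 3 * real m) - em_main ln_sq_fam 3 a \<le> 3 * (\<Sum>k<m. ln (a + 3 * real k) / (a + 3 * real k))"
    and "3 * (\<Sum>k<m. ln (a + 3 * real k) / (a + 3 * real k)) \<le> em_main ln_sq_fam 3 (a + 3 * real m) - em_main ln_sq_fam 3 a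
       + 3 ^ 6 / 15120 * (ln_sq_fam 6 (a + 3 * real m) - ln_sq_fam 6 a)"
proof -
  have p: "a + 3 * real k > 0" for k using a by (simp add: add_pos_nonneg)
  have s: "(\<Sum>k<m. ln_sq_fam 1 (a + 3 * real k)) = (\<Sum>k<m. ln (a + 3 * real k) / (a + 3 * real k))"
    by (intro sum.cong refl ln_sq_fam_eval p)
  have pos: "0 \<le> ln_sq_fam 7 x" if "x \<ge> a" for x
  proof -
    have "ln 25 \<le> ln x" using that a by simp
    then have "0 \<le> 720 * ln x - 1764" using ln_bounds(5) ln_composite(12) by simp
    then show ?thesis using that a by (subst ln_sq_fam_eval(4)) simp_all
  qed
  show "em_main ln_sq_fam 3 (a + 3 * real m) - em_main ln_sq_fam 3 a \<le> 3 * (\<Sum>k<m. ln (a + 3 * real k) / (a + 3 * real k))"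
    "3 * (\<Sum>k<m. ln (a + 3 * real k) / (a + 3 * real k)) \<le> em_main ln_sq_fam 3 (a + 3 * real m) - em_main ln_sq_fam 3 a
       + 3 ^ 6 / 15120 * (ln_sq_fam 6 (a + 3 * real m) - ln_sq_fam 6 a)"
    unfolding s[symmetric] by (rule euler_maclaurin_sum; use pos a in \<open>auto intro!: ln_sq_fam_deriv\<close>)+
qed

text \<open>After eight periods of \<open>chi3\<close>, the residue classes 1 and 2 modulo 3 are
  summed separately with step 3, from 25 and from 26. Each of these sums diverges; the growing terms
  (ln x)^2 / 2 cancel in the difference, so only the limit of the difference is formed.\<close>

lemma L_chi3_deriv_approx:
  "0.22266298022 \<le> deriv L_chi3 1" "deriv L_chi3 1 \<le> 0.22266299371"
proof -
  define g where "g = (\<lambda>n. ln (real n) / real n)"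
  define S where "S = (\<lambda>a m. \<Sum>k<m. ln (a + 3 * real k) / (a + 3 * real k))"
  define H where "H = (\<Sum>k<8. g (3 * k + 1) - g (3 * k + 2))"
  have part: "(\<Sum>n<3 * M. chi3 (Suc n) * ln (real (Suc n)) / real (Suc n)) = (\<Sum>k<M. g (3 * k + 1) - g (3 * k + 2))" for M
  proof (induction M)
    case (Suc M)
    have e: "3 * Suc M = Suc (Suc (Suc (3 * M)))" by simp
    have chi: "chi3 (Suc (3 * M)) = 1" "chi3 (Suc (Suc (3 * M))) = -1" "chi3 (Suc (Suc (Suc (3 * M)))) = 0"
    proof -
      have "Suc (3 * M) mod 3 = 1" "Suc (Suc (3 * M)) mod 3 = 2" "Suc (Suc (Suc (3 * M))) mod 3 = 0" by presburger+
      then show "chi3 (Suc (3 * M)) = 1" "chi3 (Suc (Suc (3 * M))) = -1" "chi3 (Suc (Suc (Suc (3 * M)))) = 0"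
        unfolding chi3_def by simp_all
    qed
    show ?case unfolding e sum.lessThan_Suc Suc chi by (simp add: g_def)
  qed simp
  have split: "(\<Sum>k<8 + m. g (3 * k + 1) - g (3 * k + 2)) = H + (S 25 m - S 26 m)" for m
  proof -
    have "g (3 * (8 + k) + 1) - g (3 * (8 + k) + 2) = ln (25 + 3 * real k) / (25 + 3 * real k) - ln (26 + 3 * real k) / (26 + 3 * real k)" for k
      by (simp add: g_def)
    then show ?thesis unfolding sum_lessThan_add H_def S_def by (simp only: sum_subtractf)
  qed
  have "filterlim (\<lambda>m. 3 * (8 + m)) sequentially sequentially" by (intro filterlim_subseq strict_monoI) auto
  with L_chi3_deriv(1) have "(\<lambda>m. \<Sum>n<3 * (8 + m). chi3 (Suc n) * ln (real (Suc n)) / real (Suc n)) \<longlonglongrightarrow> - deriv L_chi3 1"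
    unfolding sums_def by (rule filterlim_compose)
  then have "(\<lambda>m. H + (S 25 m - S 26 m)) \<longlonglongrightarrow> - deriv L_chi3 1" by (simp only: part split)
  from tendsto_mult[OF tendsto_const[of 3] tendsto_diff[OF this tendsto_const[of H]]]
  have lim: "(\<lambda>m. 3 * (S 25 m - S 26 m)) \<longlonglongrightarrow> 3 * (- deriv L_chi3 1 - H)" by simp
  have p: "25 + 3 * real m > 0" "26 + 3 * real m > 0" for m by simp_all
  have b25: "em_main ln_sq_fam 3 (25 + 3 * real m) - em_main ln_sq_fam 3 25 \<le> 3 * S 25 m"
    "3 * S 25 m \<le> em_main ln_sq_fam 3 (25 + 3 * real m) - em_main ln_sq_fam 3 25 + 3 ^ 6 / 15120 * (ln_sq_fam 6 (25 + 3 * real m) - ln_sq_fam 6 25)" for m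
    unfolding S_def by (rule ln_sq_partial_sum_bounds; simp)+
  have b26: "em_main ln_sq_fam 3 (26 + 3 * real m) - em_main ln_sq_fam 3 26 \<le> 3 * S 26 m"
    "3 * S 26 m \<le> em_main ln_sq_fam 3 (26 + 3 * real m) - em_main ln_sq_fam 3 26 + 3 ^ 6 / 15120 * (ln_sq_fam 6 (26 + 3 * real m) - ln_sq_fam 6 26)" for m
    unfolding S_def by (rule ln_sq_partial_sum_bounds; simp)+
  have w: "(\<lambda>m. em_main ln_sq_fam 3 (25 + 3 * real m) - em_main ln_sq_fam 3 (26 + 3 * real m)) \<longlonglongrightarrow> 0"
    unfolding ln_sq_fam_eval(1)[OF p(1)] ln_sq_fam_eval(1)[OF p(2)] by real_asymp
  have w6: "(\<lambda>m. ln_sq_fam 6 (25 + 3 * real m)) \<longlonglongrightarrow> 0" "(\<lambda>m. ln_sq_fam 6 (26 + 3 * real m)) \<longlonglongrightarrow> 0"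
    unfolding ln_sq_fam_eval(3)[OF p(1)] ln_sq_fam_eval(3)[OF p(2)] by real_asymp+
  define d where "d = em_main ln_sq_fam 3 26 - em_main ln_sq_fam 3 25"
  have hi: "3 * (- deriv L_chi3 1 - H) \<le> 0 + d + 3 ^ 6 / 15120 * (0 - ln_sq_fam 6 25)"
  proof (rule LIMSEQ_le[OF lim tendsto_add[OF tendsto_add[OF w tendsto_const] tendsto_mult[OF tendsto_const tendsto_diff[OF w6(1) tendsto_const]]]])
    have "3 * (S 25 m - S 26 m) \<le> em_main ln_sq_fam 3 (25 + 3 * real m) - em_main ln_sq_fam 3 (26 + 3 * real m) + d +
       3 ^ 6 / 15120 * (ln_sq_fam 6 (25 + 3 * real m) - ln_sq_fam 6 25)" for m
      using b25(2)[of m] b26(1)[of m] unfolding d_def right_diff_distrib by linarith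
    then show "\<exists>N. \<forall>m\<ge>N. 3 * (S 25 m - S 26 m) \<le> em_main ln_sq_fam 3 (25 + 3 * real m) - em_main ln_sq_fam 3 (26 + 3 * real m) + d +
       3 ^ 6 / 15120 * (ln_sq_fam 6 (25 + 3 * real m) - ln_sq_fam 6 25)" by blast
  qed
  have lo: "0 + d - 3 ^ 6 / 15120 * (0 - ln_sq_fam 6 26) \<le> 3 * (- deriv L_chi3 1 - H)"
  proof (rule LIMSEQ_le[OF tendsto_diff[OF tendsto_add[OF w tendsto_const] tendsto_mult[OF tendsto_const tendsto_diff[OF w6(2) tendsto_const]]] lim])
    have "em_main ln_sq_fam 3 (25 + 3 * real m) - em_main ln_sq_fam 3 (26 + 3 * real m) + d -
       3 ^ 6 / 15120 * (ln_sq_fam 6 (26 + 3 * real m) - ln_sq_fam 6 26) \<le> 3 * (S 25 m - S 26 m)" for m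
      using b25(1)[of m] b26(2)[of m] unfolding d_def right_diff_distrib by linarith
    then show "\<exists>N. \<forall>m\<ge>N. em_main ln_sq_fam 3 (25 + 3 * real m) - em_main ln_sq_fam 3 (26 + 3 * real m) + d -
       3 ^ 6 / 15120 * (ln_sq_fam 6 (26 + 3 * real m) - ln_sq_fam 6 26) \<le> 3 * (S 25 m - S 26 m)" by blast
  qed
  have H: "H = - ln 2 / 2 + ln 4 / 4 - ln 5 / 5 + ln 7 / 7 - ln 8 / 8 + ln 10 / 10 - ln 11 / 11 + ln 13 / 13 - ln 14 / 14
     + ln 16 / 16 - ln 17 / 17 + ln 19 / 19 - ln 20 / 20 + ln 22 / 22 - ln 23 / 23"
    unfolding H_def g_def by (simp add: eval_nat_numeral)
  have z: "(25 :: real) > 0" "(26 :: real) > 0" by simp_all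
  have l25: "3.218875824868 \<le> ln (25 :: real)" "ln (25 :: real) \<le> 3.218875824870"
    and l26: "3.258096538020 \<le> ln (26 :: real)" "ln (26 :: real) \<le> 3.258096538022"
    using ln_bounds unfolding ln_composite by simp_all
  \<comment> \<open>The squares of the two logarithms are enclosed separately, because linear
    arithmetic treats them as independent atoms.\<close>
  have sq: "3.218875824868\<^sup>2 \<le> (ln (25 :: real))\<^sup>2" "(ln (25 :: real))\<^sup>2 \<le> 3.218875824870\<^sup>2"
    "3.258096538020\<^sup>2 \<le> (ln (26 :: real))\<^sup>2" "(ln (26 :: real))\<^sup>2 \<le> 3.258096538022\<^sup>2"
    by (rule power_mono; use l25 l26 in simp)+
  note ev = ln_sq_fam_eval(1)[OF z(1)] ln_sq_fam_eval(1)[OF z(2)] ln_sq_fam_eval(3)[OF z(1)] ln_sq_fam_eval(3)[OF z(2)]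
  show "0.22266298022 \<le> deriv L_chi3 1"
    using hi ln_bounds l25 l26 sq unfolding H d_def ev ln_composite(1-11) by (simp add: power_divide add_divide_distrib diff_divide_distrib; linarith)
  show "deriv L_chi3 1 \<le> 0.22266299371"
    using lo ln_bounds l25 l26 sq unfolding H d_def ev ln_composite(1-11) by (simp add: power_divide add_divide_distrib diff_divide_distrib; linarith)
qed

section \<open>Assembly of the numerical value\<close>

text \<open>As zeta(2) = pi^2 / 6 and L(1)^2 = pi^2 / 27, the value zeta(2) is 9/2 L(1)^2. The
  constant becomes a polynomial in L and 1 / L whose coefficients are enclosed one by one.\<close>

lemma c_triangle_conv_L:
  defines "L \<equiv> L_chi3 1"
  shows "c_triangle = L + 1 / L * (ln 3 * (3 * euler_mascheroni - ln 3 / 4) / 8 - (\<Sum>n. ln3_defect (Suc n) / real (Suc n)) / 2)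
     + (1 / L)\<^sup>2 * (ln 3 * deriv L_chi3 1 / 8) + (1 / L) ^ 3 * (ln 3 * (- deriv zeta_series 2) / 18)"
proof -
  have L: "L > 0" using L_chi3_1_pos by (simp add: L_def)
  have "L\<^sup>2 = pi\<^sup>2 / 27" unfolding L_def L_chi3_1 by (simp add: power_divide power_mult_distrib)
  then have Z: "zeta_series 2 = 9 / 2 * L\<^sup>2" unfolding zeta_series_2 by simp
  have "ln (3 :: real) \<noteq> 0" by simp
  then show ?thesis unfolding c_triangle_conv Z L_def[symmetric] using L by (simp add: field_simps eval_nat_numeral)
qed

lemma c_triangle_approx: "\<bar>c_triangle - 0.4915036\<bar> \<le> 5 / 10 ^ 8"
proof -
  define L u g D L' Z' A B C where "L = L_chi3 1" and "u = 1 / L" and "g = (euler_mascheroni :: real)"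
    and "D = (\<Sum>n. ln3_defect (Suc n) / real (Suc n))" and "L' = deriv L_chi3 1" and "Z' = - deriv zeta_series 2"
    and "A = ln 3 * (3 * g - ln 3 / 4) / 8 - D / 2" and "B = ln 3 * L' / 8" and "C = ln 3 * Z' / 18"
  have c: "c_triangle = L + u * A + u\<^sup>2 * B + u ^ 3 * C"
    unfolding c_triangle_conv_L L_def u_def g_def D_def L'_def Z'_def A_def B_def C_def ..
  have r: "1.732050807568 \<le> sqrt 3" "sqrt 3 \<le> 1.732050807569"
    by (rule real_le_rsqrt, simp add: power2_eq_square) (rule real_le_lsqrt, simp_all add: power2_eq_square)
  note l3 = ln_bounds(3,4)
  have "L = sqrt 3 * pi / 9" unfolding L_def L_chi3_1 by (simp add: field_simps)
  moreover have "1.732050807568 * 3.141592653588 \<le> sqrt 3 * pi" "sqrt 3 * pi \<le> 1.732050807569 * 3.1415926535899"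
    using r pi_approx by (intro mult_mono; simp)+
  ultimately have L: "0.604599788077 \<le> L" "L \<le> 0.604599788079" by simp_all
  have u: "1.653986686262 \<le> u" "u \<le> 1.653986686269"
    unfolding u_def using L by (simp_all add: field_simps)
  have "1.098612288668 * (3 * 0.577215664665 - 1.098612288669 / 4) \<le> ln 3 * (3 * g - ln 3 / 4)"
    "ln 3 * (3 * g - ln 3 / 4) \<le> 1.098612288669 * (3 * 0.577215665143 - 1.098612288668 / 4)"
    using l3 euler_mascheroni_approx unfolding g_def by (intro mult_mono; simp)+
  then have A: "- 0.275494331227 \<le> A" "A \<le> - 0.275494322907"
    unfolding A_def using ln3_defect_series_bounds unfolding D_def[symmetric] by simp_all
  have "1.098612288668 * 0.22266298022 \<le> ln 3 * L'" "ln 3 * L' \<le> 1.098612288669 * 0.22266299371"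
    using l3 L_chi3_deriv_approx unfolding L'_def by (intro mult_mono; simp)+
  then have B: "0.030577535786 \<le> B" "B \<le> 0.030577537642" unfolding B_def by (simp_all add: mult.commute)
  have "1.098612288668 * 0.93754825419 \<le> ln 3 * Z'" "ln 3 * Z' \<le> 1.098612288669 * 0.93754825444"
    using l3 zeta_deriv_approx unfolding Z'_def by (intro mult_mono; simp)+
  then have C: "0.057222335180 \<le> C" "C \<le> 0.057222335199" unfolding C_def by (simp_all add: mult.commute)
  have pw: "1.653986686262\<^sup>2 \<le> u\<^sup>2" "u\<^sup>2 \<le> 1.653986686269\<^sup>2" "1.653986686262 ^ 3 \<le> u ^ 3" "u ^ 3 \<le> 1.653986686269 ^ 3"
    by (rule power_mono; use u in simp)+
  have u2: "2.735671958 \<le> u\<^sup>2" "u\<^sup>2 \<le> 2.735671959"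
    by (rule order.trans[OF _ pw(1)], simp add: power2_eq_square, rule order.trans[OF pw(2)], simp add: power2_eq_square)
  have u3: "4.524764997 \<le> u ^ 3" "u ^ 3 \<le> 4.524764999"
    by (rule order.trans[OF _ pw(3)], simp add: power3_eq_cube, rule order.trans[OF pw(4)], simp add: power3_eq_cube)
  \<comment> \<open>\<open>A\<close> is negative, so the monotonicity of products is applied to -
    A.\<close>
  have "u * (- A) \<le> 1.653986686269 * 0.275494331227" "1.653986686262 * 0.275494322907 \<le> u * (- A)"
    using u A by (intro mult_mono; simp)+
  moreover have "2.735671958 * 0.030577535786 \<le> u\<^sup>2 * B" "u\<^sup>2 * B \<le> 2.735671959 * 0.030577537642"
    using u2 B by (intro mult_mono; simp)+
  moreover have "4.524764997 * 0.057222335180 \<le> u ^ 3 * C" "u ^ 3 * C \<le> 4.524764999 * 0.057222335199"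
    using u u3 C by (intro mult_mono; simp)+
  ultimately show ?thesis unfolding c abs_le_iff using L by simp
qed

lemma A_triangle_conv: "A_triangle x = summatory hex_ideals x + summatory (dconv prim3_half rect_count) x"
  unfolding A_triangle_def summatory_def sum.distrib[symmetric]
  by (rule sum.cong[OF refl]) (simp add: a_triangle_conv)

lemma K_triangle_conv: "K_triangle = 3 * sqrt 3 * ln 3 / (8 * pi)"
proof -
  have "sqrt 3 * sqrt 3 = (3 :: real)" by simp
  then show ?thesis
    unfolding K_triangle_def L_chi3_1 zeta_series_2 by (simp add: field_simps power2_eq_square)
qed

theorem theorem4p2:
  shows "(\<lambda>x. A_triangle x
            - (9 * ln 3 / 16 * (L_chi3 1 / zeta_series 2) * (x * (ln x - 1)) + c_triangle * x))
           \<in> O[at_top](\<lambda>x. x powr (3 / 4) * ln x)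
       \<and> (\<lambda>x. A_triangle x
            - (3 * sqrt 3 * ln 3 / (8 * pi) * (x * (ln x - 1)) + c_triangle * x))
           \<in> O[at_top](\<lambda>x. x powr (3 / 4) * ln x)
       \<and> \<bar>c_triangle - 0.4915036\<bar> \<le> 5 / 10 ^ 8
       \<and> (\<exists>(f :: complex \<Rightarrow> complex) F.
            (\<forall>s. Re s > 1 \<longrightarrow>
               (\<lambda>n. of_nat (a_triangle (Suc n)) * of_nat (Suc n) powr (- s)) sums f s)
          \<and> (\<lambda>w. f (1 + w)) has_laurent_expansion F
          \<and> fls_nth F (-1) = complex_of_real c_triangle)"
proof -
  obtain C where C: "\<And>x. x \<ge> 1 \<Longrightarrow> \<bar>A_triangle x - (K_triangle * (x * (ln x - 1)) + c_triangle * x)\<bar> \<le> C * x powr (3/4)"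
    unfolding A_triangle_conv using triangle_asymptotics by blast
  have O: "(\<lambda>x. A_triangle x - (K_triangle * (x * (ln x - 1)) + c_triangle * x)) \<in> O[at_top](\<lambda>x. x powr (3 / 4) * ln x)"
  proof (rule bigoI[of _ "\<bar>C\<bar>"])
    show "eventually (\<lambda>x. norm (A_triangle x - (K_triangle * (x * (ln x - 1)) + c_triangle * x)) \<le> \<bar>C\<bar> * norm (x powr (3 / 4) * ln x)) at_top"
      \<comment> \<open>From e on, ln x \<ge> 1, so the bound C x^(3/4) passes to x^(3/4) ln
        x.\<close>
      using eventually_ge_at_top[of "exp 1"]
    proof eventually_elim
      case (elim x)
      have "(1 :: real) \<le> exp 1" by simp
      then have x: "x \<ge> 1" using elim by linarith
      have "ln (exp 1) \<le> ln x" using elim x by (subst ln_le_cancel_iff) auto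
      then have l: "1 \<le> ln x" by simp
      have "norm (A_triangle x - (K_triangle * (x * (ln x - 1)) + c_triangle * x)) \<le> C * x powr (3/4)" using C[OF x] by simp
      also have "\<dots> \<le> \<bar>C\<bar> * x powr (3/4)" by (intro mult_right_mono) auto
      also have "\<dots> \<le> \<bar>C\<bar> * (x powr (3/4) * ln x)" using l by (intro mult_left_mono) (auto simp: mult_le_cancel_left1)
      also have "x powr (3/4) * ln x = norm (x powr (3/4) * ln x)" using l by simp
      finally show ?case .
    qed
  qed
  have "\<bar>(\<Sum>n=1..N. real (a_triangle n)) - (K_triangle * (real N * (ln (real N) - 1)) + c_triangle * real N)\<bar> \<le> C * real N powr (3/4)"
    if "N \<ge> 1" for N
    using C[of "real N"] that by (simp add: A_triangle_def)
  from laurent_of_asymptotics[OF this] have laurent: "\<exists>(f :: complex \<Rightarrow> complex) F.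
            (\<forall>s. Re s > 1 \<longrightarrow>
               (\<lambda>n. of_nat (a_triangle (Suc n)) * of_nat (Suc n) powr (- s)) sums f s)
          \<and> (\<lambda>w. f (1 + w)) has_laurent_expansion F
          \<and> fls_nth F (-1) = complex_of_real c_triangle" unfolding of_real_of_nat_eq .
  show ?thesis
    using O[unfolded K_triangle_def] O[unfolded K_triangle_conv] c_triangle_approx laurent by (intro conjI)
qed

end
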